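(* Let $A=\Bbbk Q/I$ and let $R=R_\varphi$ be a reduction system satisfying $(\diamond)$ for $I$. Then any formal deformation of $A$ over a complete local Noetherian $\Bbbk$-algebra $(B,\mathfrak m)$ is gauge equivalent to $(A\widehat\otimes B,\star^{\mathrm C}_{\varphi+\widetilde\varphi})$ for some Maurer--Cartan element $\widetilde\varphi$ of $\mathbf p(Q,R)\widehat\otimes\mathfrak m$.
   Context: $\Bbbk$ is a field of characteristic $0$, $Q$ a finite quiver, $Q_n$ the paths of length $n$; $pq$ is concatenation if the target of $p$ is the source of $q$, else $0$. $\otimes=\otimes_{\Bbbk Q_0}$, $\mathrm{Hom}=\mathrm{Hom}_{\Bbbk Q_0^e}$ unless indicated; $I\subset\Bbbk Q$ a two-sided ideal, $\pi:\Bbbk Q\to A$ the projection; $\widehat\otimes$ is the $\mathfrak m$-adically completed tensor product; $B/\mathfrak m=\Bbbk$. A formal deformation of $A$ over $(B,\mathfrak m)$ is a $B$-bilinear associative product on $A\widehat\otimes B$ reducing to the product of $A$ modulo $\mathfrak m$; $\star,\star'$ are gauge equivalent if there is a $B$-module automorphism $T$ of $A\widehat\otimes B$ with $T\otimes_B\Bbbk=\mathrm{id}_A$ and $T(a\star b)=T(a)\star'T(b)$. Reduction systems: $R=\{(s,\varphi_s)\mid s\in S\}$ with $S\subset Q_{\ge2}$, $s$ not a subpath of $s'$ for $s\ne s'\in S$, $\varphi_s$ a linear combination of irreducible paths parallel to $s$; a path is irreducible if it has no subpath in $S$; $\mathrm{Irr}_S$ is the set of irreducible paths. A basic reduction sends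 one path $qsr$ ($s\in S$) to $q\varphi_sr$ and fixes all other paths; a reduction is a finite composition. A path $p$ is reduction-finite if for any infinite sequence of reductions $\mathfrak r_n\cdots\mathfrak r_1(p)$ is eventually constant, reduction-unique if moreover all irreducible $\mathfrak r(p)$ coincide. $R$ satisfies $(\diamond)$ for $I$ if $I=\langle s-\varphi_s\rangle_{s\in S}$ and all paths are reduction-unique. Then $\pi|_{\Bbbk\mathrm{Irr}_S}$ is bijective onto $A$ with inverse $\sigma$; $\mathrm{Hom}(\Bbbk S,A)=\mathrm{Hom}(\Bbbk S,\Bbbk\mathrm{Irr}_S)$, $\varphi_s=\sigma\varphi(s)$, $\widetilde\varphi_s=\sigma\widetilde\varphi(s)$. Combinatorial star product: $\mathrm{red}_{\varphi+z\widetilde\varphi}$ ($z$ a formal central variable) fixes irreducible paths and sends a reducible path $qsr$, $s$ its rightmost subpath in $S$, to $q\varphi_sr+z\,q\widetilde\varphi_sr$; iterates stabilize modulo each power of $z$, giving $\mathrm{red}^{(\infty)}_{\varphi+z\widetilde\varphi}$; $a\star^{\mathrm C}_{\varphi+\widetilde\varphi}b=\pi(\mathrm{red}^{(\infty)}_{\varphi+z\widetilde\varphi}(\sigma(a)\sigma(b))|_{z=1})$ for $a,b\in A$, extended $B$-bilinearly. Construction of $\mathbf p(Q,R)$: (1) $S_0=Q_0$, $S_1=Q_1$, $S_2=S$, and for $n\ge1$, $S_{n+2}$ is the set of paths $u_0u_1\cdots u_{n+1}$ with $u_0\in Q_1$, $u_1,\dots,u_{n+1}$ irreducible, each $u_iu_{i+1}$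 reducible and $u_id$ irreducible for every proper left subpath $d$ of $u_{i+1}$. For a path $p$, $\mathrm{split}_n(p)=\sum\pi(q)\otimes w\otimes\pi(r)$ over all $p=qwr$ with $w\in S_n$; $\mathrm{split}_n^{\mathrm R}(p)$, $\mathrm{split}^{\mathrm L}_n(p)$ are the single summands with $w$ rightmost, leftmost (zero if none). $P_n=A\otimes\Bbbk S_n\otimes A$, $P_{-1}=A$. $\delta_n$: bimodule maps with $\delta_1(1\otimes w\otimes1)=\pi(w)\otimes1-1\otimes\pi(w)$, $\delta_n(1\otimes w\otimes1)=\mathrm{split}^{\mathrm R}_{n-1}(w)-\mathrm{split}^{\mathrm L}_{n-1}(w)$ ($n>2$ odd), $=\mathrm{split}_{n-1}(w)$ ($n$ even). $\gamma_{n-1}$: left module maps with $\gamma_{n-1}(1\otimes w\otimes\pi(u))=(-1)^n\mathrm{split}_n(wu)$ for $u\in\mathrm{Irr}_S$. $\partial_0(a\otimes b)=ab$, $\rho_{-1}(a)=a\otimes1$, and for $n\ge1$: $\partial_n(a\otimes w\otimes b)=a((\mathrm{id}-\rho_{n-2}\partial_{n-1})\delta_n(1\otimes w\otimes1))b$, $\rho_{n-1}=\gamma_{n-1}+\sum_{i\ge1}\gamma_{n-1}(\delta_n\gamma_{n-1}-\partial_n\gamma_{n-1})^i$. (2) $\bar A=A/(\Bbbk Q_0\cdot1_A)$, $\varpi:A\to\bar A$, $\varpi_n=\mathrm{id}_{A\otimes\bar A^{\otimes n}}\otimes\varpi$, $\varpi_{-1}=\mathrm{id}_A$; $\mathrm{Bar}_n=A\otimes\bar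 A^{\otimes n}\otimes A$ the normalized bar resolution with differential $d_n$. $F_n:P_n\to\mathrm{Bar}_n$, $G_n:\mathrm{Bar}_n\to P_n$: $F_{-1}=G_{-1}=\mathrm{id}_A$, $F_n(a\otimes w\otimes b)=(-1)^n\varpi_{n-1}F_{n-1}\partial_n(a\otimes w\otimes1)\otimes b$, $G_n(a\otimes y\otimes b)=(\rho_{n-1}G_{n-1}d_n(a\otimes y\otimes1))b$ (so $F_0=G_0=\mathrm{id}$); $h_n(a_0\otimes\bar a_1\otimes\cdots\otimes\bar a_n\otimes a_{n+1})=\sum_{i=1}^n(-1)^{i+1}\varpi_iF_iG_i(a_0\otimes\bar a_1\otimes\cdots\otimes\bar a_i\otimes1)\otimes\bar a_{i+1}\otimes\cdots\otimes\bar a_n\otimes a_{n+1}$. (3) $P^n=\mathrm{Hom}(\Bbbk S_n,A)\cong\mathrm{Hom}_{A^e}(P_n,A)$, $f\leftrightarrow\check f$ with $f(w)=\check f(1\otimes w\otimes1)$ (similarly for Bar); $P^{m+2}$ is in degree $m$; unary bracket $\langle f\rangle(w)=(-1)^i\check f(\partial_{i+1}(1\otimes w\otimes1))$, $f\in P^i$. On $\mathrm{Hom}(\bar A^{\otimes\bullet+2},A)$ put $[f,g]=(-1)^{m+1}[f,g]_{\mathrm G}$ for $f\in\mathrm{Hom}(\bar A^{\otimes m+2},A)$, with $[\,,]_{\mathrm G}$ the Gerstenhaber bracket: for $f$ of arity $m+1$, $g$ of arity $n+1$, $f\bullet g=\sum_{i=0}^m(-1)^{ni}f(\mathrm{id}^{\otimes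 i}\otimes g\otimes\mathrm{id}^{\otimes m-i})$, $[f,g]_{\mathrm G}=f\bullet g-(-1)^{mn}g\bullet f$. Let $F^n(\psi)=\check\psi\circ F_n$, $G^n(f)=\check f\circ G_n$, $h^n(f)=(-1)^n\check f\circ h_n$ (for $f$ of arity $n+1$), under the identification $\mathrm{Hom}(M,A)\cong\mathrm{Hom}_{A^e}(A\otimes M\otimes A,A)$, $f\leftrightarrow\check f$, $f(m)=\check f(1\otimes m\otimes1)$, for $M=\Bbbk S_n$ and $M=\bar A^{\otimes n}$. Put $G_1^\bullet=G^\bullet$ and for $k>1$ $G_k^\bullet(f_1,\dots,f_k)=\sum h^\bullet([G_i^\bullet(f_{\sigma(1)},\dots,f_{\sigma(i)}),G_{k-i}^\bullet(f_{\sigma(i+1)},\dots,f_{\sigma(k)})])$, and $\langle f_1,\dots,f_k\rangle$ is given by the same sum with $h^\bullet$ replaced by $F^\bullet$; the sums are over $1\le i\le k-1$ and $(i,k-i)$-shuffles $\sigma$ with $\sigma(1)<\sigma(i+1)$. These brackets make $\mathbf p(Q,R)=P^{\bullet+2}$ an L$_\infty[1]$ algebra. A Maurer--Cartan element of $\mathbf p(Q,R)\widehat\otimes\mathfrak m$ is $\widetilde\varphi\in P^2\widehat\otimes\mathfrak m=\mathrm{Hom}(\Bbbk S,A)\widehat\otimes\mathfrak m$ with $\sum_{k\ge1}\frac1{k!}\langle\widetilde\varphi,\dots,\widetilde\varphi\rangle_k=0$ (brackets extended linearly). *)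

theory Defs
  imports
    "HOL-Library.Poly_Mapping"
    "HOL-Library.Function_Algebras"
    "HOL-Computational_Algebra.Polynomial"
    "HOL-Combinatorics.Permutations"
    "Graph_Theory.Arc_Walk"
begin

section \<open>Free modules\<close>

text \<open>The free module on a type \<open>'x\<close> of basis elements is \<open>'x \<Rightarrow>\<^sub>0 'r\<close>, with the pointwise
  scalar multiplication below. The multiplication that \<open>Poly_Mapping\<close> puts on this type (for
  monoids of keys) is not used.\<close>

definition fscale :: "'r::comm_ring_1 \<Rightarrow> ('x \<Rightarrow>\<^sub>0 'r) \<Rightarrow> ('x \<Rightarrow>\<^sub>0 'r)" where
  "fscale c x = Poly_Mapping.map (\<lambda>d. c * d) x"

abbreviation lookup where "lookup \<equiv> Poly_Mapping.lookup"
abbreviation keys where "keys \<equiv> Poly_Mapping.keys"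
abbreviation single where "single \<equiv> Poly_Mapping.single"

abbreviation base :: "'x \<Rightarrow> ('x \<Rightarrow>\<^sub>0 'r::comm_ring_1)" where
  "base p \<equiv> single p 1"

definition lin_ext :: "('r \<Rightarrow> 'y \<Rightarrow> 'y) \<Rightarrow> ('x \<Rightarrow> 'y) \<Rightarrow> ('x \<Rightarrow>\<^sub>0 'r::comm_ring_1) \<Rightarrow> 'y::comm_monoid_add"
  where "lin_ext sc g x = (\<Sum>p\<in>keys x. sc (lookup x p) (g p))"

abbreviation free_ext :: "('x \<Rightarrow> ('y \<Rightarrow>\<^sub>0 'r)) \<Rightarrow> ('x \<Rightarrow>\<^sub>0 'r::comm_ring_1) \<Rightarrow> ('y \<Rightarrow>\<^sub>0 'r)" where
  "free_ext \<equiv> lin_ext fscale"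

lemma lookup_fscale [simp]: "lookup (fscale c x) p = c * lookup x p"
  by (simp add: fscale_def Poly_Mapping.map.rep_eq when_def)

lemma module_fscale: "module (fscale :: 'r::comm_ring_1 \<Rightarrow> ('x \<Rightarrow>\<^sub>0 'r) \<Rightarrow> _)"
  by standard (simp_all add: poly_mapping_eq_iff fun_eq_iff lookup_add algebra_simps)


section \<open>Paths and path algebras\<close>

text \<open>A quiver is a finite directed multigraph in the sense of \<open>Graph_Theory\<close>. A path is a pair of
  its source and its list of arrows, so that \<open>(v, [])\<close> is the trivial path at \<open>v\<close>.\<close>

type_synonym ('v, 'e) qpath = "'v \<times> 'e list"

definition paths :: "('v, 'e) pre_digraph \<Rightarrow> ('v, 'e) qpath set" where
  "paths G = {(u, es). \<exists>v. pre_digraph.awalk G u es v}"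

abbreviation src :: "('v, 'e) qpath \<Rightarrow> 'v" where "src \<equiv> fst"

definition tgt :: "('v, 'e) pre_digraph \<Rightarrow> ('v, 'e) qpath \<Rightarrow> 'v" where
  "tgt G p = (if snd p = [] then fst p else head G (last (snd p)))"

abbreviation plen :: "('v, 'e) qpath \<Rightarrow> nat" where "plen p \<equiv> length (snd p)"

definition pcat :: "('v, 'e) qpath \<Rightarrow> ('v, 'e) qpath \<Rightarrow> ('v, 'e) qpath" where
  "pcat p q = (fst p, snd p @ snd q)"

abbreviation triv :: "'v \<Rightarrow> ('v, 'e) qpath" where "triv v \<equiv> (v, [])"

text \<open>The path algebra with coefficients in \<open>'r\<close> consists of the elements supported on paths.\<close>

definition path_alg :: "('v, 'e) pre_digraph \<Rightarrow> (('v, 'e) qpath \<Rightarrow>\<^sub>0 'r::comm_ring_1) set" where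
  "path_alg G = {x. keys x \<subseteq> paths G}"

definition pmul :: "('v, 'e) pre_digraph \<Rightarrow> (('v, 'e) qpath \<Rightarrow>\<^sub>0 'r::comm_ring_1)
    \<Rightarrow> (('v, 'e) qpath \<Rightarrow>\<^sub>0 'r) \<Rightarrow> (('v, 'e) qpath \<Rightarrow>\<^sub>0 'r)" where
  "pmul G x y = free_ext (\<lambda>p. free_ext (\<lambda>q. if tgt G p = src q then base (pcat p q) else 0) y) x"

definition pone :: "('v, 'e) pre_digraph \<Rightarrow> (('v, 'e) qpath \<Rightarrow>\<^sub>0 'r::comm_ring_1)" where
  "pone G = (\<Sum>v\<in>verts G. base (triv v))"

definition two_sided_ideal ::
  "('v, 'e) pre_digraph \<Rightarrow> (('v, 'e) qpath \<Rightarrow>\<^sub>0 'k::field) set \<Rightarrow> bool" where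
  "two_sided_ideal G I \<longleftrightarrow> I \<subseteq> path_alg G \<and> module.subspace fscale I \<and>
     (\<forall>x\<in>I. \<forall>a\<in>path_alg G. pmul G a x \<in> I \<and> pmul G x a \<in> I)"

text \<open>\<open>'a\<close> (with scalar multiplication \<open>sA\<close>) is the algebra \<open>\<bbbk>Q/I\<close> and \<open>\<pi>\<close> is the projection.
  \<open>'a\<close> is only required to be a not necessarily unital ring because it is zero for the empty
  quiver; its unit is \<open>\<pi> (pone G)\<close>.\<close>

definition quotient_algebra :: "('v, 'e) pre_digraph \<Rightarrow> (('v, 'e) qpath \<Rightarrow>\<^sub>0 'k::field) set
    \<Rightarrow> ('k \<Rightarrow> 'a \<Rightarrow> 'a) \<Rightarrow> ((('v, 'e) qpath \<Rightarrow>\<^sub>0 'k) \<Rightarrow> 'a::ring) \<Rightarrow> bool" where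
  "quotient_algebra G I sA \<pi> \<longleftrightarrow>
     vector_space sA \<and>
     (\<forall>c a b. sA c (a * b) = sA c a * b \<and> sA c (a * b) = a * sA c b) \<and>
     (\<forall>x\<in>path_alg G. \<forall>y\<in>path_alg G. \<pi> (x + y) = \<pi> x + \<pi> y \<and> \<pi> (pmul G x y) = \<pi> x * \<pi> y) \<and>
     (\<forall>c. \<forall>x\<in>path_alg G. \<pi> (fscale c x) = sA c (\<pi> x)) \<and>
     \<pi> ` path_alg G = UNIV \<and>
     {x \<in> path_alg G. \<pi> x = 0} = I"


section \<open>Reduction systems\<close>

text \<open>\<open>occs G T p\<close> is the set of all factorisations \<open>p = q w r\<close> with \<open>w \<in> T\<close>. A rightmost (leftmost)
  occurrence starts and ends at least as far to the right (left) as any other one, so there is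
  at most one.\<close>

definition occs :: "('v, 'e) pre_digraph \<Rightarrow> ('v, 'e) qpath set \<Rightarrow> ('v, 'e) qpath \<Rightarrow>
    (('v, 'e) qpath \<times> ('v, 'e) qpath \<times> ('v, 'e) qpath) set" where
  "occs G T p = {(q, w, r). q \<in> paths G \<and> w \<in> paths G \<and> r \<in> paths G \<and> w \<in> T \<and>
     tgt G q = src w \<and> tgt G w = src r \<and> p = pcat q (pcat w r)}"

definition right_occ :: "('v, 'e) pre_digraph \<Rightarrow> ('v, 'e) qpath set \<Rightarrow> ('v, 'e) qpath \<Rightarrow>
    (('v, 'e) qpath \<times> ('v, 'e) qpath \<times> ('v, 'e) qpath) set" where
  "right_occ G T p = {(q, w, r) \<in> occs G T p.
     \<forall>(q', w', r') \<in> occs G T p. plen q' \<le> plen q \<and> plen r \<le> plen r'}"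

definition left_occ :: "('v, 'e) pre_digraph \<Rightarrow> ('v, 'e) qpath set \<Rightarrow> ('v, 'e) qpath \<Rightarrow>
    (('v, 'e) qpath \<times> ('v, 'e) qpath \<times> ('v, 'e) qpath) set" where
  "left_occ G T p = {(q, w, r) \<in> occs G T p.
     \<forall>(q', w', r') \<in> occs G T p. plen q \<le> plen q' \<and> plen r' \<le> plen r}"

definition irr :: "('v, 'e) pre_digraph \<Rightarrow> ('v, 'e) qpath set \<Rightarrow> ('v, 'e) qpath set" where
  "irr G S = {p \<in> paths G. occs G S p = {}}"

definition irr_span :: "('v, 'e) pre_digraph \<Rightarrow> ('v, 'e) qpath set
    \<Rightarrow> (('v, 'e) qpath \<Rightarrow>\<^sub>0 'k::field) set" where
  "irr_span G S = {x. keys x \<subseteq> irr G S}"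

text \<open>The reduction system \<open>{(s, \<phi> s) | s \<in> S}\<close>; the values of \<open>\<phi>\<close> outside \<open>S\<close> are irrelevant.\<close>

definition reduction_system :: "('v, 'e) pre_digraph \<Rightarrow> ('v, 'e) qpath set
    \<Rightarrow> (('v, 'e) qpath \<Rightarrow> ('v, 'e) qpath \<Rightarrow>\<^sub>0 'k::field) \<Rightarrow> bool" where
  "reduction_system G S \<phi> \<longleftrightarrow>
     (\<forall>s\<in>S. s \<in> paths G \<and> plen s \<ge> 2) \<and>
     (\<forall>s\<in>S. \<forall>s'\<in>S. s \<noteq> s' \<longrightarrow> occs G {s} s' = {}) \<and>
     (\<forall>s\<in>S. \<forall>p\<in>keys (\<phi> s). p \<in> irr G S \<and> src p = src s \<and> tgt G p = tgt G s)"

definition basic_reduction :: "('v, 'e) pre_digraph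
    \<Rightarrow> (('v, 'e) qpath \<Rightarrow> ('v, 'e) qpath \<Rightarrow>\<^sub>0 'k::field)
    \<Rightarrow> ('v, 'e) qpath \<Rightarrow> ('v, 'e) qpath \<Rightarrow> ('v, 'e) qpath
    \<Rightarrow> (('v, 'e) qpath \<Rightarrow>\<^sub>0 'k) \<Rightarrow> (('v, 'e) qpath \<Rightarrow>\<^sub>0 'k)" where
  "basic_reduction G \<phi> q s r =
     free_ext (\<lambda>p. if p = pcat q (pcat s r) then pmul G (base q) (pmul G (\<phi> s) (base r)) else base p)"

inductive_set reductions :: "('v, 'e) pre_digraph \<Rightarrow> ('v, 'e) qpath set
    \<Rightarrow> (('v, 'e) qpath \<Rightarrow> ('v, 'e) qpath \<Rightarrow>\<^sub>0 'k::field)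
    \<Rightarrow> ((('v, 'e) qpath \<Rightarrow>\<^sub>0 'k) \<Rightarrow> (('v, 'e) qpath \<Rightarrow>\<^sub>0 'k)) set"
  for G S \<phi> where
  empty: "id \<in> reductions G S \<phi>"
| basic: "\<rr> \<in> reductions G S \<phi> \<Longrightarrow> s \<in> S \<Longrightarrow> (q, s, r) \<in> occs G S p \<Longrightarrow>
    basic_reduction G \<phi> q s r \<circ> \<rr> \<in> reductions G S \<phi>"

primrec iterate :: "(nat \<Rightarrow> 'x \<Rightarrow> 'x) \<Rightarrow> nat \<Rightarrow> 'x \<Rightarrow> 'x" where
  "iterate \<rr> 0 x = x"
| "iterate \<rr> (Suc n) x = \<rr> n (iterate \<rr> n x)"

definition reduction_finite where
  "reduction_finite G S \<phi> p \<longleftrightarrow>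
     (\<forall>\<rr>. (\<forall>i. \<rr> i \<in> reductions G S \<phi>) \<longrightarrow>
        (\<exists>y. eventually (\<lambda>n. iterate \<rr> n (base p) = y) sequentially))"

definition reduction_unique where
  "reduction_unique G S \<phi> p \<longleftrightarrow> reduction_finite G S \<phi> p \<and>
     (\<forall>\<rr>\<in>reductions G S \<phi>. \<forall>\<rr>'\<in>reductions G S \<phi>.
        \<rr> (base p) \<in> irr_span G S \<longrightarrow> \<rr>' (base p) \<in> irr_span G S \<longrightarrow> \<rr> (base p) = \<rr>' (base p))"

definition diamond :: "('v, 'e) pre_digraph \<Rightarrow> ('v, 'e) qpath set
    \<Rightarrow> (('v, 'e) qpath \<Rightarrow> ('v, 'e) qpath \<Rightarrow>\<^sub>0 'k::field)
    \<Rightarrow> (('v, 'e) qpath \<Rightarrow>\<^sub>0 'k) set \<Rightarrow> bool" where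
  "diamond G S \<phi> I \<longleftrightarrow> I = two_sided_ideal G hull {base s - \<phi> s | s. s \<in> S} \<and>
     (\<forall>p\<in>paths G. reduction_unique G S \<phi> p)"


section \<open>Complete local Noetherian algebras and completed tensor products\<close>

abbreviation ring_ideal :: "'b::comm_ring_1 set \<Rightarrow> bool" where
  "ring_ideal \<equiv> module.subspace (*)"

primrec ideal_pow :: "'b::comm_ring_1 set \<Rightarrow> nat \<Rightarrow> 'b set" where
  "ideal_pow \<mm> 0 = UNIV"
| "ideal_pow \<mm> (Suc n) = module.span (*) {x * y | x y. x \<in> \<mm> \<and> y \<in> ideal_pow \<mm> n}"

definition maximal_ring_ideal :: "'b::comm_ring_1 set \<Rightarrow> bool" where
  "maximal_ring_ideal J \<longleftrightarrow> ring_ideal J \<and> J \<noteq> UNIV \<and>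
     (\<forall>K. ring_ideal K \<longrightarrow> J \<subseteq> K \<longrightarrow> K = J \<or> K = UNIV)"

text \<open>The last three clauses say that \<open>B \<rightarrow> lim B/\<mm>\<^sup>n\<close> is injective and surjective, and that
  \<open>\<bbbk> \<rightarrow> B/\<mm>\<close> is bijective.\<close>

definition complete_local_noetherian ::
  "('k::field \<Rightarrow> 'b \<Rightarrow> 'b) \<Rightarrow> 'b::comm_ring_1 set \<Rightarrow> bool" where
  "complete_local_noetherian sB \<mm> \<longleftrightarrow>
     vector_space sB \<and> (\<forall>c a b. sB c (a * b) = sB c a * b) \<and>
     {J. maximal_ring_ideal J} = {\<mm>} \<and>
     (\<forall>J :: 'b set. ring_ideal J \<longrightarrow> (\<exists>X. finite X \<and> J = module.span (*) X)) \<and>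
     (\<Inter>n. ideal_pow \<mm> n) = {0} \<and>
     (\<forall>b :: nat \<Rightarrow> 'b. (\<forall>n. b (Suc n) - b n \<in> ideal_pow \<mm> n) \<longrightarrow>
        (\<exists>c. \<forall>n. c - b n \<in> ideal_pow \<mm> n)) \<and>
     (\<forall>b. \<exists>!c. b - sB c 1 \<in> \<mm>)"

text \<open>For \<open>\<bbbk>\<close>-subspaces \<open>V\<close> of \<open>'w\<close> and \<open>W\<close> of \<open>'b\<close> the tensor product \<open>V \<otimes>\<^sub>\<bbbk> W\<close> is the space of formal
  sums of pairs in \<open>V \<times> W\<close> modulo the bilinearity relations. Its quotient \<open>V \<otimes> W/(W \<inter> \<mm>\<^sup>n)\<close> is the
  space of formal sums modulo \<open>ct_null \<dots> n\<close>, and \<open>ctensor\<close> is the inverse limit of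
  these quotients: its elements are sequences of cosets \<open>x n\<close> which are compatible under the
  projections, i.e. decreasing. It is used for \<open>W = B\<close> and \<open>W = \<mm>\<close>.\<close>

definition bilinear_rels :: "('k::field \<Rightarrow> 'w \<Rightarrow> 'w) \<Rightarrow> 'w::ab_group_add set
    \<Rightarrow> ('k \<Rightarrow> 'b \<Rightarrow> 'b) \<Rightarrow> 'b::comm_ring_1 set \<Rightarrow> ('w \<times> 'b \<Rightarrow>\<^sub>0 'k) set" where
  "bilinear_rels sV V sB W =
     {base (v + v', b) - base (v, b) - base (v', b) | v v' b. v \<in> V \<and> v' \<in> V \<and> b \<in> W} \<union>
     {base (v, b + b') - base (v, b) - base (v, b') | v b b'. v \<in> V \<and> b \<in> W \<and> b' \<in> W} \<union>
     {base (sV c v, b) - fscale c (base (v, b)) | c v b. v \<in> V \<and> b \<in> W} \<union>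
     {base (v, sB c b) - fscale c (base (v, b)) | c v b. v \<in> V \<and> b \<in> W}"

definition ct_null :: "('k::field \<Rightarrow> 'w \<Rightarrow> 'w) \<Rightarrow> 'w::ab_group_add set
    \<Rightarrow> ('k \<Rightarrow> 'b \<Rightarrow> 'b) \<Rightarrow> 'b::comm_ring_1 set \<Rightarrow> 'b set \<Rightarrow> nat \<Rightarrow> ('w \<times> 'b \<Rightarrow>\<^sub>0 'k) set" where
  "ct_null sV V sB W \<mm> n = module.span fscale
     (bilinear_rels sV V sB W \<union> {base (v, b) | v b. v \<in> V \<and> b \<in> W \<inter> ideal_pow \<mm> n})"

definition ct_class :: "('k::field \<Rightarrow> 'w \<Rightarrow> 'w) \<Rightarrow> 'w::ab_group_add set
    \<Rightarrow> ('k \<Rightarrow> 'b \<Rightarrow> 'b) \<Rightarrow> 'b::comm_ring_1 set \<Rightarrow> 'b set \<Rightarrow> nat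
    \<Rightarrow> ('w \<times> 'b \<Rightarrow>\<^sub>0 'k) \<Rightarrow> ('w \<times> 'b \<Rightarrow>\<^sub>0 'k) set" where
  "ct_class sV V sB W \<mm> n t = {t'. t' - t \<in> ct_null sV V sB W \<mm> n}"

definition ctensor :: "('k::field \<Rightarrow> 'w \<Rightarrow> 'w) \<Rightarrow> 'w::ab_group_add set
    \<Rightarrow> ('k \<Rightarrow> 'b \<Rightarrow> 'b) \<Rightarrow> 'b::comm_ring_1 set \<Rightarrow> 'b set
    \<Rightarrow> (nat \<Rightarrow> ('w \<times> 'b \<Rightarrow>\<^sub>0 'k) set) set" where
  "ctensor sV V sB W \<mm> =
     {x. \<forall>n. (\<exists>t. keys t \<subseteq> V \<times> W \<and> x n = ct_class sV V sB W \<mm> n t) \<and> x (Suc n) \<subseteq> x n}"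

text \<open>Multiplication of the second tensor factor by \<open>b\<close>, on formal sums.\<close>

definition b_act :: "'b::comm_ring_1 \<Rightarrow> ('w \<times> 'b \<Rightarrow>\<^sub>0 'k::field) \<Rightarrow> ('w \<times> 'b \<Rightarrow>\<^sub>0 'k)" where
  "b_act b t = free_ext (\<lambda>(v, b'). base (v, b * b')) t"


section \<open>The projective resolution, the homotopy transfer and the brackets\<close>

text \<open>Elements of \<open>P\<^sub>n = A \<otimes> \<bbbk>S\<^sub>n \<otimes> A\<close> are represented by formal sums of triples \<open>(a, w, b)\<close>, which
  stand for \<open>a \<otimes> w \<otimes> b\<close>, and elements of \<open>Bar\<^sub>n\<close> by formal sums of lists
  \<open>[a\<^sub>0, \<dots>, a\<^sub>n\<^sub>+\<^sub>1]\<close>, which stand for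
  \<open>a\<^sub>0 \<otimes> a\<^sub>1 \<otimes> \<dots> \<otimes> a\<^sub>n\<^sub>+\<^sub>1\<close> with the inner entries read in \<open>A/\<bbbk>Q\<^sub>0\<close>; thus the maps \<open>\<varpi>\<close> are
  invisible. All maps are given on formal sums of pure tensors; equality in \<open>P\<^sub>n\<close> is equality
  modulo \<open>P_null n\<close>.\<close>

type_synonym ('v, 'e, 'k, 'a) pchain = "('a \<times> ('v, 'e) qpath \<times> 'a) \<Rightarrow>\<^sub>0 'k"
type_synonym ('k, 'a) bchain = "'a list \<Rightarrow>\<^sub>0 'k"

text \<open>\<open>(i, k - i)\<close>-shuffles \<open>\<tau>\<close> of \<open>{0, \<dots>, k - 1}\<close> with \<open>\<tau>(0) < \<tau>(i)\<close>: all indices are shifted by one.\<close>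

definition pointed_shuffles :: "nat \<Rightarrow> nat \<Rightarrow> (nat \<Rightarrow> nat) set" where
  "pointed_shuffles i k = {\<tau>. \<tau> permutes {..<k} \<and>
     strict_mono_on {..<i} \<tau> \<and> strict_mono_on {i..<k} \<tau> \<and> \<tau> 0 < \<tau> i}"

locale deformation_data =
  fixes G :: "('v, 'e) pre_digraph"
    and S :: "('v, 'e) qpath set"
    and \<phi> :: "('v, 'e) qpath \<Rightarrow> ('v, 'e) qpath \<Rightarrow>\<^sub>0 'k::field_char_0"
    and sA :: "'k \<Rightarrow> 'a \<Rightarrow> 'a::ring"
    and \<pi> :: "(('v, 'e) qpath \<Rightarrow>\<^sub>0 'k) \<Rightarrow> 'a"
    and sB :: "'k \<Rightarrow> 'b \<Rightarrow> 'b::comm_ring_1"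
    and \<mm> :: "'b set"
begin

definition \<sigma> :: "'a \<Rightarrow> (('v, 'e) qpath \<Rightarrow>\<^sub>0 'k)" where
  "\<sigma> = inv_into (irr_span G S) \<pi>"

abbreviation \<pi>p :: "('v, 'e) qpath \<Rightarrow> 'a" where "\<pi>p p \<equiv> \<pi> (base p)"

definition oneA :: 'a where "oneA = \<pi> (pone G)"

fun amb :: "nat \<Rightarrow> ('v, 'e) qpath set" where
  "amb 0 = triv ` verts G"
| "amb (Suc 0) = {p \<in> paths G. plen p = 1}"
| "amb (Suc (Suc 0)) = S"
| "amb (Suc (Suc (Suc n))) =
     {(src (us ! 0), concat (map snd us)) | us.
        length us = n + 3 \<and> set us \<subseteq> paths G \<and> plen (us ! 0) = 1 \<and>
        (\<forall>i < n + 2. tgt G (us ! i) = src (us ! Suc i) \<and> us ! Suc i \<in> irr G S \<and>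
           pcat (us ! i) (us ! Suc i) \<notin> irr G S \<and>
           (\<forall>d\<in>paths G. \<forall>e\<in>paths G. tgt G d = src e \<and> us ! Suc i = pcat d e \<and> plen e > 0 \<longrightarrow>
              pcat (us ! i) d \<in> irr G S))}"

definition split :: "nat \<Rightarrow> ('v, 'e) qpath \<Rightarrow> ('v, 'e, 'k, 'a) pchain" where
  "split n p = (\<Sum>(q, w, r) \<in> occs G (amb n) p. base (\<pi>p q, w, \<pi>p r))"

definition splitR :: "nat \<Rightarrow> ('v, 'e) qpath \<Rightarrow> ('v, 'e, 'k, 'a) pchain" where
  "splitR n p = (\<Sum>(q, w, r) \<in> right_occ G (amb n) p. base (\<pi>p q, w, \<pi>p r))"

definition splitL :: "nat \<Rightarrow> ('v, 'e) qpath \<Rightarrow> ('v, 'e, 'k, 'a) pchain" where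
  "splitL n p = (\<Sum>(q, w, r) \<in> left_occ G (amb n) p. base (\<pi>p q, w, \<pi>p r))"

text \<open>Multilinearity and \<open>\<bbbk>Q\<^sub>0\<close>-balancedness.\<close>

definition P_null :: "nat \<Rightarrow> ('v, 'e, 'k, 'a) pchain set" where
  "P_null n = module.span fscale (
     {base (a + a', w, b) - base (a, w, b) - base (a', w, b) | a a' w b. w \<in> amb n} \<union>
     {base (a, w, b + b') - base (a, w, b) - base (a, w, b') | a w b b'. w \<in> amb n} \<union>
     {base (sA c a, w, b) - fscale c (base (a, w, b)) | c a w b. w \<in> amb n} \<union>
     {base (a, w, sA c b) - fscale c (base (a, w, b)) | c a w b. w \<in> amb n} \<union>
     {base (a * \<pi>p (triv v), w, b) - (if v = src w then base (a, w, b) else 0) | a v w b.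
        v \<in> verts G \<and> w \<in> amb n} \<union>
     {base (a, w, \<pi>p (triv v) * b) - (if v = tgt G w then base (a, w, b) else 0) | a v w b.
        v \<in> verts G \<and> w \<in> amb n})"

definition lact :: "'a \<Rightarrow> ('v, 'e, 'k, 'a) pchain \<Rightarrow> ('v, 'e, 'k, 'a) pchain" where
  "lact a x = free_ext (\<lambda>(a', w, b). base (a * a', w, b)) x"

definition ract :: "('v, 'e, 'k, 'a) pchain \<Rightarrow> 'a \<Rightarrow> ('v, 'e, 'k, 'a) pchain" where
  "ract x b = free_ext (\<lambda>(a, w, b'). base (a, w, b' * b)) x"

text \<open>The bimodule map with \<open>1 \<otimes> w \<otimes> 1 \<mapsto> g w\<close>.\<close>

definition bimod_ext :: "(('v, 'e) qpath \<Rightarrow> ('v, 'e, 'k, 'a) pchain)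
    \<Rightarrow> ('v, 'e, 'k, 'a) pchain \<Rightarrow> ('v, 'e, 'k, 'a) pchain" where
  "bimod_ext g x = free_ext (\<lambda>(a, w, b). lact a (ract (g w) b)) x"

text \<open>The identification \<open>A \<otimes> A = A \<otimes> \<bbbk>Q\<^sub>0 \<otimes> A = P\<^sub>0\<close>.\<close>

definition emb0 :: "'a \<Rightarrow> 'a \<Rightarrow> ('v, 'e, 'k, 'a) pchain" where
  "emb0 a b = (\<Sum>v\<in>verts G. base (a, triv v, b))"

text \<open>\<open>\<delta>\<^sub>n(1 \<otimes> w \<otimes> 1)\<close> for \<open>n \<ge> 1\<close>.\<close>

definition delta :: "nat \<Rightarrow> ('v, 'e) qpath \<Rightarrow> ('v, 'e, 'k, 'a) pchain" where
  "delta n w =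
     (if n = 1 then emb0 (\<pi>p w) oneA - emb0 oneA (\<pi>p w)
      else if odd n then splitR (n - 1) w - splitL (n - 1) w
      else split (n - 1) w)"

text \<open>\<open>\<gamma>\<^sub>n : P\<^sub>n \<rightarrow> P\<^sub>n\<^sub>+\<^sub>1\<close>, evaluated by expanding the last factor in irreducible paths.\<close>

definition gamma :: "nat \<Rightarrow> ('v, 'e, 'k, 'a) pchain \<Rightarrow> ('v, 'e, 'k, 'a) pchain" where
  "gamma n x = free_ext (\<lambda>(a, w, b). lact a (free_ext (\<lambda>u.
      fscale ((-1) ^ (n + 1)) (if tgt G w = src u then split (n + 1) (pcat w u) else 0)) (\<sigma> b))) x"

definition partial0 :: "('v, 'e, 'k, 'a) pchain \<Rightarrow> 'a" where
  "partial0 x = lin_ext sA (\<lambda>(a, w, b). a * \<pi>p w * b) x"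

definition rho_minus1 :: "'a \<Rightarrow> ('v, 'e, 'k, 'a) pchain" where
  "rho_minus1 a = emb0 a oneA"

text \<open>\<open>\<rho>\<^sub>n\<close> in terms of \<open>d = \<partial>\<^sub>n\<^sub>+\<^sub>1\<close>. The infinite series is locally finite: only the terms which are
  non-zero in \<open>P\<^sub>n\<^sub>+\<^sub>1\<close> are summed.\<close>

definition rho_term :: "nat \<Rightarrow> (('v, 'e, 'k, 'a) pchain \<Rightarrow> ('v, 'e, 'k, 'a) pchain)
    \<Rightarrow> nat \<Rightarrow> ('v, 'e, 'k, 'a) pchain \<Rightarrow> ('v, 'e, 'k, 'a) pchain" where
  "rho_term n d i x =
     gamma n (((\<lambda>y. bimod_ext (delta (n + 1)) (gamma n y) - d (gamma n y)) ^^ i) x)"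

definition rho_from :: "nat \<Rightarrow> (('v, 'e, 'k, 'a) pchain \<Rightarrow> ('v, 'e, 'k, 'a) pchain)
    \<Rightarrow> ('v, 'e, 'k, 'a) pchain \<Rightarrow> ('v, 'e, 'k, 'a) pchain" where
  "rho_from n d x =
     gamma n x + (\<Sum>i | i \<ge> 1 \<and> rho_term n d i x \<notin> P_null (n + 1). rho_term n d i x)"

text \<open>\<open>resol n = (\<partial>\<^sub>n\<^sub>+\<^sub>1, \<rho>\<^sub>n)\<close>.\<close>

primrec resol :: "nat \<Rightarrow> (('v, 'e, 'k, 'a) pchain \<Rightarrow> ('v, 'e, 'k, 'a) pchain) \<times>
    (('v, 'e, 'k, 'a) pchain \<Rightarrow> ('v, 'e, 'k, 'a) pchain)" where
  "resol 0 =
     (let d = bimod_ext (\<lambda>w. delta 1 w - rho_minus1 (partial0 (delta 1 w)))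
      in (d, rho_from 0 d))"
| "resol (Suc n) =
     (let d = bimod_ext (\<lambda>w. delta (n + 2) w - snd (resol n) (fst (resol n) (delta (n + 2) w)))
      in (d, rho_from (Suc n) d))"

definition partial_Suc :: "nat \<Rightarrow> ('v, 'e, 'k, 'a) pchain \<Rightarrow> ('v, 'e, 'k, 'a) pchain" where
  "partial_Suc n = fst (resol n)"

definition rho :: "nat \<Rightarrow> ('v, 'e, 'k, 'a) pchain \<Rightarrow> ('v, 'e, 'k, 'a) pchain" where
  "rho n = snd (resol n)"

text \<open>The bar differential of \<open>a\<^sub>0 \<otimes> \<dots> \<otimes> a\<^sub>n\<^sub>+\<^sub>1\<close>.\<close>

definition bar_d :: "'a list \<Rightarrow> ('k, 'a) bchain" where
  "bar_d as = (\<Sum>i < length as - 1.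
     fscale ((-1) ^ i) (base (take i as @ [as ! i * as ! Suc i] @ drop (i + 2) as)))"

definition tensor_right :: "('k, 'a) bchain \<Rightarrow> 'a list \<Rightarrow> ('k, 'a) bchain" where
  "tensor_right y bs = free_ext (\<lambda>as. base (as @ bs)) y"

primrec Fm :: "nat \<Rightarrow> ('v, 'e, 'k, 'a) pchain \<Rightarrow> ('k, 'a) bchain" where
  "Fm 0 = free_ext (\<lambda>(a, w, b). base [a * \<pi>p w, b])"
| "Fm (Suc n) = free_ext (\<lambda>(a, w, b).
     fscale ((-1) ^ Suc n) (tensor_right (Fm n (partial_Suc n (base (a, w, oneA)))) [b]))"

primrec Gm :: "nat \<Rightarrow> ('k, 'a) bchain \<Rightarrow> ('v, 'e, 'k, 'a) pchain" where
  "Gm 0 = free_ext (\<lambda>as. emb0 (as ! 0) (as ! 1))"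
| "Gm (Suc n) = free_ext (\<lambda>as. ract (rho n (Gm n (bar_d (butlast as @ [oneA])))) (last as))"

definition Hm :: "nat \<Rightarrow> ('k, 'a) bchain \<Rightarrow> ('k, 'a) bchain" where
  "Hm n = free_ext (\<lambda>as. \<Sum>i = 1..n. fscale ((-1) ^ (i + 1))
     (tensor_right (Fm i (Gm i (base (take (i + 1) as @ [oneA])))) (drop (i + 1) as)))"

text \<open>Cochains in \<open>Hom(\<bbbk>S\<^sub>n, A)\<close> are functions on paths, extended by zero outside \<open>S\<^sub>n\<close>; cochains on
  the bar complex are functions on lists of elements of \<open>A\<close>. The bimodule map
  corresponding to a cochain \<open>f\<close> is \<open>eval_P f\<close> or \<open>eval_bar f\<close>.\<close>

definition eval_P :: "(('v, 'e) qpath \<Rightarrow> 'a) \<Rightarrow> ('v, 'e, 'k, 'a) pchain \<Rightarrow> 'a" where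
  "eval_P f x = lin_ext sA (\<lambda>(a, w, b). a * f w * b) x"

definition eval_bar :: "('a list \<Rightarrow> 'a) \<Rightarrow> ('k, 'a) bchain \<Rightarrow> 'a" where
  "eval_bar f y = lin_ext sA (\<lambda>as. hd as * f (butlast (tl as)) * last as) y"

definition Pn :: "nat \<Rightarrow> (('v, 'e) qpath \<Rightarrow> 'a) set" where
  "Pn n = {f. (\<forall>w\<in>amb n. f w = \<pi>p (triv (src w)) * f w * \<pi>p (triv (tgt G w))) \<and>
              (\<forall>w. w \<notin> amb n \<longrightarrow> f w = 0)}"

definition Fup :: "nat \<Rightarrow> ('a list \<Rightarrow> 'a) \<Rightarrow> ('v, 'e) qpath \<Rightarrow> 'a" where
  "Fup n \<psi> = (\<lambda>w. if w \<in> amb n then eval_bar \<psi> (Fm n (base (oneA, w, oneA))) else 0)"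

definition Gup :: "nat \<Rightarrow> (('v, 'e) qpath \<Rightarrow> 'a) \<Rightarrow> 'a list \<Rightarrow> 'a" where
  "Gup n f = (\<lambda>as. eval_P f (Gm n (base (oneA # as @ [oneA]))))"

definition hup :: "nat \<Rightarrow> ('a list \<Rightarrow> 'a) \<Rightarrow> 'a list \<Rightarrow> 'a" where
  "hup n f = (\<lambda>as. sA ((-1) ^ n) (eval_bar f (Hm n (base (oneA # as @ [oneA])))))"

text \<open>Here \<open>f\<close> has arity \<open>m + 1\<close> and \<open>g\<close> has arity \<open>n + 1\<close>.\<close>

definition gerst_circ :: "nat \<Rightarrow> nat \<Rightarrow> ('a list \<Rightarrow> 'a) \<Rightarrow> ('a list \<Rightarrow> 'a) \<Rightarrow> 'a list \<Rightarrow> 'a" where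
  "gerst_circ m n f g = (\<lambda>as. \<Sum>i\<le>m. sA ((-1) ^ (n * i))
     (f (take i as @ [g (take (n + 1) (drop i as))] @ drop (i + n + 1) as)))"

definition gerst :: "nat \<Rightarrow> nat \<Rightarrow> ('a list \<Rightarrow> 'a) \<Rightarrow> ('a list \<Rightarrow> 'a) \<Rightarrow> 'a list \<Rightarrow> 'a" where
  "gerst m n f g = (\<lambda>as. gerst_circ m n f g as - sA ((-1) ^ (m * n)) (gerst_circ n m g f as))"

text \<open>The shifted bracket of \<open>f\<close> of degree \<open>m\<close> (arity \<open>m + 2\<close>) and \<open>g\<close> of degree \<open>n\<close>.\<close>

definition brk :: "nat \<Rightarrow> nat \<Rightarrow> ('a list \<Rightarrow> 'a) \<Rightarrow> ('a list \<Rightarrow> 'a) \<Rightarrow> 'a list \<Rightarrow> 'a" where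
  "brk m n f g = (\<lambda>as. sA ((-1) ^ (m + 1)) (gerst (m + 1) (n + 1) f g as))"

text \<open>\<open>G_k k f\<close> and \<open>bracket k f\<close> are \<open>G\<^sub>k(f\<^sub>1, \<dots>, f\<^sub>k)\<close> and \<open>\<langle>f\<^sub>1, \<dots>, f\<^sub>k\<rangle>\<close> (\<open>k \<ge> 1\<close>) for elements
  \<open>f 0, \<dots>, f (k - 1)\<close> of \<open>Hom(\<bbbk>S, A)\<close>. These have degree \<open>0\<close>, so there are no Koszul
  signs, all \<open>G\<^sub>k\<close> have arity \<open>2\<close> and the brackets take values in \<open>Hom(\<bbbk>S\<^sub>3, A)\<close>.\<close>

fun G_k :: "nat \<Rightarrow> (nat \<Rightarrow> ('v, 'e) qpath \<Rightarrow> 'a) \<Rightarrow> 'a list \<Rightarrow> 'a" where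
  "G_k k f = (if k \<le> 1 then Gup 2 (f 0)
     else \<Sum>i\<in>{1..<k}. \<Sum>\<tau>\<in>pointed_shuffles i k.
       hup 2 (brk 0 0 (G_k i (\<lambda>j. f (\<tau> j))) (G_k (k - i) (\<lambda>j. f (\<tau> (i + j))))))"

declare G_k.simps [simp del]

definition unary_bracket :: "nat \<Rightarrow> (('v, 'e) qpath \<Rightarrow> 'a) \<Rightarrow> ('v, 'e) qpath \<Rightarrow> 'a" where
  "unary_bracket i f = (\<lambda>w. if w \<in> amb (i + 1)
     then sA ((-1) ^ i) (eval_P f (partial_Suc i (base (oneA, w, oneA)))) else 0)"

definition bracket :: "nat \<Rightarrow> (nat \<Rightarrow> ('v, 'e) qpath \<Rightarrow> 'a) \<Rightarrow> ('v, 'e) qpath \<Rightarrow> 'a" where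
  "bracket k f = (if k \<le> 1 then unary_bracket 2 (f 0)
     else \<Sum>i\<in>{1..<k}. \<Sum>\<tau>\<in>pointed_shuffles i k.
       Fup 3 (brk 0 0 (G_k i (\<lambda>j. f (\<tau> j))) (G_k (k - i) (\<lambda>j. f (\<tau> (i + j))))))"


section \<open>Maurer--Cartan elements\<close>

definition sP :: "'k \<Rightarrow> (('v, 'e) qpath \<Rightarrow> 'a) \<Rightarrow> ('v, 'e) qpath \<Rightarrow> 'a" where
  "sP c f = (\<lambda>w. sA c (f w))"

text \<open>The multilinear extension of the \<open>k\<close>-ary bracket applied to \<open>k\<close> copies of a formal sum \<open>t\<close>
  of pairs in \<open>P\<^sup>2 \<times> \<mm>\<close>.\<close>

definition bracket_ext :: "nat \<Rightarrow> ((('v, 'e) qpath \<Rightarrow> 'a) \<times> 'b \<Rightarrow>\<^sub>0 'k)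
    \<Rightarrow> ((('v, 'e) qpath \<Rightarrow> 'a) \<times> 'b \<Rightarrow>\<^sub>0 'k)" where
  "bracket_ext k t = (\<Sum>xs | set xs \<subseteq> keys t \<and> length xs = k.
     fscale (\<Prod>x\<leftarrow>xs. lookup t x) (base (bracket k (\<lambda>j. fst (xs ! j)), \<Prod>x\<leftarrow>xs. snd x)))"

text \<open>The Maurer--Cartan equation holds in \<open>P\<^sup>3 \<otimes>^ \<mm>\<close> iff it holds modulo \<open>\<mm>\<^sup>n\<close> for all \<open>n\<close>; there,
  the terms with \<open>k \<ge> n\<close> vanish because they lie in \<open>P\<^sup>3 \<otimes> \<mm>\<^sup>k\<close>.\<close>

definition maurer_cartan :: "(nat \<Rightarrow> ((('v, 'e) qpath \<Rightarrow> 'a) \<times> 'b \<Rightarrow>\<^sub>0 'k) set) set" where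
  "maurer_cartan = {\<xi> \<in> ctensor sP (Pn 2) sB \<mm> \<mm>.
     \<forall>n. \<forall>t\<in>\<xi> n. (\<Sum>k = 1..<n. fscale (1 / fact k) (bracket_ext k t)) \<in> ct_null sP (Pn 3) sB \<mm> \<mm> n}"


section \<open>Formal deformations\<close>

text \<open>The \<open>B\<close>-module \<open>A \<otimes>^ B\<close>. As \<open>\<mm>\<close> is finitely generated, its reduction modulo \<open>\<mm>\<close> is the
  component \<open>A \<otimes> B/\<mm>\<close> at \<open>n = 1\<close>, which is \<open>A\<close> via \<open>a \<mapsto> a \<otimes> 1\<close>.\<close>

definition AB :: "(nat \<Rightarrow> ('a \<times> 'b \<Rightarrow>\<^sub>0 'k) set) set" where
  "AB = ctensor sA UNIV sB UNIV \<mm>"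

abbreviation AB_class :: "nat \<Rightarrow> ('a \<times> 'b \<Rightarrow>\<^sub>0 'k) \<Rightarrow> ('a \<times> 'b \<Rightarrow>\<^sub>0 'k) set" where
  "AB_class \<equiv> ct_class sA UNIV sB UNIV \<mm>"

definition AB_add where
  "AB_add x y = (\<lambda>n. \<Union>s\<in>x n. \<Union>t\<in>y n. AB_class n (s + t))"

definition AB_scale where
  "AB_scale b x = (\<lambda>n. \<Union>s\<in>x n. AB_class n (b_act b s))"

definition reduces_to :: "(nat \<Rightarrow> ('a \<times> 'b \<Rightarrow>\<^sub>0 'k) set) \<Rightarrow> 'a \<Rightarrow> bool" where
  "reduces_to x a \<longleftrightarrow> x 1 = AB_class 1 (base (a, 1))"

definition formal_deformation where
  "formal_deformation star \<longleftrightarrow>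
     (\<forall>x\<in>AB. \<forall>y\<in>AB. star x y \<in> AB) \<and>
     (\<forall>x\<in>AB. \<forall>y\<in>AB. \<forall>z\<in>AB.
        star (AB_add x y) z = AB_add (star x z) (star y z) \<and>
        star x (AB_add y z) = AB_add (star x y) (star x z) \<and>
        star (star x y) z = star x (star y z)) \<and>
     (\<forall>b. \<forall>x\<in>AB. \<forall>y\<in>AB.
        star (AB_scale b x) y = AB_scale b (star x y) \<and>
        star x (AB_scale b y) = AB_scale b (star x y)) \<and>
     (\<forall>x\<in>AB. \<forall>y\<in>AB. \<forall>a a'. reduces_to x a \<longrightarrow> reduces_to y a' \<longrightarrow> reduces_to (star x y) (a * a'))"

definition gauge_equivalent where
  "gauge_equivalent star star' \<longleftrightarrow>
     (\<exists>T. bij_betw T AB AB \<and>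
        (\<forall>x\<in>AB. \<forall>y\<in>AB. T (AB_add x y) = AB_add (T x) (T y)) \<and>
        (\<forall>b. \<forall>x\<in>AB. T (AB_scale b x) = AB_scale b (T x)) \<and>
        (\<forall>x\<in>AB. \<forall>a. reduces_to x a \<longrightarrow> reduces_to (T x) a) \<and>
        (\<forall>x\<in>AB. \<forall>y\<in>AB. T (star x y) = star' (T x) (T y)))"


section \<open>The combinatorial star product\<close>

text \<open>\<open>\<phi>t t s\<close> is \<open>\<sigma>\<close> applied to the value at \<open>s\<close> of a formal sum \<open>t\<close> of pairs in \<open>Hom(\<bbbk>S, A) \<times> \<mm>\<close>.\<close>

definition \<phi>t :: "((('v, 'e) qpath \<Rightarrow> 'a) \<times> 'b \<Rightarrow>\<^sub>0 'k) \<Rightarrow> ('v, 'e) qpath \<Rightarrow> ('v, 'e) qpath \<Rightarrow>\<^sub>0 'b" where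
  "\<phi>t t s = (\<Sum>(f, b)\<in>keys t. \<Sum>u\<in>keys (\<sigma> (f s)).
      single u (sB (lookup t (f, b) * lookup (\<sigma> (f s)) u) b))"

text \<open>The variable \<open>z\<close> is that of the polynomial ring \<open>B[z]\<close>, and \<open>\<bbbk>Q \<otimes> B[z]\<close> is the path algebra
  with coefficients in \<open>B[z]\<close>.\<close>

definition kQ_to_Bz :: "(('v, 'e) qpath \<Rightarrow>\<^sub>0 'k) \<Rightarrow> (('v, 'e) qpath \<Rightarrow>\<^sub>0 'b poly)" where
  "kQ_to_Bz x = Poly_Mapping.map (\<lambda>c. [:sB c 1:]) x"

definition red :: "((('v, 'e) qpath \<Rightarrow> 'a) \<times> 'b \<Rightarrow>\<^sub>0 'k)
    \<Rightarrow> (('v, 'e) qpath \<Rightarrow>\<^sub>0 'b poly) \<Rightarrow> (('v, 'e) qpath \<Rightarrow>\<^sub>0 'b poly)" where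
  "red t = free_ext (\<lambda>p. if p \<in> irr G S then base p else
     (\<Sum>(q, s, r)\<in>right_occ G S p.
        pmul G (base q) (pmul G (kQ_to_Bz (\<phi> s)) (base r)) +
        fscale [:0, 1:]
          (pmul G (base q) (pmul G (Poly_Mapping.map (\<lambda>b. [:b:]) (\<phi>t t s)) (base r)))))"

text \<open>The coefficient of \<open>p z\<^sup>j\<close> in the \<open>z\<close>-adic limit of the iterates of \<open>red t\<close> on \<open>x\<close>, i.e. the
  eventually constant value.\<close>

definition red_lim :: "((('v, 'e) qpath \<Rightarrow> 'a) \<times> 'b \<Rightarrow>\<^sub>0 'k)
    \<Rightarrow> (('v, 'e) qpath \<Rightarrow>\<^sub>0 'b poly) \<Rightarrow> nat \<Rightarrow> ('v, 'e) qpath \<Rightarrow> 'b" where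
  "red_lim t x j p =
     (THE c. eventually (\<lambda>N. coeff (lookup ((red t ^^ N) x) p) j = c) sequentially)"

text \<open>\<open>a \<star> a'\<close> modulo \<open>\<mm>\<^sup>n\<close> for \<open>a, a' \<in> A\<close>, where \<open>t\<close> represents the deformation parameter modulo
  \<open>\<mm>\<^sup>n\<close>. After setting \<open>z = 1\<close> only the coefficients of \<open>z\<^sup>j\<close> with \<open>j < n\<close> contribute, because
  the coefficient of \<open>z\<^sup>j\<close> lies in \<open>\<bbbk>Q \<otimes> \<mm>\<^sup>j\<close>.\<close>

definition star_basic :: "nat \<Rightarrow> ((('v, 'e) qpath \<Rightarrow> 'a) \<times> 'b \<Rightarrow>\<^sub>0 'k)
    \<Rightarrow> 'a \<Rightarrow> 'a \<Rightarrow> ('a \<times> 'b \<Rightarrow>\<^sub>0 'k)" where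
  "star_basic n t a a' = (let c = red_lim t (kQ_to_Bz (pmul G (\<sigma> a) (\<sigma> a')))
     in \<Sum>j<n. \<Sum>p | c j p \<noteq> 0. base (\<pi>p p, c j p))"

text \<open>The \<open>B\<close>-bilinear extension to \<open>A \<otimes>^ B\<close>, computed modulo \<open>\<mm>\<^sup>n\<close> for each \<open>n\<close>. The cosets in
  the union do not depend on the representatives \<open>t\<close>, \<open>u\<close>, \<open>v\<close>.\<close>

definition comb_star :: "(nat \<Rightarrow> ((('v, 'e) qpath \<Rightarrow> 'a) \<times> 'b \<Rightarrow>\<^sub>0 'k) set)
    \<Rightarrow> (nat \<Rightarrow> ('a \<times> 'b \<Rightarrow>\<^sub>0 'k) set) \<Rightarrow> (nat \<Rightarrow> ('a \<times> 'b \<Rightarrow>\<^sub>0 'k) set)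
    \<Rightarrow> (nat \<Rightarrow> ('a \<times> 'b \<Rightarrow>\<^sub>0 'k) set)" where
  "comb_star \<xi> x y = (\<lambda>n. \<Union>t\<in>\<xi> n. \<Union>u\<in>x n. \<Union>v\<in>y n.
     AB_class n (free_ext (\<lambda>(a, b). free_ext (\<lambda>(a', b').
       b_act (b * b') (star_basic n t a a')) v) u))"

end

end

theory Submission
  imports Defs
begin

text \<open>
  The proof passes to coordinates, normalises the product by a gauge transformation, reads off the
  deformation parameter, and compares two fixed-point equations.

  \<open>B\<close> has a topological \<open>\<bbbk>\<close>-basis, made of \<open>1\<close> and of lifts of bases of the spaces
  \<open>\<mm>\<^sup>n/\<mm>\<^sup>n\<^sup>+\<^sup>1\<close> (\<open>top_basis_exists\<close>). Hence \<open>A \<otimes>^ B\<close> is the space \<open>C\<close> of all functions from the basis to \<open>A\<close>, filtered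
  by the functions \<open>K n\<close> that vanish on the finitely many basis elements of level less than \<open>n\<close>. This is the
  \<open>\<mm>\<close>-adic filtration since \<open>\<mm>\<close> is finitely generated (\<open>K_Suc_gens\<close>), so \<open>B\<close>-linear maps are continuous, and
  those which are the identity modulo \<open>\<mm>\<close> are bijective (\<open>Blin_bij\<close>).

  The vertices of \<open>Q\<close> lift to orthogonal idempotents of the deformed algebra
  (\<open>orthogonal_idempotents\<close>) and the arrows to elements between them. Mapping an irreducible path to the product of
  the lifts of its arrows extends to a \<open>B\<close>-linear automorphism. Transporting the product along it gives a product
  \<open>\<star>\<close> for which the vertices act as in \<open>A\<close> and \<open>x \<star> u = xu\<close> if \<open>x\<close> is an arrow and \<open>xu\<close> an irreducible path (\<open>gauge_fixed\<close>).

  Let \<open>\<Psi>(a, b) = a \<star> b - ab\<close>. For \<open>s \<in> S\<close> write \<open>s = xu\<close> with an arrow \<open>x\<close>; then \<open>u\<close> is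
  irreducible and \<open>x \<star> u = \<phi>\<^sub>s + \<phi>'\<^sub>s\<close> with \<open>\<phi>'\<^sub>s = \<Psi>(x, u)\<close>. Thus evaluating paths as \<open>\<star>\<close>-products of their arrows is
  compatible with the reductions \<open>qsr \<mapsto> q\<phi>\<^sub>sr + z q\<phi>'\<^sub>sr\<close> at \<open>z = 1\<close>. These terminate modulo each power of \<open>z\<close>,
  because already single paths are well-founded under reduction (\<open>redstep_accp\<close>). On irreducible paths the evaluation is
  the projection to \<open>A\<close>, so \<open>\<star>\<close> is the combinatorial star product of \<open>\<phi>'\<close> (\<open>comb_star_fromC\<close>).

  Let \<open>d\<close> be the Hochschild differential. For cochains \<open>\<psi>\<close> with the normalisation of
  \<open>\<Psi>\<close>, and \<open>f(s) = \<psi>(x, u)\<close> as above, one has \<open>h(d\<psi>) = G(f) - \<psi>\<close> and \<open>F(d\<psi>) = \<langle>f\<rangle>\<close> (\<open>hup_differential\<close>,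
  \<open>Fup_differential\<close>). The reason is that the homotopy \<open>\<rho>\<^sub>1\<close> is characterised by a recursion along reductions
  (\<open>tau_unique\<close>), which the functional \<open>1 \<otimes> x \<otimes> b \<mapsto> \<psi>(x, b)\<close> obeys. Associativity of \<open>\<star>\<close> is the equation
  \<open>d\<Psi> = - \<onehalf>[\<Psi>, \<Psi>]\<close>, so \<open>\<Psi> = G(\<phi>') + \<onehalf>h[\<Psi>, \<Psi>]\<close> and \<open>\<langle>\<phi>'\<rangle> + \<onehalf>F[\<Psi>, \<Psi>] = 0\<close>. By the recursive definition of the
  \<open>G\<^sub>k\<close>, the sum of all \<open>1/k! G\<^sub>k(\<phi>', \<dots>, \<phi>')\<close> satisfies the first equation in place of \<open>\<Psi>\<close>. This fixed-point equation has only one solution,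
  as the bracket raises the \<open>\<mm>\<close>-adic order (\<open>Gsum_eq_psi\<close>). Inserting this sum for \<open>\<Psi>\<close>, the second equation becomes the
  Maurer--Cartan equation for \<open>\<phi>'\<close> (\<open>xi_maurer_cartan\<close>).\<close>

section \<open>Linear extension\<close>

context module
begin

lemma lin_ext_superset:
  assumes "finite X" "keys x \<subseteq> X"
  shows "lin_ext scale g x = (\<Sum>p\<in>X. lookup x p *s g p)"
  unfolding lin_ext_def
  by (rule sum.mono_neutral_left) (use assms in \<open>auto simp: in_keys_iff\<close>)

lemma lin_ext_zero [simp]: "lin_ext scale g 0 = 0"
  by (simp add: lin_ext_def)

lemma lin_ext_single [simp]: "lin_ext scale g (single p c) = c *s g p"
  by (simp add: lin_ext_def)

lemma lin_ext_add: "lin_ext scale g (x + y) = lin_ext scale g x + lin_ext scale g y"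
  using Poly_Mapping.keys_add[of x y]
  by (simp add: lin_ext_superset[of "keys x \<union> keys y"] lookup_add scale_left_distrib sum.distrib)

lemma lin_ext_fscale: "lin_ext scale g (fscale c x) = c *s lin_ext scale g x"
proof -
  have "keys (fscale c x) \<subseteq> keys x"
    by (auto simp: in_keys_iff)
  then show ?thesis
    by (simp add: lin_ext_superset[of "keys x"] scale_sum_right)
qed

lemma lin_ext_hom: "module_hom fscale scale (lin_ext scale g)"
  by (intro module_hom.intro module_hom_axioms.intro module_fscale module_axioms
      lin_ext_add lin_ext_fscale)

lemma lin_ext_diff: "lin_ext scale g (x - y) = lin_ext scale g x - lin_ext scale g y"
  by (rule module_hom.diff[OF lin_ext_hom])

lemma lin_ext_sum: "lin_ext scale g (\<Sum>i\<in>X. f i) = (\<Sum>i\<in>X. lin_ext scale g (f i))"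
  by (rule module_hom.sum[OF lin_ext_hom])

lemma lin_ext_cong: "(\<And>p. p \<in> keys x \<Longrightarrow> g p = h p) \<Longrightarrow> lin_ext scale g x = lin_ext scale h x"
  by (simp add: lin_ext_def)

lemma lin_ext_fun_add: "lin_ext scale (\<lambda>p. g p + h p) x = lin_ext scale g x + lin_ext scale h x"
  by (simp add: lin_ext_def scale_right_distrib sum.distrib)

lemma lin_ext_fun_diff: "lin_ext scale (\<lambda>p. g p - h p) x = lin_ext scale g x - lin_ext scale h x"
  by (simp add: lin_ext_def scale_right_diff_distrib sum_subtractf)

lemma lin_ext_fun_scale: "lin_ext scale (\<lambda>p. c *s g p) x = c *s lin_ext scale g x"
  by (simp add: lin_ext_def scale_sum_right mult.commute)

lemma lin_ext_fun_zero [simp]: "lin_ext scale (\<lambda>p. 0) x = 0"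
  by (simp add: lin_ext_def)

lemma lin_ext_fun_sum: "lin_ext scale (\<lambda>p. \<Sum>i\<in>X. g i p) x = (\<Sum>i\<in>X. lin_ext scale (g i) x)"
  unfolding lin_ext_def scale_sum_right by (rule sum.swap)

lemma lin_ext_free_ext:
  "lin_ext scale g (free_ext h x) = lin_ext scale (\<lambda>p. lin_ext scale g (h p)) x"
proof -
  have "lin_ext scale g (free_ext h x) = (\<Sum>p\<in>keys x. lin_ext scale g (fscale (lookup x p) (h p)))"
    by (simp only: lin_ext_def[of fscale] lin_ext_sum)
  then show ?thesis
    by (simp only: lin_ext_fscale lin_ext_def[of scale "\<lambda>p. lin_ext scale g (h p)"])
qed

end

lemma module_hom_lin_ext:
  assumes "module_hom s1 s2 f"
  shows "f (lin_ext s1 g x) = lin_ext s2 (\<lambda>p. f (g p)) x"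
  unfolding lin_ext_def
  by (simp add: module_hom.sum[OF assms] module_hom.scale[OF assms])

interpretation fs: module "fscale :: 'r::comm_ring_1 \<Rightarrow> ('x \<Rightarrow>\<^sub>0 'r) \<Rightarrow> _"
  by (rule module_fscale)

lemma fscale_single [simp]: "fscale c (single p d) = single p (c * d)"
  by (rule poly_mapping_eqI) (simp add: lookup_single when_def)

lemma free_ext_base: "free_ext base x = x"
proof (rule poly_mapping_eqI)
  fix p
  show "lookup (free_ext base x) p = lookup x p"
    by (simp add: lin_ext_def lookup_sum lookup_single when_def in_keys_iff)
qed

lemma keys_fscale: "keys (fscale c x) \<subseteq> keys x"
  by (auto simp: in_keys_iff)

lemma keys_sum_subset: "keys (\<Sum>i\<in>X. f i) \<subseteq> (\<Union>i\<in>X. keys (f i))"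
  by (rule Poly_Mapping.keys_sum)

lemma keys_free_ext: "keys (free_ext g x) \<subseteq> (\<Union>p\<in>keys x. keys (g p))"
  unfolding lin_ext_def
  by (rule order_trans[OF keys_sum_subset]) (intro UN_mono order_refl keys_fscale)

lemma lookup_free_ext: "lookup (free_ext g x) p = (\<Sum>q\<in>keys x. lookup x q * lookup (g q) p)"
  by (simp add: lin_ext_def lookup_sum)

lemma subspace_keys: "fs.subspace {x. keys x \<subseteq> X}"
  unfolding fs.subspace_def
proof (intro conjI allI ballI)
  fix x y :: "'b \<Rightarrow>\<^sub>0 'a" and c
  assume "x \<in> {x. keys x \<subseteq> X}" "y \<in> {x. keys x \<subseteq> X}"
  then show "x + y \<in> {x. keys x \<subseteq> X}"
    using Poly_Mapping.keys_add[of x y] by auto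
next
  fix x :: "'b \<Rightarrow>\<^sub>0 'a" and c
  assume "x \<in> {x. keys x \<subseteq> X}"
  then show "fscale c x \<in> {x. keys x \<subseteq> X}"
    using keys_fscale[of c x] by auto
qed simp

lemma subspace_lin_ext:
  assumes "module s" "module.subspace s V" "\<And>p. p \<in> keys x \<Longrightarrow> g p \<in> V"
  shows "lin_ext s g x \<in> V"
  unfolding lin_ext_def
  by (intro module.subspace_sum[OF assms(1,2)] module.subspace_scale[OF assms(1,2)] assms(3))

lemma pmul_base: "pmul G (base p) (base q) = (if tgt G p = src q then base (pcat p q) else 0)"
  by (simp add: pmul_def)

lemma pmul_add_left: "pmul G (x + y) z = pmul G x z + pmul G y z"
  by (simp add: pmul_def fs.lin_ext_add)
lemma pmul_add_right: "pmul G z (x + y) = pmul G z x + pmul G z y"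
  by (simp add: pmul_def fs.lin_ext_add fs.lin_ext_fun_add)
lemma pmul_diff_left: "pmul G (x - y) z = pmul G x z - pmul G y z"
  by (simp add: pmul_def fs.lin_ext_diff)
lemma pmul_diff_right: "pmul G z (x - y) = pmul G z x - pmul G z y"
  by (simp add: pmul_def fs.lin_ext_diff fs.lin_ext_fun_diff)
lemma pmul_fscale_left: "pmul G (fscale c x) z = fscale c (pmul G x z)"
  by (simp add: pmul_def fs.lin_ext_fscale)
lemma pmul_fscale_right: "pmul G z (fscale c x) = fscale c (pmul G z x)"
  by (simp add: pmul_def fs.lin_ext_fscale fs.lin_ext_fun_scale)
lemma pmul_zero_left [simp]: "pmul G 0 z = 0"
  by (simp add: pmul_def)
lemma pmul_zero_right [simp]: "pmul G z 0 = 0"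
  by (simp add: pmul_def)

lemma pmul_context:
  assumes "\<And>u. u \<in> keys y \<Longrightarrow> src u = tgt G q \<and> tgt G u = src r"
  shows "pmul G (base q) (pmul G y (base r)) = free_ext (\<lambda>u. base (pcat q (pcat u r))) y"
proof -
  have "pmul G y (base r) = free_ext (\<lambda>u. base (pcat u r)) y"
    unfolding pmul_def by (rule fs.lin_ext_cong) (simp add: assms)
  then have "pmul G (base q) (pmul G y (base r))
      = free_ext (\<lambda>u. if tgt G q = src (pcat u r) then base (pcat q (pcat u r)) else 0) y"
    by (simp add: pmul_def fs.lin_ext_free_ext)
  also have "\<dots> = free_ext (\<lambda>u. base (pcat q (pcat u r))) y"
    by (rule fs.lin_ext_cong) (simp add: assms pcat_def)
  finally show ?thesis .
qed


section \<open>Paths\<close>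

lemma pcat_assoc: "pcat (pcat p q) r = pcat p (pcat q r)"
  by (simp add: pcat_def)

lemma src_pcat [simp]: "src (pcat p q) = src p"
  by (simp add: pcat_def)

lemma snd_pcat [simp]: "snd (pcat p q) = snd p @ snd q"
  by (simp add: pcat_def)

lemma pcat_triv_right [simp]: "pcat p (triv v) = p"
  by (simp add: pcat_def)

lemma pcat_triv_left: "pcat (triv v) p = p \<longleftrightarrow> v = src p"
  by (auto simp: pcat_def prod_eq_iff)

lemma tgt_triv [simp]: "tgt G (triv v) = v"
  by (simp add: tgt_def)

lemma tgt_Cons [simp]: "tgt G (u, e # es) = tgt G (head G e, es)"
  by (simp add: tgt_def)

lemma tgt_pcat: "tgt G p = src q \<Longrightarrow> tgt G (pcat p q) = tgt G q"
  by (auto simp: tgt_def pcat_def)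

lemma tgt_append: "tgt G (u, es @ fs) = tgt G (tgt G (u, es), fs)"
  by (auto simp: tgt_def)

context wf_digraph
begin

lemma paths_Nil [simp]: "(u, []) \<in> paths G \<longleftrightarrow> u \<in> verts G"
  by (auto simp: paths_def awalk_Nil_iff)

lemma paths_Cons [simp]:
  "(u, e # es) \<in> paths G \<longleftrightarrow> e \<in> arcs G \<and> u = tail G e \<and> (head G e, es) \<in> paths G"
  by (auto simp: paths_def awalk_Cons_iff)

lemma src_in_verts: "p \<in> paths G \<Longrightarrow> src p \<in> verts G"
  by (auto simp: paths_def awalk_hd_in_verts)

lemma paths_append:
  "(u, es @ fs) \<in> paths G \<longleftrightarrow> (u, es) \<in> paths G \<and> (tgt G (u, es), fs) \<in> paths G"
proof (induction es arbitrary: u)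
  case Nil
  then show ?case using src_in_verts[of "(u, fs)"] by auto
qed simp

lemma tgt_in_verts: "p \<in> paths G \<Longrightarrow> tgt G p \<in> verts G"
  by (metis append.right_neutral paths_Nil paths_append prod.collapse)

lemma pcat_in_paths:
  "p \<in> paths G \<Longrightarrow> q \<in> paths G \<Longrightarrow> tgt G p = src q \<Longrightarrow> pcat p q \<in> paths G"
  by (cases p, cases q) (simp add: pcat_def paths_append)

end

declare split_paired_All [simp del] split_paired_Ex [simp del]

section \<open>Reduction systems with the diamond property\<close>

locale reduction_setup = deformation_data G S \<phi> sA \<pi> sB \<mm>
  for G :: "('v, 'e) pre_digraph"
    and S :: "('v, 'e) qpath set"
    and \<phi> :: "('v, 'e) qpath \<Rightarrow> ('v, 'e) qpath \<Rightarrow>\<^sub>0 'k::field_char_0"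
    and sA :: "'k \<Rightarrow> 'a \<Rightarrow> 'a::ring"
    and \<pi> :: "(('v, 'e) qpath \<Rightarrow>\<^sub>0 'k) \<Rightarrow> 'a"
    and sB :: "'k \<Rightarrow> 'b \<Rightarrow> 'b::comm_ring_1"
    and \<mm> :: "'b set" +
  fixes I :: "(('v, 'e) qpath \<Rightarrow>\<^sub>0 'k) set"
  assumes fin: "fin_digraph G"
    and ideal: "two_sided_ideal G I"
    and quot: "quotient_algebra G I sA \<pi>"
    and redsys: "reduction_system G S \<phi>"
    and dia: "diamond G S \<phi> I"
begin

sublocale fin_digraph G
  by (rule fin)

lemma S_paths: "s \<in> S \<Longrightarrow> s \<in> paths G"
  and S_len: "s \<in> S \<Longrightarrow> 2 \<le> plen s"
  and S_sub: "s \<in> S \<Longrightarrow> s' \<in> S \<Longrightarrow> s \<noteq> s' \<Longrightarrow> occs G {s} s' = {}"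
  and phi_irr: "s \<in> S \<Longrightarrow> u \<in> keys (\<phi> s) \<Longrightarrow> u \<in> irr G S"
  and phi_src: "s \<in> S \<Longrightarrow> u \<in> keys (\<phi> s) \<Longrightarrow> src u = src s"
  and phi_tgt: "s \<in> S \<Longrightarrow> u \<in> keys (\<phi> s) \<Longrightarrow> tgt G u = tgt G s"
  using redsys unfolding reduction_system_def by auto

lemma irr_paths: "p \<in> irr G S \<Longrightarrow> p \<in> paths G"
  by (simp add: irr_def)

lemma phi_paths: "s \<in> S \<Longrightarrow> u \<in> keys (\<phi> s) \<Longrightarrow> u \<in> paths G"
  by (rule irr_paths[OF phi_irr])

lemma occsI:
  "q \<in> paths G \<Longrightarrow> w \<in> paths G \<Longrightarrow> r \<in> paths G \<Longrightarrow> w \<in> T \<Longrightarrow> tgt G q = src w \<Longrightarrow>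
    tgt G w = src r \<Longrightarrow> (q, w, r) \<in> occs G T (pcat q (pcat w r))"
  by (simp add: occs_def)

lemma occsD:
  assumes "(q, w, r) \<in> occs G T p"
  shows "q \<in> paths G" "w \<in> paths G" "r \<in> paths G" "w \<in> T" "tgt G q = src w" "tgt G w = src r"
    "p = pcat q (pcat w r)"
  using assms by (auto simp: occs_def)

lemma S_not_irr: "s \<in> S \<Longrightarrow> s \<notin> irr G S"
proof -
  assume s: "s \<in> S"
  have "(triv (src s), s, triv (tgt G s)) \<in> occs G S (pcat (triv (src s)) (pcat s (triv (tgt G s))))"
    by (rule occsI) (use S_paths[OF s] src_in_verts tgt_in_verts s in auto)
  moreover have "pcat (triv (src s)) (pcat s (triv (tgt G s))) = s"
    by (simp add: pcat_triv_left)
  ultimately show ?thesis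
    by (auto simp: irr_def)
qed

definition reduct :: "('v, 'e) qpath \<Rightarrow> ('v, 'e) qpath \<Rightarrow> ('v, 'e) qpath \<Rightarrow> (('v, 'e) qpath \<Rightarrow>\<^sub>0 'k)" where
  "reduct q s r = free_ext (\<lambda>u. base (pcat q (pcat u r))) (\<phi> s)"

lemma reduct_eq_pmul:
  assumes "(q, s, r) \<in> occs G S p"
  shows "pmul G (base q) (pmul G (\<phi> s) (base r)) = reduct q s r"
  unfolding reduct_def
  by (rule pmul_context) (use occsD[OF assms] phi_src phi_tgt in auto)

lemma keys_reduct:
  assumes "s \<in> S"
  shows "keys (reduct q s r) = (\<lambda>u. pcat q (pcat u r)) ` keys (\<phi> s)"
proof
  show "keys (reduct q s r) \<subseteq> (\<lambda>u. pcat q (pcat u r)) ` keys (\<phi> s)"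
    unfolding reduct_def by (rule order_trans[OF keys_free_ext]) auto
  show "(\<lambda>u. pcat q (pcat u r)) ` keys (\<phi> s) \<subseteq> keys (reduct q s r)"
  proof (rule image_subsetI)
    fix v assume u: "v \<in> keys (\<phi> s)"
    have "lookup (reduct q s r) (pcat q (pcat v r)) =
        (\<Sum>u'\<in>keys (\<phi> s). lookup (\<phi> s) u' * (if u' = v then 1 else 0))"
      unfolding reduct_def lookup_free_ext
    proof (rule sum.cong)
      fix u' assume "u' \<in> keys (\<phi> s)"
      then have "src u' = src v"
        using u phi_src[OF assms] by metis
      then show "lookup (\<phi> s) u' * lookup (base (pcat q (pcat u' r))) (pcat q (pcat v r)) =
          lookup (\<phi> s) u' * (if u' = v then 1 else 0)"
        by (auto simp: prod_eq_iff lookup_single when_def pcat_def)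
    qed simp
    also have "\<dots> = lookup (\<phi> s) v"
      using u by (simp add: if_distrib cong: if_cong)
    finally show "pcat q (pcat v r) \<in> keys (reduct q s r)"
      using u by (simp add: in_keys_iff)
  qed
qed

lemma keys_reduct_paths:
  assumes "(q, s, r) \<in> occs G S p" "p' \<in> keys (reduct q s r)"
  shows "p' \<in> paths G" "src p' = src p" "tgt G p' = tgt G p"
proof -
  note o = occsD[OF assms(1)]
  obtain u where u: "u \<in> keys (\<phi> s)" "p' = pcat q (pcat u r)"
    using assms(2) keys_reduct[OF o(4)] by auto
  have ur: "pcat u r \<in> paths G" "pcat s r \<in> paths G" "tgt G (pcat u r) = tgt G r" "tgt G (pcat s r) = tgt G r"
    using o phi_paths[OF o(4) u(1)] phi_tgt[OF o(4) u(1)]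
    by (auto intro!: pcat_in_paths tgt_pcat)
  show "p' \<in> paths G" "src p' = src p" "tgt G p' = tgt G p"
    using o u ur phi_src[OF o(4) u(1)] by (auto intro!: pcat_in_paths simp: tgt_pcat)
qed

lemma reduct_lookup_self:
  assumes "(q, s, r) \<in> occs G S p"
  shows "lookup (reduct q s r) p = 0"
proof (rule ccontr)
  note o = occsD[OF assms]
  assume "\<not> ?thesis"
  then obtain u where u: "u \<in> keys (\<phi> s)" "p = pcat q (pcat u r)"
    using keys_reduct[OF o(4)] by (auto simp: in_keys_iff[symmetric])
  then have "u = s"
    using o(7) phi_src[OF o(4) u(1)] by (auto simp: pcat_def prod_eq_iff)
  then show False
    using phi_irr[OF o(4) u(1)] S_not_irr[OF o(4)] by simp
qed

lemma basic_reduction_eq: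
  assumes "(q, s, r) \<in> occs G S p"
  shows "basic_reduction G \<phi> q s r x = x + fscale (lookup x p) (reduct q s r - base p)"
proof -
  have "basic_reduction G \<phi> q s r x =
      free_ext (\<lambda>p'. base p' + (if p' = p then reduct q s r - base p else 0)) x"
    unfolding basic_reduction_def occsD(7)[OF assms, symmetric] reduct_eq_pmul[OF assms]
    by (rule fs.lin_ext_cong) auto
  also have "\<dots> = x + free_ext (\<lambda>p'. if p' = p then reduct q s r - base p else 0) x"
    by (simp only: fs.lin_ext_fun_add free_ext_base)
  also have "free_ext (\<lambda>p'. if p' = p then reduct q s r - base p else 0) x =
      fscale (lookup x p) (reduct q s r - base p)"
    by (simp add: lin_ext_def if_distrib in_keys_iff cong: if_cong)
  finally show ?thesis .
qed

lemma basic_reduction_hom: "module_hom fscale fscale (basic_reduction G \<phi> q s r)"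
  unfolding basic_reduction_def by (rule fs.lin_ext_hom)

lemma basic_in_reductions:
  assumes "(q, s, r) \<in> occs G S p"
  shows "basic_reduction G \<phi> q s r \<in> reductions G S \<phi>"
  using reductions.basic[OF reductions.empty occsD(4)[OF assms] assms] by simp

text \<open>Basic reductions act on linear combinations; this is the induced relation on single paths.\<close>

definition redstep :: "('v, 'e) qpath \<Rightarrow> ('v, 'e) qpath \<Rightarrow> bool" where
  "redstep p' p \<longleftrightarrow> (\<exists>q s r. (q, s, r) \<in> occs G S p \<and> p' \<in> keys (reduct q s r))"

lemma redstep_paths: "redstep p' p \<Longrightarrow> p' \<in> paths G"
  unfolding redstep_def using keys_reduct_paths(1) by blast

lemma reduction_finite_paths: "p \<in> paths G \<Longrightarrow> reduction_finite G S \<phi> p"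
  using dia[unfolded diamond_def, THEN conjunct2] by (simp add: reduction_unique_def)

text \<open>Reduction-finiteness is about linear combinations, in which terms may cancel, whereas this is about single
  paths. Let N be the set of paths with an infinite descending chain. If v involves paths in N and every
  basic reduction of v at one of them cancels all of them, then the N-part of each such path p reduces to p minus
  a multiple of the N-part of v; reducing p and then some other path of v thus gives back p, and
  repeating this contradicts the reduction-finiteness of p. So v can always be reduced such that paths in N
  remain, which contradicts reduction-finiteness as well.\<close>

lemma redstep_accp:
  assumes "p0 \<in> paths G"
  shows "Wellfounded.accp redstep p0"
proof (rule ccontr)
  assume p0: "\<not> Wellfounded.accp redstep p0"
  define N where "N = {p \<in> paths G. \<not> Wellfounded.accp redstep p}"
  have "\<exists>c. (fst c, fst (snd c), snd (snd c)) \<in> occs G S p \<and>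
      (\<exists>p'\<in>N. p' \<in> keys (reduct (fst c) (fst (snd c)) (snd (snd c))))" if pN: "p \<in> N" for p
  proof -
    have "\<exists>p'. redstep p' p \<and> \<not> Wellfounded.accp redstep p'"
    proof (rule ccontr)
      assume "\<not> ?thesis"
      then have "\<And>p'. redstep p' p \<Longrightarrow> Wellfounded.accp redstep p'"
        by blast
      then have "Wellfounded.accp redstep p"
        by (rule accpI)
      then show False using pN by (simp add: N_def)
    qed
    then obtain p' where p': "redstep p' p" "\<not> Wellfounded.accp redstep p'"
      by (elim exE conjE)
    obtain q s r where qsr: "(q, s, r) \<in> occs G S p" "p' \<in> keys (reduct q s r)"
      using p'(1) unfolding redstep_def by (elim exE conjE)
    have "p' \<in> N"
      unfolding N_def using p'(2) redstep_paths[OF p'(1)] by simp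
    with qsr show ?thesis
      by (intro exI[of _ "(q, s, r)"]) (simp only: fst_conv snd_conv, blast)
  qed
  then have "\<exists>c. \<forall>p\<in>N. (fst (c p), fst (snd (c p)), snd (snd (c p))) \<in> occs G S p \<and>
      (\<exists>p'\<in>N. p' \<in> keys (reduct (fst (c p)) (fst (snd (c p))) (snd (snd (c p)))))"
    by (intro bchoice ballI)
  then obtain c where c: "\<forall>p\<in>N. (fst (c p), fst (snd (c p)), snd (snd (c p))) \<in> occs G S p \<and>
      (\<exists>p'\<in>N. p' \<in> keys (reduct (fst (c p)) (fst (snd (c p))) (snd (snd (c p)))))"
    by (elim exE)
  define Y where "Y p = reduct (fst (c p)) (fst (snd (c p))) (snd (snd (c p)))" for p
  define R where "R p = basic_reduction G \<phi> (fst (c p)) (fst (snd (c p))) (snd (snd (c p)))" for p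
  have occ: "(fst (c p), fst (snd (c p)), snd (snd (c p))) \<in> occs G S p" if "p \<in> N" for p
    using bspec[OF c that] by (elim conjE)
  have R: "R p \<in> reductions G S \<phi>" if "p \<in> N" for p
    unfolding R_def by (rule basic_in_reductions[OF occ[OF that]])
  have lookR: "lookup (R p x) w = lookup x w + lookup x p * (lookup (Y p) w - (if w = p then 1 else 0))"
    if "p \<in> N" for p x w
    unfolding R_def Y_def basic_reduction_eq[OF occ[OF that]]
    by (simp add: lookup_add lookup_minus lookup_single when_def)
  have Y_self: "lookup (Y p) p = 0" if "p \<in> N" for p
    unfolding Y_def by (rule reduct_lookup_self[OF occ[OF that]])
  have Y_N: "\<exists>p'\<in>N. lookup (Y p) p' \<noteq> 0" if "p \<in> N" for p
    using bspec[OF c that] unfolding Y_def[symmetric] in_keys_iff by (elim conjE)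
  define nz where "nz x \<longleftrightarrow> keys x \<inter> N \<noteq> {}" for x :: "('v, 'e) qpath \<Rightarrow>\<^sub>0 'k"
  have step: "\<exists>p\<in>keys x \<inter> N. nz (R p x)" if "nz x" for x
  proof (rule ccontr)
    assume "\<not> ?thesis"
    then have z: "lookup x w + lookup x p * (lookup (Y p) w - (if w = p then 1 else 0)) = 0"
      if "p \<in> keys x" "p \<in> N" "w \<in> N" for p w
    proof -
      have "w \<notin> keys (R p x)"
        using \<open>\<not> (\<exists>p\<in>keys x \<inter> N. nz (R p x))\<close> that unfolding nz_def by blast
      then show ?thesis
        using lookR[OF that(2), of x w] by (simp add: in_keys_iff)
    qed
    have Yeq: "lookup (Y p) w = (if w = p then 1 else 0) - lookup x w / lookup x p"
      if "p \<in> keys x" "p \<in> N" "w \<in> N" for p w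
      using z[OF that] that by (simp add: in_keys_iff field_simps split: if_splits)
    obtain p where p: "p \<in> keys x" "p \<in> N"
      using \<open>nz x\<close> by (auto simp: nz_def)
    obtain p' where p': "p' \<in> N" "lookup (Y p) p' \<noteq> 0"
      using Y_N[OF p(2)] by auto
    have "p' \<noteq> p"
      using Y_self[OF p(2)] p'(2) by auto
    then have "p' \<in> keys x"
      using Yeq[OF p p'(1)] p'(2) by (auto simp: in_keys_iff)
    define \<rr> where "\<rr> n = (if even n then R p else R p')" for n :: nat
    have it: "\<forall>w\<in>N. lookup (iterate \<rr> n (base p)) w =
        (if even n then (if w = p then 1 else 0) else lookup (Y p) w)" for n
    proof (induction n)
      case 0
      then show ?case by (simp add: lookup_single when_def)
    next
      case (Suc n)
      show ?case
      proof (cases "even n")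
        case True
        then show ?thesis using Suc p by (simp add: \<rr>_def lookR)
      next
        case False
        have "lookup (Y p) w + lookup (Y p) p' * (lookup (Y p') w - (if w = p' then 1 else 0)) = (if w = p then 1 else 0)"
          if "w \<in> N" for w
          unfolding Yeq[OF p that] Yeq[OF p p'(1)] Yeq[OF \<open>p' \<in> keys x\<close> p'(1) that]
          using \<open>p' \<noteq> p\<close> p(1) \<open>p' \<in> keys x\<close> by (simp add: in_keys_iff)
        then show ?thesis using False Suc p p' by (simp add: \<rr>_def lookR)
      qed
    qed
    have "\<forall>i. \<rr> i \<in> reductions G S \<phi>"
      using R[OF p(2)] R[OF p'(1)] by (simp add: \<rr>_def)
    then obtain y where "eventually (\<lambda>n. iterate \<rr> n (base p) = y) sequentially"
      using reduction_finite_paths p(2) unfolding reduction_finite_def N_def by blast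
    then obtain n where "\<And>m. n \<le> m \<Longrightarrow> iterate \<rr> m (base p) = y"
      by (auto simp: eventually_sequentially)
    then have "lookup (iterate \<rr> (2 * n) (base p)) p = lookup (iterate \<rr> (Suc (2 * n)) (base p)) p"
      by (metis le_SucI le_add1 mult_2)
    moreover have "lookup (iterate \<rr> (2 * n) (base p)) p = 1"
      using it[of "2 * n"] p(2) by simp
    moreover have "lookup (iterate \<rr> (Suc (2 * n)) (base p)) p = 0"
      using it[of "Suc (2 * n)"] p(2) Y_self by (simp del: iterate.simps)
    ultimately show False
      by simp
  qed
  then have "\<forall>x\<in>{x. nz x}. \<exists>p. p \<in> keys x \<inter> N \<and> nz (R p x)"
    by (simp add: Bex_def)
  from bchoice[OF this] obtain ch where ch: "\<And>x. nz x \<Longrightarrow> ch x \<in> keys x \<inter> N \<and> nz (R (ch x) x)"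
    by auto
  define X where "X = rec_nat (base p0) (\<lambda>_ x. R (ch x) x)"
  have X: "X 0 = base p0" "\<And>n. X (Suc n) = R (ch (X n)) (X n)"
    by (simp_all add: X_def)
  have "nz (X n)" for n
    by (induction n) (use assms p0 ch in \<open>auto simp: X nz_def N_def\<close>)
  then have chX: "ch (X n) \<in> keys (X n)" "ch (X n) \<in> N" for n
    using ch by auto
  have "iterate (\<lambda>n. R (ch (X n))) n (base p0) = X n" for n
    by (induction n) (simp_all add: X)
  moreover have "\<forall>n. R (ch (X n)) \<in> reductions G S \<phi>"
    using R chX by blast
  ultimately obtain y where "eventually (\<lambda>n. X n = y) sequentially"
    using reduction_finite_paths[OF assms, unfolded reduction_finite_def, THEN spec, of "\<lambda>n. R (ch (X n))"]
    by auto
  then obtain n where "\<And>m. n \<le> m \<Longrightarrow> X m = y"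
    by (auto simp: eventually_sequentially)
  then have "X (Suc n) = X n"
    by simp
  then have "lookup (X n) (ch (X n)) = 0"
    using lookR[OF chX(2), of n "X n" "ch (X n)"] Y_self[OF chX(2), of n] by (simp add: X)
  then show False
    using chX(1)[of n] by (simp add: in_keys_iff)
qed

lemma path_induct [consumes 1, case_names less]:
  assumes "p \<in> paths G"
    and "\<And>p. p \<in> paths G \<Longrightarrow> (\<And>p'. redstep\<^sup>+\<^sup>+ p' p \<Longrightarrow> P p') \<Longrightarrow> P p"
  shows "P p"
proof -
  have "\<forall>p'. redstep\<^sup>*\<^sup>* p' p \<longrightarrow> P p'"
    using redstep_accp[OF assms(1)] assms(1)
  proof (induction rule: accp_induct_rule)
    case (1 p)
    have *: "P p'" if pp: "redstep\<^sup>+\<^sup>+ p' p" for p'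
    proof -
      obtain z where z: "redstep\<^sup>*\<^sup>* p' z" "redstep z p"
        using pp
      proof (cases rule: tranclp.cases)
        case r_into_trancl
        then show ?thesis by (intro that[of p']) auto
      next
        case (trancl_into_trancl b)
        then show ?thesis by (intro that[of b] tranclp_into_rtranclp)
      qed
      show ?thesis
        using 1(2)[OF z(2) redstep_paths[OF z(2)]] z(1) by simp
    qed
    have "P p"
      by (rule assms(2)[OF 1(3) *])
    with * show ?case
      by (metis rtranclpD)
  qed
  then show ?thesis by blast
qed

lemma reductions_hom: "\<rho> \<in> reductions G S \<phi> \<Longrightarrow> module_hom fscale fscale \<rho>"
proof (induction rule: reductions.induct)
  case empty
  then show ?case by (rule fs.module_hom_id)
next
  case (basic \<rho> s q r p)
  show ?case by (rule module_hom_compose[OF basic.IH basic_reduction_hom])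
qed

lemma reductions_comp:
  "\<rho> \<in> reductions G S \<phi> \<Longrightarrow> \<rho>' \<in> reductions G S \<phi> \<Longrightarrow> \<rho> \<circ> \<rho>' \<in> reductions G S \<phi>"
proof (induction rule: reductions.induct)
  case (basic \<rho> s q r p)
  then show ?case
    unfolding comp_assoc by (intro reductions.basic)
qed simp

lemma keys_basic_reduction:
  assumes "(q, s, r) \<in> occs G S p"
  shows "keys (basic_reduction G \<phi> q s r x) \<subseteq>
    keys x \<union> (if p \<in> keys x then keys (reduct q s r) else {})"
proof
  fix w assume w: "w \<in> keys (basic_reduction G \<phi> q s r x)"
  show "w \<in> keys x \<union> (if p \<in> keys x then keys (reduct q s r) else {})"
  proof (rule ccontr)
    assume "\<not> ?thesis"
    then have "lookup x w = 0" "lookup x p = 0 \<or> lookup (reduct q s r) w = 0" "p \<in> keys x \<Longrightarrow> w \<noteq> p"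
      by (auto simp: in_keys_iff split: if_splits)
    then show False
      using w basic_reduction_eq[OF assms, of x]
      by (auto simp: in_keys_iff lookup_add lookup_minus lookup_single when_def split: if_splits)
  qed
qed

lemma reductions_keys:
  assumes "\<rho> \<in> reductions G S \<phi>"
  shows "w \<in> keys (\<rho> x) \<Longrightarrow> \<exists>p\<in>keys x. redstep\<^sup>*\<^sup>* w p"
  using assms
proof (induction arbitrary: w rule: reductions.induct)
  case (basic \<rho> s q r p)
  have "w \<in> keys (\<rho> x) \<or> p \<in> keys (\<rho> x) \<and> w \<in> keys (reduct q s r)"
    using basic.prems keys_basic_reduction[OF basic.hyps(3), of "\<rho> x"] by (auto split: if_splits)
  then show ?case
  proof
    assume a: "p \<in> keys (\<rho> x) \<and> w \<in> keys (reduct q s r)"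
    then have "redstep w p"
      using basic.hyps(3) unfolding redstep_def by blast
    then show ?thesis
      using a basic.IH[of p] by (meson converse_rtranclp_into_rtranclp)
  qed (rule basic.IH)
qed auto

lemma redstep_rtranclp_paths: "redstep\<^sup>*\<^sup>* w p \<Longrightarrow> p \<in> paths G \<Longrightarrow> w \<in> paths G"
  by (induction rule: converse_rtranclp_induct) (auto dest: redstep_paths)

lemma redstep_rtranclp_ends:
  "redstep\<^sup>*\<^sup>* w p \<Longrightarrow> src w = src p \<and> tgt G w = tgt G p"
proof (induction rule: rtranclp_induct)
  case (step y z)
  then obtain q s r where "(q, s, r) \<in> occs G S z" "y \<in> keys (reduct q s r)"
    unfolding redstep_def by (elim exE conjE)
  then show ?case using step.IH keys_reduct_paths(2,3) by simp
qed simp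

lemma common_reduction:
  assumes "finite K" "K \<subseteq> paths G"
  shows "\<exists>\<rho>\<in>reductions G S \<phi>. \<forall>p\<in>K. \<rho> (base p) \<in> irr_span G S"
proof (rule ccontr)
  assume neg: "\<not> ?thesis"
  have "\<exists>b\<in>reductions G S \<phi>. \<exists>p\<in>K. b (\<rho> (base p)) \<noteq> \<rho> (base p)" if \<rho>: "\<rho> \<in> reductions G S \<phi>" for \<rho>
  proof -
    obtain p w where p: "p \<in> K" "w \<in> keys (\<rho> (base p))" "w \<notin> irr G S"
      using neg \<rho> unfolding irr_span_def by blast
    have "redstep\<^sup>*\<^sup>* w p"
      using reductions_keys[OF \<rho> p(2)] by simp
    then have "w \<in> paths G"
      using redstep_rtranclp_paths p(1) assms(2) by blast
    then obtain q s r where o: "(q, s, r) \<in> occs G S w"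
      using p(3) by (auto simp: irr_def)
    have "lookup (basic_reduction G \<phi> q s r (\<rho> (base p))) w = 0"
      by (simp add: basic_reduction_eq[OF o] lookup_add lookup_minus reduct_lookup_self[OF o])
    then have "basic_reduction G \<phi> q s r (\<rho> (base p)) \<noteq> \<rho> (base p)"
      using p(2) by (auto simp: in_keys_iff)
    then show ?thesis
      using basic_in_reductions[OF o] p(1) by blast
  qed
  then obtain b where b: "\<And>\<rho>. \<rho> \<in> reductions G S \<phi> \<Longrightarrow> b \<rho> \<in> reductions G S \<phi>"
      "\<And>\<rho>. \<rho> \<in> reductions G S \<phi> \<Longrightarrow> \<exists>p\<in>K. b \<rho> (\<rho> (base p)) \<noteq> \<rho> (base p)"
    by metis
  define X where "X = rec_nat id (\<lambda>_ \<rho>. b \<rho> \<circ> \<rho>)"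
  have X: "X 0 = id" "\<And>n. X (Suc n) = b (X n) \<circ> X n"
    by (simp_all add: X_def)
  have XR: "X n \<in> reductions G S \<phi>" for n
  proof (induction n)
    case 0
    show ?case unfolding X by (rule reductions.empty)
  next
    case (Suc n)
    then show ?case unfolding X by (intro reductions_comp b(1))
  qed
  have it: "iterate (\<lambda>n. b (X n)) n x = X n x" for n x
    by (induction n) (simp_all add: X)
  have "eventually (\<lambda>n. X (Suc n) (base p) = X n (base p)) sequentially" if "p \<in> K" for p
  proof -
    have "\<forall>n. b (X n) \<in> reductions G S \<phi>"
      using b(1) XR by blast
    moreover have "p \<in> paths G"
      using that assms(2) by (rule subsetD[rotated])
    ultimately obtain y where "eventually (\<lambda>n. X n (base p) = y) sequentially"
      using reduction_finite_paths[of p, unfolded reduction_finite_def, THEN spec, of "\<lambda>n. b (X n)"]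
      by (auto simp: it)
    then obtain m where "\<And>n. m \<le> n \<Longrightarrow> X n (base p) = y"
      by (auto simp: eventually_sequentially)
    then show ?thesis
      unfolding eventually_sequentially by (metis le_SucI)
  qed
  then have "eventually (\<lambda>n. \<forall>p\<in>K. X (Suc n) (base p) = X n (base p)) sequentially"
    using assms(1) by (intro eventually_ball_finite) auto
  then obtain n where "\<forall>p\<in>K. X (Suc n) (base p) = X n (base p)"
    by (auto simp: eventually_sequentially)
  then show False
    using b(2)[OF XR[of n]] by (auto simp: X)
qed

text \<open>By reduction-uniqueness there is only one choice.\<close>

definition NF :: "('v, 'e) qpath \<Rightarrow> (('v, 'e) qpath \<Rightarrow>\<^sub>0 'k)" where
  "NF p = (SOME y. y \<in> irr_span G S \<and> (\<exists>\<rho>\<in>reductions G S \<phi>. \<rho> (base p) = y))"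

lemma NF:
  assumes "p \<in> paths G"
  shows "NF p \<in> irr_span G S" "\<exists>\<rho>\<in>reductions G S \<phi>. \<rho> (base p) = NF p"
proof -
  have "\<exists>y. y \<in> irr_span G S \<and> (\<exists>\<rho>\<in>reductions G S \<phi>. \<rho> (base p) = y)"
    using common_reduction[of "{p}"] assms by auto
  from someI_ex[OF this, folded NF_def]
  show "NF p \<in> irr_span G S" "\<exists>\<rho>\<in>reductions G S \<phi>. \<rho> (base p) = NF p"
    by simp_all
qed

lemma NF_unique:
  assumes "p \<in> paths G" "\<rho> \<in> reductions G S \<phi>" "\<rho> (base p) \<in> irr_span G S"
  shows "NF p = \<rho> (base p)"
proof -
  obtain \<rho>' where \<rho>': "\<rho>' \<in> reductions G S \<phi>" "\<rho>' (base p) = NF p"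
    using NF(2)[OF assms(1)] by (elim bexE)
  have "reduction_unique G S \<phi> p"
    using dia[unfolded diamond_def, THEN conjunct2] assms(1) by (rule bspec)
  from this[unfolded reduction_unique_def, THEN conjunct2, THEN bspec, OF \<rho>'(1), THEN bspec, OF assms(2)]
  show ?thesis
    using NF(1)[OF assms(1)] assms(3) \<rho>'(2) by simp
qed

lemma NF_irr:
  assumes "p \<in> irr G S"
  shows "NF p = base p"
  using NF_unique[OF irr_paths[OF assms] reductions.empty] assms by (simp add: irr_span_def)

lemma keys_NF: "p \<in> paths G \<Longrightarrow> w \<in> keys (NF p) \<Longrightarrow> redstep\<^sup>*\<^sup>* w p"
proof -
  assume "p \<in> paths G" "w \<in> keys (NF p)"
  then obtain \<rho> where "\<rho> \<in> reductions G S \<phi>" "w \<in> keys (\<rho> (base p))"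
    using NF(2)[of p] by auto
  then show ?thesis using reductions_keys[of \<rho> w "base p"] by simp
qed

lemma NF_reduct:
  assumes o: "(q, s, r) \<in> occs G S p" and p: "p \<in> paths G"
  shows "free_ext NF (reduct q s r) = NF p"
proof -
  let ?y = "reduct q s r"
  have "keys ?y \<subseteq> paths G"
    using keys_reduct_paths(1)[OF o] by (rule subsetI)
  from common_reduction[OF finite_keys this]
  obtain \<rho> where \<rho>: "\<rho> \<in> reductions G S \<phi>" "\<forall>w\<in>keys ?y. \<rho> (base w) \<in> irr_span G S"
    by (elim bexE)
  have "\<rho> ?y = \<rho> (free_ext base ?y)"
    by (simp add: free_ext_base)
  also have "\<dots> = free_ext (\<lambda>w. \<rho> (base w)) ?y"
    by (rule module_hom_lin_ext[OF reductions_hom[OF \<rho>(1)]])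
  finally have 1: "\<rho> ?y = free_ext (\<lambda>w. \<rho> (base w)) ?y" .
  have 2: "\<rho> ?y \<in> irr_span G S"
    unfolding 1 irr_span_def using \<rho>(2)
    by (intro subspace_lin_ext module_fscale subspace_keys) (auto simp: irr_span_def)
  have 3: "(\<rho> \<circ> basic_reduction G \<phi> q s r) (base p) = \<rho> ?y"
    by (simp add: basic_reduction_eq[OF o] lookup_single)
  have "free_ext NF ?y = free_ext (\<lambda>w. \<rho> (base w)) ?y"
    by (rule fs.lin_ext_cong) (use NF_unique \<rho> keys_reduct_paths[OF o] in auto)
  then show ?thesis
    using NF_unique[OF p reductions_comp[OF \<rho>(1) basic_in_reductions[OF o]]] 1 2 3 by simp
qed

end

section \<open>The algebra and its basis of irreducible paths\<close>

lemma pmul_hom_right: "module_hom fscale fscale (pmul G x)"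
  by (intro module_hom.intro module_hom_axioms.intro module_fscale pmul_add_right pmul_fscale_right)

lemma pmul_hom_left: "module_hom fscale fscale (\<lambda>x. pmul G x y)"
  by (intro module_hom.intro module_hom_axioms.intro module_fscale pmul_add_left pmul_fscale_left)

lemma pcat_triv_src [simp]: "pcat (triv (src p)) p = p"
  by (simp add: pcat_triv_left)

lemma subspace_path_alg: "fs.subspace (path_alg G)"
  unfolding path_alg_def by (rule subspace_keys)

lemma path_alg_diff: "x \<in> path_alg G \<Longrightarrow> y \<in> path_alg G \<Longrightarrow> x - y \<in> path_alg G"
  by (rule fs.subspace_diff[OF subspace_path_alg])

context reduction_setup
begin

text \<open>The contexts \<open>q\<close>, \<open>r\<close> are built in, so that the linear span of these elements is already the ideal.\<close>

definition rel_gens :: "(('v, 'e) qpath \<Rightarrow>\<^sub>0 'k) set" where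
  "rel_gens = {base p - reduct q s r | p q s r. (q, s, r) \<in> occs G S p}"

lemma occs_paths: "(q, s, r) \<in> occs G T p \<Longrightarrow> p \<in> paths G"
  using occsD[of q s r T p] by (auto intro!: pcat_in_paths)

lemma occs_extend:
  assumes o: "(q, s, r) \<in> occs G T p" and x: "x \<in> paths G" and y: "y \<in> paths G"
    and c: "tgt G x = src p" "tgt G p = src y"
  shows "(pcat x q, s, pcat r y) \<in> occs G T (pcat x (pcat p y))"
proof -
  note d = occsD[OF o]
  have c1: "tgt G x = src q"
    using c(1) d(7) by simp
  have "tgt G (pcat s r) = tgt G r"
    using d(6) by (rule tgt_pcat)
  then have c2: "tgt G r = src y"
    using c(2) tgt_pcat[of G q "pcat s r"] unfolding d(7) by (simp add: d(5))
  have "pcat x (pcat p y) = pcat (pcat x q) (pcat s (pcat r y))"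
    unfolding d(7) by (simp add: pcat_assoc)
  then show ?thesis
    using d c1 c2 x y by (auto simp: tgt_pcat intro!: occsI pcat_in_paths)
qed

lemma base_in_path_alg [intro, simp]: "p \<in> paths G \<Longrightarrow> base p \<in> path_alg G"
  by (simp add: path_alg_def)

lemma rel_gens_path_alg: "rel_gens \<subseteq> path_alg G"
proof
  fix x assume "x \<in> rel_gens"
  then obtain p q s r where o: "(q, s, r) \<in> occs G S p" and x: "x = base p - reduct q s r"
    unfolding rel_gens_def by auto
  have "reduct q s r \<in> path_alg G"
    unfolding path_alg_def using keys_reduct_paths(1)[OF o] by (simp add: subsetI)
  then show "x \<in> path_alg G"
    unfolding x by (intro fs.subspace_diff[OF subspace_path_alg] base_in_path_alg occs_paths[OF o])
qed

lemma pmul_reduct_left: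
  "pmul G (base p) (reduct q s r) = (if tgt G p = src q then reduct (pcat p q) s r else 0)"
  unfolding reduct_def module_hom_lin_ext[OF pmul_hom_right]
  by (simp add: pmul_base pcat_assoc)

lemma pmul_reduct_right:
  assumes "(q, s, r) \<in> occs G S p"
  shows "pmul G (reduct q s r) (base p') = (if tgt G p = src p' then reduct q s (pcat r p') else 0)"
proof -
  note d = occsD[OF assms]
  have t: "tgt G (pcat q (pcat u r)) = tgt G p" if "u \<in> keys (\<phi> s)" for u
    using keys_reduct_paths(3)[OF assms] that by (simp add: keys_reduct[OF d(4)])
  have "pmul G (reduct q s r) (base p') =
      free_ext (\<lambda>u. pmul G (base (pcat q (pcat u r))) (base p')) (\<phi> s)"
    unfolding reduct_def by (rule module_hom_lin_ext[OF pmul_hom_left])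
  also have "\<dots> = free_ext (\<lambda>u. if tgt G p = src p' then base (pcat q (pcat u (pcat r p'))) else 0) (\<phi> s)"
    by (rule fs.lin_ext_cong) (simp add: pmul_base t pcat_assoc)
  finally show ?thesis
    by (simp add: reduct_def)
qed

lemma triv_paths: "v \<in> verts G \<Longrightarrow> triv v \<in> paths G"
  by simp

lemma rel_gens_mult:
  assumes "p \<in> paths G" "x \<in> rel_gens"
  shows "pmul G (base p) x \<in> insert 0 rel_gens" "pmul G x (base p) \<in> insert 0 rel_gens"
proof -
  obtain p' q s r where o: "(q, s, r) \<in> occs G S p'" and x: "x = base p' - reduct q s r"
    using assms(2) unfolding rel_gens_def by auto
  note d = occsD[OF o]
  have p': "p' \<in> paths G"
    by (rule occs_paths[OF o])
  have sq: "src q = src p'"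
    by (simp add: d(7))
  show "pmul G (base p) x \<in> insert 0 rel_gens"
  proof (cases "tgt G p = src p'")
    case True
    have "(pcat p q, s, pcat r (triv (tgt G p'))) \<in> occs G S (pcat p (pcat p' (triv (tgt G p'))))"
      by (rule occs_extend[OF o assms(1) triv_paths[OF tgt_in_verts[OF p']] True]) simp
    then have "(pcat p q, s, r) \<in> occs G S (pcat p p')"
      by simp
    moreover have "pmul G (base p) x = base (pcat p p') - reduct (pcat p q) s r"
      by (simp add: x pmul_diff_right pmul_base pmul_reduct_left True sq)
    ultimately show ?thesis
      unfolding rel_gens_def by blast
  next
    case False
    then show ?thesis
      by (simp add: x pmul_diff_right pmul_base pmul_reduct_left sq)
  qed
  show "pmul G x (base p) \<in> insert 0 rel_gens"
  proof (cases "tgt G p' = src p")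
    case True
    have "(pcat (triv (src p')) q, s, pcat r p) \<in> occs G S (pcat (triv (src p')) (pcat p' p))"
      by (rule occs_extend[OF o triv_paths[OF src_in_verts[OF p']] assms(1) _ True]) simp
    then have "(q, s, pcat r p) \<in> occs G S (pcat p' p)"
      using sq by (simp add: pcat_triv_left[THEN iffD2])
    moreover have "pmul G x (base p) = base (pcat p' p) - reduct q s (pcat r p)"
      by (simp add: x pmul_diff_left pmul_base pmul_reduct_right[OF o] True)
    ultimately show ?thesis
      unfolding rel_gens_def by blast
  next
    case False
    then show ?thesis
      by (simp add: x pmul_diff_left pmul_base pmul_reduct_right[OF o])
  qed
qed

lemma path_alg_eq_lin_ext:
  "module_hom fscale fscale f \<Longrightarrow> f x = free_ext (\<lambda>p. f (base p)) x"
  using module_hom_lin_ext[of fscale fscale f base x] by (simp add: free_ext_base)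

lemma span_rel_gens_mult:
  assumes "a \<in> path_alg G" "x \<in> fs.span rel_gens"
  shows "pmul G a x \<in> fs.span rel_gens \<and> pmul G x a \<in> fs.span rel_gens"
  using assms(2)
proof (induction rule: fs.span_induct)
  case base
  show ?case
    unfolding fs.subspace_def mem_Collect_eq
    by (simp add: fs.span_zero fs.span_add fs.span_scale pmul_add_left pmul_add_right
        pmul_fscale_left pmul_fscale_right)
next
  case (step x)
  have "pmul G a x = free_ext (\<lambda>p. pmul G (base p) x) a" "pmul G x a = free_ext (\<lambda>p. pmul G x (base p)) a"
    by (rule path_alg_eq_lin_ext[OF pmul_hom_left], rule path_alg_eq_lin_ext[OF pmul_hom_right])
  moreover have "pmul G (base p) x \<in> fs.span rel_gens" "pmul G x (base p) \<in> fs.span rel_gens"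
    if "p \<in> keys a" for p
  proof -
    have p: "p \<in> paths G"
      using assms(1) that by (auto simp: path_alg_def)
    have ins: "insert 0 rel_gens \<subseteq> fs.span rel_gens"
      by (simp add: fs.span_zero fs.span_superset)
    show "pmul G (base p) x \<in> fs.span rel_gens" "pmul G x (base p) \<in> fs.span rel_gens"
      by (rule subsetD[OF ins rel_gens_mult(1)[OF p step]], rule subsetD[OF ins rel_gens_mult(2)[OF p step]])
  qed
  ultimately show ?case
    by (simp add: subspace_lin_ext module_fscale)
qed

lemma S_triv_occ: "s \<in> S \<Longrightarrow> (triv (src s), s, triv (tgt G s)) \<in> occs G S s"
  using occsI[of "triv (src s)" s "triv (tgt G s)" S] S_paths[of s] src_in_verts[of s] tgt_in_verts[of s]
  by (simp add: pcat_triv_left)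

lemma reduct_triv: "s \<in> S \<Longrightarrow> reduct (triv (src s)) s (triv (tgt G s)) = \<phi> s"
  unfolding reduct_def
proof (subst free_ext_base[symmetric], rule fs.lin_ext_cong)
  fix u assume "s \<in> S" "u \<in> keys (\<phi> s)"
  then have "src s = src u"
    by (simp add: phi_src)
  then show "base (pcat (triv (src s)) (pcat u (triv (tgt G s)))) = base u"
    by simp
qed

lemma rel_gens_triv: "s \<in> S \<Longrightarrow> base s - \<phi> s \<in> rel_gens"
  unfolding rel_gens_def using S_triv_occ[of s] reduct_triv[of s] by force

lemma I_subset_span: "I \<subseteq> fs.span rel_gens"
proof -
  have "two_sided_ideal G (fs.span rel_gens)"
    unfolding two_sided_ideal_def
    using span_rel_gens_mult fs.span_minimal[OF rel_gens_path_alg subspace_path_alg] by auto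
  moreover have "{base s - \<phi> s | s. s \<in> S} \<subseteq> fs.span rel_gens"
    using rel_gens_triv by (auto intro: fs.span_base)
  moreover have "I = two_sided_ideal G hull {base s - \<phi> s | s. s \<in> S}"
    using dia unfolding diamond_def by (rule conjunct1)
  ultimately show ?thesis
    by (simp add: hull_minimal)
qed

lemma rel_gens_subset_I: "rel_gens \<subseteq> I"
proof
  fix x assume "x \<in> rel_gens"
  then obtain p q s r where o: "(q, s, r) \<in> occs G S p" and x: "x = base p - reduct q s r"
    unfolding rel_gens_def by auto
  note d = occsD[OF o]
  have "base s - \<phi> s \<in> two_sided_ideal G hull {base s - \<phi> s | s. s \<in> S}"
    by (rule subsetD[OF hull_subset]) (use d(4) in blast)
  then have "base s - \<phi> s \<in> I"
    using dia[unfolded diamond_def, THEN conjunct1] by simp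
  then have "pmul G (base q) (pmul G (base s - \<phi> s) (base r)) \<in> I"
    using ideal d(1,3) unfolding two_sided_ideal_def by simp
  also have "pmul G (base q) (pmul G (base s - \<phi> s) (base r)) = x"
    using d(5,6) by (simp add: x pmul_diff_left pmul_diff_right pmul_base reduct_eq_pmul[OF o] d(7)[symmetric])
  finally show "x \<in> I" .
qed

lemma subspace_I: "fs.subspace I"
  using ideal by (simp add: two_sided_ideal_def)

lemma NF_kills_I:
  assumes "x \<in> I"
  shows "free_ext NF x = 0"
proof -
  have "x \<in> fs.span rel_gens"
    using assms I_subset_span by (rule subsetD[rotated])
  then show ?thesis
  proof (induction rule: fs.span_induct)
    case base
    show ?case by (simp add: fs.subspace_def fs.lin_ext_add fs.lin_ext_fscale)
  next
    case (step x)
    then obtain p q s r where o: "(q, s, r) \<in> occs G S p" and x: "x = base p - reduct q s r"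
      unfolding rel_gens_def by auto
    show ?case
      by (simp add: x fs.lin_ext_diff NF_reduct[OF o occs_paths[OF o]])
  qed
qed

lemma reductions_I:
  assumes "\<rho> \<in> reductions G S \<phi>" "x \<in> path_alg G"
  shows "x - \<rho> x \<in> I"
  using assms(1)
proof (induction rule: reductions.induct)
  case empty
  show ?case using fs.subspace_0[OF subspace_I] by simp
next
  case (basic \<rho> s q r p)
  have "base p - reduct q s r \<in> I"
    using rel_gens_subset_I basic.hyps(3) unfolding rel_gens_def by blast
  from fs.subspace_add[OF subspace_I basic.IH fs.subspace_scale[OF subspace_I this, of "lookup (\<rho> x) p"]]
  show ?case
    by (simp add: basic_reduction_eq[OF basic.hyps(3)] fs.scale_right_diff_distrib algebra_simps)
qed

lemma NF_I: "p \<in> paths G \<Longrightarrow> base p - NF p \<in> I"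
proof -
  assume p: "p \<in> paths G"
  then obtain \<rho> where "\<rho> \<in> reductions G S \<phi>" "\<rho> (base p) = NF p"
    using NF(2)[OF p] by (elim bexE)
  then show ?thesis
    using reductions_I[of \<rho> "base p"] p by simp
qed

lemma vector_space_sA: "vector_space sA"
  using quot by (simp add: quotient_algebra_def)

sublocale A: vector_space sA
  by (rule vector_space_sA)

lemma A_homI: "(\<And>x y. f (x + y) = f x + f y) \<Longrightarrow> (\<And>c x. f (sA c x) = sA c (f x)) \<Longrightarrow> module_hom sA sA f"
  by (intro module_hom.intro module_hom_axioms.intro A.module_axioms)

lemmas quot' = quot[unfolded quotient_algebra_def]

lemma sA_mult_left: "sA c a * b = sA c (a * b)" and sA_mult_right: "a * sA c b = sA c (a * b)"
  using quot'[THEN conjunct2, THEN conjunct1] by metis+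

lemma pi_add: "x \<in> path_alg G \<Longrightarrow> y \<in> path_alg G \<Longrightarrow> \<pi> (x + y) = \<pi> x + \<pi> y"
  and pi_pmul: "x \<in> path_alg G \<Longrightarrow> y \<in> path_alg G \<Longrightarrow> \<pi> (pmul G x y) = \<pi> x * \<pi> y"
  using quot'[THEN conjunct2, THEN conjunct2, THEN conjunct1] by simp_all

lemma pi_fscale: "x \<in> path_alg G \<Longrightarrow> \<pi> (fscale c x) = sA c (\<pi> x)"
  and pi_surj: "\<pi> ` path_alg G = UNIV"
  using quot'[THEN conjunct2, THEN conjunct2, THEN conjunct2] by simp_all

lemma pi_ker: "x \<in> path_alg G \<Longrightarrow> \<pi> x = 0 \<longleftrightarrow> x \<in> I"
  using quot'[THEN conjunct2, THEN conjunct2, THEN conjunct2, THEN conjunct2, THEN conjunct2] by auto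

lemma pi_zero: "\<pi> 0 = 0"
  using pi_add[of 0 0] by (simp add: path_alg_def)

lemma pi_lin_ext:
  assumes "x \<in> path_alg G"
  shows "\<pi> x = lin_ext sA \<pi>p x"
proof -
  have "\<pi> (\<Sum>p\<in>F. fscale (c p) (base p)) = (\<Sum>p\<in>F. sA (c p) (\<pi>p p))"
    if "finite F" "F \<subseteq> paths G" for F c
    using that
  proof (induction F rule: finite_induct)
    case (insert p F)
    have "fscale (c p) (base p) \<in> path_alg G" "(\<Sum>p\<in>F. fscale (c p) (base p)) \<in> path_alg G"
      using insert.prems
      by (auto intro!: fs.subspace_sum[OF subspace_path_alg] fs.subspace_scale[OF subspace_path_alg] base_in_path_alg
          simp del: fscale_single)
    then show ?case
      using insert pi_fscale[of "base p" "c p"] by (simp add: pi_add del: fscale_single)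
  qed (simp add: pi_zero)
  from this[of "keys x" "lookup x"] show ?thesis
    using assms free_ext_base[of x] unfolding path_alg_def lin_ext_def[of sA] lin_ext_def[of fscale] by simp
qed

lemma pi_diff: "x \<in> path_alg G \<Longrightarrow> y \<in> path_alg G \<Longrightarrow> \<pi> (x - y) = \<pi> x - \<pi> y"
  using path_alg_diff[of x G y] by (simp add: pi_lin_ext A.lin_ext_diff)

lemma irr_span_path_alg: "irr_span G S \<subseteq> path_alg G"
  using irr_paths by (auto simp: irr_span_def path_alg_def)

lemma subspace_irr_span: "fs.subspace (irr_span G S)"
  unfolding irr_span_def by (rule subspace_keys)

lemma NF_irr_span:
  assumes "x \<in> irr_span G S"
  shows "free_ext NF x = x"
proof -
  have "free_ext NF x = free_ext base x"
    by (rule fs.lin_ext_cong) (use assms NF_irr in \<open>auto simp: irr_span_def\<close>)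
  then show ?thesis by (simp add: free_ext_base)
qed

lemma pi_inj: "inj_on \<pi> (irr_span G S)"
proof (rule inj_onI)
  fix x y assume *: "x \<in> irr_span G S" "y \<in> irr_span G S" "\<pi> x = \<pi> y"
  then have "x - y \<in> irr_span G S"
    by (intro fs.subspace_diff[OF subspace_irr_span])
  moreover have "x - y \<in> I"
    using * irr_span_path_alg calculation pi_ker[of "x - y"] pi_diff[of x y] by auto
  ultimately have "x - y = 0"
    using NF_kills_I[of "x - y"] NF_irr_span[of "x - y"] by simp
  then show "x = y" by simp
qed

lemma pi_NF: "p \<in> paths G \<Longrightarrow> \<pi> (NF p) = \<pi>p p"
  using pi_diff[of "base p" "NF p"] pi_ker[of "base p - NF p"] NF_I[of p] NF(1)[of p] irr_span_path_alg
    path_alg_diff[of "base p" G "NF p"] by auto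

lemma pi_irr_span: "\<pi> ` irr_span G S = UNIV"
proof (rule UNIV_eq_I[symmetric])
  fix a
  obtain x where x: "x \<in> path_alg G" "a = \<pi> x"
    using pi_surj by (auto simp: set_eq_iff image_iff)
  have "free_ext NF x \<in> irr_span G S"
    using x(1) NF(1) by (intro subspace_lin_ext module_fscale subspace_irr_span) (auto simp: path_alg_def)
  moreover have "\<pi> (free_ext NF x) = a"
  proof -
    have "\<pi> (free_ext NF x) = lin_ext sA (\<lambda>p. lin_ext sA \<pi>p (NF p)) x"
      using calculation irr_span_path_alg by (subst pi_lin_ext) (auto simp: A.lin_ext_free_ext)
    also have "\<dots> = lin_ext sA \<pi>p x"
    proof (rule A.lin_ext_cong)
      fix p assume "p \<in> keys x"
      then have p: "p \<in> paths G"
        using x(1) by (auto simp: path_alg_def)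
      then show "lin_ext sA \<pi>p (NF p) = \<pi>p p"
        using pi_NF[OF p] pi_lin_ext[of "NF p"] NF(1)[OF p] irr_span_path_alg by auto
    qed
    finally show ?thesis
      using x by (simp add: pi_lin_ext)
  qed
  ultimately show "a \<in> \<pi> ` irr_span G S"
    by blast
qed

lemma pi_sigma [simp]: "\<pi> (\<sigma> a) = a"
  and sigma_irr_span: "\<sigma> a \<in> irr_span G S"
  unfolding \<sigma>_def using pi_irr_span by (auto intro: f_inv_into_f inv_into_into)

lemma sigma_pi_irr_span: "x \<in> irr_span G S \<Longrightarrow> \<sigma> (\<pi> x) = x"
  unfolding \<sigma>_def by (rule inv_into_f_f[OF pi_inj])

lemma sigma_irr: "u \<in> keys (\<sigma> a) \<Longrightarrow> u \<in> irr G S"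
  using sigma_irr_span[of a] by (auto simp: irr_span_def)

lemma sigma_path_alg: "\<sigma> a \<in> path_alg G"
  using sigma_irr_span irr_span_path_alg by blast

lemma sigma_pi_irr: "u \<in> irr G S \<Longrightarrow> \<sigma> (\<pi>p u) = base u"
  by (rule sigma_pi_irr_span) (simp add: irr_span_def)

lemma sigma_pi: "p \<in> paths G \<Longrightarrow> \<sigma> (\<pi>p p) = NF p"
  using sigma_pi_irr_span[OF NF(1)] pi_NF by simp

lemma sigma_add: "\<sigma> (a + b) = \<sigma> a + \<sigma> b"
  using sigma_pi_irr_span[OF fs.subspace_add[OF subspace_irr_span sigma_irr_span sigma_irr_span], of a b]
  by (simp add: pi_add sigma_path_alg)

lemma sigma_scale: "\<sigma> (sA c a) = fscale c (\<sigma> a)"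
  using sigma_pi_irr_span[OF fs.subspace_scale[OF subspace_irr_span sigma_irr_span], of c a]
  by (simp add: pi_fscale sigma_path_alg)

lemma sigma_hom: "module_hom sA fscale \<sigma>"
  by (intro module_hom.intro module_hom_axioms.intro module_fscale A.module_axioms sigma_add sigma_scale)

lemma sigma_zero [simp]: "\<sigma> 0 = 0"
  by (rule module_hom.zero[OF sigma_hom])

lemma expand: "lin_ext sA \<pi>p (\<sigma> a) = a"
  using pi_lin_ext[OF sigma_path_alg[of a]] by simp

lemma hom_expand: "module_hom sA s f \<Longrightarrow> f a = lin_ext s (\<lambda>u. f (\<pi>p u)) (\<sigma> a)"
  using module_hom_lin_ext[of sA s f \<pi>p "\<sigma> a"] by (simp add: expand)

lemma hom_eqI:
  assumes "module_hom sA s f" "module_hom sA s g" "\<And>u. u \<in> irr G S \<Longrightarrow> f (\<pi>p u) = g (\<pi>p u)"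
  shows "f a = g a"
proof -
  interpret s: module s using assms(1) by (simp add: module_hom_def)
  show ?thesis
    unfolding hom_expand[OF assms(1), of a] hom_expand[OF assms(2), of a]
    by (rule s.lin_ext_cong) (simp add: assms(3) sigma_irr)
qed

lemma pp_mult:
  "p \<in> paths G \<Longrightarrow> q \<in> paths G \<Longrightarrow> \<pi>p p * \<pi>p q = (if tgt G p = src q then \<pi>p (pcat p q) else 0)"
  using pi_pmul[of "base p" "base q"] by (simp add: pmul_base pi_zero split: if_splits)

lemma pi_phi:
  assumes "s \<in> S"
  shows "lin_ext sA \<pi>p (\<phi> s) = \<pi>p s"
proof -
  have "base s - \<phi> s \<in> I"
    using rel_gens_triv[OF assms] rel_gens_subset_I by blast
  moreover have p: "\<phi> s \<in> path_alg G" "(base s :: _ \<Rightarrow>\<^sub>0 'k) \<in> path_alg G"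
    using phi_paths[OF assms] S_paths[OF assms] by (auto simp: path_alg_def)
  moreover have "base s - \<phi> s \<in> path_alg G"
    by (intro path_alg_diff p)
  ultimately show ?thesis
    using pi_ker[of "base s - \<phi> s"] pi_diff[of "base s" "\<phi> s"] pi_lin_ext[of "\<phi> s"] by simp
qed

lemma sigma_pi_phi: "s \<in> S \<Longrightarrow> \<sigma> (\<pi>p s) = \<phi> s"
proof -
  assume s: "s \<in> S"
  have "\<phi> s \<in> irr_span G S" "\<phi> s \<in> path_alg G"
    using phi_irr[OF s] phi_paths[OF s] by (auto simp: irr_span_def path_alg_def)
  then show ?thesis
    using sigma_pi_irr_span[of "\<phi> s"] pi_phi[OF s] pi_lin_ext[of "\<phi> s"] by simp
qed

abbreviation ev :: "'v \<Rightarrow> 'a" where "ev v \<equiv> \<pi>p (triv v)"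

lemma ev_pp: "v \<in> verts G \<Longrightarrow> p \<in> paths G \<Longrightarrow> ev v * \<pi>p p = (if v = src p then \<pi>p p else 0)"
  by (auto simp: pp_mult pcat_triv_left[THEN iffD2])

lemma pp_ev: "v \<in> verts G \<Longrightarrow> p \<in> paths G \<Longrightarrow> \<pi>p p * ev v = (if v = tgt G p then \<pi>p p else 0)"
  by (auto simp: pp_mult)

lemma ev_ev: "v \<in> verts G \<Longrightarrow> w \<in> verts G \<Longrightarrow> ev v * ev w = (if v = w then ev v else 0)"
  by (simp add: ev_pp)

lemma oneA_eq: "oneA = (\<Sum>v\<in>verts G. ev v)"
proof -
  have one: "pone G \<in> path_alg G"
    unfolding pone_def by (intro fs.subspace_sum[OF subspace_path_alg]) simp
  show ?thesis
    unfolding oneA_def pi_lin_ext[OF one] by (simp add: pone_def A.lin_ext_sum)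
qed

lemma mult_hom_right: "module_hom sA sA (\<lambda>b. a * b)"
  by (intro A_homI) (simp_all add: distrib_left sA_mult_right)

lemma mult_hom_left: "module_hom sA sA (\<lambda>b. b * a)"
  by (intro A_homI) (simp_all add: distrib_right sA_mult_left)

lemma id_hom: "module_hom sA sA (\<lambda>a. a)"
  by (intro A_homI) simp_all

lemma oneA_pp: "p \<in> paths G \<Longrightarrow> oneA * \<pi>p p = \<pi>p p" "p \<in> paths G \<Longrightarrow> \<pi>p p * oneA = \<pi>p p"
  using src_in_verts[of p] tgt_in_verts[of p]
  by (simp_all add: oneA_eq sum_distrib_left sum_distrib_right ev_pp pp_ev)

lemma oneA_left [simp]: "oneA * a = a"
  by (rule hom_eqI[OF mult_hom_right id_hom]) (simp add: oneA_pp irr_paths)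

lemma oneA_right [simp]: "a * oneA = a"
  by (rule hom_eqI[OF mult_hom_left id_hom]) (simp add: oneA_pp irr_paths)

lemma len_irr: "p \<in> paths G \<Longrightarrow> plen p < 2 \<Longrightarrow> p \<in> irr G S"
proof (rule ccontr)
  assume p: "p \<in> paths G" "plen p < 2" "p \<notin> irr G S"
  then obtain c where "c \<in> occs G S p"
    by (auto simp: irr_def)
  then obtain q s r where o: "(q, s, r) \<in> occs G S p"
    by (cases c) auto
  have "plen s \<le> plen p"
    by (simp add: occsD(7)[OF o])
  then show False
    using S_len[OF occsD(4)[OF o]] p(2) by simp
qed

lemma triv_irr: "v \<in> verts G \<Longrightarrow> triv v \<in> irr G S"
  by (rule len_irr) simp_all

lemma sigma_ev: "v \<in> verts G \<Longrightarrow> \<sigma> (ev v) = base (triv v)"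
  by (rule sigma_pi_irr[OF triv_irr])

lemma sigma_oneA: "\<sigma> oneA = (\<Sum>v\<in>verts G. base (triv v))"
  by (simp add: oneA_eq module_hom.sum[OF sigma_hom] sigma_ev)

lemma lin_ext_sigma_ev_left:
  assumes "module sc" "v \<in> verts G"
  shows "lin_ext sc g (\<sigma> (ev v * a)) = lin_ext sc (\<lambda>u. if src u = v then g u else 0) (\<sigma> a)"
proof -
  interpret s: module sc by fact
  have "\<sigma> (ev v * a) = free_ext (\<lambda>u. \<sigma> (ev v * \<pi>p u)) (\<sigma> a)"
    by (rule hom_expand[OF module_hom_compose[OF mult_hom_right sigma_hom, unfolded o_def]])
  then show ?thesis
    by (auto simp: s.lin_ext_free_ext sigma_irr irr_paths ev_pp assms sigma_pi_irr intro!: s.lin_ext_cong)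
qed

lemma lin_ext_sigma_ev_right:
  assumes "module sc" "v \<in> verts G"
  shows "lin_ext sc g (\<sigma> (a * ev v)) = lin_ext sc (\<lambda>u. if tgt G u = v then g u else 0) (\<sigma> a)"
proof -
  interpret s: module sc by fact
  have "\<sigma> (a * ev v) = free_ext (\<lambda>u. \<sigma> (\<pi>p u * ev v)) (\<sigma> a)"
    by (rule hom_expand[OF module_hom_compose[OF mult_hom_left sigma_hom, unfolded o_def]])
  then show ?thesis
    by (auto simp: s.lin_ext_free_ext sigma_irr irr_paths pp_ev assms sigma_pi_irr intro!: s.lin_ext_cong)
qed

end

section \<open>Subpaths\<close>

definition pre :: "nat \<Rightarrow> ('v, 'e) qpath \<Rightarrow> ('v, 'e) qpath" where
  "pre i p = (src p, take i (snd p))"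

definition suf :: "('v, 'e) pre_digraph \<Rightarrow> nat \<Rightarrow> ('v, 'e) qpath \<Rightarrow> ('v, 'e) qpath" where
  "suf G i p = (tgt G (pre i p), drop i (snd p))"

definition arr :: "('v, 'e) pre_digraph \<Rightarrow> nat \<Rightarrow> ('v, 'e) qpath \<Rightarrow> ('v, 'e) qpath" where
  "arr G i p = (tgt G (pre i p), [snd p ! i])"

lemma src_pre [simp]: "src (pre i p) = src p"
  by (simp add: pre_def)

lemma src_suf: "src (suf G i p) = tgt G (pre i p)"
  and src_arr: "src (arr G i p) = tgt G (pre i p)"
  by (simp_all add: suf_def arr_def)

lemma plen_arr [simp]: "plen (arr G i p) = 1"
  by (simp add: arr_def)

lemma pcat_pre_suf: "pcat (pre i p) (suf G i p) = p"
  by (simp add: pre_def suf_def pcat_def)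

lemma pcat_pre_arr: "i < plen p \<Longrightarrow> pcat (pre i p) (arr G i p) = pre (Suc i) p"
  by (simp add: pre_def arr_def pcat_def take_Suc_conv_app_nth)

lemma tgt_arr: "i < plen p \<Longrightarrow> tgt G (arr G i p) = src (suf G (Suc i) p)"
  by (simp add: arr_def suf_def pre_def tgt_def take_Suc_conv_app_nth)

lemma pcat_arr_suf: "i < plen p \<Longrightarrow> pcat (arr G i p) (suf G (Suc i) p) = suf G i p"
  by (simp add: arr_def suf_def pre_def pcat_def Cons_nth_drop_Suc)

lemma pre_0 [simp]: "pre 0 p = triv (src p)"
  and suf_0 [simp]: "suf G 0 p = p"
  and pre_plen [simp]: "pre (plen p) p = p"
  and suf_plen [simp]: "suf G (plen p) p = triv (tgt G p)"
  by (simp_all add: pre_def suf_def)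

lemma pre_pcat_plen: "pre (plen q) (pcat q r) = q"
  by (simp add: pre_def pcat_def)

lemma tgt_suf [simp]: "tgt G (suf G i p) = tgt G p"
  using tgt_append[of G "src p" "take i (snd p)" "drop i (snd p)"] by (simp add: suf_def pre_def)

lemma pcat_pre_arr_suf: "i < plen p \<Longrightarrow> pcat (pre i p) (pcat (arr G i p) (suf G (Suc i) p)) = p"
  by (simp add: pcat_arr_suf pcat_pre_suf)

context wf_digraph
begin

lemma pre_suf_paths:
  assumes "p \<in> paths G"
  shows "pre i p \<in> paths G" "suf G i p \<in> paths G"
  using assms paths_append[of "src p" "take i (snd p)" "drop i (snd p)"]
  by (simp_all add: pre_def suf_def)

lemma arr_paths:
  assumes "p \<in> paths G" "i < plen p"
  shows "arr G i p \<in> paths G"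
proof -
  have "pcat (arr G i p) (suf G (Suc i) p) \<in> paths G"
    unfolding pcat_arr_suf[OF assms(2)] by (rule pre_suf_paths(2)[OF assms(1)])
  then show ?thesis
    using paths_append[of "tgt G (pre i p)" "[snd p ! i]" "snd (suf G (Suc i) p)"]
    by (simp add: pcat_def arr_def)
qed

end

context reduction_setup
begin

lemma pp_pcat: "p \<in> paths G \<Longrightarrow> q \<in> paths G \<Longrightarrow> tgt G p = src q \<Longrightarrow> \<pi>p p * \<pi>p q = \<pi>p (pcat p q)"
  by (simp add: pp_mult)

lemma amb_1: "w \<in> amb 1 \<longleftrightarrow> w \<in> paths G \<and> plen w = 1"
  by simp

lemma amb_2: "amb 2 = S"
  by (simp add: numeral_2_eq_2)

lemma split_1:
  assumes p: "p \<in> paths G"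
  shows "split 1 p = (\<Sum>i<plen p. base (\<pi>p (pre i p), arr G i p, \<pi>p (suf G (Suc i) p)))"
proof -
  let ?f = "\<lambda>i. (pre i p, arr G i p, suf G (Suc i) p)"
  have "occs G (amb 1) p = ?f ` {..<plen p}"
  proof (intro equalityI subsetI)
    fix c assume "c \<in> occs G (amb 1) p"
    moreover obtain q w r where c: "c = (q, w, r)"
      by (cases c) auto
    ultimately have o: "(q, w, r) \<in> occs G (amb 1) p"
      by simp
    note d = occsD[OF o]
    obtain e where w: "snd w = [e]"
      using d(4) by (auto simp: length_Suc_conv)
    have sp: "snd p = snd q @ e # snd r"
      by (simp add: d(7) w)
    have q: "pre (plen q) p = q"
      unfolding d(7) by (rule pre_pcat_plen)
    have l: "plen q < plen p"
      by (simp add: sp)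
    have wa: "w = arr G (plen q) p"
      by (simp add: prod_eq_iff arr_def q d(5) w sp)
    have "r = suf G (Suc (plen q)) p"
    proof (rule prod_eqI)
      have "pcat q w = pre (Suc (plen q)) p"
        unfolding wa by (rule pcat_pre_arr[OF l, unfolded q])
      then show "src r = src (suf G (Suc (plen q)) p)"
        using d(5,6) by (simp add: src_suf tgt_pcat[symmetric])
      show "snd r = snd (suf G (Suc (plen q)) p)"
        by (simp add: suf_def sp)
    qed
    with wa q have "(q, w, r) = ?f (plen q)"
      by simp
    then show "c \<in> ?f ` {..<plen p}"
      unfolding c by (rule image_eqI) (use l in simp)
  next
    fix c assume "c \<in> ?f ` {..<plen p}"
    then obtain i where i: "i < plen p" "c = ?f i"
      by auto
    have "?f i \<in> occs G (amb 1) (pcat (pre i p) (pcat (arr G i p) (suf G (Suc i) p)))"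
      by (rule occsI) (use i pre_suf_paths[OF p] arr_paths[OF p] in \<open>simp_all add: src_arr tgt_arr\<close>)
    then show "c \<in> occs G (amb 1) p"
      by (simp add: i pcat_pre_arr_suf)
  qed
  moreover have "inj_on ?f {..<plen p}"
    by (rule inj_on_inverseI[of _ "\<lambda>c. plen (fst c)"]) (simp add: pre_def)
  ultimately show ?thesis
    unfolding split_def by (simp add: sum.reindex)
qed

lemma irr_sub:
  assumes "pcat q (pcat w r) \<in> irr G S" "q \<in> paths G" "w \<in> paths G" "r \<in> paths G"
    "tgt G q = src w" "tgt G w = src r"
  shows "w \<in> irr G S"
proof (rule ccontr)
  assume "w \<notin> irr G S"
  then obtain c where "c \<in> occs G S w"
    using assms(3) by (auto simp: irr_def)
  then obtain a s b where o: "(a, s, b) \<in> occs G S w"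
    by (cases c) auto
  have "(pcat q a, s, pcat b r) \<in> occs G S (pcat q (pcat w r))"
    by (rule occs_extend[OF o assms(2,4,5,6)])
  then show False
    using assms(1) by (auto simp: irr_def)
qed

lemma irr_pcat_right:
  assumes "pcat q w \<in> irr G S" "q \<in> paths G" "w \<in> paths G" "tgt G q = src w"
  shows "w \<in> irr G S"
  by (rule irr_sub[of q w "triv (tgt G w)"]) (use assms tgt_in_verts in auto)

lemma irr_suf:
  assumes "p \<in> irr G S"
  shows "suf G i p \<in> irr G S"
  by (rule irr_pcat_right[of "pre i p"])
    (use assms irr_paths pre_suf_paths[OF irr_paths[OF assms]] in \<open>auto simp: pcat_pre_suf src_suf\<close>)

lemma nested_lists:
  assumes "xs @ ys @ zs = xs' @ ys' @ zs'" "length xs' \<le> length xs" "length zs' \<le> length zs"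
  shows "\<exists>a b. xs = xs' @ a \<and> zs = b @ zs' \<and> ys' = a @ ys @ b"
proof -
  obtain a where a: "xs = xs' @ a" "a @ ys @ zs = ys' @ zs'"
    using assms(1,2) append_eq_append_conv2[of xs "ys @ zs" xs' "ys' @ zs'"] by auto
  then obtain b where "zs = b @ zs'" "(a @ ys) @ b = ys'"
    using assms(3) append_eq_append_conv2[of "a @ ys" zs ys' zs'] by auto
  with a show ?thesis by auto
qed

lemma S_nested:
  assumes o: "(q, s, r) \<in> occs G S p" and o': "(q', s', r') \<in> occs G S p"
    and le: "plen q' \<le> plen q" "plen r' \<le> plen r"
  shows "q = q' \<and> s = s' \<and> r = r'"
proof -
  note d = occsD[OF o] and d' = occsD[OF o']
  have src: "src q = src q'"
    using d(7) d'(7) by (metis src_pcat)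
  have "snd q @ snd s @ snd r = snd q' @ snd s' @ snd r'"
    using d(7) d'(7) by (metis snd_pcat)
  from nested_lists[OF this le] obtain a b where
    ab: "snd q = snd q' @ a" "snd r = b @ snd r'" "snd s' = a @ snd s @ b"
    by (elim exE conjE)
  have q: "q = (src q', snd q' @ a)" and r: "r = (tgt G s, b @ snd r')"
    using ab src d(6) by (simp_all add: prod_eq_iff)
  have "(src q', snd q' @ a) \<in> paths G"
    using d(1) q by simp
  then have a: "(tgt G q', a) \<in> paths G"
    using paths_append[of "src q'" "snd q'" a] by simp
  have tq: "tgt G q = tgt G (tgt G q', a)"
    unfolding q using tgt_append[of G "src q'" "snd q'" a] by simp
  have "(tgt G s, b @ snd r') \<in> paths G"
    using d(3) r by simp
  then have b: "(tgt G s, b) \<in> paths G"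
    using paths_append[of "tgt G s" b "snd r'"] by simp
  have "((tgt G q', a), s, (tgt G s, b)) \<in> occs G {s} (pcat (tgt G q', a) (pcat s (tgt G s, b)))"
    by (rule occsI) (use a b d tq in auto)
  moreover have "pcat (tgt G q', a) (pcat s (tgt G s, b)) = s'"
    using ab(3) d'(5) by (simp add: pcat_def prod_eq_iff)
  ultimately have "s = s'"
    using S_sub[OF d(4) d'(4)] by auto
  then have "a = []" "b = []"
    using ab(3) by (auto dest: arg_cong[of _ _ length])
  moreover have "src r = src r'"
    using d(6) d'(6) \<open>s = s'\<close> by simp
  ultimately show ?thesis
    using \<open>s = s'\<close> src ab by (simp add: prod_eq_iff)
qed

lemma S_suf_irr:
  assumes s: "s \<in> S" and i: "0 < i"
  shows "suf G i s \<in> irr G S"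
proof (rule ccontr)
  have p: "suf G i s \<in> paths G" "pre i s \<in> paths G"
    using pre_suf_paths[OF S_paths[OF s]] by auto
  assume "suf G i s \<notin> irr G S"
  then obtain c where "c \<in> occs G S (suf G i s)"
    using p(1) by (auto simp: irr_def)
  then obtain a s' b where o: "(a, s', b) \<in> occs G S (suf G i s)"
    by (cases c) auto
  have "(pcat (pre i s) a, s', pcat b (triv (tgt G s))) \<in>
      occs G S (pcat (pre i s) (pcat (suf G i s) (triv (tgt G s))))"
    by (rule occs_extend[OF o p(2)]) (use tgt_in_verts[OF S_paths[OF s]] in \<open>simp_all add: src_suf\<close>)
  then have "(pcat (pre i s) a, s', b) \<in> occs G S s"
    by (simp add: pcat_pre_suf)
  from S_nested[OF this S_triv_occ[OF s]] have "plen (pcat (pre i s) a) = 0"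
    by simp
  then have "snd s = []"
    using i by (auto simp: pre_def min_def split: if_splits)
  then show False
    using S_len[OF s] by simp
qed

lemma arrow_irr_occs:
  assumes x: "x \<in> paths G" "plen x = 1" and u: "u \<in> irr G S" "tgt G x = src u"
    and o: "(q, s, r) \<in> occs G S (pcat x u)"
  shows "q = triv (src x)" "occs G S (pcat x u) = {(q, s, r)}"
proof -
  have *: "q = triv (src x)" if o: "(q, s, r) \<in> occs G S (pcat x u)" for q s r
  proof (rule ccontr)
    note d = occsD[OF o]
    assume "q \<noteq> triv (src x)"
    moreover have "src q = src x"
      using d(7) by (metis src_pcat)
    ultimately obtain e es where q: "snd q = e # es"
      by (cases "snd q") (auto simp: prod_eq_iff)
    obtain e' where x': "snd x = [e']"
      using x(2) by (auto simp: length_Suc_conv)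
    have "snd x @ snd u = snd q @ snd s @ snd r"
      using d(7) by (metis snd_pcat)
    then have eq: "e = e'" "snd u = es @ snd s @ snd r"
      using q x' by auto
    have qe: "(src q, [e] @ es) = q"
      using q by (simp add: prod_eq_iff)
    have "(tgt G (src q, [e]), es) \<in> paths G" "tgt G q = tgt G (tgt G (src q, [e]), es)"
      using d(1) paths_append[of "src q" "[e]" es] tgt_append[of G "src q" "[e]" es]
      unfolding qe by simp_all
    moreover have "tgt G (src q, [e]) = src u"
      using u(2) x' eq(1) by (simp add: tgt_def)
    ultimately have "((src u, es), s, r) \<in> occs G S (pcat (src u, es) (pcat s r))"
      by (intro occsI) (use d in auto)
    moreover have "pcat (src u, es) (pcat s r) = u"
      using eq(2) by (simp add: pcat_def prod_eq_iff)
    ultimately show False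
      using u(1) by (auto simp: irr_def)
  qed
  show q: "q = triv (src x)"
    by (rule *[OF o])
  show "occs G S (pcat x u) = {(q, s, r)}"
  proof (intro equalityI subsetI)
    fix c assume "c \<in> occs G S (pcat x u)"
    moreover obtain q' s' r' where c: "c = (q', s', r')"
      by (cases c) auto
    ultimately have o': "(q', s', r') \<in> occs G S (pcat x u)"
      by simp
    have "q' = q"
      using *[OF o'] q by simp
    show "c \<in> {(q, s, r)}"
    proof (cases "plen r \<le> plen r'")
      case True
      show ?thesis using S_nested[OF o' o _ True] \<open>q' = q\<close> c by simp
    next
      case False
      then have "plen r' \<le> plen r" by simp
      show ?thesis using S_nested[OF o o' _ \<open>plen r' \<le> plen r\<close>] \<open>q' = q\<close> c by simp
    qed
  next
    fix c assume "c \<in> {(q, s, r)}"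
    then show "c \<in> occs G S (pcat x u)" using o by simp
  qed
qed

lemma finite_occs: "finite (occs G T p)"
proof -
  have "occs G T p \<subseteq> (\<lambda>(i, j). ((src p, take i (snd p)), (tgt G (src p, take i (snd p)), take j (drop i (snd p))),
      (tgt G (src p, take (i + j) (snd p)), drop (i + j) (snd p)))) ` ({..plen p} \<times> {..plen p})" (is "_ \<subseteq> ?f ` _")
  proof
    fix c assume "c \<in> occs G T p"
    moreover obtain q w r where c: "c = (q, w, r)"
      by (cases c) auto
    ultimately have o: "(q, w, r) \<in> occs G T p"
      by simp
    note d = occsD[OF o]
    have "c = ?f (plen q, plen w)"
      unfolding c using d(5,6) tgt_pcat[of G q w]
      by (simp add: d(7) prod_eq_iff pcat_def)
    moreover have "plen q \<le> plen p" "plen w \<le> plen p"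
      by (simp_all add: d(7))
    ultimately show "c \<in> ?f ` ({..plen p} \<times> {..plen p})"
      by (intro image_eqI[of _ _ "(plen q, plen w)"]) auto
  qed
  then show ?thesis
    by (rule finite_subset) simp
qed

lemma right_occ_exists:
  assumes "p \<in> paths G" "p \<notin> irr G S"
  obtains q s r where "(q, s, r) \<in> occs G S p" "right_occ G S p = {(q, s, r)}"
proof -
  have ne: "occs G S p \<noteq> {}"
    using assms by (simp add: irr_def)
  let ?M = "Max ((\<lambda>c. plen (fst c)) ` occs G S p)"
  have "?M \<in> (\<lambda>c. plen (fst c)) ` occs G S p"
    using ne by (intro Max_in finite_imageI finite_occs) auto
  then obtain c where c: "c \<in> occs G S p" "plen (fst c) = ?M"
    by auto
  obtain q s r where qsr: "c = (q, s, r)"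
    by (cases c) auto
  have o: "(q, s, r) \<in> occs G S p"
    using c(1) qsr by simp
  have max: "plen q' \<le> plen q" if "(q', s', r') \<in> occs G S p" for q' s' r'
  proof -
    have "plen (fst (q', s', r')) \<le> ?M"
      using that by (intro Max_ge finite_imageI finite_occs imageI)
    then show ?thesis using c(2) qsr by simp
  qed
  have min: "plen r \<le> plen r'" if o': "(q', s', r') \<in> occs G S p" for q' s' r'
  proof (rule ccontr)
    assume "\<not> plen r \<le> plen r'"
    then have "plen r' \<le> plen r"
      by simp
    from S_nested[OF o o' max[OF o'] this] \<open>\<not> plen r \<le> plen r'\<close> show False
      by simp
  qed
  have "right_occ G S p = {(q, s, r)}"
  proof (intro equalityI subsetI)
    fix c' assume c': "c' \<in> right_occ G S p"
    obtain q' s' r' where q': "c' = (q', s', r')"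
      by (cases c') auto
    have o': "(q', s', r') \<in> occs G S p"
      using c' unfolding q' right_occ_def by simp
    have "plen q \<le> plen q'"
      using c' o unfolding q' right_occ_def by auto
    then show "c' \<in> {(q, s, r)}"
      using S_nested[OF o' o _ min[OF o']] unfolding q' by simp
  next
    fix c' assume "c' \<in> {(q, s, r)}"
    then show "c' \<in> right_occ G S p"
      unfolding right_occ_def using o max min by force
  qed
  with o show ?thesis by (rule that)
qed

lemma redstep_context:
  assumes "redstep p' p" "x \<in> paths G" "y \<in> paths G" "tgt G x = src p" "tgt G p = src y"
  shows "redstep (pcat x (pcat p' y)) (pcat x (pcat p y))"
proof -
  obtain q s r where o: "(q, s, r) \<in> occs G S p" "p' \<in> keys (reduct q s r)"
    using assms(1) unfolding redstep_def by (elim exE conjE)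
  note s = occsD(4)[OF o(1)]
  obtain u where u: "u \<in> keys (\<phi> s)" "p' = pcat q (pcat u r)"
    using o(2) keys_reduct[OF s] by auto
  have "pcat x (pcat p' y) \<in> keys (reduct (pcat x q) s (pcat r y))"
    unfolding keys_reduct[OF s] u(2) by (rule image_eqI[OF _ u(1)]) (simp add: pcat_assoc)
  then show ?thesis
    unfolding redstep_def using occs_extend[OF o(1) assms(2-5)] by (intro exI conjI)
qed

lemma redstep_rtranclp_context:
  assumes "redstep\<^sup>*\<^sup>* p' p" "x \<in> paths G" "y \<in> paths G" "tgt G x = src p" "tgt G p = src y"
  shows "redstep\<^sup>*\<^sup>* (pcat x (pcat p' y)) (pcat x (pcat p y))"
  using assms(1)
proof (induction rule: converse_rtranclp_induct)
  case (step p'' p')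
  have "redstep (pcat x (pcat p'' y)) (pcat x (pcat p' y))"
    by (rule redstep_context[OF step(1) assms(2,3)])
      (use redstep_rtranclp_ends[OF step(2)] assms(4,5) in auto)
  then show ?case
    using step.IH by (rule converse_rtranclp_into_rtranclp)
qed simp

end

section \<open>The differentials and the homotopy in low degrees\<close>

lemma hom_comp: "module_hom s1 s2 g \<Longrightarrow> module_hom s2 s3 f \<Longrightarrow> module_hom s1 s3 (\<lambda>x. f (g x))"
  using module_hom_compose[of s1 s2 g s3 f] by (simp add: o_def)

lemma hom_base_expand: "module_hom fscale s f \<Longrightarrow> f y = lin_ext s (\<lambda>t. f (base t)) y"
  using module_hom_lin_ext[of fscale s f base y] by (simp add: free_ext_base)

lemma hom_base_eqI:
  assumes "module_hom fscale s f" "module_hom fscale s g" "\<And>t. t \<in> keys y \<Longrightarrow> f (base t) = g (base t)"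
  shows "f y = g y"
proof -
  interpret s: module s using assms(1) by (simp add: module_hom_def)
  show ?thesis
    unfolding hom_base_expand[OF assms(1), of y] hom_base_expand[OF assms(2), of y]
    by (rule s.lin_ext_cong) (simp add: assms(3))
qed

lemma free_ext_in_keys:
  assumes "\<And>t. t \<in> keys x \<Longrightarrow> keys (g t) \<subseteq> T"
  shows "keys (free_ext g x) \<subseteq> T"
  by (rule order_trans[OF keys_free_ext]) (use assms in auto)

lemma hom_funpow:
  assumes "module_hom s s f"
  shows "module_hom s s (f ^^ n)"
proof (induction n)
  case 0
  interpret s: module s using assms by (simp add: module_hom_def)
  show ?case using s.module_hom_id by (simp add: id_def)
next
  case (Suc n)
  show ?case unfolding funpow.simps by (rule module_hom_compose[OF Suc.IH assms])
qed

context reduction_setup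
begin

text \<open>Chains are only studied through left linear maps to \<open>A\<close>, where \<open>m w b\<close> is the value at \<open>1 \<otimes> w \<otimes> b\<close>.\<close>

definition Lf :: "(('v, 'e) qpath \<Rightarrow> 'a \<Rightarrow> 'a) \<Rightarrow> ('v, 'e, 'k, 'a) pchain \<Rightarrow> 'a" where
  "Lf m y = lin_ext sA (\<lambda>(a, w, b). a * m w b) y"

text \<open>The formal sums of tensors \<open>0 \<otimes> w \<otimes> b\<close> represent zero. In low degrees the maps of the resolution are
  computed exactly up to such sums, which all functionals \<open>Lf m\<close> annihilate.\<close>

definition J :: "('v, 'e, 'k, 'a) pchain set" where
  "J = {y. keys y \<subseteq> {t. fst t = 0}}"

definition chains :: "('v, 'e) qpath set \<Rightarrow> ('v, 'e, 'k, 'a) pchain set" where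
  "chains W = {y. keys y \<subseteq> {t. fst (snd t) \<in> W}}"

lemma subspace_J: "fs.subspace J" and subspace_chains: "fs.subspace (chains W)"
  unfolding J_def chains_def by (rule subspace_keys)+

lemma Lf_hom: "module_hom fscale sA (Lf m)"
  unfolding Lf_def[abs_def]
  by (intro module_hom.intro module_hom_axioms.intro module_fscale A.module_axioms A.lin_ext_add A.lin_ext_fscale)

lemmas Lf_add = module_hom.add[OF Lf_hom]
  and Lf_diff = module_hom.diff[OF Lf_hom]
  and Lf_sum = module_hom.sum[OF Lf_hom]
  and Lf_scale = module_hom.scale[OF Lf_hom]
  and Lf_zero = module_hom.zero[OF Lf_hom]

lemma Lf_base [simp]: "Lf m (base (a, w, b)) = a * m w b"
  by (simp add: Lf_def)

lemma Lf_free_ext: "Lf m (free_ext g x) = lin_ext sA (\<lambda>t. Lf m (g t)) x"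
  by (rule module_hom_lin_ext[OF Lf_hom])

lemma lact_hom: "module_hom fscale fscale (lact a)"
  unfolding lact_def[abs_def] by (rule fs.lin_ext_hom)

lemma ract_hom: "module_hom fscale fscale (\<lambda>y. ract y b)"
  unfolding ract_def by (rule fs.lin_ext_hom)

lemma bimod_ext_hom: "module_hom fscale fscale (bimod_ext g)"
  unfolding bimod_ext_def[abs_def] by (rule fs.lin_ext_hom)

lemma gamma_hom: "module_hom fscale fscale (gamma n)"
  unfolding gamma_def[abs_def] by (rule fs.lin_ext_hom)

lemma lact_base [simp]: "lact c (base (a, w, b)) = base (c * a, w, b)"
  by (simp add: lact_def)

lemma ract_base [simp]: "ract (base (a, w, b)) c = base (a, w, b * c)"
  by (simp add: ract_def)

lemma bimod_ext_base [simp]: "bimod_ext g (base (a, w, b)) = lact a (ract (g w) b)"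
  by (simp add: bimod_ext_def)

lemma lact_lact: "lact a (lact b y) = lact (a * b) y"
proof (rule hom_base_eqI[OF hom_comp[OF lact_hom lact_hom] lact_hom])
  fix t :: "'a \<times> ('v, 'e) qpath \<times> 'a"
  show "lact a (lact b (base t)) = lact (a * b) (base t)"
    by (cases t) (simp add: mult.assoc)
qed

lemma Lf_lact: "Lf m (lact a y) = a * Lf m y"
proof (rule hom_base_eqI[OF hom_comp[OF lact_hom Lf_hom] hom_comp[OF Lf_hom mult_hom_right]])
  fix t :: "'a \<times> ('v, 'e) qpath \<times> 'a"
  show "Lf m (lact a (base t)) = a * Lf m (base t)"
    by (cases t) (simp add: mult.assoc)
qed

lemma Lf_ract: "Lf m (ract y c) = Lf (\<lambda>w b. m w (b * c)) y"
proof (rule hom_base_eqI[OF hom_comp[OF ract_hom Lf_hom] Lf_hom])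
  fix t :: "'a \<times> ('v, 'e) qpath \<times> 'a"
  show "Lf m (ract (base t) c) = Lf (\<lambda>w b. m w (b * c)) (base t)"
    by (cases t) simp
qed

lemma lact_oneA [simp]: "lact oneA y = y"
proof (rule hom_base_eqI[OF lact_hom])
  show "module_hom fscale fscale (\<lambda>y. y)"
    by (intro module_hom.intro module_hom_axioms.intro module_fscale) simp_all
  fix t :: "'a \<times> ('v, 'e) qpath \<times> 'a"
  show "lact oneA (base t) = base t"
    by (cases t) simp
qed

lemma ract_oneA [simp]: "ract y oneA = y"
proof (rule hom_base_eqI[OF ract_hom])
  show "module_hom fscale fscale (\<lambda>y. y)"
    by (intro module_hom.intro module_hom_axioms.intro module_fscale) simp_all
  fix t :: "'a \<times> ('v, 'e) qpath \<times> 'a"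
  show "ract (base t) oneA = base t"
    by (cases t) simp
qed

lemma lact_J: "y \<in> J \<Longrightarrow> lact a y \<in> J"
  unfolding J_def lact_def mem_Collect_eq
  by (rule free_ext_in_keys) (auto simp: subset_eq)

lemma lact_zero_J: "lact 0 y \<in> J"
  unfolding J_def lact_def mem_Collect_eq
  by (rule free_ext_in_keys) (auto simp: subset_eq)

lemma ract_J: "y \<in> J \<Longrightarrow> ract y b \<in> J"
  unfolding J_def ract_def mem_Collect_eq
  by (rule free_ext_in_keys) (auto simp: subset_eq)

lemma bimod_ext_J:
  assumes "y \<in> J"
  shows "bimod_ext g y \<in> J"
  unfolding bimod_ext_def
proof (rule subspace_lin_ext[OF module_fscale subspace_J])
  fix t assume "t \<in> keys y"
  then have "fst t = 0"
    using assms by (auto simp: J_def)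
  then show "(case t of (a, w, b) \<Rightarrow> lact a (ract (g w) b)) \<in> J"
    by (cases t) (simp add: lact_zero_J)
qed

lemma gamma_J:
  assumes "y \<in> J"
  shows "gamma n y \<in> J"
  unfolding gamma_def
proof (rule subspace_lin_ext[OF module_fscale subspace_J])
  fix t assume "t \<in> keys y"
  then have "fst t = 0"
    using assms by (auto simp: J_def)
  then show "(case t of (a, w, b) \<Rightarrow> lact a (free_ext (\<lambda>u. fscale ((-1) ^ (n + 1))
      (if tgt G w = src u then split (n + 1) (pcat w u) else 0)) (\<sigma> b))) \<in> J"
    by (cases t) (simp add: lact_zero_J)
qed

lemma lact_chains: "y \<in> chains W \<Longrightarrow> lact a y \<in> chains W"
  unfolding chains_def lact_def mem_Collect_eq
  by (rule free_ext_in_keys) (auto simp: subset_eq)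

lemma ract_chains: "y \<in> chains W \<Longrightarrow> ract y b \<in> chains W"
  unfolding chains_def ract_def mem_Collect_eq
  by (rule free_ext_in_keys) (auto simp: subset_eq)

lemma bimod_ext_chains:
  assumes "y \<in> chains V" "\<And>w. w \<in> V \<Longrightarrow> g w \<in> chains W"
  shows "bimod_ext g y \<in> chains W"
  unfolding bimod_ext_def
proof (rule subspace_lin_ext[OF module_fscale subspace_chains])
  fix t assume "t \<in> keys y"
  then have "fst (snd t) \<in> V"
    using assms(1) by (auto simp: chains_def)
  then show "(case t of (a, w, b) \<Rightarrow> lact a (ract (g w) b)) \<in> chains W"
    by (cases t) (auto intro!: lact_chains ract_chains assms(2))
qed

lemma split_chains: "split n p \<in> chains (amb n)"
  unfolding split_def
  by (rule fs.subspace_sum[OF subspace_chains]) (auto simp: chains_def occs_def)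

lemma right_occ_chains: "splitR n p \<in> chains (amb n)"
  unfolding splitR_def
  by (rule fs.subspace_sum[OF subspace_chains]) (auto simp: chains_def occs_def right_occ_def)

lemma left_occ_chains: "splitL n p \<in> chains (amb n)"
  unfolding splitL_def
  by (rule fs.subspace_sum[OF subspace_chains]) (auto simp: chains_def occs_def left_occ_def)

lemma gamma_chains: "gamma n y \<in> chains (amb (n + 1))"
  unfolding gamma_def
proof (rule subspace_lin_ext[OF module_fscale subspace_chains])
  fix t :: "'a \<times> ('v, 'e) qpath \<times> 'a"
  obtain a w b where t: "t = (a, w, b)" by (cases t) auto
  have "free_ext (\<lambda>u. fscale ((-1) ^ (n + 1)) (if tgt G w = src u then split (n + 1) (pcat w u) else 0)) (\<sigma> b)
      \<in> chains (amb (n + 1))"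
  proof (rule subspace_lin_ext[OF module_fscale subspace_chains])
    fix u
    show "fscale ((-1) ^ (n + 1)) (if tgt G w = src u then split (n + 1) (pcat w u) else 0) \<in> chains (amb (n + 1))"
      by (rule fs.subspace_scale[OF subspace_chains]) (use split_chains fs.subspace_0[OF subspace_chains] in auto)
  qed
  then show "(case t of (a, w, b) \<Rightarrow> lact a (free_ext (\<lambda>u. fscale ((-1) ^ (n + 1))
      (if tgt G w = src u then split (n + 1) (pcat w u) else 0)) (\<sigma> b))) \<in> chains (amb (n + 1))"
    unfolding t by (simp only: prod.case lact_chains)
qed

lemma Lf_J: "y \<in> J \<Longrightarrow> Lf m y = 0"
  unfolding Lf_def lin_ext_def by (rule sum.neutral) (auto simp: J_def split: prod.splits)

lemma Lf_cong_J: "y - z \<in> J \<Longrightarrow> Lf m y = Lf m z"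
  using Lf_J[of "y - z" m] by (simp add: Lf_diff)

lemma Lf_cong_chains:
  assumes "y \<in> chains W" "\<And>w b. w \<in> W \<Longrightarrow> m w b = m' w b"
  shows "Lf m y = Lf m' y"
  unfolding Lf_def by (rule A.lin_ext_cong) (use assms in \<open>auto simp: chains_def split: prod.splits\<close>)

lemma subspace_P_null: "fs.subspace (P_null n)"
  unfolding P_null_def by (rule fs.subspace_span)

lemma J_P_null:
  assumes "y \<in> J" "y \<in> chains (amb n)"
  shows "y \<in> P_null n"
proof -
  have "base t \<in> P_null n" if "t \<in> keys y" for t
  proof -
    have "fst t = 0" "fst (snd t) \<in> amb n"
      using that assms by (auto simp: J_def chains_def)
    then obtain w b where t: "t = (0, w, b)" "w \<in> amb n"
      by (cases t) auto
    have "base (0 + 0 :: 'a, w, b) - base (0, w, b) - base (0, w, b) \<in> P_null n"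
      unfolding P_null_def by (intro fs.span_base UnI1 CollectI exI conjI) (rule refl, rule t(2))
    then have "- base t \<in> P_null n"
      by (simp add: t(1))
    then show ?thesis
      using fs.subspace_neg[OF subspace_P_null] by fastforce
  qed
  then have "free_ext base y \<in> P_null n"
    by (rule subspace_lin_ext[OF module_fscale subspace_P_null])
  then show ?thesis
    by (simp add: free_ext_base)
qed

lemma P_rec: "partial_Suc (Suc n) = bimod_ext (\<lambda>w. delta (n + 2) w - rho n (partial_Suc n (delta (n + 2) w)))"
  by (simp add: partial_Suc_def rho_def Let_def)

lemma rho_rec: "rho n = rho_from n (partial_Suc n)"
  by (cases n) (simp_all add: partial_Suc_def rho_def Let_def)

lemma emb0_lact: "lact c (emb0 a b) = emb0 (c * a) b"
  by (simp add: emb0_def module_hom.sum[OF lact_hom])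

lemma emb0_ract: "ract (emb0 a b) c = emb0 a (b * c)"
  by (simp add: emb0_def module_hom.sum[OF ract_hom])

lemma partial0_emb0: "partial0 (emb0 a b) = a * b"
proof -
  have "partial0 (emb0 a b) = (\<Sum>v\<in>verts G. a * ev v * b)"
    by (simp add: partial0_def emb0_def A.lin_ext_sum)
  also have "\<dots> = a * oneA * b"
    by (simp only: oneA_eq sum_distrib_left sum_distrib_right)
  finally show ?thesis by simp
qed

lemma delta_1: "delta 1 w = emb0 (\<pi>p w) oneA - emb0 oneA (\<pi>p w)"
  by (simp add: delta_def)

lemma partial_1: "partial_Suc 0 = bimod_ext (\<lambda>w. emb0 (\<pi>p w) oneA - emb0 oneA (\<pi>p w) - emb0 0 oneA)"
proof -
  have "partial0 (delta 1 w) = 0" for w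
    using partial0_emb0[of "\<pi>p w" oneA] partial0_emb0[of oneA "\<pi>p w"]
    by (simp add: delta_1[unfolded One_nat_def] partial0_def A.lin_ext_diff)
  then show ?thesis
    by (simp add: partial_Suc_def Let_def rho_minus1_def delta_1[unfolded One_nat_def])
qed

lemma partial_1_base:
  "partial_Suc 0 (base (a, x, b)) = emb0 (a * \<pi>p x) b - emb0 a (\<pi>p x * b) - emb0 0 b"
  unfolding partial_1 bimod_ext_base module_hom.diff[OF ract_hom] module_hom.diff[OF lact_hom] emb0_ract emb0_lact
  by simp

lemma emb0_zero_J: "emb0 0 b \<in> J"
  unfolding emb0_def by (rule fs.subspace_sum[OF subspace_J]) (simp add: J_def)

lemma bimod_ext_diff: "bimod_ext g y - bimod_ext h y = bimod_ext (\<lambda>w. g w - h w) y"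
proof -
  have "bimod_ext (\<lambda>w. g w - h w) y = free_ext (\<lambda>t. (case t of (a, w, b) \<Rightarrow> lact a (ract (g w) b)) -
      (case t of (a, w, b) \<Rightarrow> lact a (ract (h w) b))) y"
    unfolding bimod_ext_def
    by (rule fs.lin_ext_cong) (simp add: module_hom.diff[OF ract_hom] module_hom.diff[OF lact_hom] split: prod.splits)
  then show ?thesis
    by (simp add: fs.lin_ext_fun_diff bimod_ext_def)
qed

text \<open>In degree 0 the correction terms of the homotopy vanish, because \<open>\<partial>\<^sub>1 = \<delta>\<^sub>1\<close>.\<close>

lemma rho_0: "rho 0 y = gamma 0 y"
proof -
  let ?D = "\<lambda>y. bimod_ext (delta (0 + 1)) (gamma 0 y) - partial_Suc 0 (gamma 0 y)"
  have D: "?D z \<in> J" for z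
  proof -
    have "?D z = bimod_ext (\<lambda>w. emb0 0 oneA) (gamma 0 z)"
      unfolding partial_1 bimod_ext_diff by (simp add: delta_1[unfolded One_nat_def])
    also have "\<dots> \<in> J"
      unfolding bimod_ext_def
      by (rule subspace_lin_ext[OF module_fscale subspace_J])
        (auto simp: emb0_ract emb0_lact emb0_zero_J split: prod.splits)
    finally show ?thesis .
  qed
  have "rho_term 0 (partial_Suc 0) i y \<in> P_null (0 + 1)" if i1: "i \<ge> 1" for i
  proof -
    obtain j where i: "i = Suc j"
      using i1 by (cases i) auto
    have "gamma 0 ((?D ^^ i) y) \<in> J"
      unfolding i by (rule gamma_J) (simp only: funpow.simps comp_def D)
    then show ?thesis
      unfolding rho_term_def by (rule J_P_null[OF _ gamma_chains])
  qed
  then have e: "{i. i \<ge> 1 \<and> rho_term 0 (partial_Suc 0) i y \<notin> P_null (0 + 1)} = {}"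
    by blast
  show ?thesis
    unfolding rho_rec rho_from_def e by simp
qed

lemma gamma_0_emb0: "gamma 0 (emb0 a b) = - lact a (free_ext (split 1) (\<sigma> b))"
proof -
  let ?g = "\<lambda>v u. fscale (-1) (if v = src u then split 1 (pcat (triv v) u) else 0)"
  have "gamma 0 (emb0 a b) = (\<Sum>v\<in>verts G. lact a (free_ext (?g v) (\<sigma> b)))"
    unfolding emb0_def module_hom.sum[OF gamma_hom] by (simp add: gamma_def cong: if_cong)
  also have "\<dots> = lact a (free_ext (\<lambda>u. \<Sum>v\<in>verts G. ?g v u) (\<sigma> b))"
    by (simp only: fs.lin_ext_fun_sum module_hom.sum[OF lact_hom])
  also have "free_ext (\<lambda>u. \<Sum>v\<in>verts G. ?g v u) (\<sigma> b) = free_ext (\<lambda>u. fscale (-1) (split 1 u)) (\<sigma> b)"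
  proof (rule fs.lin_ext_cong)
    fix u assume "u \<in> keys (\<sigma> b)"
    then have "src u \<in> verts G"
      using sigma_irr irr_paths src_in_verts by blast
    then have "(\<Sum>v\<in>verts G. ?g v u) = (\<Sum>v\<in>verts G. if v = src u then fscale (-1) (split 1 u) else 0)"
      by (intro sum.cong) auto
    then show "(\<Sum>v\<in>verts G. ?g v u) = fscale (-1) (split 1 u)"
      using \<open>src u \<in> verts G\<close> by simp
  qed
  finally show ?thesis
    unfolding fs.lin_ext_fun_scale module_hom.scale[OF lact_hom] by simp
qed

lemma split_1_triv: "v \<in> verts G \<Longrightarrow> split 1 (triv v) = 0"
  by (subst split_1) simp_all

lemma partial_1_split_1:
  assumes p: "p \<in> paths G"
  shows "partial_Suc 0 (split 1 p) = emb0 (\<pi>p p) (ev (tgt G p)) - emb0 (ev (src p)) (\<pi>p p)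
    - (\<Sum>i<plen p. emb0 0 (\<pi>p (suf G (Suc i) p)))"
proof -
  let ?f = "\<lambda>i. emb0 (\<pi>p (pre i p)) (\<pi>p (suf G i p))"
  have "partial_Suc 0 (split 1 p) = (\<Sum>i<plen p. partial_Suc 0 (base (\<pi>p (pre i p), arr G i p, \<pi>p (suf G (Suc i) p))))"
    unfolding split_1[OF p] partial_1 by (rule module_hom.sum[OF bimod_ext_hom])
  also have "\<dots> = (\<Sum>i<plen p. (?f (Suc i) - ?f i) - emb0 0 (\<pi>p (suf G (Suc i) p)))"
  proof (rule sum.cong)
    fix i assume "i \<in> {..<plen p}"
    then have i: "i < plen p" by simp
    have "\<pi>p (pre i p) * \<pi>p (arr G i p) = \<pi>p (pre (Suc i) p)"
      by (subst pp_pcat) (use pre_suf_paths[OF p] arr_paths[OF p i] i in \<open>simp_all add: src_arr pcat_pre_arr\<close>)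
    moreover have "\<pi>p (arr G i p) * \<pi>p (suf G (Suc i) p) = \<pi>p (suf G i p)"
      by (subst pp_pcat) (use pre_suf_paths[OF p] arr_paths[OF p i] i in \<open>simp_all add: tgt_arr pcat_arr_suf\<close>)
    ultimately show "partial_Suc 0 (base (\<pi>p (pre i p), arr G i p, \<pi>p (suf G (Suc i) p))) =
        (?f (Suc i) - ?f i) - emb0 0 (\<pi>p (suf G (Suc i) p))"
      by (simp add: partial_1_base)
  qed simp
  also have "\<dots> = (?f (plen p) - ?f 0) - (\<Sum>i<plen p. emb0 0 (\<pi>p (suf G (Suc i) p)))"
    by (simp only: sum_subtractf[of "\<lambda>i. ?f (Suc i) - ?f i"] sum_lessThan_telescope[of ?f])
  finally show ?thesis
    by simp
qed

text \<open>The Fox derivative of \<open>\<phi> s\<close>.\<close>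

definition fox :: "('v, 'e) qpath \<Rightarrow> ('v, 'e, 'k, 'a) pchain" where
  "fox s = free_ext (split 1) (\<phi> s)"

text \<open>The correction term in the differential of \<open>1 \<otimes> s \<otimes> 1\<close>.\<close>

definition hh :: "('v, 'e) qpath \<Rightarrow> ('v, 'e, 'k, 'a) pchain" where
  "hh s = rho 0 (partial_Suc 0 (delta 2 s))"

lemma delta_2: "delta 2 s = split 1 s"
  by (simp add: delta_def)

lemma partial_2: "partial_Suc 1 = bimod_ext (\<lambda>s. split 1 s - hh s)"
  using P_rec[of 0] by (simp add: hh_def delta_2 numeral_2_eq_2[symmetric])

text \<open>The differential of a generator is the difference of the Fox derivatives of the two sides of the
  relation that it stands for.\<close>

lemma hh_J:
  assumes s: "s \<in> S"
  shows "hh s - lact (ev (src s)) (fox s) \<in> J"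
proof -
  have p: "s \<in> paths G"
    by (rule S_paths[OF s])
  have "hh s = gamma 0 (partial_Suc 0 (split 1 s))"
    by (simp add: hh_def rho_0 delta_2)
  also have "\<dots> = gamma 0 (emb0 (\<pi>p s) (ev (tgt G s))) - gamma 0 (emb0 (ev (src s)) (\<pi>p s))
      - (\<Sum>i<plen s. gamma 0 (emb0 0 (\<pi>p (suf G (Suc i) s))))"
    unfolding partial_1_split_1[OF p] module_hom.diff[OF gamma_hom] module_hom.sum[OF gamma_hom] ..
  also have "gamma 0 (emb0 (\<pi>p s) (ev (tgt G s))) = 0"
    using tgt_in_verts[OF p]
    by (simp add: gamma_0_emb0 sigma_ev split_1_triv[unfolded One_nat_def] module_hom.zero[OF lact_hom])
  also have "gamma 0 (emb0 (ev (src s)) (\<pi>p s)) = - lact (ev (src s)) (fox s)"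
    by (simp add: gamma_0_emb0 sigma_pi_phi[OF s] fox_def)
  finally have "hh s - lact (ev (src s)) (fox s) = - (\<Sum>i<plen s. gamma 0 (emb0 0 (\<pi>p (suf G (Suc i) s))))"
    by simp
  also have "\<dots> \<in> J"
    by (intro fs.subspace_neg[OF subspace_J] fs.subspace_sum[OF subspace_J] gamma_J emb0_zero_J)
  finally show ?thesis .
qed

lemma hh_chains: "hh s \<in> chains (amb 1)"
  using gamma_chains[of 0] by (simp add: hh_def rho_0)

text \<open>The operator \<open>\<delta>\<^sub>2\<gamma>\<^sub>1 - \<partial>\<^sub>2\<gamma>\<^sub>1\<close>, whose powers occur in the series for \<open>\<rho>\<^sub>1\<close>.\<close>

definition D :: "('v, 'e, 'k, 'a) pchain \<Rightarrow> ('v, 'e, 'k, 'a) pchain" where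
  "D y = bimod_ext hh (gamma 1 y)"

lemma D_eq: "bimod_ext (delta (1 + 1)) (gamma 1 y) - partial_Suc 1 (gamma 1 y) = D y"
  unfolding partial_2 bimod_ext_diff D_def
  by (simp add: delta_2[unfolded numeral_2_eq_2])

lemma rho_term_1: "rho_term 1 (partial_Suc 1) i y = gamma 1 ((D ^^ i) y)"
  unfolding rho_term_def D_eq ..

lemma D_hom: "module_hom fscale fscale D"
  unfolding D_def[abs_def] by (rule hom_comp[OF gamma_hom bimod_ext_hom])

lemma D_J: "y \<in> J \<Longrightarrow> D y \<in> J"
  unfolding D_def by (intro bimod_ext_J gamma_J)

lemma D_chains: "D y \<in> chains (amb 1)"
  unfolding D_def by (rule bimod_ext_chains[OF gamma_chains hh_chains])

lemma gamma_lact: "gamma n (lact a y) = lact a (gamma n y)"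
proof (rule hom_base_eqI[OF hom_comp[OF lact_hom gamma_hom] hom_comp[OF gamma_hom lact_hom]])
  fix t :: "'a \<times> ('v, 'e) qpath \<times> 'a"
  show "gamma n (lact a (base t)) = lact a (gamma n (base t))"
    by (cases t) (simp add: gamma_def lact_lact)
qed

lemma bimod_ext_lact: "bimod_ext g (lact a y) = lact a (bimod_ext g y)"
proof (rule hom_base_eqI[OF hom_comp[OF lact_hom bimod_ext_hom] hom_comp[OF bimod_ext_hom lact_hom]])
  fix t :: "'a \<times> ('v, 'e) qpath \<times> 'a"
  show "bimod_ext g (lact a (base t)) = lact a (bimod_ext g (base t))"
    by (cases t) (simp add: lact_lact)
qed

lemma D_lact: "D (lact a y) = lact a (D y)"
  by (simp add: D_def gamma_lact[unfolded One_nat_def] bimod_ext_lact)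

lemma D_pow_lact: "(D ^^ n) (lact a y) = lact a ((D ^^ n) y)"
  by (induction n) (simp_all add: D_lact)

lemma gamma_1_base:
  "gamma 1 (base (a, x, b)) =
    lact a (free_ext (\<lambda>u. if tgt G x = src u then split 2 (pcat x u) else 0) (\<sigma> b))"
  by (simp add: gamma_def numeral_2_eq_2 cong: if_cong)

lemma gamma_1_irr:
  "u \<in> irr G S \<Longrightarrow> gamma 1 (base (a, x, \<pi>p u)) =
    (if tgt G x = src u then lact a (split 2 (pcat x u)) else 0)"
  unfolding gamma_1_base by (simp add: sigma_pi_irr module_hom.zero[OF lact_hom])

lemma gamma_1_expand: "gamma 1 (base (a, x, b)) = gamma 1 (free_ext (\<lambda>u. base (a, x, \<pi>p u)) (\<sigma> b))"
proof -
  have "gamma 1 (free_ext (\<lambda>u. base (a, x, \<pi>p u)) (\<sigma> b)) = free_ext (\<lambda>u. gamma 1 (base (a, x, \<pi>p u))) (\<sigma> b)"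
    by (rule module_hom_lin_ext[OF gamma_hom])
  also have "\<dots> = free_ext (\<lambda>u. lact a (if tgt G x = src u then split 2 (pcat x u) else 0)) (\<sigma> b)"
    by (rule fs.lin_ext_cong) (simp add: gamma_1_irr[unfolded One_nat_def] sigma_irr module_hom.zero[OF lact_hom])
  also have "\<dots> = gamma 1 (base (a, x, b))"
    unfolding gamma_1_base by (rule module_hom_lin_ext[OF lact_hom, symmetric])
  finally show ?thesis ..
qed

lemma split_2_irr: "p \<in> irr G S \<Longrightarrow> split 2 p = 0"
  by (simp add: split_def irr_def amb_2[unfolded numeral_2_eq_2] numeral_2_eq_2)

lemma split_2_arrow:
  assumes x: "x \<in> amb 1" and u: "u \<in> irr G S" "tgt G x = src u"
    and o: "(triv (src x), s, r) \<in> occs G S (pcat x u)"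
  shows "split 2 (pcat x u) = base (ev (src x), s, \<pi>p r)"
  unfolding split_def amb_2 arrow_irr_occs(2)[OF x[unfolded amb_1, THEN conjunct1] x[unfolded amb_1, THEN conjunct2] u o]
  by simp

lemma arrow_irr_cases:
  assumes x: "x \<in> amb 1" and u: "u \<in> irr G S" "tgt G x = src u"
  obtains (irr) "pcat x u \<in> irr G S"
  | (red) s r where "(triv (src x), s, r) \<in> occs G S (pcat x u)"
proof (cases "pcat x u \<in> irr G S")
  case False
  have "pcat x u \<in> paths G"
    using x u(2) irr_paths[OF u(1)] unfolding amb_1 by (auto intro: pcat_in_paths)
  then obtain c where "c \<in> occs G S (pcat x u)"
    using False by (auto simp: irr_def)
  then obtain q s r where "(q, s, r) \<in> occs G S (pcat x u)"
    by (cases c) auto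
  moreover have "q = triv (src x)"
    using arrow_irr_occs(1)[OF _ _ u calculation] x unfolding amb_1 by simp
  ultimately show ?thesis by (intro red) simp
qed (rule irr)

definition eventually_J :: "('v, 'e, 'k, 'a) pchain set" where
  "eventually_J = {y. eventually (\<lambda>n. (D ^^ n) y \<in> J) sequentially}"

lemma D_pow_hom: "module_hom fscale fscale (D ^^ n)"
  by (rule hom_funpow[OF D_hom])

lemma subspace_eventually_J: "fs.subspace eventually_J"
  unfolding fs.subspace_def
proof (intro conjI ballI allI)
  show "0 \<in> eventually_J"
    by (simp add: eventually_J_def module_hom.zero[OF D_pow_hom] fs.subspace_0[OF subspace_J])
next
  fix x y assume "x \<in> eventually_J" "y \<in> eventually_J"
  then show "x + y \<in> eventually_J"
    unfolding eventually_J_def mem_Collect_eq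
    by (rule eventually_elim2)
      (simp add: module_hom.add[OF D_pow_hom] fs.subspace_add[OF subspace_J])
next
  fix c y assume "y \<in> eventually_J"
  then show "fscale c y \<in> eventually_J"
    unfolding eventually_J_def mem_Collect_eq
    by (rule eventually_mono)
      (simp add: module_hom.scale[OF D_pow_hom] fs.subspace_scale[OF subspace_J])
qed

lemma D_eventually_J: "D y \<in> eventually_J \<longleftrightarrow> y \<in> eventually_J"
proof -
  have "(D ^^ n) (D y) = (D ^^ Suc n) y" for n
    by (simp add: funpow_swap1)
  then show ?thesis
    unfolding eventually_J_def mem_Collect_eq
    using eventually_sequentially_Suc[of "\<lambda>n. (D ^^ n) y \<in> J"] by (simp only:)
qed

lemma J_eventually_J: "y \<in> J \<Longrightarrow> y \<in> eventually_J"
proof -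
  assume y: "y \<in> J"
  have "(D ^^ n) y \<in> J" for n
    by (induction n) (simp_all add: y D_J)
  then show ?thesis by (simp add: eventually_J_def)
qed

lemma D_expand: "D (base (a, x, b)) = D (free_ext (\<lambda>u. base (a, x, \<pi>p u)) (\<sigma> b))"
  unfolding D_def gamma_1_expand[of a x b] ..

lemma eventually_J_expand:
  assumes "\<And>u. u \<in> keys (\<sigma> b) \<Longrightarrow> base (a, x, \<pi>p u) \<in> eventually_J"
  shows "base (a, x, b) \<in> eventually_J"
  unfolding D_eventually_J[of "base (a, x, b)", symmetric] D_expand D_eventually_J
  by (rule subspace_lin_ext[OF module_fscale subspace_eventually_J]) (rule assms)

lemma fox_expand:
  assumes s: "s \<in> S"
  shows "fox s = free_ext (\<lambda>u'. \<Sum>i<plen u'. base (\<pi>p (pre i u'), arr G i u', \<pi>p (suf G (Suc i) u'))) (\<phi> s)"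
  unfolding fox_def by (rule fs.lin_ext_cong) (rule split_1[OF phi_paths[OF s]])

lemma D_irr_zero:
  assumes "x \<in> amb 1" "u \<in> irr G S" "tgt G x \<noteq> src u \<or> pcat x u \<in> irr G S"
  shows "gamma 1 (base (a, x, \<pi>p u)) = 0" "D (base (a, x, \<pi>p u)) = 0"
proof -
  show "gamma 1 (base (a, x, \<pi>p u)) = 0"
    unfolding gamma_1_irr[OF assms(2)] using assms(3) split_2_irr by (auto simp: module_hom.zero[OF lact_hom])
  then show "D (base (a, x, \<pi>p u)) = 0"
    by (simp add: D_def module_hom.zero[OF bimod_ext_hom])
qed

lemma D_reducible:
  assumes "x \<in> amb 1" "u \<in> irr G S" "tgt G x = src u"
    and o: "(triv (src x), s, r) \<in> occs G S (pcat x u)"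
  shows "gamma 1 (base (a, x, \<pi>p u)) = base (a * ev (src x), s, \<pi>p r)"
    and "D (base (a, x, \<pi>p u)) - lact (a * ev (src x)) (ract (lact (ev (src x)) (fox s)) (\<pi>p r)) \<in> J"
proof -
  show g: "gamma 1 (base (a, x, \<pi>p u)) = base (a * ev (src x), s, \<pi>p r)"
    unfolding gamma_1_irr[OF assms(2)] using assms(3) split_2_arrow[OF assms] by simp
  have "src s = src x"
    using occsD(5)[OF o] by simp
  then have "hh s - lact (ev (src x)) (fox s) \<in> J"
    using hh_J[OF occsD(4)[OF o]] by simp
  then have "lact (a * ev (src x)) (ract (hh s - lact (ev (src x)) (fox s)) (\<pi>p r)) \<in> J"
    by (intro lact_J ract_J)
  then show "D (base (a, x, \<pi>p u)) - lact (a * ev (src x)) (ract (lact (ev (src x)) (fox s)) (\<pi>p r)) \<in> J"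
    unfolding D_def g by (simp add: module_hom.diff[OF ract_hom] module_hom.diff[OF lact_hom])
qed

text \<open>One step of the rewriting behind the homotopy strictly decreases the path that belongs to a tensor.\<close>

lemma descent:
  assumes q: "q \<in> paths G" "tgt G q = src x" and x: "x \<in> amb 1" and u: "u \<in> irr G S" "tgt G x = src u"
    and o: "(triv (src x), s, r) \<in> occs G S (pcat x u)"
    and u': "u' \<in> keys (\<phi> s)" and i: "i < plen u'"
    and v: "v \<in> keys (\<sigma> (\<pi>p (suf G (Suc i) u') * \<pi>p r))"
  shows "redstep\<^sup>+\<^sup>+ (pcat (pcat q (pre i u')) (pcat (arr G i u') v)) (pcat q (pcat x u))"
    and "v \<in> irr G S" and "tgt G v = tgt G u" and "arr G i u' \<in> amb 1"
    and "pcat q (pre i u') \<in> paths G" and "tgt G (pcat q (pre i u')) = src (arr G i u')"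
    and "tgt G (arr G i u') = src v"
proof -
  note d = occsD[OF o]
  have xp: "x \<in> paths G"
    using x by (simp add: amb_1)
  have up: "u \<in> paths G"
    by (rule irr_paths[OF u(1)])
  have u'p: "u' \<in> paths G" and u's: "src u' = src x" and u't: "tgt G u' = src r"
    using phi_paths[OF d(4) u'] phi_src[OF d(4) u'] phi_tgt[OF d(4) u'] d(5,6) by auto
  note ps = pre_suf_paths[OF u'p]
  have ap: "arr G i u' \<in> paths G"
    by (rule arr_paths[OF u'p i])
  show am: "arr G i u' \<in> amb 1"
    unfolding amb_1 using ap by simp
  have sr: "pcat (suf G (Suc i) u') r \<in> paths G"
    by (rule pcat_in_paths[OF ps(2) d(3)]) (simp add: u't)
  have "\<pi>p (suf G (Suc i) u') * \<pi>p r = \<pi>p (pcat (suf G (Suc i) u') r)"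
    by (rule pp_pcat[OF ps(2) d(3)]) (simp add: u't)
  then have v': "v \<in> keys (NF (pcat (suf G (Suc i) u') r))"
    using v sigma_pi[OF sr] by simp
  show vi: "v \<in> irr G S"
    by (rule sigma_irr[OF v])
  have rs: "redstep\<^sup>*\<^sup>* v (pcat (suf G (Suc i) u') r)"
    by (rule keys_NF[OF sr v'])
  have ends: "src v = src (suf G (Suc i) u')" "tgt G v = tgt G r"
    using redstep_rtranclp_ends[OF rs] by (simp_all add: tgt_pcat u't)
  have tr: "tgt G r = tgt G u"
  proof -
    have "tgt G (pcat x u) = tgt G (pcat s r)"
      unfolding d(7) using d(5) by (simp add: tgt_pcat)
    then show ?thesis
      using d(6) u(2) by (simp add: tgt_pcat)
  qed
  show "tgt G v = tgt G u"
    using ends tr by simp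
  show qp: "pcat q (pre i u') \<in> paths G"
    by (rule pcat_in_paths[OF q(1) ps(1)]) (simp add: q(2) u's)
  show qt: "tgt G (pcat q (pre i u')) = src (arr G i u')"
    using q(2) u's by (simp add: tgt_pcat src_arr)
  show ta: "tgt G (arr G i u') = src v"
    using tgt_arr[OF i] ends(1) by simp
  have "redstep\<^sup>*\<^sup>* (pcat (pcat (pcat q (pre i u')) (arr G i u')) (pcat v (triv (tgt G u))))
      (pcat (pcat (pcat q (pre i u')) (arr G i u')) (pcat (pcat (suf G (Suc i) u') r) (triv (tgt G u))))"
  proof (rule redstep_rtranclp_context[OF rs])
    show "pcat (pcat q (pre i u')) (arr G i u') \<in> paths G"
      by (rule pcat_in_paths[OF qp ap qt])
    show "tgt G (pcat (pcat q (pre i u')) (arr G i u')) = src (pcat (suf G (Suc i) u') r)"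
      using qt ta ends(1) by (simp add: tgt_pcat)
  qed (use tgt_in_verts[OF up] tr u't in \<open>simp_all add: tgt_pcat\<close>)
  moreover have "pcat (pcat (pcat q (pre i u')) (arr G i u')) (pcat (suf G (Suc i) u') r) = pcat q (pcat u' r)"
    using pcat_pre_arr_suf[OF i, of G] by (metis pcat_assoc)
  ultimately have 1: "redstep\<^sup>*\<^sup>* (pcat (pcat q (pre i u')) (pcat (arr G i u') v)) (pcat q (pcat u' r))"
    by (simp add: pcat_assoc)
  have "(pcat q (triv (src x)), s, pcat r (triv (tgt G u))) \<in> occs G S (pcat q (pcat (pcat x u) (triv (tgt G u))))"
    by (rule occs_extend[OF o q(1)]) (use q(2) u(2) tgt_in_verts[OF up] in \<open>simp_all add: tgt_pcat\<close>)
  then have "(q, s, r) \<in> occs G S (pcat q (pcat x u))"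
    by simp
  moreover have "pcat q (pcat u' r) \<in> keys (reduct q s r)"
    unfolding keys_reduct[OF d(4)] using u' by (rule imageI)
  ultimately have "redstep (pcat q (pcat u' r)) (pcat q (pcat x u))"
    unfolding redstep_def by (intro exI conjI)
  with 1 show "redstep\<^sup>+\<^sup>+ (pcat (pcat q (pre i u')) (pcat (arr G i u') v)) (pcat q (pcat x u))"
    by (rule rtranclp_into_tranclp1)
qed

text \<open>The terms of \<open>D(1 \<otimes> x \<otimes> u)\<close> are of the form \<open>q \<otimes> y \<otimes> v\<close> where \<open>qyv\<close> lies below \<open>xu\<close> in the well-founded
  reduction order.\<close>

lemma arrow_induct:
  assumes step: "\<And>x u. x \<in> amb 1 \<Longrightarrow> u \<in> irr G S \<Longrightarrow> tgt G x = src u \<Longrightarrow>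
      (\<And>s r u' i v. (triv (src x), s, r) \<in> occs G S (pcat x u) \<Longrightarrow> u' \<in> keys (\<phi> s) \<Longrightarrow> i < plen u' \<Longrightarrow>
        v \<in> keys (\<sigma> (\<pi>p (suf G (Suc i) u') * \<pi>p r)) \<Longrightarrow> P (arr G i u') v) \<Longrightarrow> P x u"
    and x: "x \<in> amb 1" and u: "u \<in> irr G S" "tgt G x = src u"
  shows "P x u"
proof -
  have *: "\<forall>q x u. q \<in> paths G \<longrightarrow> x \<in> amb 1 \<longrightarrow> u \<in> irr G S \<longrightarrow> tgt G q = src x \<longrightarrow> tgt G x = src u \<longrightarrow>
      p = pcat q (pcat x u) \<longrightarrow> P x u" if "p \<in> paths G" for p
    using that
  proof (induction p rule: path_induct)
    case (less p)
    show ?case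
    proof (intro allI impI)
      fix q x u assume a: "q \<in> paths G" "x \<in> amb 1" "u \<in> irr G S" "tgt G q = src x" "tgt G x = src u"
        "p = pcat q (pcat x u)"
      show "P x u"
      proof (rule step[OF a(2,3,5)])
        fix s r u' i v assume b: "(triv (src x), s, r) \<in> occs G S (pcat x u)" "u' \<in> keys (\<phi> s)" "i < plen u'"
          "v \<in> keys (\<sigma> (\<pi>p (suf G (Suc i) u') * \<pi>p r))"
        note ds = descent[OF a(1,4,2,3,5) b]
        show "P (arr G i u') v"
          using less(2)[OF ds(1)[folded a(6)]] ds(2,4,5,6,7) by blast
      qed
    qed
  qed
  have "pcat x u \<in> paths G"
    using x u(2) irr_paths[OF u(1)] unfolding amb_1 by (auto intro: pcat_in_paths)
  from *[OF this, rule_format, of "triv (src x)" x u] show ?thesis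
    using x u src_in_verts[of x] pcat_triv_left[of "src x" "pcat x u"] unfolding amb_1 by simp
qed

lemma base_eventually_J:
  assumes "x \<in> amb 1"
  shows "base (a, x, b) \<in> eventually_J"
proof -
  have main: "\<forall>a. base (a, x, \<pi>p u) \<in> eventually_J" if "x \<in> amb 1" "u \<in> irr G S" "tgt G x = src u" for x u
  proof (rule arrow_induct[where P = "\<lambda>x u. \<forall>a. base (a, x, \<pi>p u) \<in> eventually_J", OF _ that])
    fix x u
    assume 1: "x \<in> amb 1" "u \<in> irr G S" "tgt G x = src u"
      "\<And>s r u' i v. (triv (src x), s, r) \<in> occs G S (pcat x u) \<Longrightarrow> u' \<in> keys (\<phi> s) \<Longrightarrow> i < plen u' \<Longrightarrow>
        v \<in> keys (\<sigma> (\<pi>p (suf G (Suc i) u') * \<pi>p r)) \<Longrightarrow> \<forall>a. base (a, arr G i u', \<pi>p v) \<in> eventually_J"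
    show "\<forall>a. base (a, x, \<pi>p u) \<in> eventually_J"
    proof
      fix a
      show "base (a, x, \<pi>p u) \<in> eventually_J"
        using 1(1-3)
      proof (cases rule: arrow_irr_cases)
        case irr
        then show ?thesis
          using D_irr_zero(2)[OF 1(1,2), of a] J_eventually_J[OF fs.subspace_0[OF subspace_J]]
          by (subst D_eventually_J[symmetric]) simp
      next
        case (red s r)
        let ?y = "lact (a * ev (src x)) (ract (lact (ev (src x)) (fox s)) (\<pi>p r))"
        have "?y = free_ext (\<lambda>u'. lact (a * ev (src x)) (ract (lact (ev (src x))
            (\<Sum>i<plen u'. base (\<pi>p (pre i u'), arr G i u', \<pi>p (suf G (Suc i) u')))) (\<pi>p r))) (\<phi> s)"
          unfolding fox_expand[OF occsD(4)[OF red]]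
          by (rule module_hom_lin_ext[OF hom_comp[OF hom_comp[OF lact_hom ract_hom] lact_hom]])
        also have "\<dots> \<in> eventually_J"
        proof (rule subspace_lin_ext[OF module_fscale subspace_eventually_J])
          fix u' assume u': "u' \<in> keys (\<phi> s)"
          show "lact (a * ev (src x)) (ract (lact (ev (src x))
              (\<Sum>i<plen u'. base (\<pi>p (pre i u'), arr G i u', \<pi>p (suf G (Suc i) u')))) (\<pi>p r)) \<in> eventually_J"
            unfolding module_hom.sum[OF lact_hom] module_hom.sum[OF ract_hom] lact_base ract_base
            by (rule fs.subspace_sum[OF subspace_eventually_J], rule eventually_J_expand)
              (use 1(4)[OF red u'] in simp)
        qed
        finally have "?y \<in> eventually_J" .
        from fs.subspace_add[OF subspace_eventually_J J_eventually_J[OF D_reducible(2)[OF 1(1-3) red, of a]] this]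
        show ?thesis
          by (subst D_eventually_J[symmetric]) simp
      qed
    qed
  qed
  show ?thesis
  proof (rule eventually_J_expand)
    fix u assume "u \<in> keys (\<sigma> b)"
    then have u: "u \<in> irr G S"
      by (rule sigma_irr)
    show "base (a, x, \<pi>p u) \<in> eventually_J"
    proof (cases "tgt G x = src u")
      case True
      then show ?thesis using main[OF assms u] by simp
    next
      case False
      then show ?thesis
        using D_irr_zero(2)[OF assms u, of a] J_eventually_J[OF fs.subspace_0[OF subspace_J]]
        by (subst D_eventually_J[symmetric]) simp
    qed
  qed
qed

lemma chains_eventually_J:
  assumes "y \<in> chains (amb 1)"
  shows "y \<in> eventually_J"
proof -
  have "free_ext base y \<in> eventually_J"
  proof (rule subspace_lin_ext[OF module_fscale subspace_eventually_J])
    fix t assume "t \<in> keys y"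
    then have "fst (snd t) \<in> amb 1"
      using assms by (auto simp: chains_def)
    then show "base t \<in> eventually_J"
      by (cases t) (simp add: base_eventually_J[unfolded One_nat_def])
  qed
  then show ?thesis by (simp add: free_ext_base)
qed

end

context reduction_setup
begin

section \<open>Functionals on the second term of the resolution\<close>

text \<open>The conditions for \<open>a \<otimes> s \<otimes> b \<mapsto> a m(s, b)\<close> to be well defined on \<open>A \<otimes> \<bbbk>S \<otimes> A\<close>.\<close>

definition relm :: "(('v, 'e) qpath \<Rightarrow> 'a \<Rightarrow> 'a) \<Rightarrow> bool" where
  "relm m \<longleftrightarrow> (\<forall>s\<in>S. module_hom sA sA (m s) \<and> (\<forall>b. ev (src s) * m s b = m s b) \<and>
     (\<forall>v\<in>verts G. \<forall>b. m s (ev v * b) = (if v = tgt G s then m s b else 0)))"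

lemma relmD:
  assumes "relm m" "s \<in> S"
  shows "module_hom sA sA (m s)" "ev (src s) * m s b = m s b"
    "v \<in> verts G \<Longrightarrow> m s (ev v * b) = (if v = tgt G s then m s b else 0)"
  using assms by (auto simp: relm_def)

lemma Lf_P_null:
  assumes m: "relm m" and y: "y \<in> P_null 2"
  shows "Lf m y = 0"
proof -
  have hom: "m w (b + b') = m w b + m w b'" "m w (sA c b) = sA c (m w b)" if "w \<in> S" for w b b' c
    using module_hom.add[OF relmD(1)[OF m that]] module_hom.scale[OF relmD(1)[OF m that]] by auto
  have ev: "ev v * m w b = (if v = src w then m w b else 0)" if "w \<in> S" "v \<in> verts G" for v w b
  proof -
    have "ev v * m w b = (ev v * ev (src w)) * m w b"
      using relmD(2)[OF m that(1)] by (simp add: mult.assoc)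
    then show ?thesis
      using relmD(2)[OF m that(1)] that src_in_verts[OF S_paths[OF that(1)]] by (simp add: ev_ev)
  qed
  show ?thesis
    using y unfolding P_null_def amb_2
  proof (induction rule: fs.span_induct)
    case base
    show ?case
      unfolding fs.subspace_def mem_Collect_eq by (simp add: Lf_zero Lf_add Lf_scale)
  next
    case (step y)
    then show ?case
      by (elim UnE CollectE exE conjE)
        (auto simp: Lf_diff Lf_scale[of _ _ "base _"] hom ev relmD(3)[OF m] distrib_left distrib_right sA_mult_left
          sA_mult_right mult.assoc Lf_zero simp del: fscale_single)
  qed
qed

text \<open>Partial sums of the series for the composition of \<open>\<rho>\<^sub>1\<close> with a functional. They become constant, as \<open>D\<close> is
  locally nilpotent.\<close>

definition Phi :: "(('v, 'e) qpath \<Rightarrow> 'a \<Rightarrow> 'a) \<Rightarrow> nat \<Rightarrow> ('v, 'e, 'k, 'a) pchain \<Rightarrow> 'a" where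
  "Phi m N y = (\<Sum>i<N. Lf m (gamma 1 ((D ^^ i) y)))"

lemma rho_1_eventually:
  assumes m: "relm m" and y: "y \<in> chains (amb 1)"
  shows "eventually (\<lambda>N. Lf m (rho 1 y) = Phi m N y) sequentially"
proof -
  let ?t = "\<lambda>i. gamma 1 ((D ^^ i) y)"
  let ?Z = "{i. i \<ge> 1 \<and> ?t i \<notin> P_null (1 + 1)}"
  have "eventually (\<lambda>n. (D ^^ n) y \<in> J) sequentially"
    using chains_eventually_J[OF y] by (simp add: eventually_J_def)
  then obtain N0 where N0: "\<And>n. n \<ge> N0 \<Longrightarrow> (D ^^ n) y \<in> J"
    by (auto simp: eventually_sequentially)
  have null: "?t n \<in> P_null (1 + 1)" if "n \<ge> N0" for n
    by (rule J_P_null[OF gamma_J[OF N0[OF that]] gamma_chains])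
  have "Lf m (rho 1 y) = Phi m N y" if N: "N \<ge> Suc N0" for N
  proof -
    have sub: "?Z \<subseteq> {1..<N}"
    proof
      fix i assume "i \<in> ?Z"
      then have "\<not> N0 \<le> i"
        using null by blast
      then show "i \<in> {1..<N}"
        using \<open>i \<in> ?Z\<close> N by simp
    qed
    have "Lf m (rho 1 y) = Lf m (?t 0) + (\<Sum>i\<in>?Z. Lf m (?t i))"
      unfolding rho_rec rho_from_def rho_term_1 Lf_add Lf_sum by simp
    also have "(\<Sum>i\<in>?Z. Lf m (?t i)) = (\<Sum>i\<in>{1..<N}. Lf m (?t i))"
    proof (rule sum.mono_neutral_left[OF _ sub])
      show "\<forall>i\<in>{1..<N} - ?Z. Lf m (?t i) = 0"
        using Lf_P_null[OF m] by (auto simp: numeral_2_eq_2)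
    qed simp
    also have "Lf m (?t 0) + (\<Sum>i\<in>{1..<N}. Lf m (?t i)) = (\<Sum>i\<in>{0..<N}. Lf m (?t i))"
      using N by (subst (2) sum.atLeast_Suc_lessThan) auto
    finally show ?thesis
      by (simp add: Phi_def atLeast0LessThan)
  qed
  then show ?thesis
    unfolding eventually_sequentially by blast
qed

lemma Phi_hom: "module_hom fscale sA (Phi m N)"
proof (intro module_hom.intro module_hom_axioms.intro module_fscale A.module_axioms)
  show "Phi m N (x + y) = Phi m N x + Phi m N y" for x y
    by (simp add: Phi_def module_hom.add[OF D_pow_hom] module_hom.add[OF gamma_hom] Lf_add sum.distrib)
  show "Phi m N (fscale c x) = sA c (Phi m N x)" for c x
    by (simp add: Phi_def module_hom.scale[OF D_pow_hom] module_hom.scale[OF gamma_hom] Lf_scale A.scale_sum_right)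
qed

lemma Phi_lact: "Phi m N (lact a y) = a * Phi m N y"
  by (simp add: Phi_def D_pow_lact gamma_lact Lf_lact sum_distrib_left)

text \<open>The composition of \<open>\<rho>\<^sub>1\<close> with the functional given by \<open>m\<close>, as a function of an arrow and an element of \<open>A\<close>.\<close>

definition tau :: "(('v, 'e) qpath \<Rightarrow> 'a \<Rightarrow> 'a) \<Rightarrow> ('v, 'e) qpath \<Rightarrow> 'a \<Rightarrow> 'a" where
  "tau m x b = Lf m (rho 1 (base (oneA, x, b)))"

lemma base_chains [simp]: "base (a, w, b) \<in> chains W \<longleftrightarrow> w \<in> W"
  by (simp add: chains_def)

lemma Lf_rho_1:
  assumes m: "relm m" and y: "y \<in> chains (amb 1)"
  shows "Lf m (rho 1 y) = Lf (tau m) y"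
proof -
  have "eventually (\<lambda>N. \<forall>t\<in>keys y. tau m (fst (snd t)) (snd (snd t)) = Phi m N (base (oneA, snd t))) sequentially"
  proof (rule eventually_ball_finite)
    show "\<forall>t\<in>keys y. \<forall>\<^sub>F N in sequentially. tau m (fst (snd t)) (snd (snd t)) = Phi m N (base (oneA, snd t))"
    proof
      fix t assume "t \<in> keys y"
      then have "fst (snd t) \<in> amb 1"
        using y by (auto simp: chains_def)
      then show "\<forall>\<^sub>F N in sequentially. tau m (fst (snd t)) (snd (snd t)) = Phi m N (base (oneA, snd t))"
        unfolding tau_def prod.collapse by (intro rho_1_eventually[OF m]) (simp add: chains_def)
    qed
  qed simp
  then have "eventually (\<lambda>N. Lf m (rho 1 y) = Phi m N y \<and>
      (\<forall>t\<in>keys y. tau m (fst (snd t)) (snd (snd t)) = Phi m N (base (oneA, snd t)))) sequentially"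
    by (intro eventually_conj rho_1_eventually[OF m y])
  then obtain N where N: "Lf m (rho 1 y) = Phi m N y"
      "\<And>t. t \<in> keys y \<Longrightarrow> tau m (fst (snd t)) (snd (snd t)) = Phi m N (base (oneA, snd t))"
    by (auto simp: eventually_sequentially)
  have "Phi m N y = lin_ext sA (\<lambda>t. Phi m N (base t)) y"
    by (rule hom_base_expand[OF Phi_hom])
  also have "\<dots> = Lf (tau m) y"
    unfolding Lf_def
  proof (rule A.lin_ext_cong)
    fix t assume t: "t \<in> keys y"
    obtain a w b where abc: "t = (a, w, b)" by (cases t) auto
    have "Phi m N (base t) = a * Phi m N (base (oneA, w, b))"
      using Phi_lact[of m N a "base (oneA, w, b)"] by (simp add: abc)
    then show "Phi m N (base t) = (case t of (a, w, b) \<Rightarrow> a * tau m w b)"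
      using N(2)[OF t] by (simp add: abc)
  qed
  finally show ?thesis
    using N(1) by simp
qed

lemma Lf_rho_1_step:
  assumes m: "relm m" and y: "y \<in> chains (amb 1)"
  shows "Lf m (rho 1 y) = Lf m (gamma 1 y) + Lf m (rho 1 (D y))"
proof -
  have "eventually (\<lambda>N. Lf m (rho 1 y) = Phi m (Suc N) y \<and> Lf m (rho 1 (D y)) = Phi m N (D y)) sequentially"
    by (intro eventually_conj rho_1_eventually[OF m D_chains]
        eventually_sequentially_Suc[of "\<lambda>N. Lf m (rho 1 y) = Phi m N y", THEN iffD2] rho_1_eventually[OF m y])
  then obtain N where "Lf m (rho 1 y) = Phi m (Suc N) y" "Lf m (rho 1 (D y)) = Phi m N (D y)"
    by (auto simp: eventually_sequentially)
  then show ?thesis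
    by (simp add: Phi_def sum.lessThan_Suc_shift funpow_swap1 del: sum.lessThan_Suc)
qed

lemma tau_expand:
  assumes m: "relm m" and x: "x \<in> amb 1"
  shows "tau m x b = lin_ext sA (\<lambda>u. tau m x (\<pi>p u)) (\<sigma> b)"
proof -
  let ?z = "free_ext (\<lambda>u. base (oneA, x, \<pi>p u)) (\<sigma> b)"
  have z: "?z \<in> chains (amb 1)"
    by (rule subspace_lin_ext[OF module_fscale subspace_chains]) (use x in simp)
  have "base (oneA, x, b) \<in> chains (amb 1)"
    using x by simp
  from Lf_rho_1_step[OF m this] Lf_rho_1_step[OF m z]
  have "tau m x b = Lf m (rho 1 ?z)"
    unfolding tau_def D_expand[of oneA x b] gamma_1_expand[of oneA x b] by simp
  also have "\<dots> = Lf (tau m) ?z"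
    by (rule Lf_rho_1[OF m z])
  finally show ?thesis
    by (simp add: Lf_free_ext)
qed

lemma tau_hom:
  assumes m: "relm m" and x: "x \<in> amb 1"
  shows "module_hom sA sA (tau m x)"
proof -
  have "tau m x = (\<lambda>b. lin_ext sA (\<lambda>u. tau m x (\<pi>p u)) (\<sigma> b))"
    by (rule ext) (rule tau_expand[OF m x])
  moreover have "module_hom sA sA \<dots>"
    by (intro A_homI)
      (simp_all add: sigma_add sigma_scale A.lin_ext_add A.lin_ext_fscale)
  ultimately show ?thesis by simp
qed

lemma tau_irr:
  assumes m: "relm m" and "x \<in> amb 1" "u \<in> irr G S" "tgt G x \<noteq> src u \<or> pcat x u \<in> irr G S"
  shows "tau m x (\<pi>p u) = 0"
proof -
  have c: "base (oneA, x, \<pi>p u) \<in> chains (amb 1)"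
    using assms(2) by simp
  have "D (base (oneA, x, \<pi>p u)) = 0" "gamma 1 (base (oneA, x, \<pi>p u)) = 0"
    by (rule D_irr_zero[OF assms(2-4)])+
  then show ?thesis
    unfolding tau_def Lf_rho_1_step[OF m c]
    using Lf_rho_1[OF m fs.subspace_0[OF subspace_chains]] by (simp add: Lf_zero)
qed

lemma lact_ev_split_1:
  assumes "p \<in> paths G"
  shows "lact (ev (src p)) (split 1 p) = split 1 p"
proof -
  have "ev (src p) * \<pi>p (pre i p) = \<pi>p (pre i p)" for i
    using pre_suf_paths(1)[OF assms, of i] src_in_verts[OF assms] by (simp add: ev_pp)
  then show ?thesis
    unfolding split_1[OF assms] by (simp add: module_hom.sum[OF lact_hom])
qed

lemma lact_ev_fox:
  assumes s: "s \<in> S"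
  shows "lact (ev (src s)) (fox s) = fox s"
proof -
  have "lact (ev (src s)) (fox s) = free_ext (\<lambda>u. lact (ev (src s)) (split 1 u)) (\<phi> s)"
    unfolding fox_def by (rule module_hom_lin_ext[OF lact_hom])
  also have "\<dots> = fox s"
    unfolding fox_def
  proof (rule fs.lin_ext_cong)
    fix u assume u: "u \<in> keys (\<phi> s)"
    show "lact (ev (src s)) (split 1 u) = split 1 u"
      using lact_ev_split_1[OF phi_paths[OF s u]] phi_src[OF s u] by simp
  qed
  finally show ?thesis .
qed

lemma split_1_chains: "split 1 p \<in> chains (amb 1)"
  by (rule split_chains)

lemma fox_chains: "fox s \<in> chains (amb 1)"
  unfolding fox_def by (rule subspace_lin_ext[OF module_fscale subspace_chains split_1_chains])

text \<open>Splitting the first term off the series for \<open>\<rho>\<^sub>1\<close> gives a recursion along the reduction of \<open>xu = sr\<close>.\<close>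

lemma tau_red:
  assumes m: "relm m" and x: "x \<in> amb 1" and u: "u \<in> irr G S" "tgt G x = src u"
    and o: "(triv (src x), s, r) \<in> occs G S (pcat x u)"
  shows "tau m x (\<pi>p u) = m s (\<pi>p r) + Lf (\<lambda>w b. tau m w (b * \<pi>p r)) (fox s)"
proof -
  have s: "s \<in> S" "src s = src x"
    using occsD[OF o] by simp_all
  have c: "base (oneA, x, \<pi>p u) \<in> chains (amb 1)"
    using x by simp
  have "tau m x (\<pi>p u) = Lf m (base (oneA * ev (src x), s, \<pi>p r)) + Lf (tau m) (D (base (oneA, x, \<pi>p u)))"
    unfolding tau_def[of m x] Lf_rho_1_step[OF m c] Lf_rho_1[OF m D_chains] D_reducible(1)[OF x u o] ..
  also have "Lf (tau m) (D (base (oneA, x, \<pi>p u))) =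
      Lf (tau m) (lact (oneA * ev (src x)) (ract (lact (ev (src x)) (fox s)) (\<pi>p r)))"
    by (rule Lf_cong_J[OF D_reducible(2)[OF x u o]])
  also have "\<dots> = Lf (\<lambda>w b. tau m w (b * \<pi>p r)) (lact (ev (src s)) (lact (ev (src s)) (fox s)))"
    by (simp add: Lf_lact Lf_ract s(2))
  finally show ?thesis
    unfolding lact_ev_fox[OF s(1)] using relmD(2)[OF m s(1), of "\<pi>p r"] s(2) by simp
qed

lemma Lf_fox:
  assumes s: "s \<in> S"
  shows "Lf m (fox s) =
    lin_ext sA (\<lambda>u'. \<Sum>i<plen u'. \<pi>p (pre i u') * m (arr G i u') (\<pi>p (suf G (Suc i) u'))) (\<phi> s)"
  unfolding fox_expand[OF s] Lf_free_ext Lf_sum by simp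

text \<open>A functional on the first term that obeys the rewriting recursion is the one
  induced by the homotopy.\<close>

lemma tau_unique:
  assumes m: "relm m"
    and hom: "\<And>x. x \<in> amb 1 \<Longrightarrow> module_hom sA sA (\<theta> x)"
    and irr: "\<And>x u. x \<in> amb 1 \<Longrightarrow> u \<in> irr G S \<Longrightarrow> tgt G x \<noteq> src u \<or> pcat x u \<in> irr G S \<Longrightarrow> \<theta> x (\<pi>p u) = 0"
    and red: "\<And>x u s r. x \<in> amb 1 \<Longrightarrow> u \<in> irr G S \<Longrightarrow> tgt G x = src u \<Longrightarrow>
      (triv (src x), s, r) \<in> occs G S (pcat x u) \<Longrightarrow>
      \<theta> x (\<pi>p u) = m s (\<pi>p r) + Lf (\<lambda>w b. \<theta> w (b * \<pi>p r)) (fox s)"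
    and x: "x \<in> amb 1"
  shows "\<theta> x b = tau m x b"
proof (rule hom_eqI[OF hom[OF x] tau_hom[OF m x]])
  have *: "\<theta> x (\<pi>p u) = tau m x (\<pi>p u)" if "x \<in> amb 1" "u \<in> irr G S" "tgt G x = src u" for x u
  proof (rule arrow_induct[where P = "\<lambda>x u. \<theta> x (\<pi>p u) = tau m x (\<pi>p u)", OF _ that])
    fix x u
    assume 1: "x \<in> amb 1" "u \<in> irr G S" "tgt G x = src u"
      "\<And>s r u' i v. (triv (src x), s, r) \<in> occs G S (pcat x u) \<Longrightarrow> u' \<in> keys (\<phi> s) \<Longrightarrow> i < plen u' \<Longrightarrow>
        v \<in> keys (\<sigma> (\<pi>p (suf G (Suc i) u') * \<pi>p r)) \<Longrightarrow> \<theta> (arr G i u') (\<pi>p v) = tau m (arr G i u') (\<pi>p v)"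
    show "\<theta> x (\<pi>p u) = tau m x (\<pi>p u)"
      using 1(1-3)
    proof (cases rule: arrow_irr_cases)
      case irr
      then show ?thesis
        using assms(3)[OF 1(1,2)] tau_irr[OF m 1(1,2)] by simp
    next
      case (red s r)
      have s: "s \<in> S"
        by (rule occsD(4)[OF red])
      have "Lf (\<lambda>w b. \<theta> w (b * \<pi>p r)) (fox s) = Lf (\<lambda>w b. tau m w (b * \<pi>p r)) (fox s)"
        unfolding Lf_fox[OF s]
      proof (rule A.lin_ext_cong, rule sum.cong)
        fix u' i assume u': "u' \<in> keys (\<phi> s)" and "i \<in> {..<plen u'}"
        then have i: "i < plen u'" by simp
        have am: "arr G i u' \<in> amb 1"
          unfolding amb_1 using arr_paths[OF phi_paths[OF s u'] i] by simp
        have "\<theta> (arr G i u') (\<pi>p (suf G (Suc i) u') * \<pi>p r) = tau m (arr G i u') (\<pi>p (suf G (Suc i) u') * \<pi>p r)"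
          unfolding hom_expand[OF hom[OF am], of "\<pi>p (suf G (Suc i) u') * \<pi>p r"] tau_expand[OF m am, of "\<pi>p (suf G (Suc i) u') * \<pi>p r"]
          by (rule A.lin_ext_cong) (rule 1(4)[OF red u' i])
        then show "\<pi>p (pre i u') * \<theta> (arr G i u') (\<pi>p (suf G (Suc i) u') * \<pi>p r) =
            \<pi>p (pre i u') * tau m (arr G i u') (\<pi>p (suf G (Suc i) u') * \<pi>p r)"
          by simp
      qed simp
      then show ?thesis
        unfolding assms(4)[OF 1(1-3) red] tau_red[OF m 1(1-3) red] by simp
    qed
  qed
  fix u assume u: "u \<in> irr G S"
  show "\<theta> x (\<pi>p u) = tau m x (\<pi>p u)"
  proof (cases "tgt G x = src u")
    case True
    then show ?thesis by (rule *[OF x u])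
  next
    case False
    then show ?thesis using irr[OF x u] tau_irr[OF m x u] by simp
  qed
qed

lemma Lf_mult_right: "Lf (\<lambda>w b. m w b * c) y = Lf m y * c"
  unfolding Lf_def using module_hom_lin_ext[OF mult_hom_left[of c], of "\<lambda>(a, w, b). a * m w b" y]
  by (simp add: case_prod_unfold mult.assoc)

lemma Lf_zero_fun: "Lf (\<lambda>w b. 0) y = 0"
  unfolding Lf_def by (simp add: case_prod_unfold)

lemma Lf_fun_diff: "Lf (\<lambda>w b. m w b - m' w b) y = Lf m y - Lf m' y"
  unfolding Lf_def by (simp add: case_prod_unfold right_diff_distrib A.lin_ext_fun_diff)

lemma Lf_fun_add: "Lf (\<lambda>w b. m w b + m' w b) y = Lf m y + Lf m' y"
  unfolding Lf_def by (simp add: case_prod_unfold distrib_left A.lin_ext_fun_add)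

lemma Lf_param_hom:
  assumes y: "y \<in> chains W" and hom: "\<And>x c. x \<in> W \<Longrightarrow> module_hom sA sA (M x c)"
  shows "module_hom sA sA (\<lambda>b. Lf (\<lambda>x c. M x c b) y)"
proof (intro A_homI)
  show "Lf (\<lambda>x c. M x c (b + b')) y = Lf (\<lambda>x c. M x c b) y + Lf (\<lambda>x c. M x c b') y" for b b'
    unfolding Lf_fun_add[symmetric] by (rule Lf_cong_chains[OF y]) (rule module_hom.add[OF hom])
  show "Lf (\<lambda>x c. M x c (sA k b)) y = sA k (Lf (\<lambda>x c. M x c b) y)" for k b
  proof -
    have "Lf (\<lambda>x c. M x c (sA k b)) y = Lf (\<lambda>x c. sA k (M x c b)) y"
      by (rule Lf_cong_chains[OF y]) (rule module_hom.scale[OF hom])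
    also have "\<dots> = sA k (Lf (\<lambda>x c. M x c b) y)"
      unfolding Lf_def by (simp add: case_prod_unfold sA_mult_right A.lin_ext_fun_scale)
    finally show ?thesis .
  qed
qed

text \<open>The homotopy is compatible with right multiplication by idempotents.\<close>

lemma occ_tgt: "(q, s, r) \<in> occs G T (pcat x u) \<Longrightarrow> tgt G x = src u \<Longrightarrow> tgt G r = tgt G u"
  using occsD[of q s r T "pcat x u"] by (metis src_pcat tgt_pcat)

lemma tau_ev_right:
  assumes m: "relm m" and r: "\<And>s b. s \<in> S \<Longrightarrow> m s (b * ev v) = m s b * ev v"
    and v: "v \<in> verts G" and x: "x \<in> amb 1"
  shows "tau m x (b * ev v) = tau m x b * ev v"
proof -
  let ?m = "\<lambda>s b. m s b * ev v"
  have m': "relm ?m"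
    unfolding relm_def
  proof (intro ballI conjI allI)
    fix s b w assume s: "s \<in> S"
    show "module_hom sA sA (\<lambda>b. m s b * ev v)"
      by (rule hom_comp[OF relmD(1)[OF m s] mult_hom_left])
    show "ev (src s) * (m s b * ev v) = m s b * ev v"
      using relmD(2)[OF m s, of b] by (simp only: mult.assoc[symmetric])
    show "m s (ev w * b) * ev v = (if w = tgt G s then m s b * ev v else 0)" if "w \<in> verts G"
      using relmD(3)[OF m s that, of b] by simp
  qed
  have hom: "module_hom sA sA (\<lambda>b. tau m x (b * ev v))" if "x \<in> amb 1" for x
    by (rule hom_comp[OF mult_hom_left tau_hom[OF m that]])
  have "tau m x (b * ev v) = tau ?m x b"
  proof (rule tau_unique[OF m', where \<theta> = "\<lambda>x b. tau m x (b * ev v)", OF hom _ _ x])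
    fix x u assume xu: "x \<in> amb 1" "u \<in> irr G S"
    have uev: "\<pi>p u * ev v = (if v = tgt G u then \<pi>p u else 0)"
      by (rule pp_ev[OF v irr_paths[OF xu(2)]])
    show "tau m x (\<pi>p u * ev v) = 0" if "tgt G x \<noteq> src u \<or> pcat x u \<in> irr G S"
      using tau_irr[OF m xu that] module_hom.zero[OF tau_hom[OF m xu(1)]] by (simp add: uev)
    fix s r assume c: "tgt G x = src u" and o: "(triv (src x), s, r) \<in> occs G S (pcat x u)"
    note d = occsD[OF o]
    have rev: "\<pi>p r * ev v = (if v = tgt G u then \<pi>p r else 0)"
      using pp_ev[OF v d(3)] occ_tgt[OF o c] by simp
    have L: "Lf (\<lambda>w b. tau m w (b * \<pi>p r * ev v)) (fox s) =
        (if v = tgt G u then Lf (\<lambda>w b. tau m w (b * \<pi>p r)) (fox s) else 0)"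
    proof (cases "v = tgt G u")
      case False
      have "Lf (\<lambda>w b. tau m w (b * \<pi>p r * ev v)) (fox s) = Lf (\<lambda>w b. 0) (fox s)"
        by (rule Lf_cong_chains[OF fox_chains])
          (use False in \<open>simp add: mult.assoc rev module_hom.zero[OF tau_hom[OF m]]\<close>)
      then show ?thesis using False by (simp add: Lf_zero_fun)
    next
      case True
      then show ?thesis unfolding mult.assoc rev by simp
    qed
    have "m s (\<pi>p r) * ev v = (if v = tgt G u then m s (\<pi>p r) else 0)"
      using r[OF d(4), of "\<pi>p r"] module_hom.zero[OF relmD(1)[OF m d(4)]] by (simp add: rev split: if_splits)
    then show "tau m x (\<pi>p u * ev v) = m s (\<pi>p r) * ev v + Lf (\<lambda>w b. tau m w (b * \<pi>p r * ev v)) (fox s)"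
      unfolding L using tau_red[OF m xu c o] module_hom.zero[OF tau_hom[OF m xu(1)]] by (simp add: uev)
  qed
  then show ?thesis
    by (simp add: tau_def Lf_mult_right)
qed

lemma rho_1_chains: "rho 1 y \<in> chains S"
proof -
  have "gamma 1 z \<in> chains S" for z
    using gamma_chains[of 1 z] by (simp only: one_add_one amb_2)
  then show ?thesis
    unfolding rho_rec rho_from_def rho_term_1
    by (intro fs.subspace_add[OF subspace_chains] fs.subspace_sum[OF subspace_chains])
qed

lemma tau_cong: "(\<And>s b. s \<in> S \<Longrightarrow> m s b = m' s b) \<Longrightarrow> tau m x b = tau m' x b"
  unfolding tau_def by (rule Lf_cong_chains[OF rho_1_chains])

lemma tau_diff: "tau (\<lambda>s b. m s b - m' s b) x b = tau m x b - tau m' x b"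
  unfolding tau_def by (rule Lf_fun_diff)

lemma Lf_split_1:
  assumes "p \<in> paths G"
  shows "Lf m (split 1 p) = (\<Sum>i<plen p. \<pi>p (pre i p) * m (arr G i p) (\<pi>p (suf G (Suc i) p)))"
  unfolding split_1[OF assms] Lf_sum by simp

lemma arr_amb: "p \<in> paths G \<Longrightarrow> i < plen p \<Longrightarrow> arr G i p \<in> amb 1"
  unfolding amb_1 using arr_paths by simp

lemma Lf_split_1_ev:
  assumes p: "p \<in> paths G" and v: "v \<in> verts G" and z: "\<And>x. x \<in> amb 1 \<Longrightarrow> m x 0 = 0"
  shows "Lf (\<lambda>x c. m x (c * ev v)) (split 1 p) = (if v = tgt G p then Lf m (split 1 p) else 0)"
proof -
  have "\<pi>p (suf G i p) * ev v = (if v = tgt G p then \<pi>p (suf G i p) else 0)" for i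
    using pp_ev[OF v pre_suf_paths(2)[OF p]] by simp
  then show ?thesis
    unfolding Lf_split_1[OF p] using z arr_amb[OF p] by (auto intro!: sum.neutral)
qed

text \<open>Up to the sign this is \<open>\<rho>\<^sub>0(1 \<otimes> a)\<close>.\<close>

definition sp :: "'a \<Rightarrow> ('v, 'e, 'k, 'a) pchain" where
  "sp a = free_ext (split 1) (\<sigma> a)"

lemma sp_chains: "sp a \<in> chains (amb 1)"
  unfolding sp_def by (rule subspace_lin_ext[OF module_fscale subspace_chains split_1_chains])

lemma sp_hom: "module_hom sA fscale sp"
  unfolding sp_def[abs_def]
  by (intro module_hom.intro module_hom_axioms.intro module_fscale A.module_axioms)
    (simp_all add: sigma_add sigma_scale fs.lin_ext_add fs.lin_ext_fscale)

lemma Lf_sp: "Lf m (sp a) = lin_ext sA (\<lambda>u. Lf m (split 1 u)) (\<sigma> a)"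
  unfolding sp_def by (rule Lf_free_ext)

lemma Lf_sp_zero:
  assumes "\<And>x u. x \<in> amb 1 \<Longrightarrow> u \<in> irr G S \<Longrightarrow> tgt G x = src u \<Longrightarrow> pcat x u \<in> irr G S \<Longrightarrow> m x (\<pi>p u) = 0"
  shows "u \<in> irr G S \<Longrightarrow> Lf m (split 1 u) = 0" "Lf m (sp a) = 0"
proof -
  have *: "Lf m (split 1 u) = 0" if u: "u \<in> irr G S" for u
  proof -
    have "m (arr G i u) (\<pi>p (suf G (Suc i) u)) = 0" if "i < plen u" for i
      by (rule assms) (use that u irr_suf arr_amb[OF irr_paths[OF u]] in \<open>simp_all add: tgt_arr pcat_arr_suf\<close>)
    then show ?thesis
      unfolding Lf_split_1[OF irr_paths[OF u]] by simp
  qed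
  then show "u \<in> irr G S \<Longrightarrow> Lf m (split 1 u) = 0" .
  have "lin_ext sA (\<lambda>u. Lf m (split 1 u)) (\<sigma> a) = lin_ext sA (\<lambda>u. 0) (\<sigma> a)"
    by (rule A.lin_ext_cong) (simp only: * sigma_irr)
  then show "Lf m (sp a) = 0"
    unfolding Lf_sp by simp
qed

lemma sp_oneA: "sp oneA = 0"
proof -
  have "sp oneA = (\<Sum>v\<in>verts G. split 1 (triv v))"
    by (simp add: sp_def sigma_oneA fs.lin_ext_sum)
  also have "\<dots> = 0"
    by (rule sum.neutral) (simp add: split_1_triv[unfolded One_nat_def])
  finally show ?thesis .
qed

end

lemma single_neg: "single p (- c) = - (single p c :: _ \<Rightarrow>\<^sub>0 'r::comm_ring_1)"
  by (rule poly_mapping_eqI) (simp add: lookup_single when_def)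

lemma suf_suf: "suf G j (suf G k p) = suf G (k + j) p"
proof (rule prod_eqI)
  have "tgt G (src p, take (k + j) (snd p)) = tgt G (tgt G (src p, take k (snd p)), take j (drop k (snd p)))"
    unfolding take_add by (rule tgt_append)
  then show "src (suf G j (suf G k p)) = src (suf G (k + j) p)"
    by (simp add: suf_def pre_def)
  show "snd (suf G j (suf G k p)) = snd (suf G (k + j) p)"
    by (simp add: suf_def add.commute)
qed

context reduction_setup
begin

section \<open>Cochains\<close>

text \<open>Balanced and right linear over \<open>\<bbbk>Q\<^sub>0\<close>, and normalised in the first argument: these are the properties which
  all \<open>G\<^sub>k\<close> share, and under which \<open>G\<close>, \<open>h\<close> and \<open>F\<close> are given by functionals on the resolution.\<close>

definition rel2 :: "('a list \<Rightarrow> 'a) \<Rightarrow> bool" where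
  "rel2 f \<longleftrightarrow> (\<forall>b. module_hom sA sA (\<lambda>a. f [a, b])) \<and> (\<forall>a. module_hom sA sA (\<lambda>b. f [a, b])) \<and>
     (\<forall>v\<in>verts G. \<forall>a b. f [a * ev v, b] = f [a, ev v * b] \<and> f [a, b * ev v] = f [a, b] * ev v) \<and>
     (\<forall>b. f [oneA, b] = 0)"

definition rel3 :: "('a list \<Rightarrow> 'a) \<Rightarrow> bool" where
  "rel3 g \<longleftrightarrow> (\<forall>b c. module_hom sA sA (\<lambda>a. g [a, b, c])) \<and> (\<forall>a c. module_hom sA sA (\<lambda>b. g [a, b, c])) \<and>
     (\<forall>a b. module_hom sA sA (\<lambda>c. g [a, b, c])) \<and>
     (\<forall>v\<in>verts G. \<forall>a b c. g [a, b * ev v, c] = g [a, b, ev v * c] \<and> g [a, b, c * ev v] = g [a, b, c] * ev v) \<and>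
     (\<forall>b c. g [oneA, b, c] = 0)"

lemma eval_bar_hom: "module_hom fscale sA (eval_bar g)"
  unfolding eval_bar_def[abs_def]
  by (intro module_hom.intro module_hom_axioms.intro module_fscale A.module_axioms A.lin_ext_add A.lin_ext_fscale)

lemma tensor_right_hom: "module_hom fscale fscale (\<lambda>y. tensor_right y bs)"
  unfolding tensor_right_def by (rule fs.lin_ext_hom)

lemma eval_bar_base [simp]: "eval_bar g (base as) = hd as * g (butlast (tl as)) * last as"
  by (simp add: eval_bar_def)

lemma tensor_right_base [simp]: "tensor_right (base as) bs = base (as @ bs)"
  by (simp add: tensor_right_def)

lemma Fm_hom: "module_hom fscale fscale (Fm n)"
  by (cases n) (simp_all add: fs.lin_ext_hom)

lemma Fm_0_emb0: "Fm 0 (emb0 a b) = (\<Sum>v\<in>verts G. base [a * ev v, b])"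
  by (simp add: emb0_def fs.lin_ext_sum)

lemma Fm_1_base: "Fm 1 (base (a, x, b)) = (\<Sum>v\<in>verts G. base [a * ev v, \<pi>p x, b])
    + (\<Sum>v\<in>verts G. base [0, oneA, b]) - (\<Sum>v\<in>verts G. base [a * \<pi>p x * ev v, oneA, b])"
proof -
  have "Fm 1 (base (a, x, b)) = - tensor_right (Fm 0 (partial_Suc 0 (base (a, x, oneA)))) [b]"
    by simp
  also have "\<dots> = (\<Sum>v\<in>verts G. base [a * ev v, \<pi>p x, b])
      + (\<Sum>v\<in>verts G. base [0, oneA, b]) - (\<Sum>v\<in>verts G. base [a * \<pi>p x * ev v, oneA, b])"
    unfolding partial_1_base module_hom.diff[OF Fm_hom] Fm_0_emb0 module_hom.diff[OF tensor_right_hom]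
      module_hom.sum[OF tensor_right_hom] by simp
  finally show ?thesis .
qed

lemma sum_ev: "(\<Sum>v\<in>verts G. a * ev v * b) = a * b"
proof -
  have "(\<Sum>v\<in>verts G. a * ev v * b) = a * oneA * b"
    by (simp only: oneA_eq sum_distrib_left sum_distrib_right)
  then show ?thesis by simp
qed

lemma F1_eval:
  assumes one: "\<And>b. g (oneA # b # butlast bs) = 0" and bs: "bs \<noteq> []"
  shows "eval_bar g (tensor_right (Fm 1 y) bs) = Lf (\<lambda>x b. g (\<pi>p x # b # butlast bs) * last bs) y"
proof (rule hom_base_eqI[OF hom_comp[OF hom_comp[OF Fm_hom tensor_right_hom] eval_bar_hom] Lf_hom])
  fix t :: "'a \<times> ('v, 'e) qpath \<times> 'a"
  obtain a x b where t: "t = (a, x, b)" by (cases t) auto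
  have "eval_bar g (tensor_right (Fm 1 (base t)) bs) =
      (\<Sum>v\<in>verts G. a * ev v * (g (\<pi>p x # b # butlast bs) * last bs))"
    unfolding t Fm_1_base module_hom.diff[OF tensor_right_hom] module_hom.add[OF tensor_right_hom]
      module_hom.diff[OF eval_bar_hom] module_hom.add[OF eval_bar_hom]
      module_hom.sum[OF tensor_right_hom] module_hom.sum[OF eval_bar_hom]
    using bs by (simp add: one mult.assoc)
  then show "eval_bar g (tensor_right (Fm 1 (base t)) bs) = Lf (\<lambda>x b. g (\<pi>p x # b # butlast bs) * last bs) (base t)"
    unfolding sum_ev t by simp
qed

text \<open>The value of \<open>\<partial>\<^sub>2\<close> at \<open>1 \<otimes> s \<otimes> 1\<close>, up to \<open>J\<close>.\<close>

definition rel :: "('v, 'e) qpath \<Rightarrow> ('v, 'e, 'k, 'a) pchain" where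
  "rel s = split 1 s - fox s"

lemma rel_chains: "rel s \<in> chains (amb 1)"
  unfolding rel_def by (rule fs.subspace_diff[OF subspace_chains split_1_chains fox_chains])

lemma lact_ev_rel: "s \<in> S \<Longrightarrow> lact (ev (src s)) (rel s) = rel s"
  unfolding rel_def module_hom.diff[OF lact_hom] using lact_ev_split_1[OF S_paths] lact_ev_fox by simp

lemma partial_2_J:
  assumes s: "s \<in> S"
  shows "(split 1 s - hh s) - rel s \<in> J"
  using fs.subspace_neg[OF subspace_J hh_J[OF s, unfolded lact_ev_fox[OF s]]] by (simp add: rel_def)

lemma Lf_partial_2:
  assumes y: "y \<in> chains S"
  shows "Lf m (partial_Suc 1 y) = Lf (\<lambda>s b. Lf (\<lambda>x c. m x (c * b)) (rel s)) y"
proof (rule hom_base_eqI[OF _ Lf_hom])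
  show "module_hom fscale sA (\<lambda>y. Lf m (partial_Suc 1 y))"
    unfolding partial_2 by (rule hom_comp[OF bimod_ext_hom Lf_hom])
  fix t assume t: "t \<in> keys y"
  obtain a s b where abc: "t = (a, s, b)" by (cases t) auto
  have s: "s \<in> S"
    using y t by (auto simp: chains_def abc)
  show "Lf m (partial_Suc 1 (base t)) = Lf (\<lambda>s b. Lf (\<lambda>x c. m x (c * b)) (rel s)) (base t)"
    unfolding abc partial_2 bimod_ext_base Lf_lact Lf_ract Lf_base Lf_cong_J[OF partial_2_J[OF s]] ..
qed

lemma F2_eval:
  assumes one: "\<And>b c. g (oneA # c # butlast (b # bs)) = 0" and y: "y \<in> chains S"
  shows "eval_bar g (tensor_right (Fm 2 y) bs) =
    Lf (\<lambda>s b. Lf (\<lambda>x c. g (\<pi>p x # c # butlast (b # bs))) (rel s) * last (b # bs)) y"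
proof (rule hom_base_eqI[OF hom_comp[OF hom_comp[OF Fm_hom tensor_right_hom] eval_bar_hom] Lf_hom])
  fix t assume t: "t \<in> keys y"
  obtain a s b where abc: "t = (a, s, b)" by (cases t) auto
  have s: "s \<in> S"
    using y t by (auto simp: chains_def abc)
  have "Fm 2 (base t) = tensor_right (Fm 1 (partial_Suc 1 (base (a, s, oneA)))) [b]"
    by (simp add: abc numeral_2_eq_2)
  then have "tensor_right (Fm 2 (base t)) bs =
      tensor_right (tensor_right (Fm 1 (partial_Suc 1 (base (a, s, oneA)))) [b]) bs"
    by simp
  also have "\<dots> = tensor_right (Fm 1 (partial_Suc 1 (base (a, s, oneA)))) (b # bs)"
    by (rule hom_base_eqI[OF hom_comp[OF tensor_right_hom tensor_right_hom] tensor_right_hom]) simp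
  finally have "eval_bar g (tensor_right (Fm 2 (base t)) bs) =
      Lf (\<lambda>x c. g (\<pi>p x # c # butlast (b # bs)) * last (b # bs)) (partial_Suc 1 (base (a, s, oneA)))"
    using F1_eval[of g "b # bs" "partial_Suc 1 (base (a, s, oneA))", OF one] by (simp del: Fm.simps One_nat_def butlast.simps last.simps)
  also have "\<dots> = Lf (\<lambda>x c. g (\<pi>p x # c # butlast (b # bs)) * last (b # bs)) (lact a (rel s))"
    unfolding partial_2 bimod_ext_base ract_oneA Lf_lact Lf_cong_J[OF partial_2_J[OF s]] ..
  finally show "eval_bar g (tensor_right (Fm 2 (base t)) bs) =
      Lf (\<lambda>s b. Lf (\<lambda>x c. g (\<pi>p x # c # butlast (b # bs))) (rel s) * last (b # bs)) (base t)"
    unfolding Lf_lact Lf_mult_right by (simp add: abc mult.assoc)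
qed

text \<open>The pullback of \<open>g\<close> along \<open>F\<^sub>2\<close>, with the right factor kept as an argument.\<close>

definition gh :: "('a list \<Rightarrow> 'a) \<Rightarrow> ('v, 'e) qpath \<Rightarrow> 'a \<Rightarrow> 'a" where
  "gh g s b = Lf (\<lambda>x c. g [\<pi>p x, c, b]) (rel s)"

definition fm :: "(('v, 'e) qpath \<Rightarrow> 'a) \<Rightarrow> ('v, 'e) qpath \<Rightarrow> 'a \<Rightarrow> 'a" where
  "fm f s b = f s * b"

lemma F2_eval_oneA:
  assumes "\<And>b c. g [oneA, b, c] = 0" and "y \<in> chains S"
  shows "eval_bar g (tensor_right (Fm 2 y) [oneA]) = Lf (gh g) y"
  using F2_eval[of g "[oneA]" y] assms by (simp add: gh_def[abs_def] del: Fm.simps)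

definition d3 :: "('v, 'e) qpath \<Rightarrow> ('v, 'e, 'k, 'a) pchain" where
  "d3 w = delta 3 w - rho 1 (partial_Suc 1 (delta 3 w))"

lemma partial_3_base: "partial_Suc 2 (base (oneA, w, oneA)) = d3 w"
  using P_rec[of 1] by (simp add: d3_def numeral_2_eq_2 numeral_3_eq_3 del: One_nat_def)

lemma delta_3: "delta 3 w = splitR 2 w - splitL 2 w"
  by (simp add: delta_def)

lemma delta_3_chains: "delta 3 w \<in> chains S"
  unfolding delta_3 using right_occ_chains[of 2 w] left_occ_chains[of 2 w]
  by (intro fs.subspace_diff[OF subspace_chains]) (simp_all only: amb_2)

lemma d3_chains: "d3 w \<in> chains S"
  unfolding d3_def by (intro fs.subspace_diff[OF subspace_chains] delta_3_chains rho_1_chains)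

lemma partial_2_chains: "y \<in> chains S \<Longrightarrow> partial_Suc 1 y \<in> chains (amb 1)"
  unfolding partial_2
  by (rule bimod_ext_chains) (auto intro!: fs.subspace_diff[OF subspace_chains] split_1_chains hh_chains
      simp del: amb.simps One_nat_def)

lemma Lf_d3:
  assumes m: "relm m"
  shows "Lf m (d3 w) = Lf m (delta 3 w) - Lf (tau m) (partial_Suc 1 (delta 3 w))"
  unfolding d3_def Lf_diff Lf_rho_1[OF m partial_2_chains[OF delta_3_chains]] ..

lemma eval_P_eq: "eval_P f y = Lf (fm f) y"
  unfolding eval_P_def Lf_def fm_def by (simp add: case_prod_unfold mult.assoc)

lemma unary_bracket_eq: "unary_bracket 2 f w = (if w \<in> amb 3 then Lf (fm f) (d3 w) else 0)"
  by (simp add: unary_bracket_def eval_P_eq partial_3_base numeral_3_eq_3 numeral_2_eq_2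
      del: amb.simps One_nat_def) (simp add: partial_3_base[unfolded numeral_2_eq_2] numeral_2_eq_2)

lemma Fup_eq:
  assumes one: "\<And>b c. g [oneA, b, c] = 0"
  shows "Fup 3 g w = (if w \<in> amb 3 then - Lf (gh g) (d3 w) else 0)"
proof -
  have "Fm 3 (base (oneA, w, oneA)) = - tensor_right (Fm 2 (d3 w)) [oneA]"
    using partial_3_base[of w] by (simp add: numeral_3_eq_3 numeral_2_eq_2)
  then have "eval_bar g (Fm 3 (base (oneA, w, oneA))) = - eval_bar g (tensor_right (Fm 2 (d3 w)) [oneA])"
    by (simp add: module_hom.neg[OF eval_bar_hom])
  also have "\<dots> = - Lf (gh g) (d3 w)"
    unfolding F2_eval_oneA[of g, OF one d3_chains] ..
  finally show ?thesis
    by (simp add: Fup_def)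
qed

lemma Gm_1: "Gm 1 (base [a0, a1, a2]) = lact a0 (ract (sp a1) a2)"
proof -
  have bd: "bar_d [a0, a1, oneA] = base [a0 * a1, oneA] - base [a0, a1]"
    by (simp add: bar_d_def numeral_2_eq_2 single_neg)
  have "Gm 0 (bar_d [a0, a1, oneA]) = emb0 (a0 * a1) oneA - emb0 a0 a1"
    by (simp add: bd fs.lin_ext_diff)
  then have "rho 0 (Gm 0 (bar_d [a0, a1, oneA])) = lact a0 (sp a1)"
    using sp_oneA by (simp add: rho_0 module_hom.diff[OF gamma_hom] gamma_0_emb0 sp_def module_hom.zero[OF lact_hom])
  then have "Gm 1 (base [a0, a1, a2]) = ract (lact a0 (sp a1)) a2"
    by simp
  also have "\<dots> = lact a0 (ract (sp a1) a2)"
  proof (rule hom_base_eqI[OF hom_comp[OF lact_hom ract_hom] hom_comp[OF ract_hom lact_hom]])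
    fix t :: "'a \<times> ('v, 'e) qpath \<times> 'a"
    show "ract (lact a0 (base t)) a2 = lact a0 (ract (base t) a2)"
      by (cases t) simp
  qed
  finally show ?thesis .
qed

lemma Gm_hom: "module_hom fscale fscale (Gm n)"
  by (cases n) (simp_all add: fs.lin_ext_hom)

lemma Gm_2: "Gm 2 (base [oneA, a, b, oneA]) = rho 1 (lact a (sp b) - sp (a * b) + ract (sp a) b)"
proof -
  have bd: "bar_d [oneA, a, b, oneA] = base [a, b, oneA] - base [oneA, a * b, oneA] + base [oneA, a, b]"
    by (simp add: bar_d_def numeral_2_eq_2 numeral_3_eq_3 single_neg)
  have "Gm 1 (bar_d [oneA, a, b, oneA]) = lact a (sp b) - sp (a * b) + ract (sp a) b"
    unfolding bd module_hom.add[OF Gm_hom] module_hom.diff[OF Gm_hom] Gm_1 by simp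
  then show ?thesis
    by (simp add: numeral_2_eq_2)
qed

lemma Gm_2_chains: "Gm 2 (base [oneA, a, b, oneA]) \<in> chains S"
  unfolding Gm_2 by (rule rho_1_chains)

lemma Lf_Gm_2:
  assumes m: "relm m"
  shows "Lf m (Gm 2 (base [oneA, a, b, oneA])) = Lf (\<lambda>x c. tau m x (c * b)) (sp a)"
proof -
  have 0: "Lf (tau m) (sp c) = 0" for c
    by (rule Lf_sp_zero(2)) (use tau_irr[OF m] in blast)
  have "lact a (sp b) - sp (a * b) + ract (sp a) b \<in> chains (amb 1)"
    by (intro fs.subspace_add[OF subspace_chains] fs.subspace_diff[OF subspace_chains] lact_chains ract_chains sp_chains)
  then show ?thesis
    unfolding Gm_2 by (subst Lf_rho_1[OF m]) (simp_all add: Lf_add Lf_diff Lf_lact Lf_ract 0)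
qed

lemma Gup_eq:
  assumes "relm (fm f)"
  shows "Gup 2 f [a, b] = Lf (\<lambda>x c. tau (fm f) x (c * b)) (sp a)"
  using Lf_Gm_2[OF assms, of a b] by (simp add: Gup_def eval_P_eq)

lemma hup_eq:
  assumes one: "\<And>b c. g [oneA, b, c] = 0" and m: "relm (gh g)"
  shows "hup 2 g [a, b] = Lf (\<lambda>x c. g [\<pi>p x, c, b] - tau (gh g) x (c * b)) (sp a)"
proof -
  have H: "Hm 2 (base [oneA, a, b, oneA]) = tensor_right (Fm 1 (Gm 1 (base [oneA, a, oneA]))) [b, oneA]
      - tensor_right (Fm 2 (Gm 2 (base [oneA, a, b, oneA]))) [oneA]"
    unfolding Hm_def by (simp add: numeral_2_eq_2 numeral_3_eq_3 del: Fm.simps Gm.simps)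
  have "eval_bar g (Hm 2 (base [oneA, a, b, oneA])) =
      Lf (\<lambda>x c. g [\<pi>p x, c, b]) (sp a) - Lf (gh g) (Gm 2 (base [oneA, a, b, oneA]))"
    unfolding H module_hom.diff[OF eval_bar_hom] F2_eval_oneA[of g, OF one Gm_2_chains]
    by (subst F1_eval) (simp_all add: one Gm_1 gh_def[abs_def] del: Fm.simps Gm.simps One_nat_def)
  then show ?thesis
    unfolding Lf_Gm_2[OF m] by (simp add: hup_def Lf_fun_diff)
qed

lemma Lf_rel_ev:
  assumes s: "s \<in> S" and v: "v \<in> verts G" and z: "\<And>x. x \<in> amb 1 \<Longrightarrow> m x 0 = 0"
  shows "Lf (\<lambda>x c. m x (c * ev v)) (rel s) = (if v = tgt G s then Lf m (rel s) else 0)"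
proof -
  have "Lf (\<lambda>x c. m x (c * ev v)) (fox s) =
      lin_ext sA (\<lambda>u. if v = tgt G s then Lf m (split 1 u) else 0) (\<phi> s)"
    unfolding fox_def Lf_free_ext
  proof (rule A.lin_ext_cong)
    fix u assume u: "u \<in> keys (\<phi> s)"
    show "Lf (\<lambda>x c. m x (c * ev v)) (split 1 u) = (if v = tgt G s then Lf m (split 1 u) else 0)"
      using Lf_split_1_ev[OF phi_paths[OF s u] v, of m, OF z] phi_tgt[OF s u] by simp
  qed
  also have "\<dots> = (if v = tgt G s then Lf m (fox s) else 0)"
    by (simp add: fox_def Lf_free_ext)
  finally show ?thesis
    unfolding rel_def Lf_diff using Lf_split_1_ev[OF S_paths[OF s] v, of m, OF z] by simp
qed

lemma relm_Lf_rel: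
  assumes hom: "\<And>x c. x \<in> amb 1 \<Longrightarrow> module_hom sA sA (M x c)"
    and z: "\<And>x b. x \<in> amb 1 \<Longrightarrow> M x 0 b = 0"
    and bal: "\<And>x c b v. x \<in> amb 1 \<Longrightarrow> v \<in> verts G \<Longrightarrow> M x c (ev v * b) = M x (c * ev v) b"
  shows "relm (\<lambda>s b. Lf (\<lambda>x c. M x c b) (rel s))"
  unfolding relm_def
proof (intro ballI conjI allI)
  fix s b v assume s: "s \<in> S"
  show "module_hom sA sA (\<lambda>b. Lf (\<lambda>x c. M x c b) (rel s))"
    by (rule Lf_param_hom[OF rel_chains hom])
  show "ev (src s) * Lf (\<lambda>x c. M x c b) (rel s) = Lf (\<lambda>x c. M x c b) (rel s)"
    using Lf_lact[of "\<lambda>x c. M x c b" "ev (src s)" "rel s"] by (simp add: lact_ev_rel[OF s])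
  assume v: "v \<in> verts G"
  have "Lf (\<lambda>x c. M x c (ev v * b)) (rel s) = Lf (\<lambda>x c. M x (c * ev v) b) (rel s)"
    by (rule Lf_cong_chains[OF rel_chains]) (rule bal[OF _ v])
  then show "Lf (\<lambda>x c. M x c (ev v * b)) (rel s) = (if v = tgt G s then Lf (\<lambda>x c. M x c b) (rel s) else 0)"
    using Lf_rel_ev[OF s v, of "\<lambda>x c. M x c b", OF z] by simp
qed

lemma rel2_Lf_sp:
  assumes hom: "\<And>x c. x \<in> amb 1 \<Longrightarrow> module_hom sA sA (M x c)"
    and z: "\<And>x b. x \<in> amb 1 \<Longrightarrow> M x 0 b = 0"
    and bal: "\<And>x c b v. x \<in> amb 1 \<Longrightarrow> v \<in> verts G \<Longrightarrow> M x c (ev v * b) = M x (c * ev v) b"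
    and right: "\<And>x c b v. x \<in> amb 1 \<Longrightarrow> v \<in> verts G \<Longrightarrow> M x c (b * ev v) = M x c b * ev v"
    and f: "\<And>a b. f [a, b] = Lf (\<lambda>x c. M x c b) (sp a)"
  shows "rel2 f"
  unfolding rel2_def f
proof (intro conjI allI ballI)
  fix a b v
  show "module_hom sA sA (\<lambda>a. Lf (\<lambda>x c. M x c b) (sp a))"
    by (rule hom_comp[OF sp_hom Lf_hom])
  show "module_hom sA sA (\<lambda>b. Lf (\<lambda>x c. M x c b) (sp a))"
    by (rule Lf_param_hom[OF sp_chains hom])
  show "Lf (\<lambda>x c. M x c b) (sp oneA) = 0"
    by (simp add: sp_oneA Lf_zero)
  assume v: "v \<in> verts G"
  have "Lf (\<lambda>x c. M x c b) (sp (a * ev v)) = lin_ext sA (\<lambda>u. if tgt G u = v then Lf (\<lambda>x c. M x c b) (split 1 u) else 0) (\<sigma> a)"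
    unfolding Lf_sp by (rule lin_ext_sigma_ev_right[OF A.module_axioms v])
  also have "\<dots> = lin_ext sA (\<lambda>u. Lf (\<lambda>x c. M x (c * ev v) b) (split 1 u)) (\<sigma> a)"
  proof (rule A.lin_ext_cong)
    fix u assume "u \<in> keys (\<sigma> a)"
    then have u: "u \<in> paths G"
      by (rule irr_paths[OF sigma_irr])
    show "(if tgt G u = v then Lf (\<lambda>x c. M x c b) (split 1 u) else 0) = Lf (\<lambda>x c. M x (c * ev v) b) (split 1 u)"
      using Lf_split_1_ev[OF u v, of "\<lambda>x c. M x c b", OF z] by auto
  qed
  also have "\<dots> = Lf (\<lambda>x c. M x c (ev v * b)) (sp a)"
    unfolding Lf_sp[symmetric] by (rule Lf_cong_chains[OF sp_chains]) (simp add: bal[OF _ v])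
  finally show "Lf (\<lambda>x c. M x c b) (sp (a * ev v)) = Lf (\<lambda>x c. M x c (ev v * b)) (sp a)" .
  have "Lf (\<lambda>x c. M x c (b * ev v)) (sp a) = Lf (\<lambda>x c. M x c b * ev v) (sp a)"
    by (rule Lf_cong_chains[OF sp_chains]) (rule right[OF _ v])
  then show "Lf (\<lambda>x c. M x c (b * ev v)) (sp a) = Lf (\<lambda>x c. M x c b) (sp a) * ev v"
    by (simp add: Lf_mult_right)
qed

lemma rel3D:
  assumes "rel3 g"
  shows "module_hom sA sA (\<lambda>a. g [a, b, c])" "module_hom sA sA (\<lambda>b. g [a, b, c])" "module_hom sA sA (\<lambda>c. g [a, b, c])"
    "v \<in> verts G \<Longrightarrow> g [a, b * ev v, c] = g [a, b, ev v * c]"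
    "v \<in> verts G \<Longrightarrow> g [a, b, c * ev v] = g [a, b, c] * ev v"
    "g [oneA, b, c] = 0"
  using assms by (auto simp: rel3_def)

lemma rel2D:
  assumes "rel2 f"
  shows "module_hom sA sA (\<lambda>a. f [a, b])" "module_hom sA sA (\<lambda>b. f [a, b])"
    "v \<in> verts G \<Longrightarrow> f [a * ev v, b] = f [a, ev v * b]"
    "v \<in> verts G \<Longrightarrow> f [a, b * ev v] = f [a, b] * ev v"
    "f [oneA, b] = 0"
  using assms by (auto simp: rel2_def)

lemma relm_gh:
  assumes g: "rel3 g"
  shows "relm (gh g)"
  unfolding gh_def[abs_def]
  by (rule relm_Lf_rel[where M = "\<lambda>x c b. g [\<pi>p x, c, b]"])
    (rule rel3D(3)[OF g], rule module_hom.zero[OF rel3D(2)[OF g]], rule rel3D(4)[OF g, symmetric])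

lemma gh_right:
  assumes g: "rel3 g" and v: "v \<in> verts G"
  shows "gh g s (b * ev v) = gh g s b * ev v"
  unfolding gh_def rel3D(5)[OF g v] Lf_mult_right ..

lemma PnD:
  assumes "f \<in> Pn 2" "s \<in> S"
  shows "f s = ev (src s) * f s * ev (tgt G s)"
  using assms unfolding Pn_def amb_2 by blast

lemma relm_fm:
  assumes f: "f \<in> Pn 2"
  shows "relm (fm f)"
  unfolding relm_def fm_def
proof (intro ballI conjI allI)
  fix s b v assume s: "s \<in> S"
  note fs = PnD[OF f s]
  note vs = src_in_verts[OF S_paths[OF s]] tgt_in_verts[OF S_paths[OF s]]
  show "module_hom sA sA ((*) (f s))"
    by (rule mult_hom_right)
  have 1: "ev (src s) * f s = f s"
    by (subst fs, subst (2) fs) (simp add: mult.assoc[symmetric] ev_ev vs)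
  then show "ev (src s) * (f s * b) = f s * b"
    by (simp only: mult.assoc[symmetric])
  assume v: "v \<in> verts G"
  have "f s * ev v = ev (src s) * f s * (ev (tgt G s) * ev v)"
    by (subst fs) (simp only: mult.assoc)
  also have "\<dots> = (if v = tgt G s then f s else 0)"
    using fs by (simp add: ev_ev vs v)
  finally show "f s * (ev v * b) = (if v = tgt G s then f s * b else 0)"
    by (simp add: mult.assoc[symmetric])
qed

lemma fm_right: "fm f s (b * ev v) = fm f s b * ev v"
  by (simp add: fm_def mult.assoc)

lemma rel2_Gup:
  assumes f: "f \<in> Pn 2"
  shows "rel2 (Gup 2 f)"
proof (rule rel2_Lf_sp[where M = "\<lambda>x c b. tau (fm f) x (c * b)"])
  note m = relm_fm[OF f]
  fix x c b v assume x: "x \<in> amb 1"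
  show "module_hom sA sA (\<lambda>b. tau (fm f) x (c * b))"
    by (rule hom_comp[OF mult_hom_right tau_hom[OF m x]])
  show "tau (fm f) x (0 * b) = 0"
    using module_hom.zero[OF tau_hom[OF m x]] by simp
  show "tau (fm f) x (c * (ev v * b)) = tau (fm f) x (c * ev v * b)"
    by (simp only: mult.assoc)
  assume "v \<in> verts G"
  then show "tau (fm f) x (c * (b * ev v)) = tau (fm f) x (c * b) * ev v"
    unfolding mult.assoc[symmetric] by (intro tau_ev_right[OF m fm_right _ x])
qed (rule Gup_eq[OF relm_fm[OF f]])

lemma rel2_hup:
  assumes g: "rel3 g"
  shows "rel2 (hup 2 g)"
proof (rule rel2_Lf_sp[where M = "\<lambda>x c b. g [\<pi>p x, c, b] - tau (gh g) x (c * b)"])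
  note m = relm_gh[OF g]
  fix x c b v assume x: "x \<in> amb 1"
  show "module_hom sA sA (\<lambda>b. g [\<pi>p x, c, b] - tau (gh g) x (c * b))"
    using module_hom.add[OF tau_hom[OF m x]] module_hom.scale[OF tau_hom[OF m x]]
      module_hom.add[OF rel3D(3)[OF g]] module_hom.scale[OF rel3D(3)[OF g]]
    by (intro A_homI)
      (simp_all add: distrib_left sA_mult_right A.scale_right_diff_distrib)
  show "g [\<pi>p x, 0, b] - tau (gh g) x (0 * b) = 0"
    using module_hom.zero[OF tau_hom[OF m x]] module_hom.zero[OF rel3D(2)[OF g]] by simp
  assume v: "v \<in> verts G"
  show "g [\<pi>p x, c, ev v * b] - tau (gh g) x (c * (ev v * b)) = g [\<pi>p x, c * ev v, b] - tau (gh g) x (c * ev v * b)"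
    by (simp only: mult.assoc rel3D(4)[OF g v])
  show "g [\<pi>p x, c, b * ev v] - tau (gh g) x (c * (b * ev v)) = (g [\<pi>p x, c, b] - tau (gh g) x (c * b)) * ev v"
    using tau_ev_right[OF m gh_right[OF g v] v x, of "c * b"] by (simp add: mult.assoc rel3D(5)[OF g v] left_diff_distrib)
qed (rule hup_eq[OF rel3D(6)[OF g] relm_gh[OF g]])

lemma brk_eq:
  "brk 0 0 f g [a, b, c] = - (f [g [a, b], c] - f [a, g [b, c]] + (g [f [a, b], c] - g [a, f [b, c]]))"
proof -
  have "gerst_circ 1 1 f g [a, b, c] = f [g [a, b], c] - f [a, g [b, c]]" for f g
    by (simp add: gerst_circ_def numeral_2_eq_2 atMost_Suc)
  then show ?thesis
    by (simp add: brk_def gerst_def)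
qed

lemma rel3_brk:
  assumes f: "rel2 f" and g: "rel2 g"
  shows "rel3 (brk 0 0 f g)"
proof -
  note add = module_hom.add[OF rel2D(1)[OF f]] module_hom.add[OF rel2D(2)[OF f]]
    module_hom.add[OF rel2D(1)[OF g]] module_hom.add[OF rel2D(2)[OF g]]
  note sc = module_hom.scale[OF rel2D(1)[OF f]] module_hom.scale[OF rel2D(2)[OF f]]
    module_hom.scale[OF rel2D(1)[OF g]] module_hom.scale[OF rel2D(2)[OF g]]
  show ?thesis
    unfolding rel3_def brk_eq
  proof (intro conjI allI ballI)
    fix a b c v
    show "module_hom sA sA (\<lambda>a. - (f [g [a, b], c] - f [a, g [b, c]] + (g [f [a, b], c] - g [a, f [b, c]])))"
      "module_hom sA sA (\<lambda>b. - (f [g [a, b], c] - f [a, g [b, c]] + (g [f [a, b], c] - g [a, f [b, c]])))"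
      "module_hom sA sA (\<lambda>c. - (f [g [a, b], c] - f [a, g [b, c]] + (g [f [a, b], c] - g [a, f [b, c]])))"
      by (intro A_homI;
          simp add: add sc A.scale_right_diff_distrib A.scale_right_distrib algebra_simps)+
    show "- (f [g [oneA, b], c] - f [oneA, g [b, c]] + (g [f [oneA, b], c] - g [oneA, f [b, c]])) = 0"
      unfolding rel2D(5)[OF f] rel2D(5)[OF g]
      using module_hom.zero[OF rel2D(1)[OF f]] module_hom.zero[OF rel2D(1)[OF g]] by simp
    assume v: "v \<in> verts G"
    note e = rel2D(3)[OF f v] rel2D(3)[OF g v] rel2D(4)[OF f v] rel2D(4)[OF g v]
    show "- (f [g [a, b * ev v], c] - f [a, g [b * ev v, c]] + (g [f [a, b * ev v], c] - g [a, f [b * ev v, c]])) =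
        - (f [g [a, b], ev v * c] - f [a, g [b, ev v * c]] + (g [f [a, b], ev v * c] - g [a, f [b, ev v * c]]))"
      by (simp only: e)
    show "- (f [g [a, b], c * ev v] - f [a, g [b, c * ev v]] + (g [f [a, b], c * ev v] - g [a, f [b, c * ev v]])) =
        - (f [g [a, b], c] - f [a, g [b, c]] + (g [f [a, b], c] - g [a, f [b, c]])) * ev v"
      by (simp only: e) (simp add: algebra_simps)
  qed
qed

text \<open>A product that agrees with concatenation on irreducible paths is determined by its values on
  the elements of \<open>S\<close>: \<open>\<psi>\<close> is recovered from the cochain \<open>f\<close> on \<open>S\<close> and from the Hochschild
  differential \<open>g\<close> of \<open>\<psi>\<close>. The functional \<open>1 \<otimes> x \<otimes> b \<mapsto> \<psi>(x, b)\<close> obeys the recursion which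
  characterises the homotopy, so that evaluating \<open>G\<close> and \<open>h\<close> amounts to evaluating \<open>\<psi>\<close>.\<close>

context
  fixes \<psi> g :: "'a list \<Rightarrow> 'a" and f :: "('v, 'e) qpath \<Rightarrow> 'a"
  assumes psi: "rel2 \<psi>"
    and left: "\<And>v a b. v \<in> verts G \<Longrightarrow> \<psi> [ev v * a, b] = ev v * \<psi> [a, b]"
    and irr0: "\<And>x u. x \<in> amb 1 \<Longrightarrow> u \<in> irr G S \<Longrightarrow> tgt G x = src u \<Longrightarrow> pcat x u \<in> irr G S \<Longrightarrow>
      \<psi> [\<pi>p x, \<pi>p u] = 0"
    and f: "f \<in> Pn 2" "\<And>s. s \<in> S \<Longrightarrow> f s = \<psi> [\<pi>p (arr G 0 s), \<pi>p (suf G 1 s)]"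
    and g: "rel3 g" "\<And>a b c. g [a, b, c] = a * \<psi> [b, c] - \<psi> [a * b, c] + \<psi> [a, b * c] - \<psi> [a, b] * c"
begin

lemmas psi_hom = rel2D(1,2)[OF psi]

lemma psi_ev_left: "v \<in> verts G \<Longrightarrow> \<psi> [ev v, b] = 0"
  using left[of v oneA b] rel2D(5)[OF psi, of b] by simp

lemma psi_zero: "\<psi> [0, b] = 0" "\<psi> [a, 0] = 0"
  using module_hom.zero[OF psi_hom(1)] module_hom.zero[OF psi_hom(2)] by auto

lemma telescope_split_1:
  assumes p: "p \<in> paths G"
  shows "Lf (\<lambda>x c. \<pi>p x * \<psi> [c, b] - \<psi> [\<pi>p x * c, b]) (split 1 p) = - \<psi> [\<pi>p p, b]"
proof -
  let ?h = "\<lambda>i. \<pi>p (pre i p) * \<psi> [\<pi>p (suf G i p), b]"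
  have "Lf (\<lambda>x c. \<pi>p x * \<psi> [c, b] - \<psi> [\<pi>p x * c, b]) (split 1 p) = (\<Sum>i<plen p. ?h (Suc i) - ?h i)"
    unfolding Lf_split_1[OF p]
  proof (rule sum.cong)
    fix i assume "i \<in> {..<plen p}"
    then have i: "i < plen p" by simp
    have "\<pi>p (pre i p) * \<pi>p (arr G i p) = \<pi>p (pre (Suc i) p)"
      by (subst pp_pcat) (use pre_suf_paths[OF p] arr_paths[OF p i] i in \<open>simp_all add: src_arr pcat_pre_arr\<close>)
    moreover have "\<pi>p (arr G i p) * \<pi>p (suf G (Suc i) p) = \<pi>p (suf G i p)"
      by (subst pp_pcat) (use pre_suf_paths[OF p] arr_paths[OF p i] i in \<open>simp_all add: tgt_arr pcat_arr_suf\<close>)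
    ultimately show "\<pi>p (pre i p) * (\<pi>p (arr G i p) * \<psi> [\<pi>p (suf G (Suc i) p), b] -
        \<psi> [\<pi>p (arr G i p) * \<pi>p (suf G (Suc i) p), b]) = ?h (Suc i) - ?h i"
      by (simp add: right_diff_distrib mult.assoc[symmetric])
  qed simp
  also have "\<dots> = ?h (plen p) - ?h 0"
    by (rule sum_lessThan_telescope)
  also have "\<dots> = - \<psi> [\<pi>p p, b]"
    using psi_ev_left[OF tgt_in_verts[OF p]] left[OF src_in_verts[OF p], of "\<pi>p p" b] ev_pp[OF src_in_verts[OF p] p]
    by simp
  finally show ?thesis .
qed

lemma telescope_sp: "Lf (\<lambda>x c. \<pi>p x * \<psi> [c, b] - \<psi> [\<pi>p x * c, b]) (sp a) = - \<psi> [a, b]"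
proof -
  have "lin_ext sA (\<lambda>u. Lf (\<lambda>x c. \<pi>p x * \<psi> [c, b] - \<psi> [\<pi>p x * c, b]) (split 1 u)) (\<sigma> a) =
      lin_ext sA (\<lambda>u. - \<psi> [\<pi>p u, b]) (\<sigma> a)"
    by (rule A.lin_ext_cong) (rule telescope_split_1[OF irr_paths[OF sigma_irr]])
  also have "\<dots> = - \<psi> [a, b]"
    using hom_expand[OF psi_hom(1), of a b] by (simp add: lin_ext_def sum_negf)
  finally show ?thesis
    by (simp add: Lf_sp)
qed

lemma telescope_rel:
  assumes s: "s \<in> S"
  shows "Lf (\<lambda>x c. \<pi>p x * \<psi> [c, b] - \<psi> [\<pi>p x * c, b]) (rel s) = 0"
proof -
  have "Lf (\<lambda>x c. \<pi>p x * \<psi> [c, b] - \<psi> [\<pi>p x * c, b]) (fox s) = lin_ext sA (\<lambda>u. - \<psi> [\<pi>p u, b]) (\<phi> s)"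
    unfolding fox_def Lf_free_ext by (rule A.lin_ext_cong) (rule telescope_split_1[OF phi_paths[OF s]])
  also have "\<dots> = - \<psi> [\<pi>p s, b]"
    using module_hom_lin_ext[OF psi_hom(1), of \<pi>p "\<phi> s" b, unfolded pi_phi[OF s]] by (simp add: lin_ext_def sum_negf)
  finally show ?thesis
    by (simp add: rel_def Lf_diff telescope_split_1[OF S_paths[OF s], unfolded One_nat_def])
qed

lemma psi_irr_zero:
  "x \<in> amb 1 \<Longrightarrow> u \<in> irr G S \<Longrightarrow> tgt G x \<noteq> src u \<or> pcat x u \<in> irr G S \<Longrightarrow> \<psi> [\<pi>p x, \<pi>p u] = 0"
proof -
  assume a: "x \<in> amb 1" "u \<in> irr G S" "tgt G x \<noteq> src u \<or> pcat x u \<in> irr G S"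
  have x: "x \<in> paths G"
    using a(1) unfolding amb_1 by simp
  show ?thesis
  proof (cases "tgt G x = src u")
    case False
    have "\<psi> [\<pi>p x, \<pi>p u] = \<psi> [\<pi>p x * ev (tgt G x), \<pi>p u]"
      using pp_ev[OF tgt_in_verts[OF x] x] by simp
    also have "\<dots> = \<psi> [\<pi>p x, ev (tgt G x) * \<pi>p u]"
      by (rule rel2D(3)[OF psi tgt_in_verts[OF x]])
    also have "\<dots> = 0"
      using ev_pp[OF tgt_in_verts[OF x] irr_paths[OF a(2)]] False psi_zero by simp
    finally show ?thesis .
  qed (use irr0 a in auto)
qed

lemma split_1_head:
  assumes s: "s \<in> S" and tail: "\<And>i. 0 < i \<Longrightarrow> i < plen s \<Longrightarrow> m (arr G i s) (\<pi>p (suf G (Suc i) s)) = 0"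
  shows "Lf m (split 1 s) = ev (src s) * m (arr G 0 s) (\<pi>p (suf G 1 s))"
proof -
  have l: "{..<plen s} = insert 0 {0<..<plen s}"
    using S_len[OF s] by auto
  have "(\<Sum>i\<in>{0<..<plen s}. \<pi>p (pre i s) * m (arr G i s) (\<pi>p (suf G (Suc i) s))) = 0"
    by (rule sum.neutral) (simp add: tail)
  then show ?thesis
    unfolding Lf_split_1[OF S_paths[OF s]] l by simp
qed

abbreviation "H \<equiv> \<lambda>s b. Lf (\<lambda>x c. \<psi> [\<pi>p x, c * b]) (rel s)"

lemma relm_H: "relm H"
proof (rule relm_Lf_rel[where M = "\<lambda>x c b. \<psi> [\<pi>p x, c * b]"])
  show "module_hom sA sA (\<lambda>b. \<psi> [\<pi>p x, c * b])" for x c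
    by (rule hom_comp[OF mult_hom_right psi_hom(2)])
  show "\<psi> [\<pi>p x, 0 * b] = 0" for x b
    by (simp add: psi_zero)
  show "\<psi> [\<pi>p x, c * (ev v * b)] = \<psi> [\<pi>p x, c * ev v * b]" for x c b v
    by (simp only: mult.assoc)
qed

lemma tau_H:
  assumes x: "x \<in> amb 1"
  shows "tau H x b = \<psi> [\<pi>p x, b]"
proof (rule tau_unique[OF relm_H, where \<theta> = "\<lambda>x b. \<psi> [\<pi>p x, b]", OF psi_hom(2) psi_irr_zero _ x, symmetric])
  fix x u s r assume a: "x \<in> amb 1" "u \<in> irr G S" "tgt G x = src u" "(triv (src x), s, r) \<in> occs G S (pcat x u)"
  note d = occsD[OF a(4)]
  have x: "x \<in> paths G" "plen x = 1"
    using a(1) unfolding amb_1 by auto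
  have sr: "pcat x u = pcat s r"
    using d(5,7) by (simp add: pcat_triv_left[THEN iffD2])
  obtain e where e: "snd x = [e]"
    using x(2) by (auto simp: length_Suc_conv)
  have ne: "plen s \<ge> 2"
    by (rule S_len[OF d(4)])
  have su: "e # snd u = snd s @ snd r"
    using arg_cong[OF sr, of snd] e by simp
  have hd: "snd s ! 0 = e" "snd u = drop 1 (snd s) @ snd r"
    using su ne by (cases "snd s", auto)+
  have ax: "arr G 0 s = x"
    using hd(1) d(5) e by (simp add: arr_def prod_eq_iff)
  have comp: "tgt G (suf G i s) = src r" for i
    using d(6) by simp
  have sufr: "\<pi>p (suf G i s) * \<pi>p r = \<pi>p (pcat (suf G i s) r)" for i
    by (rule pp_pcat[OF pre_suf_paths(2)[OF S_paths[OF d(4)]] d(3) comp])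
  have u1: "pcat (suf G 1 s) r = u"
  proof (rule prod_eqI)
    have "0 < plen s" using ne by linarith
    from tgt_arr[OF this, of G, unfolded ax] show "src (pcat (suf G 1 s) r) = src u"
      using a(3) by simp
    show "snd (pcat (suf G 1 s) r) = snd u"
      using hd(2) by (simp add: suf_def)
  qed
  have irr: "pcat (suf G i s) r \<in> irr G S" if i: "0 < i" for i
  proof -
    have p: "suf G 1 s \<in> paths G" "pre (i - 1) (suf G 1 s) \<in> paths G" "suf G i s \<in> paths G"
      using pre_suf_paths S_paths[OF d(4)] by simp_all
    have si: "suf G (i - 1) (suf G 1 s) = suf G i s"
      using i by (simp add: suf_suf)
    have "pcat (pre (i - 1) (suf G 1 s)) (pcat (suf G i s) r) = u"
      using pcat_pre_suf[of "i - 1" "suf G 1 s" G] u1 unfolding si by (simp add: pcat_assoc[symmetric])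
    then have u: "pcat (pre (i - 1) (suf G 1 s)) (pcat (suf G i s) r) \<in> irr G S"
      using a(2) by (simp only:)
    have c: "tgt G (pre (i - 1) (suf G 1 s)) = src (pcat (suf G i s) r)"
      unfolding si[symmetric] src_pcat by (rule src_suf[symmetric])
    show ?thesis
      by (rule irr_pcat_right[OF u p(2) pcat_in_paths[OF p(3) d(3) comp] c])
  qed
  have "Lf (\<lambda>x c. \<psi> [\<pi>p x, c * \<pi>p r]) (split 1 s) = ev (src s) * \<psi> [\<pi>p (arr G 0 s), \<pi>p (suf G 1 s) * \<pi>p r]"
  proof (rule split_1_head[OF d(4)])
    fix i assume i: "0 < i" "i < plen s"
    have "pcat (arr G i s) (pcat (suf G (Suc i) s) r) = pcat (suf G i s) r"
      by (simp only: pcat_assoc[symmetric] pcat_arr_suf[OF i(2)])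
    then show "\<psi> [\<pi>p (arr G i s), \<pi>p (suf G (Suc i) s) * \<pi>p r] = 0"
      unfolding sufr by (intro psi_irr_zero arr_amb S_paths d(4) i irr) (simp_all add: irr i)
  qed
  also have "\<dots> = \<psi> [\<pi>p x, \<pi>p u]"
    unfolding sufr u1 ax left[OF src_in_verts[OF S_paths[OF d(4)]], symmetric]
    using ev_pp[OF src_in_verts[OF x(1)] x(1)] d(5) by simp
  finally show "\<psi> [\<pi>p x, \<pi>p u] = H s (\<pi>p r) + Lf (\<lambda>w b. \<psi> [\<pi>p w, b * \<pi>p r]) (fox s)"
    by (simp add: rel_def Lf_diff)
qed

lemma psi_sub_zero: "Lf (\<lambda>x c. \<psi> [\<pi>p x, c] * b) (sp a) = 0" "u \<in> irr G S \<Longrightarrow> Lf (\<lambda>x c. \<psi> [\<pi>p x, c]) (split 1 u) = 0"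
  using Lf_sp_zero[of "\<lambda>x c. \<psi> [\<pi>p x, c]"] irr0 by (simp_all only: Lf_mult_right mult_zero_left)

lemma psi_rel:
  assumes s: "s \<in> S"
  shows "Lf (\<lambda>x c. \<psi> [\<pi>p x, c]) (rel s) = f s"
proof -
  have 1: "Lf (\<lambda>x c. \<psi> [\<pi>p x, c]) (split 1 s) = ev (src s) * \<psi> [\<pi>p (arr G 0 s), \<pi>p (suf G 1 s)]"
  proof (rule split_1_head[OF s])
    fix i assume i: "0 < i" "i < plen s"
    show "\<psi> [\<pi>p (arr G i s), \<pi>p (suf G (Suc i) s)] = 0"
      by (rule psi_irr_zero)
        (use i s arr_amb[OF S_paths[OF s] i(2)] in \<open>simp_all add: S_suf_irr pcat_arr_suf\<close>)
  qed
  have "ev (src s) * f s = f s"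
    using relmD(2)[OF relm_fm[OF f(1)] s, of oneA] by (simp add: fm_def)
  then have "ev (src s) * \<psi> [\<pi>p (arr G 0 s), \<pi>p (suf G 1 s)] = f s"
    using f(2)[OF s] by simp
  moreover have "Lf (\<lambda>x c. \<psi> [\<pi>p x, c]) (fox s) = lin_ext sA (\<lambda>u. 0) (\<phi> s)"
    unfolding fox_def Lf_free_ext by (rule A.lin_ext_cong) (simp only: psi_sub_zero(2) phi_irr[OF s])
  ultimately show ?thesis
    using 1 by (simp add: rel_def Lf_diff)
qed

lemma gh_eq:
  assumes s: "s \<in> S"
  shows "gh g s b = H s b - fm f s b"
proof -
  have "gh g s b = Lf (\<lambda>x c. (\<pi>p x * \<psi> [c, b] - \<psi> [\<pi>p x * c, b]) + (\<psi> [\<pi>p x, c * b] - \<psi> [\<pi>p x, c] * b)) (rel s)"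
    unfolding gh_def g(2) by (simp only: add_diff_eq)
  then show ?thesis
    unfolding Lf_fun_add Lf_fun_diff[of "\<lambda>x c. \<psi> [\<pi>p x, c * b]"] telescope_rel[OF s] Lf_mult_right psi_rel[OF s] fm_def
    by simp
qed

lemma tau_gh: "x \<in> amb 1 \<Longrightarrow> tau (gh g) x b = \<psi> [\<pi>p x, b] - tau (fm f) x b"
proof -
  assume x: "x \<in> amb 1"
  have "tau (gh g) x b = tau (\<lambda>s b. H s b - fm f s b) x b"
    by (rule tau_cong) (rule gh_eq)
  then show ?thesis
    unfolding tau_diff tau_H[OF x] .
qed

text \<open>As \<open>\<tau>\<close> turns the pullback of \<open>g\<close> into \<open>\<psi>\<close> minus the terms of \<open>G(f)\<close>, what remains telescopes along the
  arrows of a path.\<close>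

lemma hup_differential: "hup 2 g [a, b] = Gup 2 f [a, b] - \<psi> [a, b]"
proof -
  have "hup 2 g [a, b] = Lf (\<lambda>x c. (\<pi>p x * \<psi> [c, b] - \<psi> [\<pi>p x * c, b]) + (tau (fm f) x (c * b) - \<psi> [\<pi>p x, c] * b)) (sp a)"
    unfolding hup_eq[OF rel3D(6)[OF g(1)] relm_gh[OF g(1)]] g(2)
    by (rule Lf_cong_chains[OF sp_chains]) (simp only: tau_gh, simp)
  then show ?thesis
    unfolding Lf_fun_add telescope_sp Lf_fun_diff[of "\<lambda>x c. tau (fm f) x (c * b)"] psi_sub_zero(1)
      Gup_eq[OF relm_fm[OF f(1)]] by simp
qed

text \<open>The pullback of \<open>g\<close> is \<open>L \<circ> \<partial>\<^sub>2 - f\<close> for \<open>L(1 \<otimes> x \<otimes> b) = \<psi>(x, b)\<close>, and \<open>L \<circ> \<partial>\<^sub>2 \<circ> \<partial>\<^sub>3 = 0\<close> because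
  \<open>L \<circ> \<partial>\<^sub>2 \<circ> \<rho>\<^sub>1 = L\<close>.\<close>

lemma Fup_differential: "Fup 3 g w = unary_bracket 2 f w"
proof -
  have "Lf H (d3 w) = Lf H (delta 3 w) - Lf (tau H) (partial_Suc 1 (delta 3 w))"
    by (rule Lf_d3[OF relm_H])
  also have "Lf (tau H) (partial_Suc 1 (delta 3 w)) = Lf (\<lambda>x b. \<psi> [\<pi>p x, b]) (partial_Suc 1 (delta 3 w))"
    by (rule Lf_cong_chains[OF partial_2_chains[OF delta_3_chains]]) (rule tau_H)
  also have "\<dots> = Lf H (delta 3 w)"
    by (rule Lf_partial_2[OF delta_3_chains])
  finally have H: "Lf H (d3 w) = 0"
    by simp
  have "Lf (gh g) (d3 w) = Lf (\<lambda>s b. H s b - fm f s b) (d3 w)"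
    by (rule Lf_cong_chains[OF d3_chains]) (rule gh_eq)
  then have "Lf (gh g) (d3 w) = - Lf (fm f) (d3 w)"
    unfolding Lf_fun_diff H by simp
  then show ?thesis
    unfolding Fup_eq[of g, OF rel3D(6)[OF g(1)]] unary_bracket_eq by simp
qed

end

lemma delta_3_ends:
  shows "lact (ev (src w)) (delta 3 w) = delta 3 w" "ract (delta 3 w) (ev (tgt G w)) = delta 3 w"
proof -
  have *: "ev (src w) * \<pi>p q = \<pi>p q" "\<pi>p r * ev (tgt G w) = \<pi>p r" if "(q, s, r) \<in> occs G T w" for q s r T
  proof -
    note d = occsD[OF that]
    have "src w = src q" "tgt G w = tgt G r"
      unfolding d(7) using d(5,6) by (simp_all add: tgt_pcat)
    then show "ev (src w) * \<pi>p q = \<pi>p q" "\<pi>p r * ev (tgt G w) = \<pi>p r"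
      using ev_pp[OF src_in_verts[OF d(1)] d(1)] pp_ev[OF tgt_in_verts[OF d(3)] d(3)] by simp_all
  qed
  show "lact (ev (src w)) (delta 3 w) = delta 3 w" "ract (delta 3 w) (ev (tgt G w)) = delta 3 w"
    unfolding delta_3 splitR_def splitL_def module_hom.diff[OF lact_hom] module_hom.diff[OF ract_hom]
      module_hom.sum[OF lact_hom] module_hom.sum[OF ract_hom]
    by (intro arg_cong2[where f = "(-)"] sum.cong refl;
        auto simp: right_occ_def left_occ_def * split: prod.splits)+
qed

lemma bimod_ext_ract: "bimod_ext h (ract y c) = ract (bimod_ext h y) c"
proof (rule hom_base_eqI[OF hom_comp[OF ract_hom bimod_ext_hom] hom_comp[OF bimod_ext_hom ract_hom]])
  fix t :: "'a \<times> ('v, 'e) qpath \<times> 'a"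
  obtain a w b where t: "t = (a, w, b)" by (cases t) auto
  have 1: "ract (ract y b) c = ract y (b * c)" for y :: "('v, 'e, 'k, 'a) pchain" and b
  proof (rule hom_base_eqI[OF hom_comp[OF ract_hom ract_hom] ract_hom])
    fix t :: "'a \<times> ('v, 'e) qpath \<times> 'a"
    show "ract (ract (base t) b) c = ract (base t) (b * c)"
      by (cases t) (simp add: mult.assoc)
  qed
  have 2: "ract (lact a y) c = lact a (ract y c)" for y :: "('v, 'e, 'k, 'a) pchain"
  proof (rule hom_base_eqI[OF hom_comp[OF lact_hom ract_hom] hom_comp[OF ract_hom lact_hom]])
    fix t :: "'a \<times> ('v, 'e) qpath \<times> 'a"
    show "ract (lact a (base t)) c = lact a (ract (base t) c)"
      by (cases t) simp
  qed
  show "bimod_ext h (ract (base t) c) = ract (bimod_ext h (base t)) c"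
    by (simp add: t 1 2)
qed

lemma Lf_ends:
  assumes y: "y \<in> chains W" "lact (ev v) y = y" "ract y (ev v') = y"
    and m: "\<And>s b. s \<in> W \<Longrightarrow> m s (b * ev v') = m s b * ev v'"
  shows "ev v * Lf m y * ev v' = Lf m y"
proof -
  have "Lf m y = Lf m (lact (ev v) (ract y (ev v')))"
    by (simp add: y)
  also have "\<dots> = ev v * Lf (\<lambda>s b. m s (b * ev v')) y"
    by (simp add: Lf_lact Lf_ract)
  also have "Lf (\<lambda>s b. m s (b * ev v')) y = Lf (\<lambda>s b. m s b * ev v') y"
    by (rule Lf_cong_chains[OF y(1) m])
  finally have "Lf m y = ev v * (Lf m y * ev v')"
    unfolding Lf_mult_right .
  then show ?thesis
    unfolding mult.assoc by (rule sym)
qed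

lemma Lf_d3_ends:
  assumes m: "relm m" and r: "\<And>s b v. v \<in> verts G \<Longrightarrow> m s (b * ev v) = m s b * ev v"
  shows "ev (src w) * Lf m (d3 w) * ev (tgt G w) = Lf m (d3 w)"
proof (cases "delta 3 w = 0")
  case True
  then have "Lf m (d3 w) = 0"
    unfolding Lf_d3[OF m] True partial_2 module_hom.zero[OF bimod_ext_hom] by (simp add: Lf_zero)
  then show ?thesis by simp
next
  case False
  have v: "tgt G w \<in> verts G"
  proof (rule ccontr)
    assume n: "tgt G w \<notin> verts G"
    have "occs G T w = {}" for T
    proof (rule ccontr)
      assume "occs G T w \<noteq> {}"
      then obtain c where "c \<in> occs G T w" by auto
      moreover obtain q s r where "c = (q, s, r)" by (cases c) auto
      ultimately have "w \<in> paths G"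
        using occs_paths by auto
      then show False using n tgt_in_verts by blast
    qed
    then have "delta 3 w = 0"
      unfolding delta_3 splitR_def splitL_def right_occ_def left_occ_def by simp
    then show False using False by simp
  qed
  let ?y = "partial_Suc 1 (delta 3 w)"
  have "ev (src w) * Lf m (delta 3 w) * ev (tgt G w) = Lf m (delta 3 w)"
    by (rule Lf_ends[where m = m and W = S, OF delta_3_chains delta_3_ends]) (rule r[OF v])
  moreover have "ev (src w) * Lf (tau m) ?y * ev (tgt G w) = Lf (tau m) ?y"
  proof (rule Lf_ends[where m = "tau m" and W = "amb 1", OF partial_2_chains[OF delta_3_chains]])
    show "lact (ev (src w)) ?y = ?y"
      unfolding partial_2 bimod_ext_lact[symmetric] delta_3_ends ..
    show "ract ?y (ev (tgt G w)) = ?y"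
      unfolding partial_2 bimod_ext_ract[symmetric] delta_3_ends ..
    show "tau m x (b * ev (tgt G w)) = tau m x b * ev (tgt G w)" if "x \<in> amb 1" for x b
      by (rule tau_ev_right[OF m r[OF v] v that])
  qed
  ultimately show ?thesis
    unfolding Lf_d3[OF m] by (simp add: right_diff_distrib left_diff_distrib)
qed

lemma Fup_Pn:
  assumes g: "rel3 g"
  shows "Fup 3 g \<in> Pn 3"
  unfolding Pn_def Fup_eq[of g, OF rel3D(6)[OF g]]
  using Lf_d3_ends[OF relm_gh[OF g] gh_right[OF g]] by simp

lemma unary_bracket_Pn:
  assumes f: "f \<in> Pn 2"
  shows "unary_bracket 2 f \<in> Pn 3"
  unfolding Pn_def unary_bracket_eq
  using Lf_d3_ends[OF relm_fm[OF f] fm_right] by simp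

end

section \<open>Topological bases of complete local algebras\<close>

locale local_alg =
  fixes sB :: "'k::field \<Rightarrow> 'b \<Rightarrow> 'b::comm_ring_1" and \<mm> :: "'b set"
  assumes cln: "complete_local_noetherian sB \<mm>"
begin

sublocale B: vector_space sB
  using cln by (simp add: complete_local_noetherian_def)

sublocale rm: module "(*) :: 'b \<Rightarrow> 'b \<Rightarrow> 'b"
  by standard (simp_all add: algebra_simps)

declare rm.scale_scale [simp del]

abbreviation "Pw \<equiv> ideal_pow \<mm>"

lemmas cln_conjs = cln[unfolded complete_local_noetherian_def, THEN conjunct2, THEN conjunct2]
lemmas cln_max = cln_conjs[THEN conjunct1]
  and cln_noetherian = cln_conjs[THEN conjunct2, THEN conjunct1]
  and cln_residue = cln_conjs[THEN conjunct2, THEN conjunct2, THEN conjunct2, THEN conjunct2]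

lemma sB_mult: "sB c a * b = sB c (a * b)" "a * sB c b = sB c (a * b)"
proof -
  show "sB c a * b = sB c (a * b)" for a b
    using cln by (simp add: complete_local_noetherian_def)
  from this[of b a] show "a * sB c b = sB c (a * b)"
    by (simp add: mult.commute)
qed

lemma subspace_Pw: "ring_ideal (Pw n)"
  by (cases n) (simp_all add: rm.subspace_span)

lemma Pw_mult_left: "y \<in> Pw n \<Longrightarrow> a * y \<in> Pw n"
  by (rule rm.subspace_scale[OF subspace_Pw])

lemma Pw_B_subspace: "B.subspace (Pw n)"
  unfolding B.subspace_def
proof (intro conjI ballI allI)
  show "0 \<in> Pw n"
    by (rule rm.subspace_0[OF subspace_Pw])
next
  fix x y assume "x \<in> Pw n" "y \<in> Pw n"
  then show "x + y \<in> Pw n"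
    by (rule rm.subspace_add[OF subspace_Pw])
next
  fix c x assume "x \<in> Pw n"
  then show "sB c x \<in> Pw n"
    using Pw_mult_left[of x n "sB c 1"] by (simp add: sB_mult)
qed

lemma Pw_Suc: "x \<in> \<mm> \<Longrightarrow> y \<in> Pw n \<Longrightarrow> x * y \<in> Pw (Suc n)"
  by (auto intro!: rm.span_base)

lemma Pw_dec: "Pw (Suc n) \<subseteq> Pw n"
  unfolding ideal_pow.simps by (rule rm.span_minimal[OF _ subspace_Pw]) (auto intro: Pw_mult_left)

lemma Pw_antimono: "i \<le> j \<Longrightarrow> Pw j \<subseteq> Pw i"
  by (rule lift_Suc_antimono_le[of Pw]) (rule Pw_dec)

lemma mm_maximal: "ring_ideal \<mm>" "\<mm> \<noteq> UNIV"
proof -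
  have "\<mm> \<in> {J. maximal_ring_ideal J}"
    using cln_max by simp
  then show "ring_ideal \<mm>" "\<mm> \<noteq> UNIV"
    by (auto simp: maximal_ring_ideal_def)
qed

lemma Pw_1 [simp]: "Pw (Suc 0) = \<mm>"
proof
  show "Pw (Suc 0) \<subseteq> \<mm>"
    unfolding ideal_pow.simps
  proof (rule rm.span_minimal[OF _ mm_maximal(1)], clarify)
    fix x y assume "x \<in> \<mm>"
    then show "x * y \<in> \<mm>"
      using rm.subspace_scale[OF mm_maximal(1), of x y] by (simp add: mult.commute)
  qed
  show "\<mm> \<subseteq> Pw (Suc 0)"
    using Pw_Suc[of _ 1 0] by auto
qed

lemma one_notin_mm: "1 \<notin> \<mm>"
  using mm_maximal rm.subspace_scale[OF mm_maximal(1), of 1] by auto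

lemma sB_one_notin_mm: "sB c 1 \<in> \<mm> \<Longrightarrow> c = 0"
proof (rule ccontr)
  assume "sB c 1 \<in> \<mm>" "c \<noteq> 0"
  then have "sB (inverse c) 1 * sB c 1 \<in> \<mm>"
    by (intro rm.subspace_scale[OF mm_maximal(1)])
  then show False
    using \<open>c \<noteq> 0\<close> one_notin_mm by (simp add: sB_mult)
qed

lemma Pw_mult: "x \<in> Pw i \<Longrightarrow> y \<in> Pw j \<Longrightarrow> x * y \<in> Pw (i + j)"
proof (induction i arbitrary: x)
  case 0
  then show ?case by (simp add: Pw_mult_left)
next
  case (Suc i)
  from Suc.prems(1) show ?case
    unfolding ideal_pow.simps(2)[of _ i]
  proof (induction rule: rm.span_induct)
    case base
    show ?case
      unfolding rm.subspace_def mem_Collect_eq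
    proof (intro conjI ballI allI)
      show "0 * y \<in> Pw (Suc i + j)"
        by (simp only: mult_zero_left rm.subspace_0[OF subspace_Pw])
    next
      fix a b assume "a \<in> {x. x * y \<in> Pw (Suc i + j)}" "b \<in> {x. x * y \<in> Pw (Suc i + j)}"
      then show "(a + b) * y \<in> Pw (Suc i + j)"
        unfolding mem_Collect_eq distrib_right by (rule rm.subspace_add[OF subspace_Pw])
    next
      fix c a assume "a \<in> {x. x * y \<in> Pw (Suc i + j)}"
      then show "c * a * y \<in> Pw (Suc i + j)"
        unfolding mem_Collect_eq mult.assoc by (rule Pw_mult_left)
    qed
  next
    case (step x)
    then obtain a b where ab: "x = a * b" "a \<in> \<mm>" "b \<in> Pw i"
      by auto
    have "a * (b * y) \<in> Pw (Suc (i + j))"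
      by (rule Pw_Suc[OF ab(2) Suc.IH[OF ab(3) Suc.prems(2)]])
    then show ?case
      by (simp only: ab(1) mult.assoc add_Suc)
  qed
qed

lemma gens_ex: "\<exists>X. finite X \<and> \<mm> = rm.span X"
  using cln_noetherian mm_maximal(1) by (elim allE impE)

definition gens :: "'b set" where
  "gens = (SOME X. finite X \<and> \<mm> = rm.span X)"

lemma gens: "finite gens" "\<mm> = rm.span gens"
  using someI_ex[OF gens_ex] by (auto simp: gens_def)

lemma gens_mm: "x \<in> gens \<Longrightarrow> x \<in> \<mm>"
  by (rule subsetD[OF equalityD2[OF gens(2)]]) (rule rm.span_base)

lemma Pw_Suc_gens:
  assumes "b \<in> Pw (Suc n)"
  shows "\<exists>z. (\<forall>x. z x \<in> Pw n) \<and> b = (\<Sum>x\<in>gens. x * z x)"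
  using assms unfolding ideal_pow.simps(2)
proof (induction rule: rm.span_induct)
  case base
  show ?case
    unfolding rm.subspace_def mem_Collect_eq
  proof (intro conjI ballI allI)
    show "\<exists>z. (\<forall>x. z x \<in> Pw n) \<and> 0 = (\<Sum>x\<in>gens. x * z x)"
      by (rule exI[of _ "\<lambda>x. 0"]) (simp add: rm.subspace_0[OF subspace_Pw])
    fix b b'
    assume "b \<in> {a. \<exists>z. (\<forall>x. z x \<in> Pw n) \<and> a = (\<Sum>x\<in>gens. x * z x)}"
    then obtain z where z: "\<forall>x. z x \<in> Pw n" "b = (\<Sum>x\<in>gens. x * z x)" by auto
    show "\<exists>z. (\<forall>x. z x \<in> Pw n) \<and> c * b = (\<Sum>x\<in>gens. x * z x)" for c
    proof (intro exI conjI)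
      show "\<forall>x. c * z x \<in> Pw n"
        using z(1) by (auto intro: Pw_mult_left)
      show "c * b = (\<Sum>x\<in>gens. x * (c * z x))"
        unfolding z(2) sum_distrib_left by (rule sum.cong) (simp_all only: mult.left_commute)
    qed
    assume "b' \<in> {a. \<exists>z. (\<forall>x. z x \<in> Pw n) \<and> a = (\<Sum>x\<in>gens. x * z x)}"
    then obtain z' where z': "\<forall>x. z' x \<in> Pw n" "b' = (\<Sum>x\<in>gens. x * z' x)" by auto
    show "\<exists>z. (\<forall>x. z x \<in> Pw n) \<and> b + b' = (\<Sum>x\<in>gens. x * z x)"
      by (rule exI[of _ "\<lambda>x. z x + z' x"])
        (simp add: z z' rm.subspace_add[OF subspace_Pw] distrib_left sum.distrib)
  qed
next
  case (step b)
  then obtain a y where ay: "b = a * y" "a \<in> \<mm>" "y \<in> Pw n"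
    by auto
  have "a \<in> rm.span gens"
    using equalityD1[OF gens(2)] ay(2) by (rule subsetD)
  then obtain u where u: "a = (\<Sum>x\<in>gens. u x * x)"
    unfolding rm.span_finite[OF gens(1)] by (elim rangeE)
  have "b = (\<Sum>x\<in>gens. x * (u x * y))"
    unfolding ay(1) u sum_distrib_right by (simp add: mult_ac)
  with ay(3) show ?case
    by (intro exI[of _ "\<lambda>x. u x * y"]) (simp add: Pw_mult_left)
qed

definition spanning :: "nat \<Rightarrow> 'b set \<Rightarrow> bool" where
  "spanning n F \<longleftrightarrow> finite F \<and> F \<subseteq> Pw n \<and> (\<forall>b\<in>Pw n. \<exists>y\<in>B.span F. b - y \<in> Pw (Suc n))"

lemma spanning_one: "spanning 0 {1}"
  unfolding spanning_def
proof (intro conjI ballI)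
  fix b
  obtain c where "b - sB c 1 \<in> \<mm>"
    using cln_residue by (elim allE ex1E)
  then show "\<exists>y\<in>B.span {1}. b - y \<in> Pw (Suc 0)"
    by (intro bexI[of _ "sB c 1"]) (auto intro: B.span_scale B.span_base simp del: ideal_pow.simps)
qed simp_all

text \<open>Noetherianity enters here: as \<open>\<mm>\<close> is finitely generated, all
  \<open>\<mm>\<^sup>n/\<mm>\<^sup>n\<^sup>+\<^sup>1\<close> are finite-dimensional.\<close>

lemma spanning_ex: "\<exists>F. spanning n F"
proof (induction n)
  case 0
  show ?case using spanning_one by blast
next
  case (Suc n)
  then obtain F where F: "finite F" "F \<subseteq> Pw n" "\<And>b. b \<in> Pw n \<Longrightarrow> \<exists>y\<in>B.span F. b - y \<in> Pw (Suc n)"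
    by (auto simp: spanning_def simp del: ideal_pow.simps)
  define F' where "F' = (\<lambda>(x, f). x * f) ` (gens \<times> F)"
  have span: "x * y \<in> B.span F'" if "x \<in> gens" "y \<in> B.span F" for x y
    using that(2)
  proof (induction rule: B.span_induct)
    case base
    show ?case
      unfolding B.subspace_def by (auto simp: distrib_left sB_mult B.span_add B.span_scale B.span_zero)
  next
    case (step f)
    then show ?case
      using that(1) by (intro B.span_base) (auto simp: F'_def)
  qed
  have "spanning (Suc n) F'"
    unfolding spanning_def
  proof (intro conjI ballI)
    show "finite F'"
      by (simp add: F'_def F(1) gens(1))
    show "F' \<subseteq> Pw (Suc n)"
      using F(2) gens_mm by (auto simp: F'_def simp del: ideal_pow.simps intro!: Pw_Suc)
    fix b assume "b \<in> Pw (Suc n)"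
    then obtain z where z: "\<And>x. z x \<in> Pw n" "b = (\<Sum>x\<in>gens. x * z x)"
      using Pw_Suc_gens by blast
    from z(1) F(3) have "\<forall>x. \<exists>y. y \<in> B.span F \<and> z x - y \<in> Pw (Suc n)"
      by blast
    then obtain y where y: "\<And>x. y x \<in> B.span F" "\<And>x. z x - y x \<in> Pw (Suc n)"
      by metis
    have "b - (\<Sum>x\<in>gens. x * y x) = (\<Sum>x\<in>gens. x * (z x - y x))"
      by (simp add: z(2) right_diff_distrib sum_subtractf)
    also have "\<dots> \<in> Pw (Suc (Suc n))"
      by (intro rm.subspace_sum[OF subspace_Pw] Pw_Suc gens_mm y(2))
    finally show "\<exists>y\<in>B.span F'. b - y \<in> Pw (Suc (Suc n))"
      by (intro bexI[of _ "\<Sum>x\<in>gens. x * y x"] B.span_sum span y(1))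
  qed
  then show ?case by blast
qed

lemma minimal_spanning_ex:
  "\<exists>F. spanning n F \<and> (\<forall>c. (\<Sum>e\<in>F. sB (c e) e) \<in> Pw (Suc n) \<longrightarrow> (\<forall>e\<in>F. c e = 0))"
proof -
  obtain F where F: "spanning n F" "\<And>F'. spanning n F' \<Longrightarrow> card F \<le> card F'"
    using ex_has_least_nat[of "spanning n" _ card] spanning_ex[of n] by auto
  have fin: "finite F"
    using F(1) by (simp add: spanning_def)
  have "c e0 = 0" if c: "(\<Sum>e\<in>F. sB (c e) e) \<in> Pw (Suc n)" and e0: "e0 \<in> F" for c e0
  proof (rule ccontr)
    assume ne: "c e0 \<noteq> 0"
    have "spanning n (F - {e0})"
      unfolding spanning_def
    proof (intro conjI ballI)
      show "finite (F - {e0})" "F - {e0} \<subseteq> Pw n"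
        using F(1) by (auto simp: spanning_def simp del: ideal_pow.simps)
      fix b assume "b \<in> Pw n"
      then obtain y where y: "y \<in> B.span F" "b - y \<in> Pw (Suc n)"
        using F(1) by (auto simp: spanning_def simp del: ideal_pow.simps)
      obtain d where d: "y = (\<Sum>e\<in>F. sB (d e) e)"
        using y(1) B.span_finite[OF fin] by auto
      define y' where "y' = (\<Sum>e\<in>F - {e0}. sB (d e - d e0 / c e0 * c e) e)"
      have "y' = (\<Sum>e\<in>F. sB (d e - d e0 / c e0 * c e) e)"
        using sum.remove[OF fin e0, of "\<lambda>e. sB (d e - d e0 / c e0 * c e) e"] ne by (simp add: y'_def)
      also have "\<dots> = y - sB (d e0 / c e0) (\<Sum>e\<in>F. sB (c e) e)"
        by (simp add: d B.scale_left_diff_distrib sum_subtractf B.scale_sum_right)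
      finally have "b - y' = (b - y) + sB (d e0 / c e0) (\<Sum>e\<in>F. sB (c e) e)"
        by simp
      also have "\<dots> \<in> Pw (Suc n)"
        by (intro B.subspace_add[OF Pw_B_subspace] B.subspace_scale[OF Pw_B_subspace] y(2) c)
      finally have "b - y' \<in> Pw (Suc n)" .
      moreover have "y' \<in> B.span (F - {e0})"
        unfolding y'_def by (intro B.span_sum B.span_scale B.span_base)
      ultimately show "\<exists>y\<in>B.span (F - {e0}). b - y \<in> Pw (Suc n)"
        by (rule bexI)
    qed
    from F(2)[OF this] card_Diff1_less[OF fin e0] show False by simp
  qed
  with F(1) show ?thesis by blast
qed

definition Fb :: "nat \<Rightarrow> 'b set" where
  "Fb n = (if n = 0 then {1} else
     (SOME F. spanning n F \<and> (\<forall>c. (\<Sum>e\<in>F. sB (c e) e) \<in> Pw (Suc n) \<longrightarrow> (\<forall>e\<in>F. c e = 0))))"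

lemma Fb: "spanning n (Fb n)" "(\<Sum>e\<in>Fb n. sB (c e) e) \<in> Pw (Suc n) \<Longrightarrow> e \<in> Fb n \<Longrightarrow> c e = 0"
proof -
  have "spanning n (Fb n) \<and> (\<forall>c. (\<Sum>e\<in>Fb n. sB (c e) e) \<in> Pw (Suc n) \<longrightarrow> (\<forall>e\<in>Fb n. c e = 0))"
  proof (cases "n = 0")
    case True
    then show ?thesis
      using spanning_one sB_one_notin_mm by (simp add: Fb_def del: ideal_pow.simps)
  next
    case False
    then have e: "Fb n = (SOME F. spanning n F \<and> (\<forall>c. (\<Sum>e\<in>F. sB (c e) e) \<in> Pw (Suc n) \<longrightarrow> (\<forall>e\<in>F. c e = 0)))"
      by (simp add: Fb_def)
    show ?thesis
      unfolding e by (rule someI_ex[OF minimal_spanning_ex])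
  qed
  then show "spanning n (Fb n)" "(\<Sum>e\<in>Fb n. sB (c e) e) \<in> Pw (Suc n) \<Longrightarrow> e \<in> Fb n \<Longrightarrow> c e = 0"
    by blast+
qed

lemma Fb_finite: "finite (Fb n)" and Fb_sub: "Fb n \<subseteq> Pw n"
  using Fb(1)[of n] by (simp_all add: spanning_def)

lemma Fb_coeffs: "b \<in> Pw n \<Longrightarrow> \<exists>c. b - (\<Sum>e\<in>Fb n. sB (c e) e) \<in> Pw (Suc n)"
proof -
  assume "b \<in> Pw n"
  then obtain y where y: "y \<in> B.span (Fb n)" "b - y \<in> Pw (Suc n)"
    using Fb(1)[of n] unfolding spanning_def by (elim conjE) (drule (1) bspec, elim bexE)
  obtain c where "y = (\<Sum>e\<in>Fb n. sB (c e) e)"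
    using y(1) B.span_finite[OF Fb_finite] by auto
  with y(2) show ?thesis
    by (intro exI[of _ c]) simp
qed

definition cf :: "nat \<Rightarrow> 'b \<Rightarrow> 'b \<Rightarrow> 'k" where
  "cf n b = (SOME c. b - (\<Sum>e\<in>Fb n. sB (c e) e) \<in> Pw (Suc n))"

lemma cf: "b \<in> Pw n \<Longrightarrow> b - (\<Sum>e\<in>Fb n. sB (cf n b e) e) \<in> Pw (Suc n)"
  unfolding cf_def by (rule someI_ex[OF Fb_coeffs])

lemma cf_unique:
  assumes "b \<in> Pw n" "b - (\<Sum>e\<in>Fb n. sB (c e) e) \<in> Pw (Suc n)" "e \<in> Fb n"
  shows "cf n b e = c e"
proof -
  have "(b - (\<Sum>e\<in>Fb n. sB (c e) e)) - (b - (\<Sum>e\<in>Fb n. sB (cf n b e) e)) \<in> Pw (Suc n)"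
    by (rule B.subspace_diff[OF Pw_B_subspace assms(2) cf[OF assms(1)]])
  then have "(\<Sum>e\<in>Fb n. sB (cf n b e - c e) e) \<in> Pw (Suc n)"
    by (simp add: B.scale_left_diff_distrib sum_subtractf del: ideal_pow.simps)
  from Fb(2)[OF this assms(3)] show ?thesis by simp
qed

lemma cf_zero: "b \<in> Pw (Suc n) \<Longrightarrow> e \<in> Fb n \<Longrightarrow> cf n b e = 0"
  using cf_unique[of b n "\<lambda>e. 0" e] Pw_dec by (auto simp del: ideal_pow.simps)

lemma cf_add:
  assumes "b \<in> Pw n" "b' \<in> Pw n" "e \<in> Fb n"
  shows "cf n (b + b') e = cf n b e + cf n b' e"
proof (rule cf_unique[where c = "\<lambda>e. cf n b e + cf n b' e", OF _ _ assms(3)])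
  show "b + b' \<in> Pw n"
    by (rule B.subspace_add[OF Pw_B_subspace assms(1,2)])
  show "b + b' - (\<Sum>e\<in>Fb n. sB (cf n b e + cf n b' e) e) \<in> Pw (Suc n)"
    using B.subspace_add[OF Pw_B_subspace cf[OF assms(1)] cf[OF assms(2)]]
    by (simp add: B.scale_left_distrib sum.distrib algebra_simps del: ideal_pow.simps)
qed

lemma cf_scale:
  assumes "b \<in> Pw n" "e \<in> Fb n"
  shows "cf n (sB k b) e = k * cf n b e"
proof (rule cf_unique[where c = "\<lambda>e. k * cf n b e", OF _ _ assms(2)])
  show "sB k b \<in> Pw n"
    by (rule B.subspace_scale[OF Pw_B_subspace assms(1)])
  show "sB k b - (\<Sum>e\<in>Fb n. sB (k * cf n b e) e) \<in> Pw (Suc n)"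
    using B.subspace_scale[OF Pw_B_subspace cf[OF assms(1)], of k]
    by (simp add: B.scale_right_diff_distrib B.scale_sum_right del: ideal_pow.simps)
qed

text \<open>What remains of \<open>b\<close> after its components of level less than \<open>n\<close> have been split off.\<close>

primrec remd :: "nat \<Rightarrow> 'b \<Rightarrow> 'b" where
  "remd 0 b = b"
| "remd (Suc n) b = remd n b - (\<Sum>e\<in>Fb n. sB (cf n (remd n b) e) e)"

lemma remd_Pw: "remd n b \<in> Pw n"
proof (induction n)
  case (Suc n)
  show ?case unfolding remd.simps by (rule cf[OF Suc.IH])
qed simp

lemma remd_add: "remd n (b + b') = remd n b + remd n b'"
proof (induction n)
  case (Suc n)
  have "(\<Sum>e\<in>Fb n. sB (cf n (remd n b + remd n b') e) e) =
      (\<Sum>e\<in>Fb n. sB (cf n (remd n b) e) e) + (\<Sum>e\<in>Fb n. sB (cf n (remd n b') e) e)"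
    unfolding sum.distrib[symmetric]
    by (rule sum.cong) (simp_all add: cf_add remd_Pw B.scale_left_distrib)
  then show ?case by (simp add: Suc)
qed simp

lemma remd_scale: "remd n (sB k b) = sB k (remd n b)"
proof (induction n)
  case (Suc n)
  have "(\<Sum>e\<in>Fb n. sB (cf n (sB k (remd n b)) e) e) = sB k (\<Sum>e\<in>Fb n. sB (cf n (remd n b) e) e)"
    unfolding B.scale_sum_right by (rule sum.cong) (simp_all add: cf_scale remd_Pw)
  then show ?case by (simp add: Suc B.scale_right_diff_distrib)
qed simp

lemma remd_id: "b \<in> Pw n \<Longrightarrow> k \<le> n \<Longrightarrow> remd k b = b"
proof (induction k)
  case (Suc k)
  then have "b \<in> Pw (Suc k)"
    using Pw_antimono[of "Suc k" n] by (auto simp del: ideal_pow.simps)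
  then have "(\<Sum>e\<in>Fb k. sB (cf k b e) e) = 0"
    by (intro sum.neutral) (simp add: cf_zero del: ideal_pow.simps)
  then show ?case
    using Suc by (simp del: ideal_pow.simps)
qed simp

lemma Fb_notin: "e \<in> Fb n \<Longrightarrow> e \<notin> Pw (Suc n)"
proof
  assume e: "e \<in> Fb n" "e \<in> Pw (Suc n)"
  have "(\<Sum>e'\<in>Fb n. sB (if e' = e then 1 else 0) e') = (\<Sum>e'\<in>Fb n. if e' = e then e' else 0)"
    by (rule sum.cong) auto
  then have "(\<Sum>e'\<in>Fb n. sB (if e' = e then 1 else 0) e') \<in> Pw (Suc n)"
    using e Fb_finite by (simp del: ideal_pow.simps)
  from Fb(2)[OF this e(1)] show False by simp
qed

lemma Fb_disjoint: "e \<in> Fb i \<Longrightarrow> e \<in> Fb j \<Longrightarrow> i = j"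
proof (rule ccontr)
  have *: False if "e \<in> Fb i" "e \<in> Fb j" "i < j" for i j
    using Fb_sub[of j] Pw_antimono[of "Suc i" j] Fb_notin[OF that(1)] that by (auto simp del: ideal_pow.simps)
  assume "e \<in> Fb i" "e \<in> Fb j" "i \<noteq> j"
  then show False
    using *[of i j] *[of j i] by linarith
qed

definition lamb :: "'b \<Rightarrow> 'b \<Rightarrow> 'k" where
  "lamb e b = cf (THE n. e \<in> Fb n) (remd (THE n. e \<in> Fb n) b) e"

lemma lamb: "e \<in> Fb n \<Longrightarrow> lamb e b = cf n (remd n b) e"
proof -
  assume e: "e \<in> Fb n"
  have "(THE n. e \<in> Fb n) = n"
    by (rule the_equality) (use e Fb_disjoint in auto)
  then show ?thesis by (simp add: lamb_def)
qed

definition Eb :: "nat \<Rightarrow> 'b set" where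
  "Eb n = (\<Union>k<n. Fb k)"

end

text \<open>\<open>E n\<close> represents a basis of \<open>B/\<mm>\<^sup>n\<close>, and \<open>lam e\<close> is the coordinate function of \<open>e\<close>.\<close>

locale top_basis = local_alg sB \<mm>
  for sB :: "'k::field \<Rightarrow> 'b \<Rightarrow> 'b::comm_ring_1" and \<mm> :: "'b set" +
  fixes E :: "nat \<Rightarrow> 'b set" and lam :: "'b \<Rightarrow> 'b \<Rightarrow> 'k"
  assumes E_finite: "finite (E n)"
    and E_mono: "i \<le> j \<Longrightarrow> E i \<subseteq> E j"
    and E_0: "E 0 = {}"
    and E_1: "E (Suc 0) = {1}"
    and E_Pw: "e \<in> E i \<Longrightarrow> e \<notin> E n \<Longrightarrow> e \<in> Pw n"
    and lam_add: "e \<in> E i \<Longrightarrow> lam e (b + b') = lam e b + lam e b'"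
    and lam_scale: "e \<in> E i \<Longrightarrow> lam e (sB c b) = c * lam e b"
    and lam_sum: "b - (\<Sum>e\<in>E n. sB (lam e b) e) \<in> Pw n"
    and lam_Pw: "b \<in> Pw n \<Longrightarrow> e \<in> E n \<Longrightarrow> lam e b = 0"
    and lam_dual: "e \<in> E i \<Longrightarrow> e' \<in> E j \<Longrightarrow> lam e e' = (if e = e' then 1 else 0)"

lemma (in local_alg) top_basis_exists: "top_basis sB \<mm> Eb lamb"
proof (unfold_locales)
  show "finite (Eb n)" for n
    by (simp add: Eb_def Fb_finite)
  show "i \<le> j \<Longrightarrow> Eb i \<subseteq> Eb j" for i j
    unfolding Eb_def by (rule UN_mono) auto
  show "Eb 0 = {}" "Eb (Suc 0) = {1}"
    by (simp_all add: Eb_def Fb_def lessThan_Suc)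
  show "e \<in> Pw n" if e: "e \<in> Eb i" "e \<notin> Eb n" for e i n
  proof -
    obtain k where k: "e \<in> Fb k" "\<not> k < n"
      using e by (auto simp: Eb_def)
    then show ?thesis
      using Fb_sub[of k] Pw_antimono[of n k] by (auto simp del: ideal_pow.simps)
  qed
  show "lamb e (b + b') = lamb e b + lamb e b'" if "e \<in> Eb i" for e i b b'
    using that by (auto simp: Eb_def lamb remd_add cf_add remd_Pw)
  show "lamb e (sB c b) = c * lamb e b" if "e \<in> Eb i" for e i b c
    using that by (auto simp: Eb_def lamb remd_scale cf_scale remd_Pw)
  show "b - (\<Sum>e\<in>Eb n. sB (lamb e b) e) \<in> Pw n" for b n
  proof -
    have "(\<Sum>e\<in>Eb n. sB (lamb e b) e) = (\<Sum>k<n. \<Sum>e\<in>Fb k. sB (lamb e b) e)"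
      unfolding Eb_def by (rule sum.UNION_disjoint) (use Fb_finite Fb_disjoint in auto)
    also have "\<dots> = (\<Sum>k<n. \<Sum>e\<in>Fb k. sB (cf k (remd k b) e) e)"
      by (simp add: lamb)
    also have "b - \<dots> = remd n b"
      by (induction n) (simp_all add: algebra_simps)
    finally show ?thesis
      using remd_Pw by simp
  qed
  show "lamb e b = 0" if be: "b \<in> Pw n" "e \<in> Eb n" for b e n
  proof -
    obtain k where k: "k < n" "e \<in> Fb k"
      using be(2) by (auto simp: Eb_def)
    then have "b \<in> Pw (Suc k)"
      using be(1) Pw_antimono[of "Suc k" n] by (auto simp del: ideal_pow.simps)
    then show ?thesis
      using k be(1) by (simp add: lamb remd_id[of b "Suc k"] cf_zero del: ideal_pow.simps)
  qed
  show "lamb e e' = (if e = e' then 1 else 0)" if ee: "e \<in> Eb i" "e' \<in> Eb j" for e e' i j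
  proof -
    obtain k m where km: "e \<in> Fb k" "e' \<in> Fb m"
      using ee by (auto simp: Eb_def)
    have e': "e' \<in> Pw m"
      using km Fb_sub by auto
    have sum: "(\<Sum>x\<in>Fb m. sB (if x = e' then 1 else 0) x) = e'"
    proof -
      have "(\<Sum>x\<in>Fb m. sB (if x = e' then 1 else 0) x) = (\<Sum>x\<in>Fb m. if x = e' then x else 0)"
        by (rule sum.cong) auto
      then show ?thesis using km Fb_finite by simp
    qed
    have cfm: "cf m e' x = (if x = e' then 1 else 0)" if "x \<in> Fb m" for x
      by (rule cf_unique[OF e' _ that]) (simp add: sum rm.subspace_0[OF subspace_Pw] del: ideal_pow.simps)
    consider "k < m" | "k = m" | "k > m" by linarith
    then show ?thesis
    proof cases
      case 1
      then have "e' \<in> Pw (Suc k)"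
        using e' Pw_antimono[of "Suc k" m] by (auto simp del: ideal_pow.simps)
      then have "lamb e e' = 0"
        using km by (simp add: lamb remd_id[of e' "Suc k"] cf_zero del: ideal_pow.simps)
      then show ?thesis using 1 km Fb_disjoint by auto
    next
      case 2
      then show ?thesis
        using km by (simp add: lamb remd_id[OF e'] cfm)
    next
      case 3
      have "(\<Sum>x\<in>Fb m. sB (cf m e' x) x) = e'"
        using sum by (simp add: cfm cong: sum.cong)
      then have S: "remd (Suc m) e' = 0"
        by (simp add: remd_id[OF e'])
      have "remd (Suc m + d) e' = 0" for d
      proof (induction d)
        case (Suc d)
        have "(\<Sum>x\<in>Fb (Suc m + d). sB (cf (Suc m + d) 0 x) x) = 0"
          by (intro sum.neutral) (simp add: cf_zero rm.subspace_0[OF subspace_Pw] del: ideal_pow.simps)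
        then show ?case using Suc by simp
      qed (use S in simp)
      from this[of "k - Suc m"] have "remd k e' = 0"
        using 3 by simp
      then have "lamb e e' = 0"
        using km by (simp add: lamb cf_zero rm.subspace_0[OF subspace_Pw] del: ideal_pow.simps)
      then show ?thesis using 3 km Fb_disjoint by auto
    qed
  qed
qed

section \<open>Coordinates on completed tensor products\<close>

lemma single_add_lookup:
  fixes t :: "'x \<Rightarrow>\<^sub>0 'r::comm_ring_1"
  shows "t = (\<Sum>p\<in>keys t. single p (lookup t p))"
  using free_ext_base[of t] by (simp add: lin_ext_def)

lemma keys_single_diff:
  "keys (single p c - single p' c' - single p'' c'' :: 'x \<Rightarrow>\<^sub>0 'r::comm_ring_1) \<subseteq> {p, p', p''}"
  by (auto simp: in_keys_iff lookup_minus lookup_single when_def split: if_splits)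

context top_basis
begin

abbreviation "Eu \<equiv> (\<Union>n. E n)"

text \<open>The map \<open>id \<otimes> lam e\<close>.\<close>

definition coord :: "('k \<Rightarrow> 'w \<Rightarrow> 'w) \<Rightarrow> ('w \<times> 'b \<Rightarrow>\<^sub>0 'k) \<Rightarrow> 'b \<Rightarrow> 'w::ab_group_add" where
  "coord sV t e = lin_ext sV (\<lambda>(v, b). sV (lam e b) v) t"

lemma lam_zero: "e \<in> E i \<Longrightarrow> lam e 0 = 0"
  using lam_scale[of e i 0 0] by simp

lemma lam_diff: "e \<in> E i \<Longrightarrow> lam e (b - b') = lam e b - lam e b'"
  using lam_add[of e i "b - b'" b'] by simp

lemma lam_lincomb: "e \<in> E i \<Longrightarrow> lam e (\<Sum>x\<in>X. sB (c x) (b x)) = (\<Sum>x\<in>X. c x * lam e (b x))"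
  by (induction X rule: infinite_finite_induct) (simp_all add: lam_zero lam_add lam_scale)

lemma lam_sum': "e \<in> E i \<Longrightarrow> lam e (\<Sum>x\<in>X. b x) = (\<Sum>x\<in>X. lam e (b x))"
  by (induction X rule: infinite_finite_induct) (simp_all add: lam_zero lam_add)

lemma lam_cong_Pw: "b - b' \<in> Pw n \<Longrightarrow> e \<in> E n \<Longrightarrow> lam e b = lam e b'"
  using lam_Pw[of "b - b'" n e] lam_diff[of e n b b'] by simp

text \<open>The product \<open>b b'\<close> may be computed from the expansion of \<open>b'\<close>.\<close>

lemma lam_mult:
  assumes "e \<in> E n"
  shows "lam e (b * b') = (\<Sum>e'\<in>E n. lam e' b' * lam e (b * e'))"
proof -
  have "b * b' - (\<Sum>e'\<in>E n. sB (lam e' b') (b * e')) = b * (b' - (\<Sum>e'\<in>E n. sB (lam e' b') e'))"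
    by (simp add: right_diff_distrib sum_distrib_left sB_mult)
  also have "\<dots> \<in> Pw n"
    by (rule Pw_mult_left[OF lam_sum])
  finally have "lam e (b * b') = lam e (\<Sum>e'\<in>E n. sB (lam e' b') (b * e'))"
    by (rule lam_cong_Pw[OF _ assms])
  then show ?thesis
    by (simp only: lam_lincomb[OF assms])
qed

context
  fixes sV :: "'k \<Rightarrow> 'w \<Rightarrow> 'w::ab_group_add" and V :: "'w set" and W :: "'b set"
  assumes sV: "vector_space sV" and V: "module.subspace sV V" and W: "B.subspace W"
begin

interpretation V: vector_space sV by (rule sV)

lemma coord_hom: "module_hom fscale sV (\<lambda>t. coord sV t e)"
  unfolding coord_def
  by (intro module_hom.intro module_hom_axioms.intro module_fscale V.module_axioms V.lin_ext_add V.lin_ext_fscale)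

lemma coord_base [simp]: "coord sV (base (v, b)) e = sV (lam e b) v"
  by (simp add: coord_def)

lemma coord_single [simp]: "coord sV (single (v, b) c) e = sV (c * lam e b) v"
  by (simp add: coord_def)

lemma ct_null_keys:
  assumes "t \<in> ct_null sV V sB W \<mm> n"
  shows "keys t \<subseteq> V \<times> W"
proof -
  have "ct_null sV V sB W \<mm> n \<subseteq> {t. keys t \<subseteq> V \<times> W}"
    unfolding ct_null_def
  proof (rule fs.span_minimal[OF _ subspace_keys])
    have k2: "keys (base p - fscale c (base p')) \<subseteq> {p, p'}" for p p' :: "'w \<times> 'b" and c :: 'k
      by (auto simp: in_keys_iff lookup_minus lookup_single when_def split: if_splits)
    show "bilinear_rels sV V sB W \<union> {base (v, b) |v b. v \<in> V \<and> b \<in> W \<inter> Pw n} \<subseteq> {t. keys t \<subseteq> V \<times> W}"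
      unfolding bilinear_rels_def
      by (intro Un_least subsetI; elim CollectE exE conjE; clarify;
          (drule subsetD[OF keys_single_diff] | drule subsetD[OF k2] | simp))
        (auto intro: V.subspace_add[OF V] V.subspace_scale[OF V] B.subspace_add[OF W] B.subspace_scale[OF W])
  qed
  with assms show ?thesis by blast
qed

lemma coord_ct_null:
  assumes "t \<in> ct_null sV V sB W \<mm> n" and e: "e \<in> E n"
  shows "coord sV t e = 0"
  using assms(1) unfolding ct_null_def
proof (induction rule: fs.span_induct)
  case base
  show ?case
    unfolding fs.subspace_def mem_Collect_eq
    by (simp add: module_hom.zero[OF coord_hom] module_hom.add[OF coord_hom] module_hom.scale[OF coord_hom])
next
  case (step t)
  then show ?case
    unfolding bilinear_rels_def
    by (elim UnE CollectE exE conjE)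
      (simp_all add: module_hom.diff[OF coord_hom] V.scale_right_distrib lam_add[OF e] V.scale_left_distrib
        lam_scale[OF e] lam_Pw[OF _ e] mult.commute)
qed

lemma subspace_ct_null: "fs.subspace (ct_null sV V sB W \<mm> n)"
  unfolding ct_null_def by (rule fs.subspace_span)

lemma ct_null_rels:
  shows "v \<in> V \<Longrightarrow> v' \<in> V \<Longrightarrow> b \<in> W \<Longrightarrow> base (v + v', b) - base (v, b) - base (v', b) \<in> ct_null sV V sB W \<mm> n"
    and "v \<in> V \<Longrightarrow> b \<in> W \<Longrightarrow> b' \<in> W \<Longrightarrow> base (v, b + b') - base (v, b) - base (v, b') \<in> ct_null sV V sB W \<mm> n"
    and "v \<in> V \<Longrightarrow> b \<in> W \<Longrightarrow> base (sV c v, b) - single (v, b) c \<in> ct_null sV V sB W \<mm> n"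
    and "v \<in> V \<Longrightarrow> b \<in> W \<Longrightarrow> base (v, sB c b) - single (v, b) c \<in> ct_null sV V sB W \<mm> n"
    and "v \<in> V \<Longrightarrow> b \<in> W \<Longrightarrow> b \<in> Pw n \<Longrightarrow> base (v, b) \<in> ct_null sV V sB W \<mm> n"
proof -
  note d = ct_null_def bilinear_rels_def fscale_single mult_1_right
  show "v \<in> V \<Longrightarrow> v' \<in> V \<Longrightarrow> b \<in> W \<Longrightarrow> base (v + v', b) - base (v, b) - base (v', b) \<in> ct_null sV V sB W \<mm> n"
    unfolding d by (rule fs.span_base, rule UnI1, rule UnI1, rule UnI1, rule UnI1) blast
  show "v \<in> V \<Longrightarrow> b \<in> W \<Longrightarrow> b' \<in> W \<Longrightarrow> base (v, b + b') - base (v, b) - base (v, b') \<in> ct_null sV V sB W \<mm> n"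
    unfolding d by (rule fs.span_base, rule UnI1, rule UnI1, rule UnI1, rule UnI2) blast
  show "v \<in> V \<Longrightarrow> b \<in> W \<Longrightarrow> base (sV c v, b) - single (v, b) c \<in> ct_null sV V sB W \<mm> n"
    unfolding d by (rule fs.span_base, rule UnI1, rule UnI1, rule UnI2) blast
  show "v \<in> V \<Longrightarrow> b \<in> W \<Longrightarrow> base (v, sB c b) - single (v, b) c \<in> ct_null sV V sB W \<mm> n"
    unfolding d by (rule fs.span_base, rule UnI1, rule UnI2) blast
  show "v \<in> V \<Longrightarrow> b \<in> W \<Longrightarrow> b \<in> Pw n \<Longrightarrow> base (v, b) \<in> ct_null sV V sB W \<mm> n"
    unfolding d by (rule fs.span_base, rule UnI2) blast
qed

lemma ct_null_sum_right:
  assumes v: "v \<in> V" and b: "\<And>x. x \<in> X \<Longrightarrow> b x \<in> W"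
  shows "base (v, \<Sum>x\<in>X. b x) - (\<Sum>x\<in>X. base (v, b x)) \<in> ct_null sV V sB W \<mm> n"
  using b
proof (induction X rule: infinite_finite_induct)
  case (insert x X)
  have s: "(\<Sum>x\<in>X. b x) \<in> W"
    by (rule B.subspace_sum[OF W]) (use insert.prems in auto)
  have "base (v, \<Sum>x\<in>X. b x) - (\<Sum>x\<in>X. base (v, b x)) \<in> ct_null sV V sB W \<mm> n"
    by (rule insert.IH) (use insert.prems in auto)
  from fs.subspace_add[OF subspace_ct_null ct_null_rels(2)[OF v _ s, of "b x"] this] insert
  show ?case by (simp add: algebra_simps)
qed (use ct_null_rels(5)[OF v B.subspace_0[OF W] B.subspace_0[OF Pw_B_subspace]] in simp_all)

lemma ct_null_sum_left:
  assumes b: "b \<in> W" and v: "\<And>x. x \<in> X \<Longrightarrow> v x \<in> V"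
  shows "base (\<Sum>x\<in>X. v x, b) - (\<Sum>x\<in>X. base (v x, b)) \<in> ct_null sV V sB W \<mm> n"
proof -
  have 0: "base (0, b) \<in> ct_null sV V sB W \<mm> n"
    using ct_null_rels(3)[OF V.subspace_0[OF V] b, of 0] by simp
  show ?thesis
    using v
  proof (induction X rule: infinite_finite_induct)
    case (insert x X)
    have s: "(\<Sum>x\<in>X. v x) \<in> V"
      by (rule V.subspace_sum[OF V]) (use insert.prems in auto)
    have "base (\<Sum>x\<in>X. v x, b) - (\<Sum>x\<in>X. base (v x, b)) \<in> ct_null sV V sB W \<mm> n"
      by (rule insert.IH) (use insert.prems in auto)
    from fs.subspace_add[OF subspace_ct_null ct_null_rels(1)[OF _ s b, of "v x"] this] insert
    show ?case by (simp add: algebra_simps)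
  qed (use 0 in simp_all)
qed

lemma ct_null_trans:
  "x - y \<in> ct_null sV V sB W \<mm> n \<Longrightarrow> y - z \<in> ct_null sV V sB W \<mm> n \<Longrightarrow> x - z \<in> ct_null sV V sB W \<mm> n"
  using fs.subspace_add[OF subspace_ct_null, of "x - y" n "y - z"] by simp

lemma ct_null_sum_cong:
  assumes "\<And>i. i \<in> X \<Longrightarrow> f i - g i \<in> ct_null sV V sB W \<mm> n"
  shows "(\<Sum>i\<in>X. f i) - (\<Sum>i\<in>X. g i) \<in> ct_null sV V sB W \<mm> n"
  unfolding sum_subtractf[symmetric] by (rule fs.subspace_sum[OF subspace_ct_null assms])

text \<open>Modulo \<open>\<mm>\<^sup>n\<close> each tensor is a sum of tensors \<open>v\<^sub>e \<otimes> e\<close> with \<open>e \<in> E n\<close>. The first hypothesis ensures that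
  this expansion can be carried out within \<open>W\<close>.\<close>

lemma ct_null_of_coord:
  assumes Wlam: "\<And>b e i. b \<in> W \<Longrightarrow> e \<in> E i \<Longrightarrow> lam e b \<noteq> 0 \<Longrightarrow> e \<in> W"
    and t: "keys t \<subseteq> V \<times> W" and c0: "\<And>e. e \<in> E n \<Longrightarrow> coord sV t e = 0"
  shows "t \<in> ct_null sV V sB W \<mm> n"
proof -
  let ?N = "ct_null sV V sB W \<mm> n"
  let ?X = "E n \<inter> W"
  have fin: "finite ?X"
    by (simp add: E_finite)
  have 1: "single (v, b) c - (\<Sum>e\<in>?X. base (sV (c * lam e b) v, e)) \<in> ?N" if v: "v \<in> V" and b: "b \<in> W" for v b c
  proof -
    define r where "r = b - (\<Sum>e\<in>E n. sB (lam e b) e)"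
    have bX: "b = (\<Sum>e\<in>?X. sB (lam e b) e) + r"
    proof -
      have "(\<Sum>e\<in>E n. sB (lam e b) e) = (\<Sum>e\<in>?X. sB (lam e b) e)"
        by (rule sum.mono_neutral_right) (use E_finite Wlam[OF b] in auto)
      then show ?thesis by (simp add: r_def)
    qed
    have inW: "(\<Sum>e\<in>?X. sB (lam e b) e) \<in> W"
      by (intro B.subspace_sum[OF W] B.subspace_scale[OF W]) auto
    have rW: "r \<in> W"
    proof -
      have "r = b - (\<Sum>e\<in>?X. sB (lam e b) e)"
        by (subst bX) simp
      then show ?thesis
        using B.subspace_diff[OF W b inW] by simp
    qed
    have rP: "r \<in> Pw n"
      unfolding r_def by (rule lam_sum)
    have "base (v, b) - base (v, \<Sum>e\<in>?X. sB (lam e b) e) \<in> ?N"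
      using fs.subspace_add[OF subspace_ct_null ct_null_rels(2)[OF v inW rW] ct_null_rels(5)[OF v rW rP]] bX by simp
    moreover have "base (v, \<Sum>e\<in>?X. sB (lam e b) e) - (\<Sum>e\<in>?X. base (v, sB (lam e b) e)) \<in> ?N"
      by (rule ct_null_sum_right[OF v]) (auto intro: B.subspace_scale[OF W])
    moreover have "(\<Sum>e\<in>?X. base (v, sB (lam e b) e)) - (\<Sum>e\<in>?X. single (v, e) (lam e b)) \<in> ?N"
      by (rule ct_null_sum_cong) (rule ct_null_rels(4)[OF v], simp)
    ultimately have 2: "base (v, b) - (\<Sum>e\<in>?X. single (v, e) (lam e b)) \<in> ?N"
      using ct_null_trans[OF ct_null_trans] by blast
    have "single (v, b) c - (\<Sum>e\<in>?X. single (v, e) (c * lam e b)) =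
        fscale c (base (v, b) - (\<Sum>e\<in>?X. single (v, e) (lam e b)))"
      by (simp add: fs.scale_right_diff_distrib fs.scale_sum_right)
    also have "\<dots> \<in> ?N"
      by (rule fs.subspace_scale[OF subspace_ct_null 2])
    finally have 3: "single (v, b) c - (\<Sum>e\<in>?X. single (v, e) (c * lam e b)) \<in> ?N" .
    have "(\<Sum>e\<in>?X. single (v, e) (c * lam e b)) - (\<Sum>e\<in>?X. base (sV (c * lam e b) v, e)) \<in> ?N"
    proof (rule ct_null_sum_cong)
      fix e assume e: "e \<in> ?X"
      have "- (base (sV (c * lam e b) v, e) - single (v, e) (c * lam e b)) \<in> ?N"
        by (rule fs.subspace_neg[OF subspace_ct_null ct_null_rels(3)[OF v]]) (use e in simp)
      then show "single (v, e) (c * lam e b) - base (sV (c * lam e b) v, e) \<in> ?N"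
        by simp
    qed
    with 3 show ?thesis by (rule ct_null_trans)
  qed
  have "t - (\<Sum>p\<in>keys t. \<Sum>e\<in>?X. base (sV (lookup t p * lam e (snd p)) (fst p), e)) \<in> ?N"
  proof -
    have "(\<Sum>p\<in>keys t. single p (lookup t p)) -
        (\<Sum>p\<in>keys t. \<Sum>e\<in>?X. base (sV (lookup t p * lam e (snd p)) (fst p), e)) \<in> ?N"
    proof (rule ct_null_sum_cong)
      fix p assume "p \<in> keys t"
      then have "fst p \<in> V" "snd p \<in> W"
        using t by auto
      from 1[OF this, of "lookup t p"]
      show "single p (lookup t p) - (\<Sum>e\<in>?X. base (sV (lookup t p * lam e (snd p)) (fst p), e)) \<in> ?N"
        by simp
    qed
    then show ?thesis by (simp only: single_add_lookup[symmetric])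
  qed
  moreover have "(\<Sum>p\<in>keys t. \<Sum>e\<in>?X. base (sV (lookup t p * lam e (snd p)) (fst p), e)) \<in> ?N"
  proof -
    have "(\<Sum>p\<in>keys t. base (sV (lookup t p * lam e (snd p)) (fst p), e)) \<in> ?N" if e: "e \<in> ?X" for e
    proof -
      have "base (\<Sum>p\<in>keys t. sV (lookup t p * lam e (snd p)) (fst p), e) -
          (\<Sum>p\<in>keys t. base (sV (lookup t p * lam e (snd p)) (fst p), e)) \<in> ?N"
        by (rule ct_null_sum_left) (use e t in \<open>auto intro!: V.subspace_scale[OF V]\<close>)
      moreover have "(\<Sum>p\<in>keys t. sV (lookup t p * lam e (snd p)) (fst p)) = coord sV t e"
        by (simp add: coord_def lin_ext_def case_prod_unfold)
      moreover have "base (0, e) \<in> ?N"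
        using ct_null_rels(3)[OF V.subspace_0[OF V], of e 0] e by simp
      ultimately show ?thesis
        using c0[of e] e fs.subspace_diff[OF subspace_ct_null, of "base (0, e)" n
          "base (0, e) - (\<Sum>p\<in>keys t. base (sV (lookup t p * lam e (snd p)) (fst p), e))"] by simp
    qed
    then show ?thesis
      by (subst sum.swap) (rule fs.subspace_sum[OF subspace_ct_null])
  qed
  ultimately show ?thesis
    using fs.subspace_add[OF subspace_ct_null, of "t - (\<Sum>p\<in>keys t. \<Sum>e\<in>?X. base (sV (lookup t p * lam e (snd p)) (fst p), e))" n
      "\<Sum>p\<in>keys t. \<Sum>e\<in>?X. base (sV (lookup t p * lam e (snd p)) (fst p), e)"] by simp
qed

lemma ct_class_iff:
  assumes Wlam: "\<And>b e i. b \<in> W \<Longrightarrow> e \<in> E i \<Longrightarrow> lam e b \<noteq> 0 \<Longrightarrow> e \<in> W"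
    and t: "keys t \<subseteq> V \<times> W"
  shows "t' \<in> ct_class sV V sB W \<mm> n t \<longleftrightarrow> keys t' \<subseteq> V \<times> W \<and> (\<forall>e\<in>E n. coord sV t' e = coord sV t e)"
proof
  assume "t' \<in> ct_class sV V sB W \<mm> n t"
  then have n: "t' - t \<in> ct_null sV V sB W \<mm> n"
    by (simp add: ct_class_def)
  have "keys ((t' - t) + t) \<subseteq> V \<times> W"
    using Poly_Mapping.keys_add[of "t' - t" t] ct_null_keys[OF n] t by blast
  moreover have "coord sV t' e = coord sV t e" if "e \<in> E n" for e
    using coord_ct_null[OF n that] by (simp add: module_hom.diff[OF coord_hom])
  ultimately show "keys t' \<subseteq> V \<times> W \<and> (\<forall>e\<in>E n. coord sV t' e = coord sV t e)"
    by simp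
next
  assume a: "keys t' \<subseteq> V \<times> W \<and> (\<forall>e\<in>E n. coord sV t' e = coord sV t e)"
  have "t' - t \<in> ct_null sV V sB W \<mm> n"
  proof (rule ct_null_of_coord[OF Wlam])
    show "keys (t' - t) \<subseteq> V \<times> W"
      using a t fs.subspace_diff[OF subspace_keys, of t' "V \<times> W" t] by simp
  qed (use a in \<open>simp_all add: module_hom.diff[OF coord_hom]\<close>)
  then show "t' \<in> ct_class sV V sB W \<mm> n t"
    by (simp add: ct_class_def)
qed

end

end

section \<open>The completed tensor product in coordinates\<close>

locale def_setup = reduction_setup G S \<phi> sA \<pi> sB \<mm> I + top_basis sB \<mm> E lam
  for G :: "('v, 'e) pre_digraph"
    and S :: "('v, 'e) qpath set"
    and \<phi> :: "('v, 'e) qpath \<Rightarrow> ('v, 'e) qpath \<Rightarrow>\<^sub>0 'k::field_char_0"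
    and sA :: "'k \<Rightarrow> 'a \<Rightarrow> 'a::ring"
    and \<pi> :: "(('v, 'e) qpath \<Rightarrow>\<^sub>0 'k) \<Rightarrow> 'a"
    and sB :: "'k \<Rightarrow> 'b \<Rightarrow> 'b::comm_ring_1"
    and \<mm> :: "'b set"
    and I :: "(('v, 'e) qpath \<Rightarrow>\<^sub>0 'k) set"
    and E :: "nat \<Rightarrow> 'b set" and lam :: "'b \<Rightarrow> 'b \<Rightarrow> 'k"
begin

text \<open>A function \<open>f\<close> stands for the infinite sum of the tensors \<open>f e \<otimes> e\<close>.\<close>

definition C :: "('b \<Rightarrow> 'a) set" where
  "C = {f. \<forall>e. e \<notin> Eu \<longrightarrow> f e = 0}"

definition K :: "nat \<Rightarrow> ('b \<Rightarrow> 'a) set" where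
  "K n = {f \<in> C. \<forall>e\<in>E n. f e = 0}"

definition lev :: "'b \<Rightarrow> nat" where
  "lev e = (LEAST n. e \<in> E n)"

text \<open>Basis elements outside \<open>E (lev e)\<close> lie in \<open>\<mm>\<close> to the power \<open>lev e\<close> and do not contribute to the value at \<open>e\<close>.\<close>

definition act :: "'b \<Rightarrow> ('b \<Rightarrow> 'a) \<Rightarrow> 'b \<Rightarrow> 'a" where
  "act b f = (\<lambda>e. if e \<in> Eu then \<Sum>e'\<in>E (lev e). sA (lam e (b * e')) (f e') else 0)"

definition iota :: "'a \<Rightarrow> 'b \<Rightarrow> 'a" where
  "iota a = (\<lambda>e. if e = 1 then a else 0)"

lemma Eu_I: "e \<in> E n \<Longrightarrow> e \<in> Eu"
  by blast

lemma lev: "e \<in> Eu \<Longrightarrow> e \<in> E (lev e)" and lev_le: "e \<in> E n \<Longrightarrow> lev e \<le> n"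
  unfolding lev_def by (auto intro: LeastI Least_le)

lemma one_Eu: "1 \<in> Eu"
  using E_1 by (intro UN_I[of "Suc 0"]) auto

lemma E_Suc_one: "1 \<in> E (Suc n)"
  using E_1 E_mono[of "Suc 0" "Suc n"] by auto

lemma act_eq:
  assumes "e \<in> E n"
  shows "act b f e = (\<Sum>e'\<in>E n. sA (lam e (b * e')) (f e'))"
proof -
  have "(\<Sum>e'\<in>E (lev e). sA (lam e (b * e')) (f e')) = (\<Sum>e'\<in>E n. sA (lam e (b * e')) (f e'))"
  proof (rule sum.mono_neutral_left[OF E_finite E_mono[OF lev_le[OF assms]]])
    show "\<forall>e'\<in>E n - E (lev e). sA (lam e (b * e')) (f e') = 0"
      using lam_Pw[OF Pw_mult_left[OF E_Pw] lev[OF Eu_I[OF assms]]] by auto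
  qed
  then show ?thesis
    using assms by (auto simp: act_def)
qed

lemma C_0 [simp]: "0 \<in> C" and C_add: "f \<in> C \<Longrightarrow> g \<in> C \<Longrightarrow> f + g \<in> C"
  and C_diff: "f \<in> C \<Longrightarrow> g \<in> C \<Longrightarrow> f - g \<in> C" and C_minus: "f \<in> C \<Longrightarrow> - f \<in> C"
  by (simp_all add: C_def)

lemma sum_fun_apply: "(\<Sum>i\<in>X. f i) e = (\<Sum>i\<in>X. f i e)" for f :: "'i \<Rightarrow> 'b \<Rightarrow> 'a"
  by (induction X rule: infinite_finite_induct) simp_all

lemma C_sum: "(\<And>i. i \<in> X \<Longrightarrow> f i \<in> C) \<Longrightarrow> (\<Sum>i\<in>X. f i) \<in> C"
  by (simp add: C_def sum_fun_apply)

lemma act_C [simp]: "act b f \<in> C" and iota_C [simp]: "iota a \<in> C"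
  using one_Eu by (auto simp: C_def act_def iota_def)

lemma act_add: "act b (f + g) = act b f + act b g"
  by (rule ext) (simp add: act_def A.scale_right_distrib sum.distrib)

lemma act_zero [simp]: "act b 0 = 0"
  by (rule ext) (simp add: act_def)

lemma act_sum: "act b (\<Sum>i\<in>X. f i) = (\<Sum>i\<in>X. act b (f i))"
  by (induction X rule: infinite_finite_induct) (simp_all only: sum.infinite sum.empty sum.insert act_zero act_add not_False_eq_True)

lemma act_diff: "act b (f - g) = act b f - act b g"
  using act_add[of b "f - g" g] by simp

lemma act_add_left: "act (b + b') f = act b f + act b' f"
  by (rule ext) (auto simp: act_def distrib_right lam_add A.scale_left_distrib sum.distrib[symmetric] intro!: sum.cong dest!: lev)

lemma act_scale: "act (sB c b) f = (\<lambda>e. sA c (act b f e))"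
  by (rule ext) (auto simp: act_def sB_mult lam_scale A.scale_sum_right intro!: sum.cong)

lemma act_zero_left [simp]: "act 0 f = 0"
  using act_add_left[of 0 0 f] by simp

lemma act_sum_left: "act (\<Sum>i\<in>X. b i) f = (\<Sum>i\<in>X. act (b i) f)"
  by (induction X rule: infinite_finite_induct) (simp_all add: act_add_left)

lemma act_mult: "act (b * b') f = act b (act b' f)"
proof
  fix e
  show "act (b * b') f e = act b (act b' f) e"
  proof (cases "e \<in> Eu")
    case True
    then obtain n where e: "e \<in> E n" by blast
    have "act b (act b' f) e = (\<Sum>e'\<in>E n. sA (lam e (b * e')) (\<Sum>e''\<in>E n. sA (lam e' (b' * e'')) (f e'')))"
      by (simp add: act_eq[OF e] act_eq)
    also have "\<dots> = (\<Sum>e''\<in>E n. sA (\<Sum>e'\<in>E n. lam e' (b' * e'') * lam e (b * e')) (f e''))"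
      by (simp add: A.scale_sum_right A.scale_sum_left mult.commute) (rule sum.swap)
    also have "\<dots> = act (b * b') f e"
      unfolding act_eq[OF e] lam_mult[OF e, symmetric] mult.assoc ..
    finally show ?thesis ..
  qed (auto simp: act_def)
qed

lemma act_one: "f \<in> C \<Longrightarrow> act 1 f = f"
proof
  fix e assume f: "f \<in> C"
  show "act 1 f e = f e"
  proof (cases "e \<in> Eu")
    case True
    then obtain n where e: "e \<in> E n" by blast
    have "act 1 f e = (\<Sum>e'\<in>E n. if e = e' then f e' else 0)"
      unfolding act_eq[OF e] by (rule sum.cong) (auto simp: lam_dual[OF e])
    then show ?thesis using e by (simp add: E_finite)
  qed (use f in \<open>auto simp: act_def C_def\<close>)
qed

lemma act_iota: "e \<in> Eu \<Longrightarrow> act b (iota a) e = sA (lam e b) a"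
proof -
  assume "e \<in> Eu"
  then obtain m where m: "e \<in> E m" by blast
  then have e: "e \<in> E (Suc m)"
    using E_mono[of m "Suc m"] by auto
  have "act b (iota a) e = (\<Sum>e'\<in>E (Suc m). if e' = 1 then sA (lam e b) a else 0)"
    unfolding act_eq[OF e] by (rule sum.cong) (auto simp: iota_def)
  then show ?thesis using E_Suc_one by (simp add: E_finite)
qed

lemma K_C: "f \<in> K n \<Longrightarrow> f \<in> C" and K_0: "K 0 = C"
  by (auto simp: K_def E_0)

lemma K_zero [simp]: "0 \<in> K n" and K_add: "f \<in> K n \<Longrightarrow> g \<in> K n \<Longrightarrow> f + g \<in> K n"
  and K_diff: "f \<in> K n \<Longrightarrow> g \<in> K n \<Longrightarrow> f - g \<in> K n" and K_minus: "f \<in> K n \<Longrightarrow> - f \<in> K n"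
  by (simp_all add: K_def C_add C_diff C_minus)

lemma K_sum: "(\<And>i. i \<in> X \<Longrightarrow> f i \<in> K n) \<Longrightarrow> (\<Sum>i\<in>X. f i) \<in> K n"
  by (induction X rule: infinite_finite_induct) (simp_all add: K_add)

lemma K_antimono: "i \<le> j \<Longrightarrow> f \<in> K j \<Longrightarrow> f \<in> K i"
  using E_mono[of i j] by (auto simp: K_def)

lemma K_Inter: "(\<And>n. f \<in> K n) \<Longrightarrow> f = 0"
proof
  fix e assume f: "\<And>n. f \<in> K n"
  show "f e = 0 e"
  proof (cases "e \<in> Eu")
    case True
    then obtain n where "e \<in> E n" by blast
    then show ?thesis using f[of n] by (simp add: K_def)
  qed (use f[of 0] in \<open>simp add: K_def C_def\<close>)
qed

lemma act_K:
  assumes "b \<in> Pw i" "f \<in> K j"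
  shows "act b f \<in> K (i + j)"
  unfolding K_def
proof (intro CollectI conjI ballI act_C)
  fix e assume e: "e \<in> E (i + j)"
  show "act b f e = 0"
    unfolding act_eq[OF e]
  proof (rule sum.neutral, rule ballI)
    fix e' assume e': "e' \<in> E (i + j)"
    show "sA (lam e (b * e')) (f e') = 0"
    proof (cases "e' \<in> E j")
      case True
      then show ?thesis using assms(2) by (simp add: K_def)
    next
      case False
      then show ?thesis
        using lam_Pw[OF Pw_mult[OF assms(1) E_Pw[OF e' False]] e] by simp
    qed
  qed
qed

lemma act_K_Suc: "x \<in> \<mm> \<Longrightarrow> f \<in> K n \<Longrightarrow> act x f \<in> K (Suc n)"
  using act_K[of x "Suc 0" f n] by (simp del: ideal_pow.simps)

lemma act_K_same: "f \<in> K n \<Longrightarrow> act b f \<in> K n"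
  using act_K[of b 0 f n] by simp

lemma act_Pw_K: "b \<in> Pw n \<Longrightarrow> f \<in> C \<Longrightarrow> act b f \<in> K n"
  using act_K[of b n f 0] by (simp add: K_0)

lemma expand_K:
  assumes "f \<in> C"
  shows "f - (\<Sum>e\<in>E n. act e (iota (f e))) \<in> K n"
  unfolding K_def
proof (intro CollectI conjI ballI C_diff assms C_sum act_C)
  fix e assume e: "e \<in> E n"
  have "(\<Sum>e'\<in>E n. act e' (iota (f e')) e) = (\<Sum>e'\<in>E n. if e = e' then f e' else 0)"
    by (rule sum.cong) (auto simp: act_iota[OF Eu_I[OF e]] lam_dual[OF e])
  then show "(f - (\<Sum>e\<in>E n. act e (iota (f e)))) e = 0"
    using e by (simp add: sum_fun_apply E_finite)
qed

text \<open>The filtration is the \<open>\<mm>\<close>-adic one; this is what makes \<open>B\<close>-linear maps continuous.\<close>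

lemma K_Suc_gens:
  assumes f: "f \<in> K (Suc n)"
  shows "\<exists>z. (\<forall>x. z x \<in> K n) \<and> f = (\<Sum>x\<in>gens. act x (z x))"
proof -
  have "\<exists>u. (\<forall>x. u x \<in> Pw (lev e - 2)) \<and> e = (\<Sum>x\<in>gens. x * u x)" if e: "e \<in> Eu" "e \<notin> E (Suc n)" for e
  proof -
    have l: "lev e > Suc n"
      using e lev[OF e(1)] E_mono[of "lev e" "Suc n"] by (meson not_le subsetD)
    have "e \<notin> E (lev e - 1)"
      using lev_le[of e "lev e - 1"] l by linarith
    then have "e \<in> Pw (Suc (lev e - 2))"
      using E_Pw[OF lev[OF e(1)], of "lev e - 1"] l by (simp add: Suc_diff_Suc numeral_2_eq_2 del: ideal_pow.simps)
    then show ?thesis by (rule Pw_Suc_gens)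
  qed
  then have "\<forall>e\<in>Eu - E (Suc n). \<exists>u. (\<forall>x. u x \<in> Pw (lev e - 2)) \<and> e = (\<Sum>x\<in>gens. x * u x)"
    by blast
  from bchoice[OF this] obtain u where
    u: "\<And>e x. e \<in> Eu \<Longrightarrow> e \<notin> E (Suc n) \<Longrightarrow> u e x \<in> Pw (lev e - 2)"
      "\<And>e. e \<in> Eu \<Longrightarrow> e \<notin> E (Suc n) \<Longrightarrow> e = (\<Sum>x\<in>gens. x * u e x)"
    by blast
  have f0: "f e = 0" if "e \<in> E (Suc n)" for e
    using f that by (simp add: K_def)
  define z where "z x = (\<lambda>e'. if e' \<in> Eu then \<Sum>e\<in>E (Suc (lev e')). sA (lam e' (u e x)) (f e) else 0)" for x
  have small: "sA (lam e' (u e x)) (f e) = 0" if "e \<in> Eu" "e \<notin> E (Suc k)" "e' \<in> E k" for e e' x k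
  proof (cases "e \<in> E (Suc n)")
    case False
    have "lev e > Suc k"
      using that(2) lev[OF that(1)] E_mono[of "lev e" "Suc k"] by (meson not_le subsetD)
    then have "k \<le> lev e - 2"
      by linarith
    from subsetD[OF Pw_antimono[OF this] u(1)[OF that(1) False]] have "u e x \<in> Pw k" .
    then show ?thesis
      using lam_Pw[OF _ that(3)] by simp
  qed (simp add: f0)
  have z_eq: "z x e' = (\<Sum>e\<in>E (Suc k). sA (lam e' (u e x)) (f e))" if e': "e' \<in> E k" for x e' k
  proof -
    have "(\<Sum>e\<in>E (Suc (lev e')). sA (lam e' (u e x)) (f e)) = (\<Sum>e\<in>E (Suc k). sA (lam e' (u e x)) (f e))"
    proof (rule sum.mono_neutral_left[OF E_finite E_mono])
      show "Suc (lev e') \<le> Suc k"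
        using lev_le[OF e'] by simp
      show "\<forall>e\<in>E (Suc k) - E (Suc (lev e')). sA (lam e' (u e x)) (f e) = 0"
        using small[OF Eu_I _ lev[OF Eu_I[OF e']]] by blast
    qed
    then show ?thesis
      using e' by (auto simp: z_def)
  qed
  have "z x \<in> K n" for x
    unfolding K_def
  proof (intro CollectI conjI ballI)
    show "z x \<in> C"
      by (simp add: C_def z_def)
    show "z x e' = 0" if "e' \<in> E n" for e'
      unfolding z_eq[OF that] by (rule sum.neutral) (simp add: f0)
  qed
  moreover have "f = (\<Sum>x\<in>gens. act x (z x))"
  proof
    fix e0
    show "f e0 = (\<Sum>x\<in>gens. act x (z x)) e0"
    proof (cases "e0 \<in> Eu")
      case True
      then obtain k where e0: "e0 \<in> E k" by blast
      have lx: "lam e0 (x * u e x) = (\<Sum>e'\<in>E k. lam e0 (x * e') * lam e' (u e x))" for x e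
        by (subst lam_mult[OF e0]) (simp only: mult.commute)
      have "(\<Sum>x\<in>gens. act x (z x)) e0 =
          (\<Sum>x\<in>gens. \<Sum>e'\<in>E k. \<Sum>e\<in>E (Suc k). sA (lam e0 (x * e') * lam e' (u e x)) (f e))"
        by (simp add: sum_fun_apply act_eq[OF e0] z_eq A.scale_sum_right)
      also have "\<dots> = (\<Sum>e\<in>E (Suc k). \<Sum>x\<in>gens. \<Sum>e'\<in>E k. sA (lam e0 (x * e') * lam e' (u e x)) (f e))"
        by (subst (2) sum.swap, subst sum.swap) (rule refl)
      also have "\<dots> = (\<Sum>e\<in>E (Suc k). sA (lam e0 (\<Sum>x\<in>gens. x * u e x)) (f e))"
        by (simp only: lam_sum'[OF e0] lx A.scale_sum_left)
      also have "\<dots> = (\<Sum>e\<in>E (Suc k). if e0 = e then f e else 0)"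
      proof (rule sum.cong)
        fix e assume e: "e \<in> E (Suc k)"
        show "sA (lam e0 (\<Sum>x\<in>gens. x * u e x)) (f e) = (if e0 = e then f e else 0)"
        proof (cases "e \<in> E (Suc n)")
          case False
          from u(2)[OF Eu_I[OF e] False] have "(\<Sum>x\<in>gens. x * u e x) = e"
            by (rule sym)
          then show ?thesis
            by (simp add: lam_dual[OF e0 e])
        qed (simp add: f0)
      qed simp
      also have "\<dots> = f e0"
        using e0 E_mono[of k "Suc k"] by (auto simp: E_finite)
      finally show ?thesis ..
    next
      case False
      moreover have "f \<in> C" "(\<Sum>x\<in>gens. act x (z x)) \<in> C"
        using K_C[OF f] by (auto intro: C_sum)
      ultimately show ?thesis by (simp add: C_def)
    qed
  qed
  ultimately show ?thesis by blast
qed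

definition fromC :: "('b \<Rightarrow> 'a) \<Rightarrow> nat \<Rightarrow> ('a \<times> 'b \<Rightarrow>\<^sub>0 'k) set" where
  "fromC f = (\<lambda>n. AB_class n (\<Sum>e\<in>E n. base (f e, e)))"

lemma coord_rep:
  assumes "vector_space sV" "e \<in> E n" "finite X" "X \<subseteq> E n"
  shows "coord sV (\<Sum>e\<in>X. base (f e, e)) e = (if e \<in> X then f e else 0)"
proof -
  interpret V: vector_space sV by fact
  have "coord sV (\<Sum>e\<in>X. base (f e, e)) e = (\<Sum>e'\<in>X. sV (lam e e') (f e'))"
    by (simp add: coord_def V.lin_ext_sum)
  also have "\<dots> = (\<Sum>e'\<in>X. if e = e' then f e' else 0)"
    by (rule sum.cong) (use assms lam_dual[OF assms(2)] in auto)
  finally show ?thesis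
    using assms(3) by simp
qed

lemmas AB_class_iff = ct_class_iff[OF vector_space_sA A.subspace_UNIV B.subspace_UNIV, simplified]

lemma mem_fromC: "t \<in> fromC f n \<longleftrightarrow> (\<forall>e\<in>E n. coord sA t e = f e)"
  unfolding fromC_def AB_class_iff by (simp add: coord_rep[OF vector_space_sA _ E_finite])

lemma AB_class_eq: "(\<And>e. e \<in> E n \<Longrightarrow> coord sA t e = f e) \<Longrightarrow> AB_class n t = fromC f n"
  by (rule set_eqI) (simp add: AB_class_iff mem_fromC)

lemma fromC_AB: "fromC f \<in> AB"
  unfolding AB_def ctensor_def
proof (intro CollectI allI conjI)
  fix n
  show "\<exists>t. keys t \<subseteq> UNIV \<times> UNIV \<and> fromC f n = AB_class n t"
    by (rule exI[of _ "\<Sum>e\<in>E n. base (f e, e)"]) (simp add: fromC_def)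
  show "fromC f (Suc n) \<subseteq> fromC f n"
  proof
    fix t assume "t \<in> fromC f (Suc n)"
    moreover have "E n \<subseteq> E (Suc n)"
      by (rule E_mono) simp
    ultimately show "t \<in> fromC f n"
      unfolding mem_fromC by blast
  qed
qed

lemma AB_fromC:
  assumes "x \<in> AB"
  shows "\<exists>f\<in>C. x = fromC f"
proof -
  have x: "\<And>n. \<exists>t. x n = AB_class n t" "\<And>n. x (Suc n) \<subseteq> x n"
    using assms by (auto simp: AB_def ctensor_def)
  from x(1) obtain t where t: "\<And>n. x n = AB_class n (t n)" by metis
  have mono: "x j \<subseteq> x i" if "i \<le> j" for i j
    by (rule lift_Suc_antimono_le[of x, OF x(2) that])
  have co: "coord sA (t j) e = coord sA (t i) e" if "i \<le> j" "e \<in> E i" for i j e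
  proof -
    have "t j \<in> x j"
      unfolding t by (simp add: AB_class_iff)
    then have "t j \<in> AB_class i (t i)"
      using mono[OF that(1)] t by blast
    then show ?thesis
      using that(2) by (simp add: AB_class_iff)
  qed
  define f where "f = (\<lambda>e. if e \<in> Eu then coord sA (t (lev e)) e else 0)"
  have "x = fromC f"
  proof
    fix n
    show "x n = fromC f n"
      unfolding t
    proof (rule AB_class_eq)
      fix e assume e: "e \<in> E n"
      then show "coord sA (t n) e = f e"
        using co[OF lev_le[OF e] lev[OF Eu_I[OF e]]] by (auto simp: f_def)
    qed
  qed
  moreover have "f \<in> C"
    by (simp add: C_def f_def)
  ultimately show ?thesis by blast
qed

lemma fromC_inj:
  assumes "f \<in> C" "g \<in> C" "fromC f = fromC g"
  shows "f = g"
proof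
  fix e
  show "f e = g e"
  proof (cases "e \<in> Eu")
    case True
    then obtain n where e: "e \<in> E n" by blast
    have "(\<Sum>e\<in>E n. base (f e, e)) \<in> fromC f n"
      unfolding mem_fromC by (simp add: coord_rep[OF vector_space_sA _ E_finite])
    then have "(\<Sum>e\<in>E n. base (f e, e)) \<in> fromC g n"
      by (simp add: assms(3))
    then show ?thesis
      unfolding mem_fromC using e by (simp add: coord_rep[OF vector_space_sA _ E_finite])
  qed (use assms in \<open>simp add: C_def\<close>)
qed

lemma fromC_mem_ex: "\<exists>t. t \<in> fromC f n"
  by (rule exI[of _ "\<Sum>e\<in>E n. base (f e, e)"]) (simp add: mem_fromC coord_rep[OF vector_space_sA _ E_finite])

lemma coordA_hom: "module_hom fscale sA (\<lambda>t. coord sA t e)"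
  by (rule coord_hom[OF vector_space_sA A.subspace_UNIV B.subspace_UNIV])

lemma UN_const: "X \<noteq> {} \<Longrightarrow> (\<And>x. x \<in> X \<Longrightarrow> F x = A) \<Longrightarrow> (\<Union>x\<in>X. F x) = A"
  by auto

lemma AB_add_fromC: "AB_add (fromC f) (fromC g) = fromC (f + g)"
proof
  fix n
  have "AB_class n (s + t) = fromC (f + g) n" if "s \<in> fromC f n" "t \<in> fromC g n" for s t
    by (rule AB_class_eq) (use that in \<open>simp add: mem_fromC module_hom.add[OF coordA_hom]\<close>)
  then show "AB_add (fromC f) (fromC g) n = fromC (f + g) n"
    unfolding AB_add_def using fromC_mem_ex[of f n] fromC_mem_ex[of g n] by (intro UN_const) auto
qed

lemma coord_b_act:
  assumes e: "e \<in> E n"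
  shows "coord sA (b_act b t) e = (\<Sum>e'\<in>E n. sA (lam e (b * e')) (coord sA t e'))"
proof -
  have "coord sA (b_act b t) e = lin_ext sA (\<lambda>p. coord sA (case p of (v, b') \<Rightarrow> base (v, b * b')) e) t"
    unfolding b_act_def by (rule module_hom_lin_ext[OF coordA_hom])
  also have "\<dots> = lin_ext sA (\<lambda>p. \<Sum>e'\<in>E n. sA (lam e (b * e')) (case p of (v, b') \<Rightarrow> sA (lam e' b') v)) t"
  proof (rule A.lin_ext_cong)
    fix p :: "'a \<times> 'b"
    obtain v b' where p: "p = (v, b')" by (cases p) auto
    have "sA (lam e (b * b')) v = (\<Sum>e'\<in>E n. sA (lam e (b * e')) (sA (lam e' b') v))"
      by (subst lam_mult[OF e]) (simp add: A.scale_sum_left mult.commute)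
    then show "coord sA (case p of (v, b') \<Rightarrow> base (v, b * b')) e =
        (\<Sum>e'\<in>E n. sA (lam e (b * e')) (case p of (v, b') \<Rightarrow> sA (lam e' b') v))"
      by (simp add: p coord_def)
  qed
  finally show ?thesis
    by (simp only: A.lin_ext_fun_sum A.lin_ext_fun_scale coord_def)
qed

lemma AB_scale_fromC: "AB_scale b (fromC f) = fromC (act b f)"
proof
  fix n
  have "AB_class n (b_act b s) = fromC (act b f) n" if "s \<in> fromC f n" for s
    by (rule AB_class_eq) (use that in \<open>simp add: mem_fromC coord_b_act act_eq\<close>)
  then show "AB_scale b (fromC f) n = fromC (act b f) n"
    unfolding AB_scale_def using fromC_mem_ex[of f n] by (intro UN_const) auto
qed

lemma reduces_to_fromC: "reduces_to (fromC f) a \<longleftrightarrow> f 1 = a"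
proof -
  have "AB_class (Suc 0) (base (a, 1)) = fromC (iota a) (Suc 0)"
    by (rule AB_class_eq) (auto simp: E_1 coord_def iota_def lam_dual[of 1 "Suc 0" 1 "Suc 0"])
  then have "reduces_to (fromC f) a \<longleftrightarrow> fromC f (Suc 0) = fromC (iota a) (Suc 0)"
    by (simp add: reduces_to_def)
  also have "\<dots> \<longleftrightarrow> f 1 = a"
  proof
    assume eq: "fromC f (Suc 0) = fromC (iota a) (Suc 0)"
    obtain t where "t \<in> fromC f (Suc 0)"
      using fromC_mem_ex by blast
    moreover from this have "t \<in> fromC (iota a) (Suc 0)"
      by (simp only: eq)
    ultimately show "f 1 = a"
      by (simp add: mem_fromC E_1 iota_def)
  next
    assume "f 1 = a"
    then show "fromC f (Suc 0) = fromC (iota a) (Suc 0)"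
      by (intro set_eqI) (simp add: mem_fromC E_1 iota_def)
  qed
  finally show ?thesis .
qed

end

section \<open>Linear maps over the base\<close>

context def_setup
begin

definition Blin :: "(('b \<Rightarrow> 'a) \<Rightarrow> 'b \<Rightarrow> 'a) \<Rightarrow> bool" where
  "Blin L \<longleftrightarrow> (\<forall>f g. L (f + g) = L f + L g) \<and> (\<forall>b f. L (act b f) = act b (L f)) \<and> (\<forall>f. L f \<in> C)"

lemma BlinD: "Blin L \<Longrightarrow> L (f + g) = L f + L g" "Blin L \<Longrightarrow> L (act b f) = act b (L f)" "Blin L \<Longrightarrow> L f \<in> C"
  by (simp_all add: Blin_def)

lemma Blin_zero: "Blin L \<Longrightarrow> L 0 = 0"
  using BlinD(1)[of L 0 0] by simp

lemma Blin_diff: "Blin L \<Longrightarrow> L (f - g) = L f - L g"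
  using BlinD(1)[of L "f - g" g] by simp

lemma Blin_sum: "Blin L \<Longrightarrow> L (\<Sum>i\<in>X. f i) = (\<Sum>i\<in>X. L (f i))"
  by (induction X rule: infinite_finite_induct)
    (simp_all only: sum.infinite sum.empty sum.insert Blin_zero BlinD(1) not_False_eq_True)

lemma Blin_K:
  assumes L: "Blin L"
  shows "f \<in> K n \<Longrightarrow> L f \<in> K n"
proof (induction n arbitrary: f)
  case 0
  then show ?case using BlinD(3)[OF L] by (simp add: K_0)
next
  case (Suc n)
  obtain z where z: "\<forall>x. z x \<in> K n" "f = (\<Sum>x\<in>gens. act x (z x))"
    using K_Suc_gens[OF Suc.prems] by blast
  have "L f = (\<Sum>x\<in>gens. act x (L (z x)))"
    unfolding z(2) Blin_sum[OF L] BlinD(2)[OF L] ..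
  then show ?case
    using z(1) Suc.IH by (auto intro!: K_sum act_K_Suc gens_mm)
qed

lemma Blin_small_K:
  assumes L: "Blin L" and small: "\<And>f. f \<in> C \<Longrightarrow> L f - f \<in> K (Suc 0)"
  shows "f \<in> K n \<Longrightarrow> L f - f \<in> K (Suc n)"
proof (induction n arbitrary: f)
  case 0
  then have "f \<in> C" by (simp only: K_0)
  then show ?case by (rule small)
next
  case (Suc n)
  obtain z where z: "\<forall>x. z x \<in> K n" "f = (\<Sum>x\<in>gens. act x (z x))"
    using K_Suc_gens[OF Suc.prems] by blast
  have "L f - f = (\<Sum>x\<in>gens. act x (L (z x) - z x))"
    unfolding z(2) Blin_sum[OF L] BlinD(2)[OF L] act_diff sum_subtractf ..
  then show ?case
    by (simp only:) (intro K_sum act_K_Suc gens_mm Suc.IH z(1)[rule_format])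
qed

text \<open>The value of a Cauchy sequence at each basis element is eventually constant.\<close>

lemma limit_ex:
  assumes X: "\<And>k. X k \<in> C" "\<And>k. X (Suc k) - X k \<in> K k"
  shows "\<exists>f\<in>C. \<forall>k. f - X k \<in> K k"
proof -
  define f where "f = (\<lambda>e. if e \<in> Eu then X (lev e) e else 0)"
  have fC: "f \<in> C"
    by (simp add: C_def f_def)
  have *: "X (lev e + d) e = X (lev e) e" if e: "e \<in> Eu" for e d
  proof (induction d)
    case (Suc d)
    have "e \<in> E (lev e + d)"
      using lev[OF e] E_mono[of "lev e" "lev e + d"] by auto
    then have "(X (Suc (lev e + d)) - X (lev e + d)) e = 0"
      using X(2)[of "lev e + d"] by (simp add: K_def)
    then show ?case
      using Suc by simp
  qed simp
  have "f - X k \<in> K k" for k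
    unfolding K_def
  proof (intro CollectI conjI ballI C_diff fC X(1))
    fix e assume e: "e \<in> E k"
    show "(f - X k) e = 0"
      using *[OF Eu_I[OF e], of "k - lev e"] lev_le[OF e] Eu_I[OF e] by (auto simp: f_def)
  qed
  with fC show ?thesis by blast
qed

text \<open>A preimage of \<open>g\<close> is the limit of the iteration \<open>f \<mapsto> f + (g - L f)\<close>.\<close>

lemma Blin_bij:
  assumes L: "Blin L" and small: "\<And>f. f \<in> C \<Longrightarrow> L f - f \<in> K (Suc 0)"
  shows "bij_betw L C C"
proof (rule bij_betw_imageI)
  show "inj_on L C"
  proof (rule inj_onI)
    fix f g assume fg: "f \<in> C" "g \<in> C" "L f = L g"
    have "f - g \<in> K n" for n
    proof (induction n)
      case 0
      show ?case unfolding K_0 by (rule C_diff[OF fg(1,2)])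
    next
      case (Suc n)
      have "L (f - g) = 0"
        unfolding Blin_diff[OF L] fg(3) by simp
      with K_minus[OF Blin_small_K[OF L small Suc]] have "- (0 - (f - g)) \<in> K (Suc n)"
        by (simp only:)
      then show ?case by (simp only: diff_0 minus_minus)
    qed
    then have "f - g = 0" by (rule K_Inter)
    then show "f = g" by simp
  qed
  show "L ` C = C"
  proof (intro equalityI subsetI)
    fix g assume g: "g \<in> C"
    define X where "X = rec_nat 0 (\<lambda>_ f. f + (g - L f))"
    have X: "X 0 = 0" "\<And>k. X (Suc k) = X k + (g - L (X k))"
      by (simp_all add: X_def)
    have XC: "X k \<in> C" for k
    proof (induction k)
      case (Suc k)
      then show ?case unfolding X(2) by (intro C_add C_diff g BlinD(3)[OF L])
    qed (simp only: X(1) C_0)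
    have R: "g - L (X k) \<in> K k" for k
    proof (induction k)
      case 0
      then show ?case unfolding K_0 by (intro C_diff g BlinD(3)[OF L])
    next
      case (Suc k)
      have "g - L (X (Suc k)) = - (L (g - L (X k)) - (g - L (X k)))"
        unfolding X(2) BlinD(1)[OF L] by simp
      with K_minus[OF Blin_small_K[OF L small Suc]] show ?case
        by (simp only:)
    qed
    have "X (Suc k) - X k \<in> K k" for k
      using R[of k] by (simp add: X(2))
    from limit_ex[of X, OF XC this] obtain f where f: "f \<in> C" "\<And>k. f - X k \<in> K k"
      by blast
    have "g - L f \<in> K k" for k
      using K_diff[OF R[of k] Blin_K[OF L f(2)[of k]]] by (simp add: Blin_diff[OF L])
    then have "g - L f = 0" by (rule K_Inter)
    then show "g \<in> L ` C" using f(1) by (intro image_eqI[of _ _ f]) simp_all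
  qed (use BlinD(3)[OF L] in auto)
qed

definition sF :: "'k \<Rightarrow> ('b \<Rightarrow> 'a) \<Rightarrow> 'b \<Rightarrow> 'a" where
  "sF c f = (\<lambda>e. sA c (f e))"

sublocale F: vector_space sF
  by standard (simp_all add: sF_def fun_eq_iff A.scale_right_distrib A.scale_left_distrib)

lemma sF_act: "f \<in> C \<Longrightarrow> sF c f = act (sB c 1) f"
  using act_scale[of c 1 f] by (simp add: act_one sF_def)

lemma C_sF: "f \<in> C \<Longrightarrow> sF c f \<in> C"
  by (simp add: C_def sF_def)

lemma C_lin_ext: "(\<And>u. u \<in> keys x \<Longrightarrow> g u \<in> C) \<Longrightarrow> lin_ext sF g x \<in> C"
  unfolding lin_ext_def by (intro C_sum C_sF)

lemma iota_hom: "module_hom sA sF iota"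
  by (intro module_hom.intro module_hom_axioms.intro A.module_axioms F.module_axioms)
    (auto simp: iota_def sF_def)

lemma K_1_iff: "f \<in> K (Suc 0) \<longleftrightarrow> f \<in> C \<and> f 1 = 0"
  by (auto simp: K_def E_1)

end

section \<open>Deformed products in coordinates\<close>

locale C_algebra = def_setup G S \<phi> sA \<pi> sB \<mm> I E lam
  for G :: "('v, 'e) pre_digraph"
    and S :: "('v, 'e) qpath set"
    and \<phi> :: "('v, 'e) qpath \<Rightarrow> ('v, 'e) qpath \<Rightarrow>\<^sub>0 'k::field_char_0"
    and sA :: "'k \<Rightarrow> 'a \<Rightarrow> 'a::ring"
    and \<pi> :: "(('v, 'e) qpath \<Rightarrow>\<^sub>0 'k) \<Rightarrow> 'a"
    and sB :: "'k \<Rightarrow> 'b \<Rightarrow> 'b::comm_ring_1"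
    and \<mm> :: "'b set"
    and I :: "(('v, 'e) qpath \<Rightarrow>\<^sub>0 'k) set"
    and E :: "nat \<Rightarrow> 'b set" and lam :: "'b \<Rightarrow> 'b \<Rightarrow> 'k" +
  fixes st :: "('b \<Rightarrow> 'a) \<Rightarrow> ('b \<Rightarrow> 'a) \<Rightarrow> 'b \<Rightarrow> 'a"
  assumes st_C [simp]: "st f g \<in> C"
    and st_add_left: "st (f + f') g = st f g + st f' g"
    and st_add_right: "st f (g + g') = st f g + st f g'"
    and st_assoc: "st (st f g) h = st f (st g h)"
    and st_act_left: "st (act b f) g = act b (st f g)"
    and st_act_right: "st f (act b g) = act b (st f g)"
    and st_one: "st f g 1 = f 1 * g 1"
begin

lemma Blin_left: "Blin (\<lambda>f. st f g)" and Blin_right: "Blin (st f)"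
  by (simp_all add: Blin_def st_add_left st_add_right st_act_left st_act_right)

lemmas st_zero_left [simp] = Blin_zero[OF Blin_left]
  and st_zero_right [simp] = Blin_zero[OF Blin_right]
  and st_diff_left = Blin_diff[OF Blin_left]
  and st_diff_right = Blin_diff[OF Blin_right]
  and st_sum_left = Blin_sum[OF Blin_left]
  and st_sum_right = Blin_sum[OF Blin_right]
  and st_K_left = Blin_K[OF Blin_left]
  and st_K_right = Blin_K[OF Blin_right]

lemma st_K_Suc:
  assumes "f \<in> K (Suc 0)" "g \<in> K n"
  shows "st f g \<in> K (Suc n)"
proof -
  obtain z where "f = (\<Sum>x\<in>gens. act x (z x))"
    using K_Suc_gens[OF assms(1)] by blast
  then have "st f g = (\<Sum>x\<in>gens. act x (st (z x) g))"
    by (simp only: st_sum_left st_act_left)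
  then show ?thesis
    using st_K_right[OF assms(2)] by (auto intro!: K_sum act_K_Suc gens_mm)
qed

lemma st_sF_right: "g \<in> C \<Longrightarrow> st f (sF c g) = sF c (st f g)"
  by (simp add: sF_act st_act_right)

lemma st_sF_left: "f \<in> C \<Longrightarrow> st (sF c f) g = sF c (st f g)"
  by (simp add: sF_act st_act_left)

lemma st_lin_ext_right: "(\<And>u. u \<in> keys x \<Longrightarrow> h u \<in> C) \<Longrightarrow> st f (lin_ext sF h x) = lin_ext sF (\<lambda>u. st f (h u)) x"
  unfolding lin_ext_def st_sum_right by (rule sum.cong) (simp_all add: st_sF_right)

lemma st_lin_ext_left: "(\<And>u. u \<in> keys x \<Longrightarrow> h u \<in> C) \<Longrightarrow> st (lin_ext sF h x) g = lin_ext sF (\<lambda>u. st (h u) g) x"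
  unfolding lin_ext_def st_sum_left by (rule sum.cong) (simp_all add: st_sF_left)

text \<open>Newton's iteration \<open>x \<mapsto> 3 x\<^sup>2 - 2 x\<^sup>3\<close> for idempotents, written as \<open>x + u\<close> with
  \<open>u = d - 2 x d\<close> and \<open>d = x\<^sup>2 - x\<close>.\<close>

lemma idempotent_lift:
  assumes p: "p \<in> C" "st p p - p \<in> K (Suc 0)"
  shows "\<exists>e\<in>C. st e e = e \<and> e - p \<in> K (Suc 0) \<and>
    (\<forall>f. (st f p = 0 \<longrightarrow> st f e = 0) \<and> (st p f = 0 \<longrightarrow> st e f = 0))"
proof -
  define d where "d x = st x x - x" for x
  define u where "u x = d x - (st x (d x) + st x (d x))" for x
  define X where "X = rec_nat p (\<lambda>_ x. x + u x)"
  have X: "X 0 = p" "\<And>k. X (Suc k) = X k + u (X k)"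
    by (simp_all add: X_def)
  have XC: "X k \<in> C" for k
  proof (induction k)
    case (Suc k)
    then show ?case unfolding X(2) u_def d_def by (intro C_add C_diff st_C)
  qed (simp add: X(1) p)
  have uK: "u x \<in> K n" if "d x \<in> K n" for x n
    unfolding u_def by (intro K_diff K_add that st_K_right)
  have dd: "d (x + u x) = st (u x) (u x) - (st (d x) (d x) + st (d x) (d x) + st (d x) (d x) + st (d x) (d x))" for x
    unfolding u_def d_def
    by (simp only: st_add_left st_add_right st_diff_left st_diff_right st_assoc) (simp only: algebra_simps)
  have dK: "d (X k) \<in> K (Suc k)" for k
  proof (induction k)
    case 0
    show ?case unfolding X(1) d_def by (rule p(2))
  next
    case (Suc k)
    have d1: "d (X k) \<in> K (Suc 0)"
      by (rule K_antimono[OF _ Suc]) simp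
    show ?case
      unfolding X(2) dd
      by (intro K_diff K_add st_K_Suc uK Suc d1)
  qed
  have "X (Suc k) - X k \<in> K k" for k
    using K_antimono[OF _ uK[OF dK[of k]], of k] by (simp add: X(2))
  from limit_ex[of X, OF XC this] obtain e where e: "e \<in> C" "\<And>k. e - X k \<in> K k"
    by blast
  have "st e e - e \<in> K k" for k
  proof -
    have "st e e - e = st (e - X k) e + st (X k) (e - X k) + d (X k) - (e - X k)"
      by (simp add: st_diff_left st_diff_right d_def)
    also have "\<dots> \<in> K k"
      using K_antimono[OF _ dK[of k], of k] by (intro K_diff K_add st_K_left st_K_right e(2)) simp
    finally show ?thesis .
  qed
  then have idem: "st e e = e"
    using K_Inter[of "st e e - e"] by simp
  have "X k - p \<in> K (Suc 0)" for k
  proof (induction k)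
    case (Suc k)
    have uX: "u (X k) \<in> K (Suc 0)"
      by (rule K_antimono[OF _ uK[OF dK[of k]]]) simp
    have "X (Suc k) - p = (X k - p) + u (X k)"
      unfolding X(2) by simp
    with K_add[OF Suc uX] show ?case by (simp only:)
  qed (simp only: X(1) diff_self K_zero)
  from K_add[OF e(2)[of "Suc 0"] this[of "Suc 0"]] have ep: "e - p \<in> K (Suc 0)"
    by simp
  have "st f e = 0" if "st f p = 0" for f
  proof -
    have "st f (X k) = 0" for k
    proof (induction k)
      case (Suc k)
      have z: "st f (st (X k) g) = 0" for g
        unfolding st_assoc[symmetric] Suc by simp
      show ?case
        unfolding X(2) u_def d_def st_add_right st_diff_right Suc z by simp
    qed (simp add: X(1) that)
    then have "st f e \<in> K k" for k
      using st_K_right[OF e(2)[of k], of f] by (simp add: st_diff_right)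
    then show ?thesis by (rule K_Inter)
  qed
  moreover have "st e f = 0" if "st p f = 0" for f
  proof -
    have "st (X k) f = 0" for k
    proof (induction k)
      case (Suc k)
      have z: "st (st g (X k)) f = 0" for g
        unfolding st_assoc Suc by simp
      have z2: "st (st g (st (X k) (X k))) f = 0" for g
        unfolding st_assoc Suc by simp
      show ?case
        unfolding X(2) u_def d_def st_add_left st_diff_left st_add_right st_diff_right Suc z z2 by simp
    qed (simp add: X(1) that)
    then have "st e f \<in> K k" for k
      using st_K_left[OF e(2)[of k], of f] by (simp add: st_diff_left)
    then show ?thesis by (rule K_Inter)
  qed
  ultimately show ?thesis
    using e(1) idem ep by blast
qed

text \<open>Let \<open>f\<close> be the sum of the orthogonal lifts found so far. The next idempotent \<open>q\<close> is first compressed to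
  \<open>(1 - f) q (1 - f)\<close>, and Newton's iteration preserves the orthogonality to \<open>f\<close>.\<close>

lemma orthogonal_idempotents:
  assumes "finite V" "V \<subseteq> verts G"
  shows "\<exists>h. (\<forall>v\<in>V. h v \<in> C \<and> h v 1 = ev v) \<and> (\<forall>v\<in>V. \<forall>w\<in>V. st (h v) (h w) = (if v = w then h v else 0))"
  using assms
proof (induction V rule: finite_induct)
  case (insert v V)
  have "V \<subseteq> verts G" using insert.prems by simp
  from insert.IH[OF this] obtain h where hh: "(\<forall>v\<in>V. h v \<in> C \<and> h v 1 = ev v) \<and>
      (\<forall>v\<in>V. \<forall>w\<in>V. st (h v) (h w) = (if v = w then h v else 0))"
    by (elim exE)
  have h: "\<And>v. v \<in> V \<Longrightarrow> h v \<in> C" "\<And>v. v \<in> V \<Longrightarrow> h v 1 = ev v"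
      "\<And>v w. v \<in> V \<Longrightarrow> w \<in> V \<Longrightarrow> st (h v) (h w) = (if v = w then h v else 0)"
    using hh by simp_all
  have vG: "v \<in> verts G" "V \<subseteq> verts G"
    using insert.prems by auto
  define f where "f = (\<Sum>v\<in>V. h v)"
  define q where "q = iota (ev v)"
  define p where "p = q - st f q - st q f + st f (st q f)"
  have fh: "st f (h w) = h w" "st (h w) f = h w" if "w \<in> V" for w
    using that insert.hyps(1) unfolding f_def st_sum_left st_sum_right by (simp_all add: h(3) if_distrib cong: if_cong)
  have ff: "st f f = f"
  proof -
    have "st f f = (\<Sum>w\<in>V. st f (h w))"
      by (subst (2) f_def) (rule st_sum_right)
    also have "\<dots> = (\<Sum>w\<in>V. h w)"
      by (rule sum.cong[OF refl]) (rule fh)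
    finally show ?thesis by (simp only: f_def)
  qed
  have f1: "f 1 = (\<Sum>w\<in>V. ev w)"
    by (simp add: f_def sum_fun_apply h(2))
  have o: "f 1 * ev v = 0" "ev v * f 1 = 0"
    unfolding f1 sum_distrib_left sum_distrib_right
    by (rule sum.neutral, use insert.hyps(2) vG ev_ev in auto)+
  have p1: "p 1 = ev v"
    by (simp add: p_def st_one q_def iota_def o mult.assoc[symmetric])
  have pC: "p \<in> C"
    unfolding p_def q_def by (intro C_add C_diff st_C iota_C)
  have fp: "st f p = 0"
    unfolding p_def by (simp only: st_add_right st_diff_right st_assoc[symmetric] ff) simp
  have pf: "st p f = 0"
    unfolding p_def by (simp only: st_add_left st_diff_left st_assoc ff) simp
  have "st p p - p \<in> K (Suc 0)"
    by (simp add: K_1_iff C_diff pC st_one p1 ev_ev vG)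
  from idempotent_lift[OF pC this] obtain e where e: "e \<in> C" "st e e = e" "e - p \<in> K (Suc 0)" "st f e = 0" "st e f = 0"
    using fp pf by blast
  have e1: "e 1 = ev v"
    using e(3) p1 by (simp add: K_1_iff)
  have he: "st (h w) e = 0" "st e (h w) = 0" if "w \<in> V" for w
  proof -
    have "st (h w) e = st (st (h w) f) e" "st e (h w) = st e (st f (h w))"
      by (simp_all add: fh[OF that])
    then show "st (h w) e = 0" "st e (h w) = 0"
      by (simp_all add: st_assoc e(4)) (simp add: st_assoc[symmetric] e(5))
  qed
  show ?case
    by (rule exI[of _ "h(v := e)"]) (use insert.hyps(2) h e e1 he in auto)
qed simp

definition idem :: "'v \<Rightarrow> 'b \<Rightarrow> 'a" where
  "idem = (SOME h. (\<forall>v\<in>verts G. h v \<in> C \<and> h v 1 = ev v) \<and>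
     (\<forall>v\<in>verts G. \<forall>w\<in>verts G. st (h v) (h w) = (if v = w then h v else 0)))"

lemma idem: "v \<in> verts G \<Longrightarrow> idem v \<in> C" "v \<in> verts G \<Longrightarrow> idem v 1 = ev v"
  "v \<in> verts G \<Longrightarrow> w \<in> verts G \<Longrightarrow> st (idem v) (idem w) = (if v = w then idem v else 0)"
  using someI_ex[OF orthogonal_idempotents[OF finite_verts subset_refl]] unfolding idem_def by auto

definition arrow :: "'e \<Rightarrow> 'b \<Rightarrow> 'a" where
  "arrow x = st (idem (tail G x)) (st (iota (\<pi>p (tail G x, [x]))) (idem (head G x)))"

fun Th :: "('v, 'e) qpath \<Rightarrow> 'b \<Rightarrow> 'a" where
  "Th (v, []) = idem v"
| "Th (v, x # xs) = st (arrow x) (Th (head G x, xs))"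

lemma Th_C: "p \<in> paths G \<Longrightarrow> Th p \<in> C"
  by (cases p rule: Th.cases) (auto simp: idem)

lemma Th_left: "p \<in> paths G \<Longrightarrow> v \<in> verts G \<Longrightarrow> st (idem v) (Th p) = (if src p = v then Th p else 0)"
proof (cases p rule: Th.cases)
  case (2 u x xs)
  assume a: "p \<in> paths G" "v \<in> verts G"
  then have x: "x \<in> arcs G" "u = tail G x"
    using 2 by auto
  have "st (idem v) (arrow x) = (if v = u then arrow x else 0)"
    unfolding arrow_def st_assoc[symmetric] using a(2) x by (simp add: idem)
  then show ?thesis
    unfolding 2 Th.simps st_assoc[symmetric] by simp
qed (auto simp: idem)

lemma Th_right: "p \<in> paths G \<Longrightarrow> v \<in> verts G \<Longrightarrow> st (Th p) (idem v) = (if tgt G p = v then Th p else 0)"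
  by (induction p rule: Th.induct) (auto simp: idem st_assoc)

lemma Th_one: "p \<in> paths G \<Longrightarrow> Th p 1 = \<pi>p p"
proof (induction p rule: Th.induct)
  case (2 v x xs)
  then have x: "x \<in> arcs G" "v = tail G x" "(head G x, xs) \<in> paths G"
    by auto
  have px: "(tail G x, [x]) \<in> paths G"
    using x(1) by simp
  have "arrow x 1 = ev (tail G x) * (\<pi>p (tail G x, [x]) * ev (head G x))"
    using x(1) by (simp add: arrow_def st_one idem iota_def)
  also have "\<dots> = \<pi>p (tail G x, [x])"
    using x(1) px by (simp add: pp_ev ev_pp)
  finally have "Th (v, x # xs) 1 = \<pi>p (tail G x, [x]) * \<pi>p (head G x, xs)"
    using 2 x by (simp add: st_one)
  also have "\<dots> = \<pi>p (v, x # xs)"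
    using px x by (subst pp_pcat) (simp_all add: pcat_def)
  finally show ?case .
qed (simp add: idem)

definition tauT :: "'a \<Rightarrow> 'b \<Rightarrow> 'a" where
  "tauT a = lin_ext sF Th (\<sigma> a)"

lemma Th_sigma_C: "u \<in> keys (\<sigma> a) \<Longrightarrow> Th u \<in> C"
  by (rule Th_C[OF irr_paths[OF sigma_irr]])

lemma tauT_C [simp]: "tauT a \<in> C"
  unfolding tauT_def by (rule C_lin_ext[OF Th_sigma_C])

lemma tauT_hom: "module_hom sA sF tauT"
  unfolding tauT_def[abs_def]
  by (intro module_hom.intro module_hom_axioms.intro A.module_axioms F.module_axioms)
    (simp_all add: sigma_add sigma_scale F.lin_ext_add F.lin_ext_fscale)

lemma tauT_irr: "u \<in> irr G S \<Longrightarrow> tauT (\<pi>p u) = Th u"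
  by (simp add: tauT_def sigma_pi_irr)

lemma tauT_one: "tauT a 1 = a"
proof -
  have "tauT a 1 = lin_ext sA (\<lambda>u. Th u 1) (\<sigma> a)"
    by (simp add: tauT_def lin_ext_def sum_fun_apply sF_def)
  also have "\<dots> = lin_ext sA \<pi>p (\<sigma> a)"
    by (rule A.lin_ext_cong) (rule Th_one[OF irr_paths[OF sigma_irr]])
  finally show ?thesis by (simp add: expand)
qed

text \<open>The \<open>B\<close>-linear continuous extension of \<open>tauT\<close>.\<close>

definition T :: "('b \<Rightarrow> 'a) \<Rightarrow> 'b \<Rightarrow> 'a" where
  "T f = (\<lambda>e. if e \<in> Eu then (\<Sum>e'\<in>E (lev e). act e' (tauT (f e'))) e else 0)"

lemma T_C [simp]: "T f \<in> C"
  by (simp add: T_def C_def)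

lemma T_K: "T f - (\<Sum>e\<in>E n. act e (tauT (f e))) \<in> K n"
  unfolding K_def
proof (intro CollectI conjI ballI C_diff T_C C_sum act_C)
  fix e assume e: "e \<in> E n"
  have "(\<Sum>e'\<in>E (lev e). act e' (tauT (f e')) e) = (\<Sum>e'\<in>E n. act e' (tauT (f e')) e)"
  proof (rule sum.mono_neutral_left[OF E_finite E_mono[OF lev_le[OF e]]], rule ballI)
    fix e' assume "e' \<in> E n - E (lev e)"
    then have "act e' (tauT (f e')) \<in> K (lev e)"
      using E_Pw[of e' n "lev e"] by (intro act_Pw_K) auto
    then show "act e' (tauT (f e')) e = 0"
      using lev[OF Eu_I[OF e]] by (simp add: K_def)
  qed
  then show "(T f - (\<Sum>e\<in>E n. act e (tauT (f e)))) e = 0"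
    using e by (auto simp: T_def sum_fun_apply)
qed

lemma eq_mod_K: "(\<And>n. f - g \<in> K n) \<Longrightarrow> f = g"
  using K_Inter[of "f - g"] by simp

lemma T_iota: "T (iota a) = tauT a"
proof (rule eq_mod_K)
  fix n
  have "(\<Sum>e\<in>E (Suc n). act e (tauT (iota a e))) = (\<Sum>e\<in>E (Suc n). if e = 1 then tauT a else 0)"
    by (rule sum.cong) (auto simp: iota_def act_one module_hom.zero[OF tauT_hom])
  then have "(\<Sum>e\<in>E (Suc n). act e (tauT (iota a e))) = tauT a"
    using E_Suc_one by (simp add: E_finite)
  then show "T (iota a) - tauT a \<in> K n"
    using K_antimono[OF _ T_K[of "iota a" "Suc n"], of n] by simp
qed

lemma T_one: "T f 1 = f 1"
proof -
  have "(T f - (\<Sum>e\<in>E (Suc 0). act e (tauT (f e)))) 1 = 0"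
    using T_K[of f "Suc 0"] by (simp add: K_1_iff)
  then show ?thesis
    by (simp add: E_1 act_one tauT_one)
qed

lemma Blin_T: "Blin T"
  unfolding Blin_def
proof (intro conjI allI T_C)
  show "T (f + g) = T f + T g" for f g
    by (rule ext) (simp add: T_def module_hom.add[OF tauT_hom] act_add sum_fun_apply sum.distrib)
  fix b f
  show "T (act b f) = act b (T f)"
  proof (rule eq_mod_K)
    fix n
    let ?t = "\<lambda>e. tauT (f e)"
    have "(\<Sum>e\<in>E n. act e (tauT (act b f e))) = (\<Sum>e\<in>E n. \<Sum>e'\<in>E n. act (sB (lam e (b * e')) e) (?t e'))"
    proof (rule sum.cong)
      fix e assume e: "e \<in> E n"
      have "tauT (act b f e) = (\<Sum>e'\<in>E n. sF (lam e (b * e')) (?t e'))"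
        by (simp add: act_eq[OF e] module_hom.sum[OF tauT_hom] module_hom.scale[OF tauT_hom])
      then show "act e (tauT (act b f e)) = (\<Sum>e'\<in>E n. act (sB (lam e (b * e')) e) (?t e'))"
        by (simp add: act_sum sF_act act_mult[symmetric] sB_mult)
    qed simp
    also have "\<dots> = (\<Sum>e'\<in>E n. act (\<Sum>e\<in>E n. sB (lam e (b * e')) e) (?t e'))"
      by (subst sum.swap) (simp only: act_sum_left)
    finally have 1: "(\<Sum>e\<in>E n. act e (tauT (act b f e))) = (\<Sum>e'\<in>E n. act (\<Sum>e\<in>E n. sB (lam e (b * e')) e) (?t e'))" .
    have "act b (\<Sum>e\<in>E n. act e (?t e)) - (\<Sum>e\<in>E n. act e (tauT (act b f e))) =
        (\<Sum>e'\<in>E n. act (b * e' - (\<Sum>e\<in>E n. sB (lam e (b * e')) e)) (?t e'))"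
    proof -
      have "act (b * e' - (\<Sum>e\<in>E n. sB (lam e (b * e')) e)) (?t e') =
          act b (act e' (?t e')) - act (\<Sum>e\<in>E n. sB (lam e (b * e')) e) (?t e')" for e'
        using act_add_left[of "b * e' - (\<Sum>e\<in>E n. sB (lam e (b * e')) e)" "\<Sum>e\<in>E n. sB (lam e (b * e')) e" "?t e'"]
        by (simp add: act_mult)
      then show ?thesis
        by (simp only: 1 act_sum sum_subtractf)
    qed
    also have "\<dots> \<in> K n"
      by (intro K_sum act_Pw_K lam_sum tauT_C)
    finally have 2: "act b (\<Sum>e\<in>E n. act e (?t e)) - (\<Sum>e\<in>E n. act e (tauT (act b f e))) \<in> K n" .
    have 3: "act b (T f) - act b (\<Sum>e\<in>E n. act e (?t e)) \<in> K n"
      unfolding act_diff[symmetric] by (rule act_K_same[OF T_K])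
    have "T (act b f) - act b (T f) = (T (act b f) - (\<Sum>e\<in>E n. act e (tauT (act b f e)))) -
        (act b (\<Sum>e\<in>E n. act e (?t e)) - (\<Sum>e\<in>E n. act e (tauT (act b f e)))) -
        (act b (T f) - act b (\<Sum>e\<in>E n. act e (?t e)))"
      by simp
    with K_diff[OF K_diff[OF T_K[of "act b f" n] 2] 3] show "T (act b f) - act b (T f) \<in> K n"
      by (simp only:)
  qed
qed

lemma T_bij: "bij_betw T C C"
  by (rule Blin_bij[OF Blin_T]) (simp add: K_1_iff C_diff T_one)

definition Ti :: "('b \<Rightarrow> 'a) \<Rightarrow> 'b \<Rightarrow> 'a" where
  "Ti = inv_into C T"

lemma Ti_C: "f \<in> C \<Longrightarrow> Ti f \<in> C" and T_Ti: "f \<in> C \<Longrightarrow> T (Ti f) = f" and Ti_T: "f \<in> C \<Longrightarrow> Ti (T f) = f"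
  using T_bij inv_into_into[of f T C] f_inv_into_f[of f T C] inv_into_f_f[of T C f] unfolding Ti_def bij_betw_def
  by simp_all

lemma T_inj: "f \<in> C \<Longrightarrow> g \<in> C \<Longrightarrow> T f = T g \<Longrightarrow> f = g"
  using T_bij by (auto simp: bij_betw_def inj_on_def)

definition st' :: "('b \<Rightarrow> 'a) \<Rightarrow> ('b \<Rightarrow> 'a) \<Rightarrow> 'b \<Rightarrow> 'a" where
  "st' f g = Ti (st (T f) (T g))"

lemma st'_C: "st' f g \<in> C" and T_st': "T (st' f g) = st (T f) (T g)"
  by (simp_all add: st'_def Ti_C T_Ti)

lemma C_algebra_st': "C_algebra G S \<phi> sA \<pi> sB \<mm> I E lam st'"
proof (unfold_locales)
  fix f f' g g' h b
  show "st' f g \<in> C" by (rule st'_C)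
  show "st' (f + f') g = st' f g + st' f' g"
    by (rule T_inj) (simp_all add: st'_C C_add T_st' BlinD(1)[OF Blin_T] st_add_left)
  show "st' f (g + g') = st' f g + st' f g'"
    by (rule T_inj) (simp_all add: st'_C C_add T_st' BlinD(1)[OF Blin_T] st_add_right)
  show "st' (st' f g) h = st' f (st' g h)"
    by (rule T_inj) (simp_all add: st'_C T_st' st_assoc)
  show "st' (act b f) g = act b (st' f g)"
    by (rule T_inj) (simp_all add: st'_C T_st' BlinD(2)[OF Blin_T] st_act_left)
  show "st' f (act b g) = act b (st' f g)"
    by (rule T_inj) (simp_all add: st'_C T_st' BlinD(2)[OF Blin_T] st_act_right)
  show "st' f g 1 = f 1 * g 1"
    using T_one[of "st' f g"] by (simp add: T_st' st_one T_one)
qed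

lemma st'_ev_left:
  assumes v: "v \<in> verts G"
  shows "st' (iota (ev v)) (iota a) = iota (ev v * a)"
proof (rule T_inj[OF st'_C iota_C])
  have "st (idem v) (tauT a) = lin_ext sF (\<lambda>u. st (idem v) (Th u)) (\<sigma> a)"
    unfolding tauT_def by (rule st_lin_ext_right[OF Th_sigma_C])
  also have "\<dots> = lin_ext sF (\<lambda>u. if src u = v then Th u else 0) (\<sigma> a)"
    by (rule F.lin_ext_cong) (rule Th_left[OF irr_paths[OF sigma_irr] v])
  also have "\<dots> = tauT (ev v * a)"
    unfolding tauT_def by (rule lin_ext_sigma_ev_left[OF F.module_axioms v, symmetric])
  finally show "T (st' (iota (ev v)) (iota a)) = T (iota (ev v * a))"
    by (simp add: T_st' T_iota tauT_irr[OF triv_irr[OF v]])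
qed

lemma st'_ev_right:
  assumes v: "v \<in> verts G"
  shows "st' (iota a) (iota (ev v)) = iota (a * ev v)"
proof (rule T_inj[OF st'_C iota_C])
  have "st (tauT a) (idem v) = lin_ext sF (\<lambda>u. st (Th u) (idem v)) (\<sigma> a)"
    unfolding tauT_def by (rule st_lin_ext_left[OF Th_sigma_C])
  also have "\<dots> = lin_ext sF (\<lambda>u. if tgt G u = v then Th u else 0) (\<sigma> a)"
    by (rule F.lin_ext_cong) (rule Th_right[OF irr_paths[OF sigma_irr] v])
  also have "\<dots> = tauT (a * ev v)"
    unfolding tauT_def by (rule lin_ext_sigma_ev_right[OF F.module_axioms v, symmetric])
  finally show "T (st' (iota a) (iota (ev v))) = T (iota (a * ev v))"
    by (simp add: T_st' T_iota tauT_irr[OF triv_irr[OF v]])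
qed

lemma st'_irr:
  assumes x: "x \<in> amb 1" and u: "u \<in> irr G S" "tgt G x = src u" and xu: "pcat x u \<in> irr G S"
  shows "st' (iota (\<pi>p x)) (iota (\<pi>p u)) = iota (\<pi>p (pcat x u))"
proof (rule T_inj[OF st'_C iota_C])
  have xp: "x \<in> paths G" "plen x = 1"
    using x unfolding amb_1 by auto
  then obtain e where e: "x = (tail G e, [e])" "e \<in> arcs G"
    by (cases x) (auto simp: length_Suc_conv)
  have xi: "x \<in> irr G S"
    by (rule len_irr) (use xp in auto)
  have "arrow e = st (arrow e) (idem (head G e))"
    unfolding arrow_def st_assoc using e(2) by (simp add: idem)
  then have "Th x = arrow e"
    by (simp add: e(1))
  moreover have "Th (pcat x u) = st (arrow e) (Th u)"
    using u(2) by (simp add: e(1) pcat_def tgt_def)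
  ultimately show "T (st' (iota (\<pi>p x)) (iota (\<pi>p u))) = T (iota (\<pi>p (pcat x u)))"
    by (simp add: T_st' T_iota tauT_irr xi u(1) xu)
qed

end

text \<open>The normal form of a deformed product up to gauge equivalence.\<close>

locale gauge_fixed = C_algebra G S \<phi> sA \<pi> sB \<mm> I E lam st
  for G :: "('v, 'e) pre_digraph"
    and S :: "('v, 'e) qpath set"
    and \<phi> :: "('v, 'e) qpath \<Rightarrow> ('v, 'e) qpath \<Rightarrow>\<^sub>0 'k::field_char_0"
    and sA :: "'k \<Rightarrow> 'a \<Rightarrow> 'a::ring"
    and \<pi> :: "(('v, 'e) qpath \<Rightarrow>\<^sub>0 'k) \<Rightarrow> 'a"
    and sB :: "'k \<Rightarrow> 'b \<Rightarrow> 'b::comm_ring_1"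
    and \<mm> :: "'b set"
    and I :: "(('v, 'e) qpath \<Rightarrow>\<^sub>0 'k) set"
    and E :: "nat \<Rightarrow> 'b set" and lam :: "'b \<Rightarrow> 'b \<Rightarrow> 'k"
    and st :: "('b \<Rightarrow> 'a) \<Rightarrow> ('b \<Rightarrow> 'a) \<Rightarrow> 'b \<Rightarrow> 'a" +
  assumes st_ev_left: "v \<in> verts G \<Longrightarrow> st (iota (ev v)) (iota a) = iota (ev v * a)"
    and st_ev_right: "v \<in> verts G \<Longrightarrow> st (iota a) (iota (ev v)) = iota (a * ev v)"
    and st_irr: "x \<in> amb 1 \<Longrightarrow> u \<in> irr G S \<Longrightarrow> tgt G x = src u \<Longrightarrow> pcat x u \<in> irr G S \<Longrightarrow>
      st (iota (\<pi>p x)) (iota (\<pi>p u)) = iota (\<pi>p (pcat x u))"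

lemma (in C_algebra) gauge_fixed_st': "gauge_fixed G S \<phi> sA \<pi> sB \<mm> I E lam st'"
  by (intro gauge_fixed.intro C_algebra_st' gauge_fixed_axioms.intro st'_ev_left st'_ev_right st'_irr)

section \<open>The deformation parameter of a normalised product\<close>

context def_setup
begin

definition Rmul :: "'a \<Rightarrow> ('b \<Rightarrow> 'a) \<Rightarrow> 'b \<Rightarrow> 'a" where
  "Rmul c f = (\<lambda>e. if e \<in> Eu then f e * c else 0)"

definition Lmul :: "'a \<Rightarrow> ('b \<Rightarrow> 'a) \<Rightarrow> 'b \<Rightarrow> 'a" where
  "Lmul c f = (\<lambda>e. if e \<in> Eu then c * f e else 0)"

lemma Blin_Rmul: "Blin (Rmul c)"
  unfolding Blin_def
proof (intro conjI allI)
  fix f g b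
  show "Rmul c (f + g) = Rmul c f + Rmul c g"
    by (rule ext) (simp add: Rmul_def distrib_right)
  show "Rmul c (act b f) = act b (Rmul c f)"
  proof (rule ext)
    fix e
    show "Rmul c (act b f) e = act b (Rmul c f) e"
    proof (cases "e \<in> Eu")
      case True
      then obtain n where e: "e \<in> E n" by blast
      have "act b (Rmul c f) e = (\<Sum>e'\<in>E n. sA (lam e (b * e')) (f e') * c)"
        unfolding act_eq[OF e] by (rule sum.cong[OF refl]) (use Eu_I in \<open>simp add: Rmul_def sA_mult_left\<close>)
      then show ?thesis
        unfolding Rmul_def using True by (simp add: act_eq[OF e] sum_distrib_right)
    qed (simp add: Rmul_def act_def)
  qed
  show "Rmul c f \<in> C" by (simp add: Rmul_def C_def)
qed

lemma Blin_Lmul: "Blin (Lmul c)"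
  unfolding Blin_def
proof (intro conjI allI)
  fix f g b
  show "Lmul c (f + g) = Lmul c f + Lmul c g"
    by (rule ext) (simp add: Lmul_def distrib_left)
  show "Lmul c (act b f) = act b (Lmul c f)"
  proof (rule ext)
    fix e
    show "Lmul c (act b f) e = act b (Lmul c f) e"
    proof (cases "e \<in> Eu")
      case True
      then obtain n where e: "e \<in> E n" by blast
      have "act b (Lmul c f) e = (\<Sum>e'\<in>E n. c * sA (lam e (b * e')) (f e'))"
        unfolding act_eq[OF e] by (rule sum.cong[OF refl]) (use Eu_I in \<open>simp add: Lmul_def sA_mult_right\<close>)
      then show ?thesis
        unfolding Lmul_def using True by (simp add: act_eq[OF e] sum_distrib_left)
    qed (simp add: Lmul_def act_def)
  qed
  show "Lmul c f \<in> C" by (simp add: Lmul_def C_def)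
qed

lemma Rmul_iota: "Rmul c (iota a) = iota (a * c)" and Lmul_iota: "Lmul c (iota a) = iota (c * a)"
  using one_Eu by (auto simp: Rmul_def Lmul_def iota_def fun_eq_iff)

lemma Blin_eqI:
  assumes L: "Blin L" and M: "Blin M" and eq: "\<And>a. L (iota a) = M (iota a)" and f: "f \<in> C"
  shows "L f = M f"
proof -
  have "L f - M f \<in> K n" for n
  proof -
    let ?s = "\<Sum>e\<in>E n. act e (iota (f e))"
    have s: "L ?s = M ?s"
      unfolding Blin_sum[OF L] Blin_sum[OF M] BlinD(2)[OF L] BlinD(2)[OF M] eq ..
    have "L f - M f = L (f - ?s) - M (f - ?s)"
      unfolding Blin_diff[OF L] Blin_diff[OF M] s by simp
    with K_diff[OF Blin_K[OF L expand_K[OF f]] Blin_K[OF M expand_K[OF f]], of n] show ?thesis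
      by (simp only:)
  qed
  then have "L f - M f = 0" by (rule K_Inter)
  then show ?thesis by (simp only: right_minus_eq)
qed

lemma vector_space_sP: "vector_space sP"
  by standard (simp_all add: sP_def fun_eq_iff A.scale_right_distrib A.scale_left_distrib)

lemma subspace_Pn: "module.subspace sP (Pn n)"
proof -
  interpret P: vector_space sP by (rule vector_space_sP)
  show ?thesis
    unfolding P.subspace_def Pn_def
    by (auto simp: sP_def distrib_left distrib_right sA_mult_left sA_mult_right)
qed

lemma mm_B_subspace: "B.subspace \<mm>"
  using Pw_B_subspace[of "Suc 0"] by (simp only: Pw_1)

lemma E_mm: "e \<in> E i \<Longrightarrow> e \<noteq> 1 \<Longrightarrow> e \<in> \<mm>"
  using E_Pw[of e i "Suc 0"] by (simp only: E_1 Pw_1) simp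

lemma mm_lam: "b \<in> \<mm> \<Longrightarrow> e \<in> E i \<Longrightarrow> lam e b \<noteq> 0 \<Longrightarrow> e \<in> \<mm>"
  using lam_Pw[of b "Suc 0" e] E_mm[of e i] by (simp only: E_1 Pw_1) auto

lemmas coordP_hom = coord_hom[OF vector_space_sP subspace_Pn[of 2] mm_B_subspace]
  and coordP_base = coord_base[OF vector_space_sP subspace_Pn[of 2] mm_B_subspace]

end

context gauge_fixed
begin

definition psi :: "'b \<Rightarrow> 'a list \<Rightarrow> 'a" where
  "psi e as = (st (iota (as ! 0)) (iota (as ! 1)) - iota (as ! 0 * as ! 1)) e"

lemma psi_eq: "psi e [a, b] = st (iota a) (iota b) e - iota (a * b) e"
  by (simp add: psi_def)

lemma st_iota: "st (iota a) (iota b) e = iota (a * b) e + psi e [a, b]"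
  by (simp add: psi_eq)

lemma psi_1: "psi 1 [a, b] = 0"
  by (simp add: psi_eq st_one iota_def)

lemma psi_notin: "e \<notin> Eu \<Longrightarrow> psi e [a, b] = 0"
  using st_C[of "iota a" "iota b"] iota_C[of "a * b"] by (simp add: psi_eq C_def)

lemma st_ev_mid: "v \<in> verts G \<Longrightarrow> st (iota (a * ev v)) (iota b) = st (iota a) (iota (ev v * b))"
  by (simp add: st_ev_right[symmetric] st_ev_left[symmetric] st_assoc)

lemma st_ev_right_C: "v \<in> verts G \<Longrightarrow> f \<in> C \<Longrightarrow> st f (iota (ev v)) = Rmul (ev v) f"
  by (rule Blin_eqI[OF Blin_left Blin_Rmul]) (simp_all add: st_ev_right Rmul_iota)

lemma st_ev_left_C: "v \<in> verts G \<Longrightarrow> f \<in> C \<Longrightarrow> st (iota (ev v)) f = Lmul (ev v) f"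
  by (rule Blin_eqI[OF Blin_right Blin_Lmul]) (simp_all add: st_ev_left Lmul_iota)

lemma iota_add: "iota (a + b) = iota a + iota b"
  by (rule module_hom.add[OF iota_hom])

lemma iota_scale: "iota (sA c a) = sF c (iota a)"
  by (rule module_hom.scale[OF iota_hom])

lemma psi_ev_left: "v \<in> verts G \<Longrightarrow> psi e [ev v * a, b] = ev v * psi e [a, b]"
proof (cases "e \<in> Eu")
  case True
  assume v: "v \<in> verts G"
  have "st (iota (ev v * a)) (iota b) = Lmul (ev v) (st (iota a) (iota b))"
    unfolding st_ev_left[OF v, symmetric] st_assoc by (rule st_ev_left_C[OF v st_C])
  then show ?thesis
    using True by (simp add: psi_eq Lmul_def right_diff_distrib iota_def mult.assoc)
qed (simp add: psi_notin)

lemma rel2_psi: "rel2 (psi e)"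
  unfolding rel2_def
proof (intro conjI allI ballI)
  fix a b v
  show "module_hom sA sA (\<lambda>a. psi e [a, b])"
  proof (intro A_homI)
    fix x y c
    show "psi e [x + y, b] = psi e [x, b] + psi e [y, b]"
      unfolding psi_eq distrib_right iota_add st_add_left by simp
    show "psi e [sA c x, b] = sA c (psi e [x, b])"
      unfolding psi_eq sA_mult_left iota_scale st_sF_left[OF iota_C]
      by (simp add: sF_def A.scale_right_diff_distrib)
  qed
  show "module_hom sA sA (\<lambda>b. psi e [a, b])"
  proof (intro A_homI)
    fix x y c
    show "psi e [a, x + y] = psi e [a, x] + psi e [a, y]"
      unfolding psi_eq distrib_left iota_add st_add_right by simp
    show "psi e [a, sA c x] = sA c (psi e [a, x])"
      unfolding psi_eq sA_mult_right iota_scale st_sF_right[OF iota_C]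
      by (simp add: sF_def A.scale_right_diff_distrib)
  qed
  assume v: "v \<in> verts G"
  show "psi e [a * ev v, b] = psi e [a, ev v * b]"
    unfolding psi_eq st_ev_mid[OF v] mult.assoc ..
  show "psi e [a, b * ev v] = psi e [a, b] * ev v"
  proof (cases "e \<in> Eu")
    case True
    have "st (iota a) (iota (b * ev v)) = Rmul (ev v) (st (iota a) (iota b))"
      unfolding st_ev_right[OF v, symmetric] st_assoc[symmetric] by (rule st_ev_right_C[OF v st_C])
    then show ?thesis
      using True by (simp add: psi_eq Rmul_def left_diff_distrib iota_def mult.assoc)
  qed (simp add: psi_notin)
next
  fix b
  have "st (iota oneA) (iota b) = (\<Sum>v\<in>verts G. iota (ev v * b))"
    unfolding oneA_eq module_hom.sum[OF iota_hom] st_sum_left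
    by (rule sum.cong[OF refl]) (rule st_ev_left)
  also have "\<dots> = iota (oneA * b)"
    unfolding oneA_eq sum_distrib_right module_hom.sum[OF iota_hom] ..
  finally show "psi e [oneA, b] = 0"
    by (simp add: psi_eq)
qed

lemma psi_irr: "x \<in> amb 1 \<Longrightarrow> u \<in> irr G S \<Longrightarrow> tgt G x = src u \<Longrightarrow> pcat x u \<in> irr G S \<Longrightarrow>
    psi e [\<pi>p x, \<pi>p u] = 0"
proof -
  assume a: "x \<in> amb 1" "u \<in> irr G S" "tgt G x = src u" "pcat x u \<in> irr G S"
  have "x \<in> paths G" using a(1) unfolding amb_1 by simp
  then have "\<pi>p x * \<pi>p u = \<pi>p (pcat x u)"
    using a irr_paths[OF a(2)] by (simp add: pp_mult)
  then show ?thesis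
    unfolding psi_eq st_irr[OF a] by simp
qed

definition ft :: "'b \<Rightarrow> ('v, 'e) qpath \<Rightarrow> 'a" where
  "ft e s = (if s \<in> S then psi e [\<pi>p (arr G 0 s), \<pi>p (suf G 1 s)] else 0)"

lemma ft_1: "ft 1 = 0"
  by (rule ext) (simp add: ft_def psi_1)

lemma ft_Pn: "ft e \<in> Pn 2"
  unfolding Pn_def amb_2
proof (intro CollectI conjI ballI allI impI)
  fix s assume s: "s \<in> S"
  have p: "s \<in> paths G" "0 < plen s"
    using S_paths[OF s] S_len[OF s] by auto
  note v = src_in_verts[OF p(1)] tgt_in_verts[OF p(1)]
  have a: "ev (src s) * \<pi>p (arr G 0 s) = \<pi>p (arr G 0 s)"
    using ev_pp[OF v(1) arr_paths[OF p]] by (simp add: src_arr)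
  have b: "\<pi>p (suf G 1 s) * ev (tgt G s) = \<pi>p (suf G 1 s)"
    using pp_ev[OF v(2) pre_suf_paths(2)[OF p(1)]] by simp
  have "psi e [ev (src s) * \<pi>p (arr G 0 s), \<pi>p (suf G 1 s) * ev (tgt G s)] =
      ev (src s) * psi e [\<pi>p (arr G 0 s), \<pi>p (suf G 1 s)] * ev (tgt G s)"
    using rel2_psi[of e] v unfolding rel2_def psi_ev_left[OF v(1)] by (simp only: mult.assoc)
  then show "ft e s = ev (src s) * ft e s * ev (tgt G s)"
    using s unfolding a b by (simp only: ft_def if_True)
qed (simp add: ft_def)

definition xi :: "nat \<Rightarrow> ((('v, 'e) qpath \<Rightarrow> 'a) \<times> 'b \<Rightarrow>\<^sub>0 'k) set" where
  "xi n = ct_class sP (Pn 2) sB \<mm> \<mm> n (\<Sum>e\<in>E n - {1}. base (ft e, e))"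

lemma xi_rep_keys: "keys (\<Sum>e\<in>E n - {1}. base (ft e, e) :: _ \<Rightarrow>\<^sub>0 'k) \<subseteq> Pn 2 \<times> \<mm>"
  by (rule order_trans[OF keys_sum_subset]) (use ft_Pn E_mm in auto)

lemma xi_iff: "t \<in> xi n \<longleftrightarrow> keys t \<subseteq> Pn 2 \<times> \<mm> \<and> (\<forall>e\<in>E n. coord sP t e = ft e)"
proof -
  have hs: "coord sP (\<Sum>e\<in>E n - {1}. base (ft e, e)) e' = (\<Sum>e\<in>E n - {1}. coord sP (base (ft e, e)) e')" for e'
    by (rule module_hom.sum[OF coordP_hom])
  have "coord sP (\<Sum>e\<in>E n - {1}. base (ft e, e)) e = ft e" if "e \<in> E n" for e
  proof (cases "e = 1")
    case True
    have "coord sP (\<Sum>e\<in>E n - {1}. base (ft e, e)) e = 0"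
      unfolding True hs
    proof (rule sum.neutral, rule ballI)
      fix e' assume e': "e' \<in> E n - {1}"
      have "lam 1 e' = 0"
        using lam_dual[of 1 "Suc 0" e' n] e' E_1 by auto
      then show "coord sP (base (ft e', e')) 1 = 0"
        by (simp add: coordP_base) (simp add: sP_def fun_eq_iff)
    qed
    then show ?thesis using True ft_1 by simp
  next
    case False
    have "coord sP (\<Sum>e\<in>E n - {1}. base (ft e, e)) e = (\<Sum>e'\<in>E n - {1}. if e' = e then ft e else 0)"
      unfolding hs
    proof (rule sum.cong[OF refl])
      fix e' assume e': "e' \<in> E n - {1}"
      show "coord sP (base (ft e', e')) e = (if e' = e then ft e else 0)"
        using lam_dual[OF \<open>e \<in> E n\<close>, of e' n] e'
        by (auto simp: coordP_base sP_def fun_eq_iff)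
    qed
    then show ?thesis using that False by (simp add: E_finite)
  qed
  moreover have "t \<in> xi n \<longleftrightarrow> keys t \<subseteq> Pn 2 \<times> \<mm> \<and>
      (\<forall>e\<in>E n. coord sP t e = coord sP (\<Sum>e\<in>E n - {1}. base (ft e, e)) e)"
    unfolding xi_def
    by (rule ct_class_iff[OF vector_space_sP subspace_Pn mm_B_subspace _ xi_rep_keys]) (rule mm_lam)
  ultimately show ?thesis by simp
qed

lemma xi_ctensor: "xi \<in> ctensor sP (Pn 2) sB \<mm> \<mm>"
  unfolding ctensor_def
proof (intro CollectI allI conjI)
  fix n
  show "\<exists>t. keys t \<subseteq> Pn 2 \<times> \<mm> \<and> xi n = ct_class sP (Pn 2) sB \<mm> \<mm> n t"
    by (rule exI[of _ "\<Sum>e\<in>E n - {1}. base (ft e, e)"]) (simp only: xi_rep_keys xi_def simp_thms)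
  have "E n \<subseteq> E (Suc n)" by (rule E_mono) simp
  then show "xi (Suc n) \<subseteq> xi n"
    by (intro subsetI) (simp only: xi_iff, blast)
qed

lemma xi_ex: "\<exists>t. t \<in> xi n"
proof -
  have "(\<Sum>e\<in>E n - {1}. base (ft e, e)) \<in> xi n"
    unfolding xi_def ct_class_def using fs.subspace_0[OF subspace_ct_null[OF vector_space_sP subspace_Pn mm_B_subspace]]
    by simp
  then show ?thesis ..
qed

fun Om :: "('v, 'e) qpath \<Rightarrow> 'b \<Rightarrow> 'a" where
  "Om (v, []) = iota (ev v)"
| "Om (v, x # xs) = st (iota (\<pi>p (tail G x, [x]))) (Om (head G x, xs))"

lemma Om_C [simp]: "Om p \<in> C"
  by (cases p rule: Om.cases) simp_all

lemma st_ev_Om: "q \<in> paths G \<Longrightarrow> st (iota (ev (src q))) (Om q) = Om q"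
proof (cases q rule: Om.cases)
  case (2 v x xs)
  assume q: "q \<in> paths G"
  then have x: "(tail G x, [x]) \<in> paths G" "v = tail G x" "tail G x \<in> verts G"
    using 2 by auto
  then show ?thesis
    unfolding 2 by (simp add: st_assoc[symmetric] st_ev_left ev_pp)
qed (simp add: st_ev_left ev_ev)

lemma Om_mult:
  "p \<in> paths G \<Longrightarrow> q \<in> paths G \<Longrightarrow> tgt G p = src q \<Longrightarrow> st (Om p) (Om q) = Om (pcat p q)"
proof (induction p rule: Om.induct)
  case (1 v)
  then have "pcat (v, []) q = q" by (simp add: pcat_triv_left)
  then show ?case using st_ev_Om[of q] 1 by simp
next
  case (2 v x xs)
  have "pcat (v, x # xs) q = (v, x # snd (pcat (head G x, xs) q))" "pcat (head G x, xs) q = (head G x, snd (pcat (head G x, xs) q))"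
    by (simp_all add: pcat_def)
  then show ?case
    using 2 by (simp add: st_assoc)
qed

lemma Om_irr: "p \<in> irr G S \<Longrightarrow> Om p = iota (\<pi>p p)"
proof (induction p rule: Om.induct)
  case (2 v x xs)
  have p: "(v, x # xs) \<in> paths G" by (rule irr_paths[OF 2(2)])
  have s: "suf G (Suc 0) (v, x # xs) = (head G x, xs)"
    by (simp add: suf_def pre_def tgt_def)
  have i: "(head G x, xs) \<in> irr G S"
    using irr_suf[OF 2(2), of "Suc 0"] unfolding s .
  have a: "(tail G x, [x]) \<in> amb 1"
    unfolding amb_1 using p by simp
  have e: "pcat (tail G x, [x]) (head G x, xs) = (v, x # xs)"
    using p by (simp add: pcat_def)
  show ?case
    unfolding Om.simps 2(1)[OF i] st_irr[OF a i _ 2(2)[folded e], simplified] e ..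
qed simp

lemma Om_S:
  assumes s: "s \<in> S"
  shows "Om s e = iota (\<pi>p s) e + ft e s"
proof -
  obtain x xs where sx: "s = (src s, x # xs)"
    using S_len[OF s] by (cases "snd s") (auto simp: prod_eq_iff)
  have p: "(src s, x # xs) \<in> paths G" using S_paths[OF s] sx by simp
  have a: "arr G 0 s = (tail G x, [x])"
    by (subst sx) (use p in \<open>simp add: arr_def pre_def\<close>)
  have b: "suf G 1 s = (head G x, xs)"
    by (subst sx) (simp add: suf_def pre_def tgt_def)
  have "Om s = st (iota (\<pi>p (arr G 0 s))) (iota (\<pi>p (suf G 1 s)))"
  proof -
    have "Om s = st (iota (\<pi>p (arr G 0 s))) (Om (head G x, xs))"
      unfolding a by (subst sx) (rule Om.simps(2))
    also have "Om (head G x, xs) = iota (\<pi>p (suf G 1 s))"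
      unfolding b[symmetric] by (rule Om_irr[OF S_suf_irr[OF s]]) simp
    finally show ?thesis .
  qed
  moreover have "\<pi>p (arr G 0 s) * \<pi>p (suf G 1 s) = \<pi>p s"
  proof -
    have "arr G 0 s \<in> paths G" "suf G 1 s \<in> paths G"
      using arr_paths[OF S_paths[OF s], of 0] pre_suf_paths(2)[OF S_paths[OF s]] S_len[OF s] by fastforce+
    moreover have "tgt G (arr G 0 s) = src (suf G 1 s)" "pcat (arr G 0 s) (suf G 1 s) = s"
      using tgt_arr[of 0 s] pcat_arr_suf[of 0 s] S_len[OF s] by fastforce+
    ultimately show ?thesis by (simp add: pp_mult)
  qed
  ultimately show ?thesis
    using s by (simp only: st_iota ft_def if_True)
qed

end

section \<open>Evaluating reductions\<close>

lemma lookup_map_zero: "f 0 = 0 \<Longrightarrow> lookup (Poly_Mapping.map f x) p = f (lookup x p)"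
  by (simp add: Poly_Mapping.map.rep_eq when_def)

text \<open>Polynomials which are divisible by \<open>z\<^sup>n\<close>.\<close>

definition low :: "nat \<Rightarrow> 'r::comm_ring_1 poly \<Rightarrow> bool" where
  "low n c \<longleftrightarrow> (\<forall>i<n. coeff c i = 0)"

lemma low_0 [simp]: "low n 0" and low_add: "low n c \<Longrightarrow> low n d \<Longrightarrow> low n (c + d)"
  by (simp_all add: low_def)

lemma low_sum: "(\<And>i. i \<in> X \<Longrightarrow> low n (f i)) \<Longrightarrow> low n (\<Sum>i\<in>X. f i)"
  by (induction X rule: infinite_finite_induct) (simp_all add: low_add)

lemma low_mult: "low n c \<Longrightarrow> low n (c * d)" and low_mult': "low n d \<Longrightarrow> low n (c * d)"
  by (auto simp: low_def coeff_mult intro!: sum.neutral)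

lemma low_Suc: "low n c \<Longrightarrow> low (Suc n) ([:0, 1:] * c)"
  by (auto simp: low_def coeff_pCons split: nat.splits)

context def_setup
begin

text \<open>The coefficient of \<open>z\<^sup>j\<close> is of order \<open>j + d\<close>: reductions preserve this condition for \<open>d = 0\<close>, since \<open>z\<close> always
  comes with a coefficient in \<open>\<mm>\<close>.\<close>

definition FP :: "nat \<Rightarrow> 'b poly set" where
  "FP d = {c. \<forall>j. coeff c j \<in> Pw (j + d)}"

lemma Pw_0' [simp]: "0 \<in> Pw n" and Pw_add': "x \<in> Pw n \<Longrightarrow> y \<in> Pw n \<Longrightarrow> x + y \<in> Pw n"
  by (rule B.subspace_0[OF Pw_B_subspace] B.subspace_add[OF Pw_B_subspace], assumption?)+

lemma Pw_sum': "(\<And>i. i \<in> X \<Longrightarrow> f i \<in> Pw n) \<Longrightarrow> (\<Sum>i\<in>X. f i) \<in> Pw n"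
  by (rule B.subspace_sum[OF Pw_B_subspace])

lemma FP_zero [simp]: "0 \<in> FP d" and FP_add: "c \<in> FP d \<Longrightarrow> c' \<in> FP d \<Longrightarrow> c + c' \<in> FP d"
  by (simp_all add: FP_def Pw_add' del: ideal_pow.simps)

lemma FP_sum: "(\<And>i. i \<in> X \<Longrightarrow> f i \<in> FP d) \<Longrightarrow> (\<Sum>i\<in>X. f i) \<in> FP d"
  by (induction X rule: infinite_finite_induct) (simp_all add: FP_add)

lemma FP_mult: "c \<in> FP 0 \<Longrightarrow> c' \<in> FP d \<Longrightarrow> c * c' \<in> FP d"
  unfolding FP_def mem_Collect_eq coeff_mult
proof (intro allI Pw_sum')
  fix k i :: nat assume a: "\<forall>j. coeff c j \<in> Pw (j + 0)" "\<forall>j. coeff c' j \<in> Pw (j + d)" "i \<in> {..k}"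
  have "coeff c i * coeff c' (k - i) \<in> Pw (i + (k - i + d))"
    by (rule Pw_mult) (use a(1)[rule_format, of i] a(2) in simp_all)
  then show "coeff c i * coeff c' (k - i) \<in> Pw (k + d)"
    using a(3) by simp
qed

lemma FP_mult': "c \<in> FP d \<Longrightarrow> c' \<in> FP 0 \<Longrightarrow> c * c' \<in> FP d"
  using FP_mult[of c' c d] by (simp only: mult.commute)

lemma FP_const: "b \<in> Pw d \<Longrightarrow> [:b:] \<in> FP d"
  unfolding FP_def by (auto simp: coeff_pCons simp del: ideal_pow.simps split: nat.splits)

lemma FP_one [simp]: "1 \<in> FP 0"
  unfolding one_pCons by (rule FP_const) simp

lemma FP_shift: "c \<in> FP 1 \<Longrightarrow> [:0, 1:] * c \<in> FP 0"
  unfolding FP_def by (auto simp: coeff_pCons simp del: ideal_pow.simps split: nat.splits)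

lemma lookup_kQ: "lookup (kQ_to_Bz x) p = [:sB (lookup x p) 1:]"
  unfolding kQ_to_Bz_def by (rule lookup_map_zero) simp

lemma keys_kQ: "keys (kQ_to_Bz x) \<subseteq> keys x"
  by (auto simp: in_keys_iff lookup_kQ)

abbreviation mapC :: "(('v, 'e) qpath \<Rightarrow>\<^sub>0 'b) \<Rightarrow> (('v, 'e) qpath \<Rightarrow>\<^sub>0 'b poly)" where
  "mapC y \<equiv> Poly_Mapping.map (\<lambda>b. [:b:]) y"

lemma lookup_mapC: "lookup (mapC y) p = [:lookup y p:]"
  by (rule lookup_map_zero) simp

lemma keys_mapC: "keys (mapC y) \<subseteq> keys y"
  by (auto simp: in_keys_iff lookup_mapC)

lemma mapC_add: "mapC (x + y) = mapC x + mapC y" and mapC_zero: "mapC 0 = 0"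
  by (rule poly_mapping_eqI, simp add: lookup_mapC lookup_add)+

lemma mapC_sum: "mapC (\<Sum>i\<in>X. f i) = (\<Sum>i\<in>X. mapC (f i))"
  by (induction X rule: infinite_finite_induct) (simp_all only: sum.infinite sum.empty sum.insert mapC_add mapC_zero not_False_eq_True)

lemma mapC_single: "mapC (single p b) = single p [:b:]"
  by (rule poly_mapping_eqI) (simp add: lookup_mapC lookup_single when_def)

lemma sigma_ends:
  assumes a: "a = ev v * a * ev w" "v \<in> verts G" "w \<in> verts G" and u: "u \<in> keys (\<sigma> a)"
  shows "src u = v" "tgt G u = w"
proof -
  have l: "ev v * a = a" "a * ev w = a"
    by (subst (1 2) a(1), simp add: mult.assoc[symmetric] ev_ev a(2,3))
      (subst (1 2) a(1), simp add: mult.assoc ev_ev a(2,3))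
  have 1: "\<sigma> a = free_ext (\<lambda>u. if src u = v then base u else 0) (\<sigma> a)"
    using lin_ext_sigma_ev_left[OF module_fscale a(2), of base a] by (simp only: l free_ext_base)
  have 2: "\<sigma> a = free_ext (\<lambda>u. if tgt G u = w then base u else 0) (\<sigma> a)"
    using lin_ext_sigma_ev_right[OF module_fscale a(3), of base a] by (simp only: l free_ext_base)
  have "u \<in> keys (free_ext (\<lambda>u. if src u = v then base u else 0) (\<sigma> a))" using u 1 by simp
  then show "src u = v" using keys_free_ext by (fastforce split: if_splits)
  have "u \<in> keys (free_ext (\<lambda>u. if tgt G u = w then base u else 0) (\<sigma> a))" using u 2 by simp
  then show "tgt G u = w" using keys_free_ext by (fastforce split: if_splits)
qed

definition rp where
  "rp t = (\<lambda>p. if p \<in> irr G S then base p else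
     (\<Sum>(q, s, r)\<in>right_occ G S p.
        pmul G (base q) (pmul G (kQ_to_Bz (\<phi> s)) (base r)) +
        fscale [:0, 1:]
          (pmul G (base q) (pmul G (Poly_Mapping.map (\<lambda>b. [:b:]) (\<phi>t t s)) (base r)))))"

lemma red_eq: "red t = free_ext (rp t)"
  unfolding red_def rp_def ..

lemma red_hom: "module_hom fscale fscale (red t)"
  unfolding red_eq by (rule fs.lin_ext_hom)

lemma rp_irr: "p \<in> irr G S \<Longrightarrow> rp t p = base p"
  by (simp add: rp_def)

lemma red_base: "red t (base p) = rp t p"
  unfolding red_eq by simp

context
  fixes t :: "(('v, 'e) qpath \<Rightarrow> 'a) \<times> 'b \<Rightarrow>\<^sub>0 'k"
  assumes t: "keys t \<subseteq> Pn 2 \<times> \<mm>"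
begin

lemma phit_sum: "\<phi>t t s = (\<Sum>x\<in>keys t. \<Sum>u\<in>keys (\<sigma> (fst x s)).
    single u (sB (lookup t x * lookup (\<sigma> (fst x s)) u) (snd x)))"
  unfolding \<phi>t_def by (rule sum.cong) (auto simp: case_prod_unfold)

lemma keys_phit:
  assumes s: "s \<in> S" and u: "u \<in> keys (\<phi>t t s)"
  shows "u \<in> irr G S" "src u = src s" "tgt G u = tgt G s"
proof -
  obtain x where x: "x \<in> keys t" "u \<in> keys (\<Sum>u\<in>keys (\<sigma> (fst x s)).
      single u (sB (lookup t x * lookup (\<sigma> (fst x s)) u) (snd x)))"
    by (rule UN_E[OF subsetD[OF keys_sum_subset u[unfolded phit_sum]]])
  then obtain u' where "u' \<in> keys (\<sigma> (fst x s))" "u \<in> keys (single u' (sB (lookup t x * lookup (\<sigma> (fst x s)) u') (snd x)))"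
    by (elim UN_E[OF subsetD[OF keys_sum_subset]])
  then have u': "u \<in> keys (\<sigma> (fst x s))"
    by (auto split: if_splits)
  show "u \<in> irr G S" by (rule sigma_irr[OF u'])
  have "fst x \<in> Pn 2" using x(1) t by auto
  from sigma_ends[OF PnD[OF this s] _ _ u']
  show "src u = src s" "tgt G u = tgt G s"
    using src_in_verts[OF S_paths[OF s]] tgt_in_verts[OF S_paths[OF s]] by auto
qed

lemma phit_mm: "lookup (\<phi>t t s) u \<in> \<mm>"
  unfolding phit_sum lookup_sum
proof (intro B.subspace_sum[OF mm_B_subspace])
  fix x u' assume "x \<in> keys t"
  then have "snd x \<in> \<mm>" using t by auto
  then show "lookup (single u' (sB (lookup t x * lookup (\<sigma> (fst x s)) u') (snd x))) u \<in> \<mm>"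
    by (auto simp: lookup_single when_def intro: B.subspace_scale[OF mm_B_subspace] B.subspace_0[OF mm_B_subspace])
qed

lemma keys_kQ_phi: "s \<in> S \<Longrightarrow> u \<in> keys (kQ_to_Bz (\<phi> s)) \<Longrightarrow> u \<in> irr G S \<and> src u = src s \<and> tgt G u = tgt G s"
  using keys_kQ[of "\<phi> s"] phi_irr[of s u] phi_src[of s u] phi_tgt[of s u] by auto

lemma keys_mapC_phit: "s \<in> S \<Longrightarrow> u \<in> keys (mapC (\<phi>t t s)) \<Longrightarrow> u \<in> irr G S \<and> src u = src s \<and> tgt G u = tgt G s"
  using keys_mapC[of "\<phi>t t s"] keys_phit[of s u] by auto

lemma rp_reducible:
  assumes "(q, s, r) \<in> occs G S p" "right_occ G S p = {(q, s, r)}" "p \<notin> irr G S"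
  shows "rp t p = free_ext (\<lambda>u. base (pcat q (pcat u r))) (kQ_to_Bz (\<phi> s)) +
    fscale [:0, 1:] (free_ext (\<lambda>u. base (pcat q (pcat u r))) (mapC (\<phi>t t s)))"
proof -
  note o = occsD[OF assms(1)]
  have 1: "pmul G (base q) (pmul G (kQ_to_Bz (\<phi> s)) (base r)) = free_ext (\<lambda>u. base (pcat q (pcat u r))) (kQ_to_Bz (\<phi> s))"
    by (rule pmul_context, drule keys_kQ_phi[OF o(4)]) (simp add: o(5,6))
  have 2: "pmul G (base q) (pmul G (mapC (\<phi>t t s)) (base r)) = free_ext (\<lambda>u. base (pcat q (pcat u r))) (mapC (\<phi>t t s))"
    by (rule pmul_context, drule keys_mapC_phit[OF o(4)]) (simp add: o(5,6))
  show ?thesis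
    unfolding rp_def assms(2) using assms(3) by (simp only: if_False sum.insert sum.empty finite.emptyI empty_iff
        not_False_eq_True case_prod_conv 1 2 add_0_right)
qed

lemma rp_cases:
  obtains "p \<in> irr G S" "rp t p = base p" | "p \<notin> paths G" "rp t p = 0"
  | q s r where "(q, s, r) \<in> occs G S p" "p \<in> paths G" "p \<notin> irr G S"
    "rp t p = free_ext (\<lambda>u. base (pcat q (pcat u r))) (kQ_to_Bz (\<phi> s)) +
      fscale [:0, 1:] (free_ext (\<lambda>u. base (pcat q (pcat u r))) (mapC (\<phi>t t s)))"
proof (cases "p \<in> irr G S")
  case True
  then show ?thesis using that(1) rp_irr by blast
next
  case n: False
  show ?thesis
  proof (cases "p \<in> paths G")
    case True
    obtain q s r where o: "(q, s, r) \<in> occs G S p" "right_occ G S p = {(q, s, r)}"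
      by (rule right_occ_exists[OF True n])
    show ?thesis
      by (rule that(3)[OF o(1) True n rp_reducible[OF o n]])
  next
    case False
    have "right_occ G S p = {}"
    proof (rule ccontr)
      assume "right_occ G S p \<noteq> {}"
      then obtain c where "c \<in> right_occ G S p" by (elim ex_in_conv[THEN iffD2, THEN exE])
      then obtain q s r where "(q, s, r) \<in> occs G S p"
        unfolding right_occ_def by (cases c) auto
      note o = occsD[OF this]
      have "p \<in> paths G"
        unfolding o(7) using o by (intro pcat_in_paths) simp_all
      with False show False ..
    qed
    then show ?thesis
      using that(2) False n by (simp add: rp_def)
  qed
qed

lemma context_paths: "(q, s, r) \<in> occs G S p \<Longrightarrow> u \<in> irr G S \<Longrightarrow> src u = src s \<Longrightarrow> tgt G u = tgt G s \<Longrightarrow>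
    pcat q (pcat u r) \<in> paths G"
  using occsD[of q s r] irr_paths[of u] by (intro pcat_in_paths) simp_all

lemma keys_context:
  assumes o: "(q, s, r) \<in> occs G S p" and y: "\<And>u. u \<in> keys y \<Longrightarrow> u \<in> irr G S \<and> src u = src s \<and> tgt G u = tgt G s"
  shows "keys (free_ext (\<lambda>u. base (pcat q (pcat u r))) y :: _ \<Rightarrow>\<^sub>0 'b poly) \<subseteq> paths G"
  by (rule order_trans[OF keys_free_ext]) (use context_paths[OF o] y in auto)

lemma rp_paths: "keys (rp t p) \<subseteq> paths G"
proof (cases rule: rp_cases[of p])
  case 1
  then show ?thesis using irr_paths by auto
next
  case (3 q s r)
  note s = occsD(4)[OF 3(1)]
  have 1: "keys (free_ext (\<lambda>u. base (pcat q (pcat u r))) (kQ_to_Bz (\<phi> s)) :: _ \<Rightarrow>\<^sub>0 'b poly) \<subseteq> paths G"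
    by (rule keys_context[OF 3(1) keys_kQ_phi[OF s]])
  have 2: "keys (free_ext (\<lambda>u. base (pcat q (pcat u r))) (mapC (\<phi>t t s)) :: _ \<Rightarrow>\<^sub>0 'b poly) \<subseteq> paths G"
    by (rule keys_context[OF 3(1) keys_mapC_phit[OF s]])
  show ?thesis
    unfolding 3(4)
    by (rule order_trans[OF keys_add]) (use 1 order_trans[OF keys_fscale 2] in auto)
qed simp

lemma red_paths: "keys (red t y) \<subseteq> paths G"
  unfolding red_eq by (rule order_trans[OF keys_free_ext]) (use rp_paths in blast)

lemma rp_FP: "lookup (rp t p) p' \<in> FP 0"
proof (cases rule: rp_cases[of p])
  case 1
  then show ?thesis by (auto simp: lookup_single when_def)
next
  case (3 q s r)
  have b: "lookup (base p1) p2 \<in> FP 0" for p1 p2 :: "('v, 'e) qpath"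
    by (auto simp: lookup_single when_def)
  have 1: "lookup (free_ext (\<lambda>u. base (pcat q (pcat u r))) (kQ_to_Bz (\<phi> s))) p' \<in> FP 0"
    unfolding lookup_free_ext by (intro FP_sum FP_mult b) (simp add: lookup_kQ FP_const)
  have 2: "lookup (free_ext (\<lambda>u. base (pcat q (pcat u r))) (mapC (\<phi>t t s))) p' \<in> FP 1"
    unfolding lookup_free_ext
  proof (intro FP_sum FP_mult' b)
    fix u
    show "lookup (mapC (\<phi>t t s)) u \<in> FP 1"
      unfolding lookup_mapC by (rule FP_const) (simp only: One_nat_def Pw_1 phit_mm)
  qed
  show ?thesis
    unfolding 3(4) lookup_add lookup_fscale by (rule FP_add[OF 1 FP_shift[OF 2]])
qed simp

lemma red_FP:
  assumes "\<And>p. lookup y p \<in> FP 0"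
  shows "lookup (red t y) p \<in> FP 0"
  unfolding red_eq lookup_free_ext by (intro FP_sum FP_mult assms rp_FP)

text \<open>Then all further reductions leave the element unchanged modulo \<open>z\<^sup>n\<close>.\<close>

definition good :: "nat \<Rightarrow> (('v, 'e) qpath \<Rightarrow>\<^sub>0 'b poly) \<Rightarrow> bool" where
  "good n y \<longleftrightarrow> (\<forall>p. p \<notin> irr G S \<longrightarrow> low n (lookup y p))"

lemma red_low:
  assumes "good n y"
  shows "low n (lookup (red t y - y) p)"
proof -
  have "red t y - y = free_ext (\<lambda>p. rp t p - base p) y"
    by (simp add: red_eq fs.lin_ext_fun_diff free_ext_base)
  moreover have "low n (lookup y q * lookup (rp t q - base q) p)" for q
  proof (cases "q \<in> irr G S")
    case True
    then show ?thesis by (simp add: rp_irr)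
  next
    case False
    then show ?thesis using assms by (simp add: good_def low_mult)
  qed
  ultimately show ?thesis
    by (simp only: lookup_free_ext) (rule low_sum)
qed

lemma good_red: "good n y \<Longrightarrow> good n (red t y)"
proof -
  assume g: "good n y"
  have "low n (lookup (red t y) p)" if "p \<notin> irr G S" for p
    using low_add[OF red_low[OF g, of p], of "lookup y p"] g that by (simp add: good_def lookup_minus)
  then show ?thesis by (simp add: good_def)
qed

lemma good_iter: "good n y \<Longrightarrow> good n ((red t ^^ k) y) \<and> low n (lookup ((red t ^^ k) y - y) p)"
proof (induction k)
  case (Suc k)
  then have IH: "good n ((red t ^^ k) y)" "low n (lookup ((red t ^^ k) y - y) p)" by auto
  show ?case
    using good_red[OF IH(1)] low_add[OF red_low[OF IH(1), of p] IH(2)] by (simp add: lookup_minus)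
qed simp

definition fin :: "nat \<Rightarrow> (('v, 'e) qpath \<Rightarrow>\<^sub>0 'b poly) \<Rightarrow> bool" where
  "fin n y \<longleftrightarrow> (\<exists>M. good n ((red t ^^ M) y))"

lemma iter_hom: "module_hom fscale fscale (red t ^^ k)"
proof (induction k)
  case 0
  then show ?case using fs.module_hom_id by (simp add: id_def)
next
  case (Suc k)
  then show ?case unfolding funpow.simps by (rule module_hom_compose[OF _ red_hom])
qed

lemma good_add: "good n x \<Longrightarrow> good n y \<Longrightarrow> good n (x + y)"
  by (simp add: good_def lookup_add low_add)

lemma good_ge: "good n ((red t ^^ M) y) \<Longrightarrow> M \<le> N \<Longrightarrow> good n ((red t ^^ N) y)"
  using good_iter[of n "(red t ^^ M) y" "N - M"] by (simp add: funpow_add[symmetric, THEN fun_cong, unfolded comp_def])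

lemma fin_add: "fin n x \<Longrightarrow> fin n y \<Longrightarrow> fin n (x + y)"
proof -
  assume "fin n x" "fin n y"
  then obtain M N where "good n ((red t ^^ M) x)" "good n ((red t ^^ N) y)"
    unfolding fin_def by (elim exE)
  then have "good n ((red t ^^ max M N) x)" "good n ((red t ^^ max M N) y)"
    using good_ge[of n M x "max M N"] good_ge[of n N y "max M N"] by simp_all
  then show ?thesis
    unfolding fin_def by (intro exI[of _ "max M N"]) (simp add: module_hom.add[OF iter_hom] good_add)
qed

lemma fin_zero: "fin n 0"
  unfolding fin_def good_def by (intro exI[of _ 0]) simp

lemma fin_sum: "(\<And>i. i \<in> X \<Longrightarrow> fin n (f i)) \<Longrightarrow> fin n (\<Sum>i\<in>X. f i)"
  by (induction X rule: infinite_finite_induct) (simp_all add: fin_add fin_zero)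

lemma fin_fscale: "fin n y \<Longrightarrow> fin n (fscale c y)"
  unfolding fin_def module_hom.scale[OF iter_hom] good_def lookup_fscale using low_mult' by blast

lemma fin_Suc: "fin n y \<Longrightarrow> fin (Suc n) (fscale [:0, 1:] y)"
  unfolding fin_def module_hom.scale[OF iter_hom] good_def lookup_fscale using low_Suc by blast

lemma fin_free_ext: "(\<And>p. p \<in> keys y \<Longrightarrow> fin n (g p)) \<Longrightarrow> fin n (free_ext g y)"
  unfolding lin_ext_def by (intro fin_sum fin_fscale)

lemma fin_red: "fin n (red t y) \<Longrightarrow> fin n y"
proof -
  assume "fin n (red t y)"
  then obtain M where "good n ((red t ^^ M) (red t y))" unfolding fin_def by (elim exE)
  then have "good n ((red t ^^ Suc M) y)" by (simp add: funpow_swap1)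
  then show ?thesis unfolding fin_def by (rule exI)
qed

text \<open>A reduction step strictly decreases a path in the well-founded order of the reduction system
  or else produces a factor \<open>z\<close>.\<close>

lemma fin_path: "p \<in> paths G \<Longrightarrow> fin n (base p)"
proof (induction n arbitrary: p)
  case 0
  show ?case unfolding fin_def good_def by (simp add: low_def)
next
  case (Suc n)
  from Suc.prems show ?case
  proof (induction p rule: path_induct)
    case (less p)
    show ?case
    proof (cases rule: rp_cases[of p])
      case 1
      then have "good (Suc n) ((red t ^^ 0) (base p))"
        by (auto simp: good_def lookup_single when_def)
      then show ?thesis unfolding fin_def by (rule exI)
    next
      case 2
      then show ?thesis using less.hyps by simp
    next
      case (3 q s r)
      note s = occsD(4)[OF 3(1)]
      have "fin (Suc n) (free_ext (\<lambda>u. base (pcat q (pcat u r))) (kQ_to_Bz (\<phi> s)))"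
      proof (rule fin_free_ext)
        fix u assume "u \<in> keys (kQ_to_Bz (\<phi> s))"
        then have "u \<in> keys (\<phi> s)" using keys_kQ by blast
        then have "pcat q (pcat u r) \<in> keys (reduct q s r)"
          unfolding keys_reduct[OF s] by (rule imageI)
        then have "redstep (pcat q (pcat u r)) p"
          unfolding redstep_def using 3(1) by blast
        then show "fin (Suc n) (base (pcat q (pcat u r)))"
          by (intro less.IH tranclp.r_into_trancl)
      qed
      moreover have "fin n (free_ext (\<lambda>u. base (pcat q (pcat u r))) (mapC (\<phi>t t s)))"
      proof (rule fin_free_ext)
        fix u assume "u \<in> keys (mapC (\<phi>t t s))"
        then show "fin n (base (pcat q (pcat u r)))"
          by (intro Suc.IH context_paths[OF 3(1)]) (use keys_mapC_phit[OF s] in auto)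
      qed
      ultimately have "fin (Suc n) (red t (base p))"
        unfolding red_base 3(4) by (intro fin_add fin_Suc)
      then show ?thesis by (rule fin_red)
    qed
  qed
qed

lemma red_lim_eq:
  assumes M: "good n ((red t ^^ M) x)" and j: "j < n"
  shows "red_lim t x j p = coeff (lookup ((red t ^^ M) x) p) j"
proof -
  let ?c = "coeff (lookup ((red t ^^ M) x) p) j"
  have "coeff (lookup ((red t ^^ N) x) p) j = ?c" if "M \<le> N" for N
  proof -
    have "(red t ^^ N) x = (red t ^^ (N - M)) ((red t ^^ M) x)"
      using that by (simp add: funpow_add[symmetric, THEN fun_cong, unfolded comp_def])
    then show ?thesis
      using conjunct2[OF good_iter[OF M, of "N - M" p]] j by (simp add: low_def lookup_minus)
  qed
  then have ev: "\<forall>\<^sub>F N in sequentially. coeff (lookup ((red t ^^ N) x) p) j = ?c"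
    unfolding eventually_sequentially by blast
  show ?thesis
    unfolding red_lim_def
  proof (intro the_equality)
    show "\<forall>\<^sub>F N in sequentially. coeff (lookup ((red t ^^ N) x) p) j = ?c" by (rule ev)
    fix c assume "\<forall>\<^sub>F N in sequentially. coeff (lookup ((red t ^^ N) x) p) j = c"
    from eventually_conj[OF this ev] show "c = ?c"
      unfolding eventually_sequentially by auto
  qed
qed

end

end

context gauge_fixed
begin

text \<open>Evaluation of elements of \<open>\<bbbk>Q \<otimes> B[z]\<close> at \<open>z = 1\<close> and in the deformed algebra. Reductions preserve it.\<close>

definition Ev1 :: "(('v, 'e) qpath \<Rightarrow>\<^sub>0 'b poly) \<Rightarrow> 'b \<Rightarrow> 'a" where
  "Ev1 y = (\<Sum>p\<in>keys y. act (poly (lookup y p) 1) (Om p))"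

lemma Ev1_superset: "finite X \<Longrightarrow> keys y \<subseteq> X \<Longrightarrow> Ev1 y = (\<Sum>p\<in>X. act (poly (lookup y p) 1) (Om p))"
  unfolding Ev1_def by (rule sum.mono_neutral_left) (auto simp: in_keys_iff)

lemma Ev1_add: "Ev1 (x + y) = Ev1 x + Ev1 y"
proof -
  let ?X = "keys x \<union> keys y"
  have X: "finite ?X" "keys x \<subseteq> ?X" "keys y \<subseteq> ?X" "keys (x + y) \<subseteq> ?X"
    using keys_add[of x y] by auto
  show ?thesis
    unfolding Ev1_superset[OF X(1,2)] Ev1_superset[OF X(1,3)] Ev1_superset[OF X(1,4)] lookup_add poly_add
      act_add_left sum.distrib ..
qed

lemma Ev1_zero: "Ev1 0 = 0"
  by (simp add: Ev1_def)

lemma Ev1_sum: "Ev1 (\<Sum>i\<in>X. f i) = (\<Sum>i\<in>X. Ev1 (f i))"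
  by (induction X rule: infinite_finite_induct)
    (simp_all only: sum.infinite sum.empty sum.insert Ev1_add Ev1_zero not_False_eq_True)

lemma Ev1_fscale: "Ev1 (fscale c y) = act (poly c 1) (Ev1 y)"
  unfolding Ev1_superset[OF finite_keys keys_fscale] lookup_fscale poly_mult act_mult
  by (simp only: Ev1_def act_sum)

lemma Ev1_single: "Ev1 (single p c) = act (poly c 1) (Om p)"
proof -
  have "Ev1 (single p c) = (\<Sum>p'\<in>{p}. act (poly (lookup (single p c) p') 1) (Om p'))"
    by (rule Ev1_superset) simp_all
  then show ?thesis by simp
qed

lemma Ev1_base: "Ev1 (base p) = Om p"
  by (simp add: Ev1_single act_one)

lemma Ev1_free_ext: "Ev1 (free_ext g y) = (\<Sum>p\<in>keys y. act (poly (lookup y p) 1) (Ev1 (g p)))"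
  unfolding lin_ext_def Ev1_sum Ev1_fscale ..

lemma Ev1_C [simp]: "Ev1 y \<in> C"
  unfolding Ev1_def by (intro C_sum act_C)

lemma Ev1_kQ: "Ev1 (kQ_to_Bz x) = lin_ext sF Om x"
  unfolding Ev1_superset[OF finite_keys keys_kQ] lin_ext_def by (simp add: lookup_kQ sF_act)

lemma Ev1_context:
  assumes o: "(q, s, r) \<in> occs G S p" and y: "\<And>u. u \<in> keys y \<Longrightarrow> u \<in> irr G S \<and> src u = src s \<and> tgt G u = tgt G s"
  shows "Ev1 (free_ext (\<lambda>u. base (pcat q (pcat u r))) y) = st (Om q) (st (Ev1 y) (Om r))"
proof -
  note o' = occsD[OF o]
  have "Om (pcat q (pcat u r)) = st (Om q) (st (Om u) (Om r))" if "u \<in> keys y" for u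
  proof -
    have u: "u \<in> paths G" "tgt G q = src u" "tgt G u = src r"
      using y[OF that] irr_paths o'(5,6) by auto
    have "st (Om u) (Om r) = Om (pcat u r)" by (rule Om_mult[OF u(1) o'(3) u(3)])
    moreover have "st (Om q) (Om (pcat u r)) = Om (pcat q (pcat u r))"
      by (rule Om_mult[OF o'(1) pcat_in_paths[OF u(1) o'(3) u(3)]]) (simp add: u(2))
    ultimately show ?thesis by simp
  qed
  then have "Ev1 (free_ext (\<lambda>u. base (pcat q (pcat u r))) y) =
      (\<Sum>u\<in>keys y. act (poly (lookup y u) 1) (st (Om q) (st (Om u) (Om r))))"
    unfolding Ev1_free_ext Ev1_base by (intro sum.cong) simp_all
  then show ?thesis
    unfolding Ev1_def st_sum_left st_sum_right st_act_left st_act_right .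
qed

context
  fixes t :: "(('v, 'e) qpath \<Rightarrow> 'a) \<times> 'b \<Rightarrow>\<^sub>0 'k" and n
  assumes tn: "t \<in> xi n"
begin

lemma t: "keys t \<subseteq> Pn 2 \<times> \<mm>" and coord_t: "e \<in> E n \<Longrightarrow> coord sP t e = ft e"
  using tn xi_iff by auto

lemma Ev1_phit: "Ev1 (mapC (\<phi>t t s)) = (\<Sum>x\<in>keys t. act (sB (lookup t x) (snd x)) (iota (fst x s)))"
proof -
  have "(\<Sum>u\<in>keys (\<sigma> a). act (sB (c * lookup (\<sigma> a) u) b) (Om u)) = act (sB c b) (iota a)" for a c b
  proof -
    have "act (sB (c * lookup (\<sigma> a) u) b) (Om u) = act (sB c b) (sF (lookup (\<sigma> a) u) (iota (\<pi>p u)))"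
      if "u \<in> keys (\<sigma> a)" for u
      unfolding Om_irr[OF sigma_irr[OF that]] by (simp add: sF_act act_mult[symmetric] sB_mult mult.commute)
    then have "(\<Sum>u\<in>keys (\<sigma> a). act (sB (c * lookup (\<sigma> a) u) b) (Om u)) =
        act (sB c b) (lin_ext sF (\<lambda>u. iota (\<pi>p u)) (\<sigma> a))"
      unfolding lin_ext_def act_sum by (intro sum.cong) simp_all
    then show ?thesis
      using hom_expand[OF iota_hom, of a] by simp
  qed
  then show ?thesis
    unfolding phit_sum[OF t] mapC_sum mapC_single Ev1_sum Ev1_single by simp
qed

lemma Ev1_rp: "p \<in> paths G \<Longrightarrow> Ev1 (rp t p) - Om p \<in> K n"
proof (cases rule: rp_cases[OF t, of p])
  case 1
  then show ?thesis by (simp only: Ev1_base diff_self K_zero)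
next
  case (3 q s r)
  note o = occsD[OF 3(1)]
  have sum_P_apply: "(\<Sum>i\<in>X. f i) w = (\<Sum>i\<in>X. f i w)" for f :: "_ \<Rightarrow> ('v, 'e) qpath \<Rightarrow> 'a" and X w
    by (induction X rule: infinite_finite_induct) simp_all
  define D where "D = iota (\<pi>p s) + Ev1 (mapC (\<phi>t t s)) - Om s"
  have DK: "D \<in> K n"
    unfolding K_def
  proof (intro CollectI conjI ballI)
    show "D \<in> C" unfolding D_def by (intro C_diff C_add iota_C Ev1_C Om_C)
    fix e assume e: "e \<in> E n"
    have "Ev1 (mapC (\<phi>t t s)) e = (\<Sum>x\<in>keys t. sA (lookup t x) (sA (lam e (snd x)) (fst x s)))"
      unfolding Ev1_phit sum_fun_apply by (simp add: act_iota[OF Eu_I[OF e]] lam_scale[OF e])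
    also have "\<dots> = coord sP t e s"
      unfolding coord_def lin_ext_def by (simp add: sum_P_apply sP_def case_prod_unfold)
    finally show "D e = 0"
      unfolding D_def by (simp add: Om_S[OF o(4)] coord_t[OF e])
  qed
  have "Ev1 (kQ_to_Bz (\<phi> s)) = lin_ext sF (\<lambda>u. iota (\<pi>p u)) (\<phi> s)"
    unfolding Ev1_kQ by (rule F.lin_ext_cong) (rule Om_irr[OF phi_irr[OF o(4)]])
  also have "\<dots> = iota (\<pi>p s)"
    unfolding module_hom_lin_ext[OF iota_hom, symmetric] pi_phi[OF o(4)] ..
  finally have 1: "Ev1 (kQ_to_Bz (\<phi> s)) = iota (\<pi>p s)" .
  have 2: "Om p = st (Om q) (st (Om s) (Om r))"
    unfolding o(7) Om_mult[OF o(2,3,6)] by (rule Om_mult[symmetric]) (simp_all add: o pcat_in_paths)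
  have e1: "Ev1 (free_ext (\<lambda>u. base (pcat q (pcat u r))) (kQ_to_Bz (\<phi> s))) = st (Om q) (st (Ev1 (kQ_to_Bz (\<phi> s))) (Om r))"
    by (rule Ev1_context[OF 3(1)]) (rule keys_kQ_phi[OF t o(4)])
  have e2: "Ev1 (free_ext (\<lambda>u. base (pcat q (pcat u r))) (mapC (\<phi>t t s))) = st (Om q) (st (Ev1 (mapC (\<phi>t t s))) (Om r))"
    by (rule Ev1_context[OF 3(1)]) (rule keys_mapC_phit[OF t o(4)])
  have "Ev1 (rp t p) - Om p = st (Om q) (st D (Om r))"
    unfolding 3(4) Ev1_add Ev1_fscale e1 e2 1 2 D_def
    by (simp add: st_add_left st_add_right st_diff_left st_diff_right act_one)
  then show ?thesis
    using st_K_right[OF st_K_left[OF DK]] by (simp only:)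
qed simp

lemma Ev1_red: "keys y \<subseteq> paths G \<Longrightarrow> Ev1 (red t y) - Ev1 y \<in> K n"
proof -
  assume y: "keys y \<subseteq> paths G"
  have "Ev1 (red t y) - Ev1 y = (\<Sum>p\<in>keys y. act (poly (lookup y p) 1) (Ev1 (rp t p) - Om p))"
    unfolding red_eq Ev1_free_ext by (simp only: Ev1_def act_diff sum_subtractf)
  then show ?thesis
    using y by (simp only:) (intro K_sum act_K_same Ev1_rp, blast)
qed

lemma Ev1_iter: "keys y \<subseteq> paths G \<Longrightarrow> keys ((red t ^^ k) y) \<subseteq> paths G \<and> Ev1 ((red t ^^ k) y) - Ev1 y \<in> K n"
proof (induction k)
  case 0
  then show ?case by (simp only: funpow_0 diff_self K_zero simp_thms)
next
  case (Suc k)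
  note IH = conjunct1[OF Suc.IH[OF Suc.prems]] conjunct2[OF Suc.IH[OF Suc.prems]]
  have "Ev1 ((red t ^^ Suc k) y) - Ev1 y = (Ev1 (red t ((red t ^^ k) y)) - Ev1 ((red t ^^ k) y)) + (Ev1 ((red t ^^ k) y) - Ev1 y)"
    by simp
  with K_add[OF Ev1_red[OF IH(1)] IH(2)] have "Ev1 ((red t ^^ Suc k) y) - Ev1 y \<in> K n"
    by (simp only:)
  moreover have "keys ((red t ^^ Suc k) y) \<subseteq> paths G"
    using red_paths[OF t, of "(red t ^^ k) y"] by simp
  ultimately show ?case by blast
qed

lemma Ev1_good:
  assumes y: "keys y \<subseteq> paths G" "good n y" "\<And>p. lookup y p \<in> FP 0" and e: "e \<in> E n"
  shows "Ev1 y e = (\<Sum>p\<in>keys y. \<Sum>j<n. sA (lam e (coeff (lookup y p) j)) (\<pi>p p))"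
  unfolding Ev1_def sum_fun_apply
proof (rule sum.cong[OF refl])
  fix p assume "p \<in> keys y"
  define c where "c = lookup y p"
  have c: "coeff c j \<in> Pw j" for j
    using y(3)[of p] by (simp add: FP_def c_def del: ideal_pow.simps)
  define m where "m = max n (Suc (degree c))"
  have "poly c 1 = (\<Sum>j<m. coeff c j)"
    unfolding poly_altdef power_one mult_1_right
    by (rule sum.mono_neutral_left) (auto simp: m_def coeff_eq_0)
  also have "{..<m} = {..<n} \<union> {n..<m}"
    by (auto simp: m_def)
  also have "(\<Sum>j\<in>{..<n} \<union> {n..<m}. coeff c j) = (\<Sum>j<n. coeff c j) + (\<Sum>j\<in>{n..<m}. coeff c j)"
    by (rule sum.union_disjoint) auto
  finally have "poly c 1 - (\<Sum>j<n. coeff c j) = (\<Sum>j\<in>{n..<m}. coeff c j)"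
    by simp
  also have "\<dots> \<in> Pw n"
    by (rule Pw_sum') (use c Pw_antimono in fastforce)
  finally have r: "poly c 1 - (\<Sum>j<n. coeff c j) \<in> Pw n" .
  show "act (poly (lookup y p) 1) (Om p) e = (\<Sum>j<n. sA (lam e (coeff (lookup y p) j)) (\<pi>p p))"
    unfolding c_def[symmetric]
  proof (cases "p \<in> irr G S")
    case True
    show "act (poly c 1) (Om p) e = (\<Sum>j<n. sA (lam e (coeff c j)) (\<pi>p p))"
      unfolding Om_irr[OF True] act_iota[OF Eu_I[OF e]] lam_cong_Pw[OF r e] lam_sum'[OF e] A.scale_sum_left ..
  next
    case False
    then have z: "\<And>j. j < n \<Longrightarrow> coeff c j = 0"
      using y(2) by (simp add: good_def[OF t] low_def c_def)
    then have "poly c 1 \<in> Pw n"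
      using r by (simp del: ideal_pow.simps)
    then have "act (poly c 1) (Om p) e = 0"
      using act_Pw_K[OF _ Om_C, of "poly c 1" n p] e by (simp add: K_def del: ideal_pow.simps)
    then show "act (poly c 1) (Om p) e = (\<Sum>j<n. sA (lam e (coeff c j)) (\<pi>p p))"
      using z by (simp add: lam_zero[OF e])
  qed
qed

lemma Om_mult_zero: "p \<in> irr G S \<Longrightarrow> q \<in> irr G S \<Longrightarrow> tgt G p \<noteq> src q \<Longrightarrow> st (Om p) (Om q) = 0"
proof -
  assume p: "p \<in> irr G S" "q \<in> irr G S" "tgt G p \<noteq> src q"
  note P = irr_paths[OF p(1)] irr_paths[OF p(2)]
  have "st (iota (\<pi>p p)) (iota (\<pi>p q)) = st (iota (\<pi>p p * ev (tgt G p))) (iota (\<pi>p q))"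
    using pp_ev[OF tgt_in_verts[OF P(1)] P(1)] by simp
  also have "\<dots> = st (iota (\<pi>p p)) (iota (ev (tgt G p) * \<pi>p q))"
    by (rule st_ev_mid[OF tgt_in_verts[OF P(1)]])
  also have "ev (tgt G p) * \<pi>p q = 0"
    using ev_pp[OF tgt_in_verts[OF P(1)] P(2)] p(3) by simp
  finally show ?thesis
    by (simp only: Om_irr p module_hom.zero[OF iota_hom] st_zero_right)
qed

lemma pmul_sigma_paths: "keys (pmul G (\<sigma> a) (\<sigma> a')) \<subseteq> paths G"
proof
  fix u assume "u \<in> keys (pmul G (\<sigma> a) (\<sigma> a'))"
  then obtain p q where pq: "p \<in> keys (\<sigma> a)" "q \<in> keys (\<sigma> a')" "u \<in> keys (if tgt G p = src q then base (pcat p q) else (0 :: _ \<Rightarrow>\<^sub>0 'k))"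
    unfolding pmul_def by (elim UN_E[OF subsetD[OF keys_free_ext]]) auto
  then show "u \<in> paths G"
    using irr_paths[OF sigma_irr[OF pq(1)]] irr_paths[OF sigma_irr[OF pq(2)]]
    by (auto split: if_splits intro: pcat_in_paths)
qed

lemma Ev1_product: "Ev1 (kQ_to_Bz (pmul G (\<sigma> a) (\<sigma> a'))) = st (iota a) (iota a')"
proof -
  have i: "iota a = lin_ext sF Om (\<sigma> a)" for a
    using hom_expand[OF iota_hom, of a] F.lin_ext_cong[of "\<sigma> a" "\<lambda>u. iota (\<pi>p u)" Om] Om_irr sigma_irr by simp
  have "Ev1 (kQ_to_Bz (pmul G (\<sigma> a) (\<sigma> a'))) =
      lin_ext sF (\<lambda>p. lin_ext sF (\<lambda>q. lin_ext sF Om (if tgt G p = src q then base (pcat p q) else 0)) (\<sigma> a')) (\<sigma> a)"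
    unfolding Ev1_kQ pmul_def F.lin_ext_free_ext ..
  also have "\<dots> = lin_ext sF (\<lambda>p. lin_ext sF (\<lambda>q. st (Om p) (Om q)) (\<sigma> a')) (\<sigma> a)"
  proof (intro F.lin_ext_cong)
    fix p q assume pq: "p \<in> keys (\<sigma> a)" "q \<in> keys (\<sigma> a')"
    note P = sigma_irr[OF pq(1)] sigma_irr[OF pq(2)]
    show "lin_ext sF Om (if tgt G p = src q then base (pcat p q) else 0) = st (Om p) (Om q)"
      using Om_mult[OF irr_paths[OF P(1)] irr_paths[OF P(2)]] Om_mult_zero[OF P] by simp
  qed
  also have "\<dots> = lin_ext sF (\<lambda>p. st (Om p) (iota a')) (\<sigma> a)"
    unfolding i[of a'] by (simp only: st_lin_ext_right[OF Om_C])
  also have "\<dots> = st (iota a) (iota a')"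
    unfolding i[of a] by (rule st_lin_ext_left[OF Om_C, symmetric])
  finally show ?thesis .
qed

text \<open>Reduce until all reducible paths have coefficients divisible by \<open>z\<^sup>n\<close>. As the coefficient of \<open>z\<^sup>j\<close> lies in
  \<open>\<mm>\<^sup>j\<close>, what is cut off vanishes modulo \<open>\<mm>\<^sup>n\<close>, and evaluation is invariant.\<close>

lemma coord_star_basic:
  assumes e: "e \<in> E n"
  shows "coord sA (star_basic n t a a') e = st (iota a) (iota a') e"
proof -
  define x where "x = kQ_to_Bz (pmul G (\<sigma> a) (\<sigma> a'))"
  have xp: "keys x \<subseteq> paths G"
    unfolding x_def using keys_kQ pmul_sigma_paths by blast
  have xF: "lookup x p \<in> FP 0" for p
    unfolding x_def lookup_kQ by (rule FP_const) simp
  have "fin t n (free_ext base x)"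
    by (rule fin_free_ext[OF t], rule fin_path[OF t]) (use xp in blast)
  then obtain M where M: "good n ((red t ^^ M) x)"
    unfolding free_ext_base fin_def[OF t] by (elim exE)
  define y where "y = (red t ^^ M) x"
  have yF: "lookup y p \<in> FP 0" for p
  proof -
    have "\<forall>p. lookup ((red t ^^ k) x) p \<in> FP 0" for k
      by (induction k) (simp_all add: xF red_FP[OF t])
    then show ?thesis by (simp add: y_def)
  qed
  have yp: "keys y \<subseteq> paths G" "Ev1 y - Ev1 x \<in> K n"
    using Ev1_iter[OF xp, of M] by (simp_all only: y_def)
  have "coord sA (star_basic n t a a') e =
      (\<Sum>j<n. \<Sum>p | coeff (lookup y p) j \<noteq> 0. sA (lam e (coeff (lookup y p) j)) (\<pi>p p))"
    unfolding star_basic_def Let_def x_def[symmetric] module_hom.sum[OF coordA_hom]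
    by (rule sum.cong[OF refl]) (simp add: red_lim_eq[OF t M] y_def coord_base[OF vector_space_sA A.subspace_UNIV B.subspace_UNIV])
  also have "\<dots> = (\<Sum>j<n. \<Sum>p\<in>keys y. sA (lam e (coeff (lookup y p) j)) (\<pi>p p))"
  proof (rule sum.cong[OF refl], rule sum.mono_neutral_left)
    fix j
    show "{p. coeff (lookup y p) j \<noteq> 0} \<subseteq> keys y"
      by (auto simp: in_keys_iff)
  qed (simp_all add: lam_zero[OF e])
  also have "\<dots> = Ev1 y e"
    unfolding Ev1_good[OF yp(1) M[folded y_def] yF e] by (rule sum.swap)
  also have "\<dots> = Ev1 x e"
    using yp(2) e by (simp add: K_def)
  finally show ?thesis
    by (simp only: x_def Ev1_product)
qed

end

lemma comb_star_fromC:
  "comb_star xi (fromC f) (fromC g) = fromC (st f g)" if fg: "f \<in> C" "g \<in> C"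
proof
  fix n
  have main: "AB_class n (free_ext (\<lambda>(a, b). free_ext (\<lambda>(a', b').
       b_act (b * b') (star_basic n t a a')) v) u) = fromC (st f g) n"
    if t: "t \<in> xi n" and u: "u \<in> fromC f n" and v: "v \<in> fromC g n" for t u v
  proof (rule AB_class_eq)
    fix e assume e: "e \<in> E n"
    define F where "F u = (\<Sum>x\<in>keys u. act (sB (lookup u x) (snd x)) (iota (fst x)))" for u :: "'a \<times> 'b \<Rightarrow>\<^sub>0 'k"
    have FK: "F u - f \<in> K n" if u: "u \<in> fromC f n" and f: "f \<in> C" for u f
      unfolding K_def
    proof (intro CollectI conjI ballI)
      show "F u - f \<in> C" unfolding F_def by (intro C_diff C_sum act_C f)
      fix e assume e: "e \<in> E n"
      have "F u e = coord sA u e"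
        unfolding F_def sum_fun_apply coord_def lin_ext_def
        by (simp add: act_iota[OF Eu_I[OF e]] lam_scale[OF e] case_prod_unfold)
      then show "(F u - f) e = 0" using u[unfolded mem_fromC] e by simp
    qed
    have st_F: "st (F u) (F v) = (\<Sum>x\<in>keys u. \<Sum>y\<in>keys v. act (sB (lookup u x) (snd x) * sB (lookup v y) (snd y))
        (st (iota (fst x)) (iota (fst y))))"
      unfolding F_def st_sum_left st_act_left unfolding st_sum_right st_act_right act_mult by (simp only: act_sum)
    have c: "coord sA (b_act b (star_basic n t a a')) e = act b (st (iota a) (iota a')) e" for a a' b
      unfolding coord_b_act[OF e] act_eq[OF e] by (rule sum.cong[OF refl]) (simp only: coord_star_basic[OF t])
    have c2: "sA c (act b h e) = act (sB c b) h e" for c b h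
      by (simp add: act_scale)
    have "coord sA (free_ext (\<lambda>(a, b). free_ext (\<lambda>(a', b'). b_act (b * b') (star_basic n t a a')) v) u) e =
        (\<Sum>x\<in>keys u. \<Sum>y\<in>keys v. sA (lookup u x) (sA (lookup v y)
          (coord sA (b_act (snd x * snd y) (star_basic n t (fst x) (fst y))) e)))"
      unfolding module_hom_lin_ext[OF coordA_hom] case_prod_unfold module_hom_lin_ext[OF coordA_hom]
      unfolding lin_ext_def A.scale_sum_right ..
    also have "\<dots> = st (F u) (F v) e"
      unfolding st_F sum_fun_apply c c2 by (simp add: sB_mult mult.commute[of "lookup v _"])
    also have "\<dots> = st f g e"
    proof -
      have "st (F u) (F v) - st f g = st (F u - f) (F v) + st f (F v - g)"
        by (simp add: st_diff_left st_diff_right)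
      with K_add[OF st_K_left[OF FK[OF u fg(1)]] st_K_right[OF FK[OF v fg(2)]]]
      have "st (F u) (F v) - st f g \<in> K n" by (simp only:)
      then show ?thesis using e by (simp add: K_def)
    qed
    finally show "coord sA (free_ext (\<lambda>(a, b). free_ext (\<lambda>(a', b'). b_act (b * b') (star_basic n t a a')) v) u) e = st f g e" .
  qed
  obtain t u v where "t \<in> xi n" "u \<in> fromC f n" "v \<in> fromC g n"
    using xi_ex fromC_mem_ex by blast
  then show "comb_star xi (fromC f) (fromC g) n = fromC (st f g) n"
    unfolding comb_star_def by (intro UN_const main) auto
qed

end

section \<open>Counting shuffles\<close>

lemma strict_mono_on_map_sorted:
  fixes \<tau> :: "nat \<Rightarrow> nat"
  assumes "strict_mono_on {i..<j} \<tau>"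
  shows "map \<tau> [i..<j] = sorted_list_of_set (\<tau> ` {i..<j})"
proof (rule sorted_distinct_set_unique)
  show "sorted (map \<tau> [i..<j])"
    unfolding sorted_iff_nth_mono_less using strict_mono_onD[OF assms] by (fastforce simp: less_imp_le)
  show "distinct (map \<tau> [i..<j])"
    using strict_mono_on_imp_inj_on[OF assms] by (simp add: distinct_map)
qed simp_all

lemma strict_mono_on_sorted_nth:
  "finite A \<Longrightarrow> strict_mono_on {..<card A} (\<lambda>j. sorted_list_of_set A ! j)" for A :: "nat set"
  by (rule strict_mono_onI) (simp add: sorted_wrt_nth_less[OF strict_sorted_list_of_set])

text \<open>A pointed shuffle is determined by the image of \<open>{0, \<dots>, i - 1}\<close>, which is any subset of size \<open>i\<close>
  that contains \<open>0\<close>.\<close>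

lemma pointed_shuffles_bij:
  assumes i: "1 \<le> i" "i < k"
  shows "bij_betw (\<lambda>\<tau>. \<tau> ` {..<i}) (pointed_shuffles i k) {A. A \<subseteq> {..<k} \<and> card A = i \<and> 0 \<in> A}"
proof (rule bij_betw_imageI)
  have l: "map \<tau> [0..<i] = sorted_list_of_set (\<tau> ` {..<i})" "map \<tau> [i..<k] = sorted_list_of_set ({..<k} - \<tau> ` {..<i})"
    if "\<tau> \<in> pointed_shuffles i k" for \<tau>
  proof -
    have t: "\<tau> permutes {..<k}" "strict_mono_on {0..<i} \<tau>" "strict_mono_on {i..<k} \<tau>"
      using that by (auto simp: pointed_shuffles_def lessThan_atLeast0)
    show "map \<tau> [0..<i] = sorted_list_of_set (\<tau> ` {..<i})"
      using strict_mono_on_map_sorted[OF t(2)] by (simp add: lessThan_atLeast0)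
    have "\<tau> ` {i..<k} = \<tau> ` ({..<k} - {..<i})"
      by (rule arg_cong[of _ _ "(`) \<tau>"]) auto
    also have "\<dots> = {..<k} - \<tau> ` {..<i}"
      using permutes_image[OF t(1)] inj_on_image_set_diff[OF permutes_inj[OF t(1)], of "{..<k}" "{..<i}"] by simp
    finally show "map \<tau> [i..<k] = sorted_list_of_set ({..<k} - \<tau> ` {..<i})"
      using strict_mono_on_map_sorted[OF t(3)] by simp
  qed
  show "inj_on (\<lambda>\<tau>. \<tau> ` {..<i}) (pointed_shuffles i k)"
  proof (rule inj_onI)
    fix \<tau> \<tau>' assume a: "\<tau> \<in> pointed_shuffles i k" "\<tau>' \<in> pointed_shuffles i k" "\<tau> ` {..<i} = \<tau>' ` {..<i}"
    have p: "\<tau> permutes {..<k}" "\<tau>' permutes {..<k}"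
      using a(1,2) by (auto simp: pointed_shuffles_def)
    have "map \<tau> [0..<i] = map \<tau>' [0..<i]" "map \<tau> [i..<k] = map \<tau>' [i..<k]"
      using l[OF a(1)] l[OF a(2)] a(3) by simp_all
    then have "\<tau> j = \<tau>' j" for j
      using p[THEN permutes_not_in, of j] by (cases "j < i"; cases "j < k") (auto simp: map_eq_conv)
    then show "\<tau> = \<tau>'" by (rule ext)
  qed
  show "(\<lambda>\<tau>. \<tau> ` {..<i}) ` pointed_shuffles i k = {A. A \<subseteq> {..<k} \<and> card A = i \<and> 0 \<in> A}"
  proof (intro equalityI subsetI)
    fix A assume "A \<in> (\<lambda>\<tau>. \<tau> ` {..<i}) ` pointed_shuffles i k"
    then obtain \<tau> where t: "\<tau> \<in> pointed_shuffles i k" "A = \<tau> ` {..<i}" by blast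
    have p: "\<tau> permutes {..<k}" "strict_mono_on {..<i} \<tau>" "strict_mono_on {i..<k} \<tau>" "\<tau> 0 < \<tau> i"
      using t(1) by (auto simp: pointed_shuffles_def)
    have "A \<subseteq> {..<k}"
      unfolding t(2) using permutes_image[OF p(1)] i by (metis image_mono lessThan_subset_iff less_imp_le)
    moreover have "card A = i"
      unfolding t(2) using card_image[OF inj_on_subset[OF permutes_inj[OF p(1)] subset_UNIV], of "{..<i}"] by simp
    moreover have "0 \<in> A"
    proof -
      obtain j where j: "j < k" "\<tau> j = 0"
        using permutes_image[OF p(1)] i by (metis gr_implies_not0 imageE lessThan_iff not_gr_zero)
      have "j < i"
      proof (rule ccontr)
        assume "\<not> j < i"
        then have "\<tau> i \<le> \<tau> j"
          using strict_mono_onD[OF p(3), of i j] j(1) i(2) by (cases "i = j") auto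
        then show False using p(4) j(2) by simp
      qed
      then show ?thesis using j(2) unfolding t(2) by force
    qed
    ultimately show "A \<in> {A. A \<subseteq> {..<k} \<and> card A = i \<and> 0 \<in> A}" by simp
  next
    fix A assume "A \<in> {A. A \<subseteq> {..<k} \<and> card A = i \<and> 0 \<in> A}"
    then have A: "A \<subseteq> {..<k}" "card A = i" "0 \<in> A" by auto
    have fA: "finite A" "finite ({..<k} - A)" using A(1) by (auto intro: finite_subset)
    have cA: "card ({..<k} - A) = k - i"
      using A(1,2) fA by (simp add: card_Diff_subset)
    define l1 l2 where "l1 = sorted_list_of_set A" and "l2 = sorted_list_of_set ({..<k} - A)"
    have ls: "set l1 = A" "set l2 = {..<k} - A" "length l1 = i" "length l2 = k - i"
      using fA cA A(2) by (simp_all add: l1_def l2_def)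
    define \<tau> where "\<tau> = (\<lambda>j. if j < k then (l1 @ l2) ! j else j)"
    have "bij_betw (\<lambda>j. (l1 @ l2) ! j) {..<k} {..<k}"
      by (rule bij_betw_nth) (use ls i A(1) fA in \<open>auto simp: l1_def l2_def\<close>)
    then have "bij_betw \<tau> {..<k} {..<k}"
      by (rule bij_betw_cong[THEN iffD1, rotated]) (simp add: \<tau>_def)
    then have perm: "\<tau> permutes {..<k}"
      by (rule bij_imp_permutes) (simp add: \<tau>_def)
    have t1: "\<tau> j = l1 ! j" if "j < i" for j
      using that i ls by (simp add: \<tau>_def nth_append)
    have t2: "\<tau> j = l2 ! (j - i)" if "i \<le> j" "j < k" for j
      using that i ls by (simp add: \<tau>_def nth_append)
    have s1: "strict_mono_on {..<i} \<tau>"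
      using strict_mono_on_sorted_nth[OF fA(1)] unfolding A(2) strict_mono_on_def by (simp add: t1 l1_def)
    have s2: "strict_mono_on {i..<k} \<tau>"
    proof (rule strict_mono_onI)
      fix r s assume "r \<in> {i..<k}" "s \<in> {i..<k}" "r < s"
      then show "\<tau> r < \<tau> s"
        using strict_mono_onD[OF strict_mono_on_sorted_nth[OF fA(2)], of "r - i" "s - i"] by (simp add: t2 cA l2_def)
    qed
    have img: "\<tau> ` {..<i} = A"
    proof -
      have "\<tau> ` {..<i} = (\<lambda>j. l1 ! j) ` {..<length l1}"
        by (rule image_cong) (simp_all add: t1 ls)
      also have "\<dots> = set l1"
        by (auto simp: set_conv_nth)
      finally show ?thesis by (simp add: ls)
    qed
    have "\<tau> 0 = 0"
    proof -
      obtain j where j: "j < i" "\<tau> j = 0" using A(3) img by force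
      then show ?thesis using strict_mono_onD[OF s1, of 0 j] i by (cases "j = 0") auto
    qed
    moreover have "\<tau> i \<noteq> 0"
    proof
      assume "\<tau> i = 0"
      then have "\<tau> i \<in> A" using A(3) by simp
      then obtain j where "j < i" "\<tau> j = \<tau> i" unfolding img[symmetric] by auto
      then show False using permutes_inj[OF perm] by (auto dest: injD)
    qed
    ultimately have "\<tau> \<in> pointed_shuffles i k"
      unfolding pointed_shuffles_def using perm s1 s2 by simp
    then show "A \<in> (\<lambda>\<tau>. \<tau> ` {..<i}) ` pointed_shuffles i k"
      using img by blast
  qed
qed

lemma card_pointed_shuffles:
  assumes i: "1 \<le> i" "i < k"
  shows "card (pointed_shuffles i k) = (k - 1) choose (i - 1)"
proof -
  have "bij_betw (insert 0) {A. A \<subseteq> {1..<k} \<and> card A = i - 1} {A. A \<subseteq> {..<k} \<and> card A = i \<and> 0 \<in> A}"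
  proof (rule bij_betwI[where g = "\<lambda>A. A - {0}"])
    show "insert 0 \<in> {A. A \<subseteq> {1..<k} \<and> card A = i - 1} \<rightarrow> {A. A \<subseteq> {..<k} \<and> card A = i \<and> 0 \<in> A}"
    proof (intro Pi_I CollectI)
      fix A assume "A \<in> {A. A \<subseteq> {1..<k} \<and> card A = i - 1}"
      then have A: "A \<subseteq> {1..<k}" "card A = i - 1" "0 \<notin> A" "finite A" by (auto intro: finite_subset)
      then show "insert 0 A \<subseteq> {..<k} \<and> card (insert 0 A) = i \<and> 0 \<in> insert 0 A"
        using i by auto
    qed
    show "(\<lambda>A. A - {0}) \<in> {A. A \<subseteq> {..<k} \<and> card A = i \<and> 0 \<in> A} \<rightarrow> {A. A \<subseteq> {1..<k} \<and> card A = i - 1}"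
      by (auto simp: card_Diff_singleton Suc_le_eq intro!: neq0_conv[THEN iffD1])
  qed auto
  then have "card {A. A \<subseteq> {1..<k} \<and> card A = i - 1} = card (pointed_shuffles i k)"
    using bij_betw_same_card[OF pointed_shuffles_bij[OF i]] by (simp add: bij_betw_same_card)
  then show ?thesis
    using n_subsets[of "{1..<k}" "i - 1"] by simp
qed

section \<open>Bilinearity of the brackets\<close>

context reduction_setup
begin

lemma rel2_comb:
  assumes "\<And>i. i \<in> X \<Longrightarrow> rel2 (f i)"
  shows "rel2 (\<lambda>as. \<Sum>i\<in>X. sA (c i) (f i as))"
proof -
  note add = module_hom.add[OF rel2D(1)[OF assms]] module_hom.add[OF rel2D(2)[OF assms]]
  note sc = module_hom.scale[OF rel2D(1)[OF assms]] module_hom.scale[OF rel2D(2)[OF assms]]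
  show ?thesis
    unfolding rel2_def
  proof (intro conjI allI ballI)
    fix a b v
    show "module_hom sA sA (\<lambda>a. \<Sum>i\<in>X. sA (c i) (f i [a, b]))" "module_hom sA sA (\<lambda>b. \<Sum>i\<in>X. sA (c i) (f i [a, b]))"
      by (intro A_homI;
          simp add: add sc A.scale_right_distrib sum.distrib A.scale_sum_right mult.commute)+
    show "(\<Sum>i\<in>X. sA (c i) (f i [oneA, b])) = 0"
      by (simp add: rel2D(5)[OF assms])
    assume v: "v \<in> verts G"
    show "(\<Sum>i\<in>X. sA (c i) (f i [a * ev v, b])) = (\<Sum>i\<in>X. sA (c i) (f i [a, ev v * b]))"
      by (rule sum.cong[OF refl]) (simp only: rel2D(3)[OF assms v])
    show "(\<Sum>i\<in>X. sA (c i) (f i [a, b * ev v])) = (\<Sum>i\<in>X. sA (c i) (f i [a, b])) * ev v"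
      unfolding sum_distrib_right by (rule sum.cong[OF refl]) (simp only: rel2D(4)[OF assms v] sA_mult_left)
  qed
qed

text \<open>Evaluations of \<open>F\<^sup>3(g)\<close> and \<open>h\<^sup>2(g)\<close> are the intended examples, so that the brackets and the \<open>G\<^sub>k\<close>
  can be treated alike. Cochains are functions on lists of any length, whence the clause on lists of length \<open>3\<close>.\<close>

definition cubic :: "(('a list \<Rightarrow> 'a) \<Rightarrow> 'a) \<Rightarrow> bool" where
  "cubic L \<longleftrightarrow> (\<forall>g g'. rel3 g \<longrightarrow> (\<forall>a b c. g [a, b, c] = g' [a, b, c]) \<longrightarrow> L g = L g') \<and>
     (\<forall>g g'. L (\<lambda>as. g as + g' as) = L g + L g') \<and> (\<forall>c g. L (\<lambda>as. sA c (g as)) = sA c (L g))"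

lemma cubicD:
  assumes "cubic L"
  shows "rel3 g \<Longrightarrow> (\<And>a b c. g [a, b, c] = g' [a, b, c]) \<Longrightarrow> L g = L g'"
    "L (\<lambda>as. g as + g' as) = L g + L g'" "L (\<lambda>as. sA c (g as)) = sA c (L g)"
  using assms unfolding cubic_def by blast+

lemma cubic_zero: "cubic L \<Longrightarrow> L (\<lambda>as. 0) = 0"
  using cubicD(3)[of L 0] by simp

lemma cubic_sum: "cubic L \<Longrightarrow> L (\<lambda>as. \<Sum>i\<in>X. g i as) = (\<Sum>i\<in>X. L (g i))"
proof -
  assume L: "cubic L"
  show ?thesis
    by (induction X rule: infinite_finite_induct) (simp_all add: cubic_zero[OF L] cubicD(2)[OF L])
qed

lemma rel3_cong: "rel3 g \<Longrightarrow> (\<And>a b c. g [a, b, c] = g' [a, b, c]) \<Longrightarrow> rel3 g'"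
  unfolding rel3_def by simp

lemma gh_cong: "(\<And>a b c. g [a, b, c] = g' [a, b, c]) \<Longrightarrow> gh g = gh g'"
  unfolding gh_def by (intro ext) simp

lemma eval_bar_add: "eval_bar (\<lambda>as. g as + g' as) y = eval_bar g y + eval_bar g' y"
  unfolding eval_bar_def by (simp add: distrib_left distrib_right A.lin_ext_fun_add)

lemma eval_bar_scale: "eval_bar (\<lambda>as. sA c (g as)) y = sA c (eval_bar g y)"
  unfolding eval_bar_def by (simp add: sA_mult_left sA_mult_right A.lin_ext_fun_scale)

lemma cubic_hup: "cubic (\<lambda>g. hup 2 g [a, b])"
  unfolding cubic_def
proof (intro conjI allI impI)
  fix g g' :: "'a list \<Rightarrow> 'a" and c
  show "hup 2 (\<lambda>as. g as + g' as) [a, b] = hup 2 g [a, b] + hup 2 g' [a, b]"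
    by (simp add: hup_def eval_bar_add A.scale_right_distrib)
  show "hup 2 (\<lambda>as. sA c (g as)) [a, b] = sA c (hup 2 g [a, b])"
    by (simp add: hup_def eval_bar_scale mult.commute)
  assume g: "rel3 g" "\<forall>a b c. g [a, b, c] = g' [a, b, c]"
  have g': "rel3 g'" by (rule rel3_cong[OF g(1)]) (simp add: g(2))
  have e: "gh g = gh g'" by (rule gh_cong) (simp add: g(2))
  show "hup 2 g [a, b] = hup 2 g' [a, b]"
    unfolding hup_eq[OF rel3D(6)[OF g(1)] relm_gh[OF g(1)]] hup_eq[OF rel3D(6)[OF g'] relm_gh[OF g']] e
    using g(2) by simp
qed

lemma cubic_Fup: "cubic (\<lambda>g. Fup 3 g w)"
  unfolding cubic_def
proof (intro conjI allI impI)
  fix g g' :: "'a list \<Rightarrow> 'a" and c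
  show "Fup 3 (\<lambda>as. g as + g' as) w = Fup 3 g w + Fup 3 g' w"
    by (simp add: Fup_def eval_bar_add del: amb.simps)
  show "Fup 3 (\<lambda>as. sA c (g as)) w = sA c (Fup 3 g w)"
    by (simp add: Fup_def eval_bar_scale del: amb.simps)
  assume g: "rel3 g" "\<forall>a b c. g [a, b, c] = g' [a, b, c]"
  have g': "rel3 g'" by (rule rel3_cong[OF g(1)]) (simp add: g(2))
  have e: "gh g = gh g'" by (rule gh_cong) (simp add: g(2))
  show "Fup 3 g w = Fup 3 g' w"
    unfolding Fup_eq[of g, OF rel3D(6)[OF g(1)]] Fup_eq[of g', OF rel3D(6)[OF g']] e ..
qed

lemma brk_commute: "brk 0 0 f g = brk 0 0 g f"
  by (rule ext) (simp add: brk_def gerst_def)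

lemma brk_comb:
  assumes f: "\<And>i. i \<in> X \<Longrightarrow> rel2 (f i)" and g: "\<And>j. j \<in> Y \<Longrightarrow> rel2 (g j)"
  shows "brk 0 0 (\<lambda>as. \<Sum>i\<in>X. sA (c i) (f i as)) (\<lambda>as. \<Sum>j\<in>Y. sA (d j) (g j as)) [x, y, z] =
    (\<Sum>i\<in>X. \<Sum>j\<in>Y. sA (c i) (sA (d j) (brk 0 0 (f i) (g j) [x, y, z])))"
proof -
  have 1: "(\<Sum>i\<in>X. sA (c i) (f i [\<Sum>j\<in>Y. sA (d j) (g j [u, v]), w])) = (\<Sum>i\<in>X. \<Sum>j\<in>Y. sA (c i) (sA (d j) (f i [g j [u, v], w])))" for u v w
    by (rule sum.cong[OF refl]) (simp only: module_hom.sum[OF rel2D(1)[OF f]] module_hom.scale[OF rel2D(1)[OF f]] A.scale_sum_right)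
  have 2: "(\<Sum>i\<in>X. sA (c i) (f i [w, \<Sum>j\<in>Y. sA (d j) (g j [u, v])])) = (\<Sum>i\<in>X. \<Sum>j\<in>Y. sA (c i) (sA (d j) (f i [w, g j [u, v]])))" for u v w
    by (rule sum.cong[OF refl]) (simp only: module_hom.sum[OF rel2D(2)[OF f]] module_hom.scale[OF rel2D(2)[OF f]] A.scale_sum_right)
  have 3: "(\<Sum>j\<in>Y. sA (d j) (g j [\<Sum>i\<in>X. sA (c i) (f i [u, v]), w])) = (\<Sum>i\<in>X. \<Sum>j\<in>Y. sA (c i) (sA (d j) (g j [f i [u, v], w])))" for u v w
    by (subst sum.swap, rule sum.cong[OF refl])
      (simp only: module_hom.sum[OF rel2D(1)[OF g]] module_hom.scale[OF rel2D(1)[OF g]] A.scale_sum_right A.scale_left_commute)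
  have 4: "(\<Sum>j\<in>Y. sA (d j) (g j [w, \<Sum>i\<in>X. sA (c i) (f i [u, v])])) = (\<Sum>i\<in>X. \<Sum>j\<in>Y. sA (c i) (sA (d j) (g j [w, f i [u, v]])))" for u v w
    by (subst sum.swap, rule sum.cong[OF refl])
      (simp only: module_hom.sum[OF rel2D(2)[OF g]] module_hom.scale[OF rel2D(2)[OF g]] A.scale_sum_right A.scale_left_commute)
  show ?thesis
    unfolding brk_eq 1 2 3 4
    by (simp only: A.scale_minus_right A.scale_right_distrib A.scale_right_diff_distrib sum.distrib sum_subtractf sum_negf)
qed

lemma cubic_brk_comb:
  assumes L: "cubic L" and f: "\<And>i. i \<in> X \<Longrightarrow> rel2 (f i)" and g: "\<And>j. j \<in> Y \<Longrightarrow> rel2 (g j)"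
  shows "L (brk 0 0 (\<lambda>as. \<Sum>i\<in>X. sA (c i) (f i as)) (\<lambda>as. \<Sum>j\<in>Y. sA (d j) (g j as))) =
    (\<Sum>i\<in>X. \<Sum>j\<in>Y. sA (c i) (sA (d j) (L (brk 0 0 (f i) (g j)))))"
proof -
  have "L (brk 0 0 (\<lambda>as. \<Sum>i\<in>X. sA (c i) (f i as)) (\<lambda>as. \<Sum>j\<in>Y. sA (d j) (g j as))) =
      L (\<lambda>as. \<Sum>i\<in>X. \<Sum>j\<in>Y. sA (c i) (sA (d j) (brk 0 0 (f i) (g j) as)))"
    by (rule cubicD(1)[OF L rel3_brk[OF rel2_comb[OF f] rel2_comb[OF g]]]) (simp_all only: brk_comb[OF f g])
  then show ?thesis
    by (simp only: cubic_sum[OF L] cubicD(3)[OF L])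
qed

lemma brk_cong:
  assumes "\<And>a b. f [a, b] = f' [a, b]" "\<And>a b. g [a, b] = g' [a, b]"
  shows "brk 0 0 f g [a, b, c] = brk 0 0 f' g' [a, b, c]"
  unfolding brk_eq by (simp add: assms)

lemma brk_zero:
  assumes "rel2 f" "\<And>a b. g [a, b] = 0"
  shows "brk 0 0 f g [a, b, c] = 0"
  unfolding brk_eq using module_hom.zero[OF rel2D(1)[OF assms(1)]] module_hom.zero[OF rel2D(2)[OF assms(1)]]
  by (simp add: assms(2))

lemma G_k_cong: "(\<And>j. j < k \<Longrightarrow> f j = g j) \<Longrightarrow> 1 \<le> k \<Longrightarrow> G_k k f = G_k k g"
proof (induction k arbitrary: f g rule: less_induct)
  case (less k)
  have "(\<Sum>i\<in>{1..<k}. \<Sum>\<tau>\<in>pointed_shuffles i k.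
       hup 2 (brk 0 0 (G_k i (\<lambda>j. f (\<tau> j))) (G_k (k - i) (\<lambda>j. f (\<tau> (i + j)))))) =
     (\<Sum>i\<in>{1..<k}. \<Sum>\<tau>\<in>pointed_shuffles i k.
       hup 2 (brk 0 0 (G_k i (\<lambda>j. g (\<tau> j))) (G_k (k - i) (\<lambda>j. g (\<tau> (i + j))))))"
  proof (intro sum.cong refl)
    fix i \<tau> assume i: "i \<in> {1..<k}" and t: "\<tau> \<in> pointed_shuffles i k"
    have m: "\<tau> j < k" if "j < k" for j
      using t that permutes_in_image[of \<tau> "{..<k}" j] by (simp add: pointed_shuffles_def)
    have "G_k i (\<lambda>j. f (\<tau> j)) = G_k i (\<lambda>j. g (\<tau> j))"
      by (rule less.IH) (use i m less.prems(1) in auto)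
    moreover have "G_k (k - i) (\<lambda>j. f (\<tau> (i + j))) = G_k (k - i) (\<lambda>j. g (\<tau> (i + j)))"
      by (rule less.IH) (use i m less.prems(1) in auto)
    ultimately show "hup 2 (brk 0 0 (G_k i (\<lambda>j. f (\<tau> j))) (G_k (k - i) (\<lambda>j. f (\<tau> (i + j))))) =
        hup 2 (brk 0 0 (G_k i (\<lambda>j. g (\<tau> j))) (G_k (k - i) (\<lambda>j. g (\<tau> (i + j)))))" by simp
  qed
  then show ?case
    using less.prems by (simp add: G_k.simps[of k])
qed

lemma sum_list_fun_apply: "(\<Sum>i\<in>X. f i) as = (\<Sum>i\<in>X. f i as)" for f :: "'i \<Rightarrow> 'c \<Rightarrow> 'a"
  by (induction X rule: infinite_finite_induct) simp_all

lemma rel2_sum: "(\<And>i. i \<in> X \<Longrightarrow> rel2 (f i)) \<Longrightarrow> rel2 (\<Sum>i\<in>X. f i)"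
  using rel2_comb[of X f "\<lambda>_. 1"] by (simp add: sum_list_fun_apply[symmetric])

lemma rel2_G_k: "(\<And>j. j < k \<Longrightarrow> f j \<in> Pn 2) \<Longrightarrow> 1 \<le> k \<Longrightarrow> rel2 (G_k k f)"
proof (induction k arbitrary: f rule: less_induct)
  case (less k)
  show ?case
  proof (cases "k \<le> 1")
    case True
    then show ?thesis using less.prems rel2_Gup[of "f 0"] by (simp add: G_k.simps[of k])
  next
    case False
    have "rel2 (\<Sum>i\<in>{1..<k}. \<Sum>\<tau>\<in>pointed_shuffles i k.
       hup 2 (brk 0 0 (G_k i (\<lambda>j. f (\<tau> j))) (G_k (k - i) (\<lambda>j. f (\<tau> (i + j))))))"
    proof (intro rel2_sum rel2_hup rel3_brk)
      fix i \<tau> assume i: "i \<in> {1..<k}" and t: "\<tau> \<in> pointed_shuffles i k"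
      have m: "\<tau> j < k" if "j < k" for j
        using t that permutes_in_image[of \<tau> "{..<k}" j] by (simp add: pointed_shuffles_def)
      show "rel2 (G_k i (\<lambda>j. f (\<tau> j)))" "rel2 (G_k (k - i) (\<lambda>j. f (\<tau> (i + j))))"
        by (rule less.IH; use i m less.prems(1) in auto)+
    qed
    then show ?thesis using False by (simp add: G_k.simps[of k])
  qed
qed

lemma bracket_Pn:
  assumes f: "\<And>j. j < k \<Longrightarrow> f j \<in> Pn 2" and k: "1 \<le> k"
  shows "bracket k f \<in> Pn 3"
proof (cases "k \<le> 1")
  case True
  then show ?thesis using assms unary_bracket_Pn[of "f 0"] by (simp add: bracket_def del: amb.simps)
next
  case False
  interpret P: vector_space sP
    by standard (simp_all add: sP_def fun_eq_iff A.scale_right_distrib A.scale_left_distrib)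
  have P3: "P.subspace (Pn 3)"
    unfolding P.subspace_def Pn_def
    by (auto simp: sP_def distrib_left distrib_right sA_mult_left sA_mult_right simp del: amb.simps)
  have "(\<Sum>i\<in>{1..<k}. \<Sum>\<tau>\<in>pointed_shuffles i k.
      Fup 3 (brk 0 0 (G_k i (\<lambda>j. f (\<tau> j))) (G_k (k - i) (\<lambda>j. f (\<tau> (i + j)))))) \<in> Pn 3"
  proof (intro P.subspace_sum[OF P3] Fup_Pn rel3_brk)
    fix i \<tau> assume i: "i \<in> {1..<k}" and t: "\<tau> \<in> pointed_shuffles i k"
    have m: "\<tau> j < k" if "j < k" for j
      using t that permutes_in_image[of \<tau> "{..<k}" j] by (simp add: pointed_shuffles_def)
    show "rel2 (G_k i (\<lambda>j. f (\<tau> j)))" "rel2 (G_k (k - i) (\<lambda>j. f (\<tau> (i + j))))"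
      by (rule rel2_G_k; use i m f in auto)+
  qed
  then show ?thesis using False by (simp add: bracket_def)
qed

lemma Gup_hom: "module_hom sP sA (\<lambda>f. Gup 2 f [a, b])" and unary_bracket_hom: "module_hom sP sA (\<lambda>f. unary_bracket 2 f w)"
proof -
  interpret P: vector_space sP
    by standard (simp_all add: sP_def fun_eq_iff A.scale_right_distrib A.scale_left_distrib)
  have e: "eval_P (f + g) y = eval_P f y + eval_P g y" "eval_P (sP c f) y = sA c (eval_P f y)" for f g c y
    unfolding eval_P_def by (simp_all add: case_prod_unfold distrib_left distrib_right A.lin_ext_fun_add sP_def
        sA_mult_left sA_mult_right A.lin_ext_fun_scale)
  show "module_hom sP sA (\<lambda>f. Gup 2 f [a, b])" "module_hom sP sA (\<lambda>f. unary_bracket 2 f w)"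
    by (intro module_hom.intro module_hom_axioms.intro A.module_axioms P.module_axioms;
      simp add: Gup_def unary_bracket_def e A.scale_right_distrib mult.commute del: amb.simps)+
qed

end

section \<open>The Maurer--Cartan equation\<close>

lemma quad_swap:
  "(\<Sum>a\<in>A. \<Sum>b\<in>B. \<Sum>c\<in>C. \<Sum>d\<in>D. f a b c d) = (\<Sum>c\<in>C. \<Sum>d\<in>D. \<Sum>a\<in>A. \<Sum>b\<in>B. (f a b c d :: 'z::comm_monoid_add))"
proof -
  have "(\<Sum>a\<in>A. \<Sum>b\<in>B. \<Sum>c\<in>C. \<Sum>d\<in>D. f a b c d) = (\<Sum>p\<in>A \<times> B. \<Sum>q\<in>C \<times> D. f (fst p) (snd p) (fst q) (snd q))"
    by (simp add: sum.cartesian_product')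
  also have "\<dots> = (\<Sum>q\<in>C \<times> D. \<Sum>p\<in>A \<times> B. f (fst p) (snd p) (fst q) (snd q))"
    by (rule sum.swap)
  also have "\<dots> = (\<Sum>c\<in>C. \<Sum>d\<in>D. \<Sum>a\<in>A. \<Sum>b\<in>B. f a b c d)"
    by (simp add: sum.cartesian_product')
  finally show ?thesis .
qed

lemma sum_antidiagonals:
  fixes Z :: "nat \<Rightarrow> nat \<Rightarrow> 'z::comm_monoid_add"
  assumes "\<And>i j. n \<le> i + j \<Longrightarrow> Z i j = 0"
  shows "(\<Sum>k\<in>{1..<n}. \<Sum>i\<in>{1..<k}. Z i (k - i)) = (\<Sum>i\<in>{1..<n}. \<Sum>j\<in>{1..<n}. Z i j)"
proof -
  have "(\<Sum>k\<in>{1..<n}. \<Sum>i\<in>{1..<k}. Z i (k - i)) = (\<Sum>p\<in>(SIGMA k:{1..<n}. {1..<k}). Z (snd p) (fst p - snd p))"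
    by (simp add: sum.Sigma case_prod_unfold)
  also have "\<dots> = (\<Sum>p\<in>{p \<in> {1..<n} \<times> {1..<n}. fst p + snd p < n}. Z (fst p) (snd p))"
    by (rule sum.reindex_bij_witness[of _ "\<lambda>p. (fst p + snd p, fst p)" "\<lambda>p. (snd p, fst p - snd p)"]) auto
  also have "\<dots> = (\<Sum>p\<in>{1..<n} \<times> {1..<n}. Z (fst p) (snd p))"
    by (rule sum.mono_neutral_left) (auto intro!: assms simp: not_less)
  finally show ?thesis
    by (simp add: sum.cartesian_product case_prod_unfold)
qed

lemma permute_list_bij:
  assumes t: "\<tau> permutes {..<k}"
  shows "bij_betw (permute_list \<tau>) {xs. set xs \<subseteq> X \<and> length xs = k} {xs. set xs \<subseteq> X \<and> length xs = k}"
proof (rule bij_betwI[where g = "permute_list (inv \<tau>)"])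
  have i: "inv \<tau> permutes {..<k}" by (rule permutes_inv[OF t])
  show "permute_list \<tau> \<in> {xs. set xs \<subseteq> X \<and> length xs = k} \<rightarrow> {xs. set xs \<subseteq> X \<and> length xs = k}"
    "permute_list (inv \<tau>) \<in> {xs. set xs \<subseteq> X \<and> length xs = k} \<rightarrow> {xs. set xs \<subseteq> X \<and> length xs = k}"
    using t i by auto
  fix xs assume "xs \<in> {xs. set xs \<subseteq> X \<and> length xs = k}"
  then have l: "length xs = k" by simp
  show "permute_list (inv \<tau>) (permute_list \<tau> xs) = xs"
    using permute_list_compose[of "inv \<tau>" xs \<tau>] i l permutes_inv_o(1)[OF t] by simp
  show "permute_list \<tau> (permute_list (inv \<tau>) xs) = xs"
    using permute_list_compose[of \<tau> xs "inv \<tau>"] t l permutes_inv_o(2)[OF t] by simp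
qed

lemma sum_lists_append:
  assumes "i \<le> k"
  shows "(\<Sum>xs | set xs \<subseteq> X \<and> length xs = k. f xs) =
    (\<Sum>ys | set ys \<subseteq> X \<and> length ys = i. \<Sum>zs | set zs \<subseteq> X \<and> length zs = k - i. (f (ys @ zs) :: 'z::comm_monoid_add))"
proof -
  have "(\<Sum>xs | set xs \<subseteq> X \<and> length xs = k. f xs) =
      (\<Sum>p\<in>{ys. set ys \<subseteq> X \<and> length ys = i} \<times> {zs. set zs \<subseteq> X \<and> length zs = k - i}. f (fst p @ snd p))"
    by (rule sum.reindex_bij_witness[of _ "\<lambda>p. fst p @ snd p" "\<lambda>xs. (take i xs, drop i xs)"])
      (use assms in \<open>auto dest: in_set_takeD in_set_dropD\<close>)
  then show ?thesis
    by (simp add: sum.cartesian_product case_prod_unfold)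
qed

lemma prod_list_permute: "\<tau> permutes {..<length xs} \<Longrightarrow> prod_list (map g (permute_list \<tau> xs)) = prod_list (map g xs)"
  for g :: "'x \<Rightarrow> 'r::comm_monoid_mult"
  by (metis mset_map mset_permute_list prod_mset_prod_list)

context gauge_fixed
begin

lemma lam_product:
  assumes e: "e \<in> E n"
  shows "lam e (b * b') = (\<Sum>e'\<in>E n. \<Sum>e''\<in>E n. lam e (e' * e'') * (lam e' b * lam e'' b'))"
proof -
  have "lam e (b * b') = (\<Sum>e''\<in>E n. lam e'' b' * lam e (b * e''))"
    by (rule lam_mult[OF e])
  also have "\<dots> = (\<Sum>e''\<in>E n. lam e'' b' * (\<Sum>e'\<in>E n. lam e' b * lam e (e'' * e')))"
    by (rule sum.cong[OF refl]) (simp only: mult.commute[of b] lam_mult[OF e, of _ b])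
  also have "\<dots> = (\<Sum>e'\<in>E n. \<Sum>e''\<in>E n. lam e (e' * e'') * (lam e' b * lam e'' b'))"
    unfolding sum_distrib_left by (subst sum.swap) (simp add: mult_ac)
  finally show ?thesis .
qed

context
  fixes t :: "(('v, 'e) qpath \<Rightarrow> 'a) \<times> 'b \<Rightarrow>\<^sub>0 'k" and n
  assumes tn: "t \<in> xi n"
begin

abbreviation Lk :: "nat \<Rightarrow> ((('v, 'e) qpath \<Rightarrow> 'a) \<times> 'b) list set" where
  "Lk k \<equiv> {xs. set xs \<subseteq> keys t \<and> length xs = k}"

definition wt :: "((('v, 'e) qpath \<Rightarrow> 'a) \<times> 'b) list \<Rightarrow> 'b \<Rightarrow> 'k" where
  "wt xs e = (\<Prod>x\<leftarrow>xs. lookup t x) * lam e (\<Prod>x\<leftarrow>xs. snd x)"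

definition Gx :: "nat \<Rightarrow> ((('v, 'e) qpath \<Rightarrow> 'a) \<times> 'b) list \<Rightarrow> 'a list \<Rightarrow> 'a" where
  "Gx k xs = G_k k (\<lambda>j. fst (xs ! j))"

definition Gc :: "nat \<Rightarrow> 'b \<Rightarrow> 'a list \<Rightarrow> 'a" where
  "Gc k e = (\<lambda>as. \<Sum>xs\<in>Lk k. sA (wt xs e) (Gx k xs as))"

text \<open>The component at \<open>e\<close> of the sum of all \<open>1/k! G\<^sub>k(t, \<dots>, t)\<close>, modulo \<open>\<mm>\<^sup>n\<close>.\<close>

definition Gsum :: "'b \<Rightarrow> 'a list \<Rightarrow> 'a" where
  "Gsum e = (\<lambda>as. \<Sum>k\<in>{1..<n}. sA (1 / fact k) (Gc k e as))"

lemma Lk_Pn: "xs \<in> Lk k \<Longrightarrow> j < k \<Longrightarrow> fst (xs ! j) \<in> Pn 2"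
proof -
  assume a: "xs \<in> Lk k" "j < k"
  then have "xs ! j \<in> keys t" using nth_mem[of j xs] by auto
  then show ?thesis using t[OF tn] by auto
qed

lemma Lk_prod: "xs \<in> Lk k \<Longrightarrow> (\<Prod>x\<leftarrow>xs. snd x) \<in> Pw k"
proof (induction xs arbitrary: k)
  case (Cons x xs)
  then have "x \<in> keys t" "(\<Prod>x\<leftarrow>xs. snd x) \<in> Pw (length xs)" "k = Suc (length xs)" by auto
  moreover from this have "snd x \<in> \<mm>" using t[OF tn] by auto
  ultimately show ?case by (simp add: Pw_Suc del: ideal_pow.simps)
qed simp

lemma rel2_Gx: "1 \<le> k \<Longrightarrow> xs \<in> Lk k \<Longrightarrow> rel2 (Gx k xs)"
  unfolding Gx_def by (rule rel2_G_k[OF Lk_Pn])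

lemma rel2_Gc: "1 \<le> k \<Longrightarrow> rel2 (Gc k e)"
  unfolding Gc_def by (intro rel2_comb rel2_Gx)

lemma rel2_Gsum: "rel2 (Gsum e)"
  unfolding Gsum_def by (intro rel2_comb rel2_Gc) simp

lemma wt_zero: "xs \<in> Lk k \<Longrightarrow> e \<in> E k \<Longrightarrow> wt xs e = 0"
  using lam_Pw[OF Lk_prod] by (simp add: wt_def del: ideal_pow.simps)

lemma Gc_zero: "e \<in> E k \<Longrightarrow> Gc k e as = 0"
  unfolding Gc_def by (rule sum.neutral) (simp add: wt_zero)

lemma Gsum_1: "Gsum 1 as = 0"
proof -
  have "(1::'b) \<in> E k" if "1 \<le> k" for k
    using E_Suc_one[of "k - 1"] that by simp
  then show ?thesis unfolding Gsum_def by (simp add: Gc_zero)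
qed

text \<open>As all arguments have degree \<open>0\<close>, each shuffle contributes the same amount to a sum over all lists of arguments.\<close>

lemma shuffle_sum:
  assumes L: "cubic L" and e: "e \<in> E n" and i: "1 \<le> i" "i < k" and tau: "\<tau> \<in> pointed_shuffles i k"
  shows "(\<Sum>xs\<in>Lk k. sA (wt xs e) (L (brk 0 0 (G_k i (\<lambda>j. fst (xs ! \<tau> j))) (G_k (k - i) (\<lambda>j. fst (xs ! \<tau> (i + j)))))))
    = (\<Sum>e'\<in>E n. \<Sum>e''\<in>E n. sA (lam e (e' * e'')) (L (brk 0 0 (Gc i e') (Gc (k - i) e''))))"
proof -
  have p: "\<tau> permutes {..<k}" using tau by (simp add: pointed_shuffles_def)
  define Q where "Q xs = sA (wt xs e) (L (brk 0 0 (G_k i (\<lambda>j. fst (xs ! j))) (G_k (k - i) (\<lambda>j. fst (xs ! (i + j))))))"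
    for xs :: "((('v, 'e) qpath \<Rightarrow> 'a) \<times> 'b) list"
  have "sA (wt xs e) (L (brk 0 0 (G_k i (\<lambda>j. fst (xs ! \<tau> j))) (G_k (k - i) (\<lambda>j. fst (xs ! \<tau> (i + j)))))) = Q (permute_list \<tau> xs)"
    if xs: "xs \<in> Lk k" for xs
  proof -
    have l: "length xs = k" using xs by simp
    have w: "wt (permute_list \<tau> xs) e = wt xs e"
      unfolding wt_def using p l by (simp add: prod_list_permute)
    have 1: "G_k i (\<lambda>j. fst (permute_list \<tau> xs ! j)) = G_k i (\<lambda>j. fst (xs ! \<tau> j))"
      by (rule G_k_cong) (use i p l in \<open>simp_all add: permute_list_nth\<close>)
    have 2: "G_k (k - i) (\<lambda>j. fst (permute_list \<tau> xs ! (i + j))) = G_k (k - i) (\<lambda>j. fst (xs ! \<tau> (i + j)))"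
      by (rule G_k_cong) (use i p l in \<open>simp_all add: permute_list_nth\<close>)
    show ?thesis unfolding Q_def w 1 2 ..
  qed
  then have "(\<Sum>xs\<in>Lk k. sA (wt xs e) (L (brk 0 0 (G_k i (\<lambda>j. fst (xs ! \<tau> j))) (G_k (k - i) (\<lambda>j. fst (xs ! \<tau> (i + j)))))))
      = (\<Sum>xs\<in>Lk k. Q (permute_list \<tau> xs))"
    by (rule sum.cong[OF refl])
  also have "\<dots> = (\<Sum>xs\<in>Lk k. Q xs)"
    by (rule sum.reindex_bij_betw[OF permute_list_bij[OF p]])
  also have "\<dots> = (\<Sum>ys\<in>Lk i. \<Sum>zs\<in>Lk (k - i). Q (ys @ zs))"
    by (rule sum_lists_append) (use i in simp)
  also have "\<dots> = (\<Sum>ys\<in>Lk i. \<Sum>zs\<in>Lk (k - i). \<Sum>e'\<in>E n. \<Sum>e''\<in>E n.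
      sA (lam e (e' * e'')) (sA (wt ys e') (sA (wt zs e'') (L (brk 0 0 (Gx i ys) (Gx (k - i) zs))))))"
  proof (intro sum.cong refl)
    fix ys zs assume ys: "ys \<in> Lk i" and zs: "zs \<in> Lk (k - i)"
    have 1: "G_k i (\<lambda>j. fst ((ys @ zs) ! j)) = Gx i ys"
      unfolding Gx_def by (rule G_k_cong) (use ys i in \<open>simp_all add: nth_append\<close>)
    have 2: "G_k (k - i) (\<lambda>j. fst ((ys @ zs) ! (i + j))) = Gx (k - i) zs"
      unfolding Gx_def by (rule G_k_cong) (use ys i in \<open>simp_all add: nth_append\<close>)
    have "wt (ys @ zs) e = (\<Prod>x\<leftarrow>ys. lookup t x) * (\<Prod>x\<leftarrow>zs. lookup t x) * lam e ((\<Prod>x\<leftarrow>ys. snd x) * (\<Prod>x\<leftarrow>zs. snd x))"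
      by (simp add: wt_def)
    also have "\<dots> = (\<Sum>e'\<in>E n. \<Sum>e''\<in>E n. (\<Prod>x\<leftarrow>ys. lookup t x) * (\<Prod>x\<leftarrow>zs. lookup t x) *
        (lam e (e' * e'') * (lam e' (\<Prod>x\<leftarrow>ys. snd x) * lam e'' (\<Prod>x\<leftarrow>zs. snd x))))"
      unfolding lam_product[OF e, of "\<Prod>x\<leftarrow>ys. snd x"] sum_distrib_left ..
    also have "\<dots> = (\<Sum>e'\<in>E n. \<Sum>e''\<in>E n. lam e (e' * e'') * (wt ys e' * wt zs e''))"
      unfolding wt_def by (intro sum.cong refl) (simp only: mult_ac)
    finally have w: "wt (ys @ zs) e = (\<Sum>e'\<in>E n. \<Sum>e''\<in>E n. lam e (e' * e'') * (wt ys e' * wt zs e''))" .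
    show "Q (ys @ zs) = (\<Sum>e'\<in>E n. \<Sum>e''\<in>E n.
      sA (lam e (e' * e'')) (sA (wt ys e') (sA (wt zs e'') (L (brk 0 0 (Gx i ys) (Gx (k - i) zs))))))"
      unfolding Q_def 1 2 w by (simp only: A.scale_sum_left A.scale_scale)
  qed
  also have "\<dots> = (\<Sum>e'\<in>E n. \<Sum>e''\<in>E n. \<Sum>ys\<in>Lk i. \<Sum>zs\<in>Lk (k - i).
      sA (lam e (e' * e'')) (sA (wt ys e') (sA (wt zs e'') (L (brk 0 0 (Gx i ys) (Gx (k - i) zs))))))"
    by (rule quad_swap)
  also have "\<dots> = (\<Sum>e'\<in>E n. \<Sum>e''\<in>E n. sA (lam e (e' * e'')) (L (brk 0 0 (Gc i e') (Gc (k - i) e''))))"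
  proof (intro sum.cong refl)
    fix e' e''
    have "L (brk 0 0 (Gc i e') (Gc (k - i) e'')) =
        (\<Sum>ys\<in>Lk i. \<Sum>zs\<in>Lk (k - i). sA (wt ys e') (sA (wt zs e'') (L (brk 0 0 (Gx i ys) (Gx (k - i) zs)))))"
      unfolding Gc_def by (rule cubic_brk_comb[OF L]) (use i in \<open>auto intro: rel2_Gx\<close>)
    then show "(\<Sum>ys\<in>Lk i. \<Sum>zs\<in>Lk (k - i). sA (lam e (e' * e'')) (sA (wt ys e') (sA (wt zs e'') (L (brk 0 0 (Gx i ys) (Gx (k - i) zs))))))
        = sA (lam e (e' * e'')) (L (brk 0 0 (Gc i e') (Gc (k - i) e'')))"
      by (simp only: A.scale_sum_right)
  qed
  finally show ?thesis .
qed

text \<open>The bracket of parts of the sizes \<open>i\<close> and \<open>k - i\<close> occurs with the factor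
  \<open>(k - 1 choose i - 1) i! (k - i)! / k! = i/k\<close>. The bracket is symmetric,
  so \<open>i/k\<close> may be replaced by the mean \<open>\<onehalf>\<close> of \<open>i/k\<close> and \<open>(k - i)/k\<close>.\<close>

lemma multilinear_sum:
  assumes N: "module_hom sP sA N" and L: "cubic L" and e: "e \<in> E n" and n: "2 \<le> n"
  shows "(\<Sum>k\<in>{1..<n}. sA (1 / fact k) (\<Sum>xs\<in>Lk k. sA (wt xs e) (if k \<le> 1 then N (fst (xs ! 0))
      else \<Sum>i\<in>{1..<k}. \<Sum>\<tau>\<in>pointed_shuffles i k.
        L (brk 0 0 (G_k i (\<lambda>j. fst (xs ! \<tau> j))) (G_k (k - i) (\<lambda>j. fst (xs ! \<tau> (i + j)))))))) =
    N (ft e) + sA (1 / 2) (\<Sum>e'\<in>E n. \<Sum>e''\<in>E n. sA (lam e (e' * e'')) (L (brk 0 0 (Gsum e') (Gsum e''))))"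
proof -
  define Y where "Y i j = (\<Sum>e'\<in>E n. \<Sum>e''\<in>E n. sA (lam e (e' * e'')) (L (brk 0 0 (Gc i e') (Gc j e''))))" for i j
  define Z where "Z i j = sA (1 / fact i) (sA (1 / fact j) (Y i j))" for i j
  define R where "R k xs = (\<Sum>i\<in>{1..<k}. \<Sum>\<tau>\<in>pointed_shuffles i k.
        L (brk 0 0 (G_k i (\<lambda>j. fst (xs ! \<tau> j))) (G_k (k - i) (\<lambda>j. fst (xs ! \<tau> (i + j))))))"
    for k and xs :: "((('v, 'e) qpath \<Rightarrow> 'a) \<times> 'b) list"
  have Ysym: "Y i j = Y j i" for i j
    unfolding Y_def by (subst sum.swap) (simp add: brk_commute[of "Gc j _"] mult.commute)
  have Y0: "Y i j = 0" if "n \<le> i + j" "1 \<le> i" "1 \<le> j" for i j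
    unfolding Y_def
  proof (intro sum.neutral ballI)
    fix e' e'' assume E: "e' \<in> E n" "e'' \<in> E n"
    have z: "L (brk 0 0 (Gc i e') (Gc j e'')) = 0" if "e' \<in> E i \<or> e'' \<in> E j"
    proof -
      have "brk 0 0 (Gc i e') (Gc j e'') [a, b, c] = 0" for a b c
      proof (cases "e'' \<in> E j")
        case True
        show ?thesis by (rule brk_zero[OF rel2_Gc[OF \<open>1 \<le> i\<close>]]) (rule Gc_zero[OF True])
      next
        case False
        then have "e' \<in> E i" using that by blast
        then show ?thesis
          unfolding brk_commute[of "Gc i e'"] by (intro brk_zero[OF rel2_Gc[OF \<open>1 \<le> j\<close>]] Gc_zero)
      qed
      then have "L (brk 0 0 (Gc i e') (Gc j e'')) = L (\<lambda>as. 0)"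
        by (intro cubicD(1)[OF L] rel3_brk rel2_Gc \<open>1 \<le> i\<close> \<open>1 \<le> j\<close>)
      then show ?thesis by (simp only: cubic_zero[OF L])
    qed
    have "lam e (e' * e'') = 0" if "e' \<notin> E i" "e'' \<notin> E j"
    proof (rule lam_Pw[OF _ e])
      have "e' * e'' \<in> Pw (i + j)"
        by (rule Pw_mult[OF E_Pw[OF E(1) that(1)] E_Pw[OF E(2) that(2)]])
      then show "e' * e'' \<in> Pw n"
        using Pw_antimono[OF \<open>n \<le> i + j\<close>] by blast
    qed
    then show "sA (lam e (e' * e'')) (L (brk 0 0 (Gc i e') (Gc j e''))) = 0"
      using z by (cases "e' \<in> E i \<or> e'' \<in> E j") auto
  qed
  have 1: "sA (1 / fact k) (\<Sum>xs\<in>Lk k. sA (wt xs e) (R k xs)) = sA (1 / 2) (\<Sum>i\<in>{1..<k}. Z i (k - i))" for k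
  proof -
    have "(\<Sum>xs\<in>Lk k. sA (wt xs e) (R k xs)) = (\<Sum>i\<in>{1..<k}. \<Sum>\<tau>\<in>pointed_shuffles i k.
        \<Sum>xs\<in>Lk k. sA (wt xs e) (L (brk 0 0 (G_k i (\<lambda>j. fst (xs ! \<tau> j))) (G_k (k - i) (\<lambda>j. fst (xs ! \<tau> (i + j)))))))"
      unfolding R_def A.scale_sum_right by (subst sum.swap, rule sum.cong[OF refl], rule sum.swap)
    also have "\<dots> = (\<Sum>i\<in>{1..<k}. \<Sum>\<tau>\<in>pointed_shuffles i k. Y i (k - i))"
      unfolding Y_def by (intro sum.cong refl shuffle_sum[OF L e]) auto
    also have "\<dots> = (\<Sum>i\<in>{1..<k}. sA (of_nat ((k - 1) choose (i - 1))) (Y i (k - i)))"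
      by (rule sum.cong[OF refl]) (simp add: A.sum_constant_scale card_pointed_shuffles)
    finally have h: "(\<Sum>xs\<in>Lk k. sA (wt xs e) (R k xs)) = (\<Sum>i\<in>{1..<k}. sA (of_nat ((k - 1) choose (i - 1))) (Y i (k - i)))" .
    have "sA (1 / fact k) (\<Sum>xs\<in>Lk k. sA (wt xs e) (R k xs)) =
        (\<Sum>i\<in>{1..<k}. sA (of_nat i / of_nat k) (Z i (k - i)))" (is "_ = ?s")
      unfolding h A.scale_sum_right
    proof (intro sum.cong refl)
      fix i assume i: "i \<in> {1..<k}"
      then obtain i' k' where ik: "i = Suc i'" "k = Suc k'" "i' \<le> k'"
        by (cases i; cases k) auto
      have "(1 / fact k) * of_nat ((k - 1) choose (i - 1)) = (of_nat i / of_nat k) * ((1 / fact i) * (1 / fact (k - i)) :: 'k)"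
        using binomial_fact[OF ik(3), where 'a = 'k] of_nat_neq_0[of k', where 'a = 'k] of_nat_neq_0[of i', where 'a = 'k]
        unfolding ik by (simp add: field_simps del: of_nat_Suc)
      then show "sA (1 / fact k) (sA (of_nat ((k - 1) choose (i - 1))) (Y i (k - i))) = sA (of_nat i / of_nat k) (Z i (k - i))"
        unfolding Z_def A.scale_scale by (simp only:)
    qed
    moreover have "?s + ?s = (\<Sum>i\<in>{1..<k}. Z i (k - i))"
    proof -
      have "?s = (\<Sum>i\<in>{1..<k}. sA (of_nat (k - i) / of_nat k) (Z i (k - i)))"
        by (rule sum.reindex_bij_witness[of _ "\<lambda>i. k - i" "\<lambda>i. k - i"])
          (auto simp: Z_def Ysym mult.commute)
      then have "?s + ?s = ?s + (\<Sum>i\<in>{1..<k}. sA (of_nat (k - i) / of_nat k) (Z i (k - i)))" by simp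
      also have "\<dots> = (\<Sum>i\<in>{1..<k}. Z i (k - i))"
        unfolding sum.distrib[symmetric]
      proof (rule sum.cong[OF refl])
        fix i assume "i \<in> {1..<k}"
        then have "of_nat i / of_nat k + of_nat (k - i) / of_nat k = (1 :: 'k)"
          by (simp add: of_nat_diff add_divide_distrib[symmetric])
        then show "sA (of_nat i / of_nat k) (Z i (k - i)) + sA (of_nat (k - i) / of_nat k) (Z i (k - i)) = Z i (k - i)"
          unfolding A.scale_left_distrib[symmetric] by simp
      qed
      finally show ?thesis .
    qed
    moreover have "?s = sA (1 / 2) (?s + ?s)"
      unfolding A.scale_right_distrib A.scale_left_distrib[symmetric] by simp
    ultimately show ?thesis by (simp only:)
  qed
  have 2: "(\<Sum>e'\<in>E n. \<Sum>e''\<in>E n. sA (lam e (e' * e'')) (L (brk 0 0 (Gsum e') (Gsum e'')))) =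
      (\<Sum>i\<in>{1..<n}. \<Sum>j\<in>{1..<n}. Z i j)"
  proof -
    have "(\<Sum>e'\<in>E n. \<Sum>e''\<in>E n. sA (lam e (e' * e'')) (L (brk 0 0 (Gsum e') (Gsum e'')))) =
        (\<Sum>e'\<in>E n. \<Sum>e''\<in>E n. \<Sum>i\<in>{1..<n}. \<Sum>j\<in>{1..<n}.
          sA (1 / fact i) (sA (1 / fact j) (sA (lam e (e' * e'')) (L (brk 0 0 (Gc i e') (Gc j e''))))))"
    proof (intro sum.cong refl)
      fix e' e''
      have "L (brk 0 0 (Gsum e') (Gsum e'')) = (\<Sum>i\<in>{1..<n}. \<Sum>j\<in>{1..<n}. sA (1 / fact i) (sA (1 / fact j) (L (brk 0 0 (Gc i e') (Gc j e'')))))"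
        unfolding Gsum_def by (rule cubic_brk_comb[OF L]) (auto intro: rel2_Gc)
      then show "sA (lam e (e' * e'')) (L (brk 0 0 (Gsum e') (Gsum e''))) = (\<Sum>i\<in>{1..<n}. \<Sum>j\<in>{1..<n}.
          sA (1 / fact i) (sA (1 / fact j) (sA (lam e (e' * e'')) (L (brk 0 0 (Gc i e') (Gc j e''))))))"
        by (simp only: A.scale_sum_right A.scale_left_commute[of "lam e (e' * e'')"])
    qed
    also have "\<dots> = (\<Sum>i\<in>{1..<n}. \<Sum>j\<in>{1..<n}. Z i j)"
      unfolding Z_def Y_def A.scale_sum_right by (rule quad_swap)
    finally show ?thesis .
  qed
  have 3: "(\<Sum>xs\<in>Lk 1. sA (wt xs e) (N (fst (xs ! 0)))) = N (ft e)"
  proof -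
    have "(\<Sum>xs\<in>Lk 1. sA (wt xs e) (N (fst (xs ! 0)))) = (\<Sum>x\<in>keys t. sA (wt [x] e) (N (fst x)))"
      by (rule sum.reindex_bij_witness[of _ "\<lambda>x. [x]" "\<lambda>xs. xs ! 0"]) (auto simp: length_Suc_conv)
    also have "\<dots> = (\<Sum>x\<in>keys t. sA (lookup t x) (N (sP (lam e (snd x)) (fst x))))"
      by (rule sum.cong[OF refl]) (simp add: wt_def module_hom.scale[OF N])
    also have "\<dots> = N (coord sP t e)"
      unfolding coord_def module_hom_lin_ext[OF N] unfolding lin_ext_def by (simp add: case_prod_unfold)
    finally show ?thesis by (simp only: coord_t[OF tn e])
  qed
  have "(\<Sum>k\<in>{1..<n}. sA (1 / fact k) (\<Sum>xs\<in>Lk k. sA (wt xs e) (if k \<le> 1 then N (fst (xs ! 0)) else R k xs))) =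
      (\<Sum>k\<in>{1..<n}. (if k = 1 then N (ft e) else 0) + sA (1 / fact k) (\<Sum>xs\<in>Lk k. sA (wt xs e) (R k xs)))"
  proof (rule sum.cong[OF refl])
    fix k assume k: "k \<in> {1..<n}"
    show "sA (1 / fact k) (\<Sum>xs\<in>Lk k. sA (wt xs e) (if k \<le> 1 then N (fst (xs ! 0)) else R k xs)) =
        (if k = 1 then N (ft e) else 0) + sA (1 / fact k) (\<Sum>xs\<in>Lk k. sA (wt xs e) (R k xs))"
    proof (cases "k = 1")
      case True
      then show ?thesis using 3 by (simp add: R_def)
    qed (use k in simp)
  qed
  also have "\<dots> = N (ft e) + (\<Sum>k\<in>{1..<n}. sA (1 / 2) (\<Sum>i\<in>{1..<k}. Z i (k - i)))"
    unfolding sum.distrib 1 using n by simp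
  also have "(\<Sum>k\<in>{1..<n}. sA (1 / 2) (\<Sum>i\<in>{1..<k}. Z i (k - i))) = sA (1 / 2) (\<Sum>k\<in>{1..<n}. \<Sum>i\<in>{1..<k}. Z i (k - i))"
    by (simp only: A.scale_sum_right)
  also have "(\<Sum>k\<in>{1..<n}. \<Sum>i\<in>{1..<k}. Z i (k - i)) =
      (\<Sum>k\<in>{1..<n}. \<Sum>i\<in>{1..<k}. if 1 \<le> i \<and> 1 \<le> k - i then Z i (k - i) else 0)"
    by (intro sum.cong refl) auto
  also have "\<dots> = (\<Sum>i\<in>{1..<n}. \<Sum>j\<in>{1..<n}. if 1 \<le> i \<and> 1 \<le> j then Z i j else 0)"
    by (rule sum_antidiagonals) (auto simp: Z_def Y0)
  also have "\<dots> = (\<Sum>i\<in>{1..<n}. \<Sum>j\<in>{1..<n}. Z i j)"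
    by (intro sum.cong refl) auto
  finally show ?thesis
    by (simp only: 2 R_def)
qed

lemma Gsum_eq:
  assumes e: "e \<in> E n" and n: "2 \<le> n"
  shows "Gsum e [a, b] = Gup 2 (ft e) [a, b] +
    sA (1 / 2) (\<Sum>e'\<in>E n. \<Sum>e''\<in>E n. sA (lam e (e' * e'')) (hup 2 (brk 0 0 (Gsum e') (Gsum e'')) [a, b]))"
proof -
  have G: "G_k k f [a, b] = (if k \<le> 1 then Gup 2 (f 0) [a, b] else \<Sum>i\<in>{1..<k}. \<Sum>\<tau>\<in>pointed_shuffles i k.
       hup 2 (brk 0 0 (G_k i (\<lambda>j. f (\<tau> j))) (G_k (k - i) (\<lambda>j. f (\<tau> (i + j))))) [a, b])" for k f
    by (subst G_k.simps) (simp add: sum_list_fun_apply)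
  have "Gsum e [a, b] = (\<Sum>k\<in>{1..<n}. sA (1 / fact k) (\<Sum>xs\<in>Lk k. sA (wt xs e) (if k \<le> 1 then Gup 2 (fst (xs ! 0)) [a, b]
      else \<Sum>i\<in>{1..<k}. \<Sum>\<tau>\<in>pointed_shuffles i k.
        hup 2 (brk 0 0 (G_k i (\<lambda>j. fst (xs ! \<tau> j))) (G_k (k - i) (\<lambda>j. fst (xs ! \<tau> (i + j))))) [a, b])))"
    unfolding Gsum_def Gc_def Gx_def by (intro sum.cong arg_cong2[of _ _ _ _ sA] refl) (rule G)
  then show ?thesis
    unfolding multilinear_sum[OF Gup_hom cubic_hup e n] .
qed

lemma bracket_sum:
  assumes e: "e \<in> E n" and n: "2 \<le> n"
  shows "coord sP (\<Sum>k = 1..<n. fscale (1 / fact k) (bracket_ext k t)) e w = unary_bracket 2 (ft e) w +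
    sA (1 / 2) (\<Sum>e'\<in>E n. \<Sum>e''\<in>E n. sA (lam e (e' * e'')) (Fup 3 (brk 0 0 (Gsum e') (Gsum e'')) w))"
proof -
  have G: "bracket k f w = (if k \<le> 1 then unary_bracket 2 (f 0) w else \<Sum>i\<in>{1..<k}. \<Sum>\<tau>\<in>pointed_shuffles i k.
       Fup 3 (brk 0 0 (G_k i (\<lambda>j. f (\<tau> j))) (G_k (k - i) (\<lambda>j. f (\<tau> (i + j))))) w)" for k f
    by (simp add: bracket_def sum_list_fun_apply)
  have "coord sP (\<Sum>k = 1..<n. fscale (1 / fact k) (bracket_ext k t)) e w =
      (\<Sum>k\<in>{1..<n}. sA (1 / fact k) (\<Sum>xs\<in>Lk k. sA (wt xs e) (bracket k (\<lambda>j. fst (xs ! j)) w)))"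
    unfolding bracket_ext_def module_hom.sum[OF coordP_hom] module_hom.scale[OF coordP_hom] coordP_base
    by (simp add: sum_list_fun_apply sP_def wt_def)
  also have "\<dots> = (\<Sum>k\<in>{1..<n}. sA (1 / fact k) (\<Sum>xs\<in>Lk k. sA (wt xs e) (if k \<le> 1 then unary_bracket 2 (fst (xs ! 0)) w
      else \<Sum>i\<in>{1..<k}. \<Sum>\<tau>\<in>pointed_shuffles i k.
        Fup 3 (brk 0 0 (G_k i (\<lambda>j. fst (xs ! \<tau> j))) (G_k (k - i) (\<lambda>j. fst (xs ! \<tau> (i + j))))) w)))"
    by (intro sum.cong arg_cong2[of _ _ _ _ sA] refl) (rule G)
  finally show ?thesis
    unfolding multilinear_sum[OF unary_bracket_hom cubic_Fup e n] .
qed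

lemma bracket_sum_keys:
  "keys (\<Sum>k = 1..<n. fscale (1 / fact k) (bracket_ext k t)) \<subseteq> Pn 3 \<times> \<mm>"
proof (rule order_trans[OF keys_sum_subset], rule UN_least, rule order_trans[OF keys_fscale])
  fix k assume k: "k \<in> {1..<n}"
  show "keys (bracket_ext k t) \<subseteq> Pn 3 \<times> \<mm>"
    unfolding bracket_ext_def
  proof (rule order_trans[OF keys_sum_subset], rule UN_least, rule order_trans[OF keys_fscale])
    fix xs assume xs: "xs \<in> Lk k"
    have "bracket k (\<lambda>j. fst (xs ! j)) \<in> Pn 3"
      by (rule bracket_Pn[OF Lk_Pn[OF xs]]) (use k in auto)
    moreover have "(\<Prod>x\<leftarrow>xs. snd x) \<in> \<mm>"
      using Lk_prod[OF xs] Pw_antimono[of "Suc 0" k] k by (auto simp only: Pw_1 atLeastLessThan_iff One_nat_def Suc_le_eq)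
    ultimately show "keys (base (bracket k (\<lambda>j. fst (xs ! j)), \<Prod>x\<leftarrow>xs. snd x) :: _ \<Rightarrow>\<^sub>0 'k) \<subseteq> Pn 3 \<times> \<mm>"
      by simp
  qed
qed

end

end

section \<open>Associativity in coordinates\<close>

context gauge_fixed
begin

lemma act_sum_coord:
  assumes e: "e \<in> E n"
  shows "(\<Sum>e'\<in>E n. act e' (\<lambda>x. iota (g e') x + p e' x)) e =
    g e + (\<Sum>e'\<in>E n. \<Sum>e''\<in>E n. sA (lam e (e' * e'')) (p e' e''))"
proof -
  have "act e' (\<lambda>x. iota (g e') x + p e' x) e = sA (lam e e') (g e') + (\<Sum>e''\<in>E n. sA (lam e (e' * e'')) (p e' e''))" for e'
    unfolding act_eq[OF e] A.scale_right_distrib sum.distrib act_iota[OF Eu_I[OF e], of e' "g e'", unfolded act_eq[OF e]] ..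
  moreover have "(\<Sum>e'\<in>E n. sA (lam e e') (g e')) = (\<Sum>e'\<in>E n. if e' = e then g e else 0)"
    by (rule sum.cong[OF refl]) (use lam_dual[OF e] in auto)
  ultimately show ?thesis
    using e by (simp add: sum_fun_apply sum.distrib E_finite)
qed

lemma st_iota_right_coord:
  assumes f: "f \<in> C" and e: "e \<in> E n"
  shows "st f (iota c) e = f e * c + (\<Sum>e'\<in>E n. \<Sum>e''\<in>E n. sA (lam e (e' * e'')) (psi e'' [f e', c]))"
proof -
  have "st f (iota c) - st (\<Sum>e'\<in>E n. act e' (iota (f e'))) (iota c) = st (f - (\<Sum>e'\<in>E n. act e' (iota (f e')))) (iota c)"
    by (rule st_diff_left[symmetric])
  with st_K_left[OF expand_K[OF f], of n "iota c"]
  have "st f (iota c) - st (\<Sum>e'\<in>E n. act e' (iota (f e'))) (iota c) \<in> K n" by (simp only:)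
  then have "st f (iota c) e = st (\<Sum>e'\<in>E n. act e' (iota (f e'))) (iota c) e"
    using e by (simp add: K_def)
  also have "st (\<Sum>e'\<in>E n. act e' (iota (f e'))) (iota c) = (\<Sum>e'\<in>E n. act e' (\<lambda>x. iota (f e' * c) x + psi x [f e', c]))"
    unfolding st_sum_left st_act_left by (intro sum.cong refl arg_cong[of _ _ "act _"] ext) (rule st_iota)
  finally show ?thesis
    unfolding act_sum_coord[OF e] .
qed

lemma st_iota_left_coord:
  assumes f: "f \<in> C" and e: "e \<in> E n"
  shows "st (iota c) f e = c * f e + (\<Sum>e'\<in>E n. \<Sum>e''\<in>E n. sA (lam e (e' * e'')) (psi e'' [c, f e']))"
proof -
  have "st (iota c) f - st (iota c) (\<Sum>e'\<in>E n. act e' (iota (f e'))) = st (iota c) (f - (\<Sum>e'\<in>E n. act e' (iota (f e'))))"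
    by (rule st_diff_right[symmetric])
  with st_K_right[OF expand_K[OF f], of "iota c" n]
  have "st (iota c) f - st (iota c) (\<Sum>e'\<in>E n. act e' (iota (f e'))) \<in> K n" by (simp only:)
  then have "st (iota c) f e = st (iota c) (\<Sum>e'\<in>E n. act e' (iota (f e'))) e"
    using e by (simp add: K_def)
  also have "st (iota c) (\<Sum>e'\<in>E n. act e' (iota (f e'))) = (\<Sum>e'\<in>E n. act e' (\<lambda>x. iota (c * f e') x + psi x [c, f e']))"
    unfolding st_sum_right st_act_right by (intro sum.cong refl arg_cong[of _ _ "act _"] ext) (rule st_iota)
  finally show ?thesis
    unfolding act_sum_coord[OF e] .
qed

text \<open>The Hochschild differential of \<open>psi e\<close>.\<close>

definition gpsi :: "'b \<Rightarrow> 'a list \<Rightarrow> 'a" where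
  "gpsi e as = as ! 0 * psi e [as ! 1, as ! 2] - psi e [as ! 0 * as ! 1, as ! 2]
     + psi e [as ! 0, as ! 1 * as ! 2] - psi e [as ! 0, as ! 1] * as ! 2"

lemma gpsi_eq: "gpsi e [a, b, c] = a * psi e [b, c] - psi e [a * b, c] + psi e [a, b * c] - psi e [a, b] * c"
  by (simp add: gpsi_def)

lemma gpsi_assoc:
  assumes e: "e \<in> E n"
  shows "gpsi e [a, b, c] = (\<Sum>e'\<in>E n. \<Sum>e''\<in>E n. sA (lam e (e' * e'')) (psi e'' [psi e' [a, b], c] - psi e'' [a, psi e' [b, c]]))"
proof -
  define f where "f a b = st (iota a) (iota b) - iota (a * b)" for a b
  have fC: "f a b \<in> C" for a b unfolding f_def by (intro C_diff st_C iota_C)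
  have fe: "f a b e = psi e [a, b]" for a b e by (simp add: f_def psi_eq)
  have st_f: "st (iota a) (iota b) = iota (a * b) + f a b" for a b by (simp add: f_def)
  have "st (st (iota a) (iota b)) (iota c) e = iota (a * b * c) e + psi e [a * b, c] + st (f a b) (iota c) e"
    unfolding st_f[of a b] st_add_left by (simp add: st_iota)
  moreover have "st (iota a) (st (iota b) (iota c)) e = iota (a * (b * c)) e + psi e [a, b * c] + st (iota a) (f b c) e"
    unfolding st_f[of b c] st_add_right by (simp add: st_iota)
  ultimately have "psi e [a * b, c] + st (f a b) (iota c) e = psi e [a, b * c] + st (iota a) (f b c) e"
    by (simp add: st_assoc mult.assoc)
  then have "psi e [a * b, c] + (psi e [a, b] * c + (\<Sum>e'\<in>E n. \<Sum>e''\<in>E n. sA (lam e (e' * e'')) (psi e'' [psi e' [a, b], c]))) =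
      psi e [a, b * c] + (a * psi e [b, c] + (\<Sum>e'\<in>E n. \<Sum>e''\<in>E n. sA (lam e (e' * e'')) (psi e'' [a, psi e' [b, c]])))"
    unfolding st_iota_right_coord[OF fC e] st_iota_left_coord[OF fC e] fe .
  then show ?thesis
    unfolding gpsi_eq A.scale_right_diff_distrib sum_subtractf by (simp add: algebra_simps)
qed

lemma gpsi_brk:
  assumes e: "e \<in> E n"
  shows "gpsi e [a, b, c] = sA (- 1 / 2) (\<Sum>e'\<in>E n. \<Sum>e''\<in>E n. sA (lam e (e' * e'')) (brk 0 0 (psi e') (psi e'') [a, b, c]))"
proof -
  define Z where "Z e' e'' = psi e'' [psi e' [a, b], c] - psi e'' [a, psi e' [b, c]]" for e' e''
  define s where "s = (\<Sum>e'\<in>E n. \<Sum>e''\<in>E n. sA (lam e (e' * e'')) (Z e' e''))"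
  have "brk 0 0 (psi e') (psi e'') [a, b, c] = - (Z e'' e' + Z e' e'')" for e' e''
    by (simp add: brk_eq Z_def)
  then have "(\<Sum>e'\<in>E n. \<Sum>e''\<in>E n. sA (lam e (e' * e'')) (brk 0 0 (psi e') (psi e'') [a, b, c])) =
      - ((\<Sum>e'\<in>E n. \<Sum>e''\<in>E n. sA (lam e (e' * e'')) (Z e'' e')) + s)"
    by (simp add: s_def A.scale_right_distrib sum.distrib sum_negf A.scale_minus_right A.scale_right_diff_distrib sum_subtractf)
  also have "(\<Sum>e'\<in>E n. \<Sum>e''\<in>E n. sA (lam e (e' * e'')) (Z e'' e')) = s"
    unfolding s_def by (subst sum.swap) (simp add: mult.commute)
  finally have "sA (- 1 / 2) (\<Sum>e'\<in>E n. \<Sum>e''\<in>E n. sA (lam e (e' * e'')) (brk 0 0 (psi e') (psi e'') [a, b, c])) = sA (- 1 / 2) (- (s + s))"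
    by (simp only:)
  also have "\<dots> = s"
    unfolding A.scale_minus_right A.scale_right_distrib A.scale_left_distrib[symmetric] by simp
  finally show ?thesis
    unfolding gpsi_assoc[OF e] s_def Z_def ..
qed

lemma rel3_gpsi: "rel3 (gpsi e)"
proof -
  note P = rel2D[OF rel2_psi[of e]]
  note add = module_hom.add[OF P(1)] module_hom.add[OF P(2)]
  note sc = module_hom.scale[OF P(1)] module_hom.scale[OF P(2)]
  show ?thesis
    unfolding rel3_def gpsi_eq
  proof (intro conjI allI ballI)
    fix a b c v
    show "module_hom sA sA (\<lambda>a. a * psi e [b, c] - psi e [a * b, c] + psi e [a, b * c] - psi e [a, b] * c)"
      "module_hom sA sA (\<lambda>b. a * psi e [b, c] - psi e [a * b, c] + psi e [a, b * c] - psi e [a, b] * c)"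
      "module_hom sA sA (\<lambda>c. a * psi e [b, c] - psi e [a * b, c] + psi e [a, b * c] - psi e [a, b] * c)"
      by (intro A_homI;
          simp add: add sc distrib_left distrib_right sA_mult_left sA_mult_right A.scale_right_diff_distrib A.scale_right_distrib)+
    show "oneA * psi e [b, c] - psi e [oneA * b, c] + psi e [oneA, b * c] - psi e [oneA, b] * c = 0"
      by (simp add: P(5))
    assume v: "v \<in> verts G"
    note q = P(3)[OF v] P(4)[OF v]
    show "a * psi e [b * ev v, c] - psi e [a * (b * ev v), c] + psi e [a, b * ev v * c] - psi e [a, b * ev v] * c =
        a * psi e [b, ev v * c] - psi e [a * b, ev v * c] + psi e [a, b * (ev v * c)] - psi e [a, b] * (ev v * c)"
      by (simp only: mult.assoc[symmetric] q)
    show "a * psi e [b, c * ev v] - psi e [a * b, c * ev v] + psi e [a, b * (c * ev v)] - psi e [a, b] * (c * ev v) =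
        (a * psi e [b, c] - psi e [a * b, c] + psi e [a, b * c] - psi e [a, b] * c) * ev v"
      by (simp only: mult.assoc[symmetric] q left_diff_distrib distrib_right)
  qed
qed

lemma cubic_gpsi:
  assumes L: "cubic L" and e: "e \<in> E n"
  shows "L (gpsi e) = sA (- 1 / 2) (\<Sum>e'\<in>E n. \<Sum>e''\<in>E n. sA (lam e (e' * e'')) (L (brk 0 0 (psi e') (psi e''))))"
proof -
  have "L (gpsi e) = L (\<lambda>as. sA (- 1 / 2) (\<Sum>e'\<in>E n. \<Sum>e''\<in>E n. sA (lam e (e' * e'')) (brk 0 0 (psi e') (psi e'') as)))"
    by (rule cubicD(1)[OF L rel3_gpsi]) (rule gpsi_brk[OF e])
  then show ?thesis
    by (simp only: cubic_sum[OF L] cubicD(3)[OF L])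
qed

lemma hup_gpsi: "hup 2 (gpsi e) [a, b] = Gup 2 (ft e) [a, b] - psi e [a, b]"
  and Fup_gpsi: "Fup 3 (gpsi e) w = unary_bracket 2 (ft e) w"
proof -
  have f: "s \<in> S \<Longrightarrow> ft e s = psi e [\<pi>p (arr G 0 s), \<pi>p (suf G 1 s)]" for s
    by (simp add: ft_def)
  show "hup 2 (gpsi e) [a, b] = Gup 2 (ft e) [a, b] - psi e [a, b]"
    by (rule hup_differential[where \<psi> = "psi e" and f = "ft e" and g = "gpsi e",
          OF rel2_psi psi_ev_left psi_irr ft_Pn f rel3_gpsi gpsi_eq])
  show "Fup 3 (gpsi e) w = unary_bracket 2 (ft e) w"
    by (rule Fup_differential[where \<psi> = "psi e" and f = "ft e" and g = "gpsi e",
          OF rel2_psi psi_ev_left psi_irr ft_Pn f rel3_gpsi gpsi_eq])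
qed

lemma psi_fixed:
  assumes e: "e \<in> E n"
  shows "psi e [a, b] = Gup 2 (ft e) [a, b] +
    sA (1 / 2) (\<Sum>e'\<in>E n. \<Sum>e''\<in>E n. sA (lam e (e' * e'')) (hup 2 (brk 0 0 (psi e') (psi e'')) [a, b]))"
  using hup_gpsi[of e a b] cubic_gpsi[OF cubic_hup e, of a b] by (simp add: algebra_simps)

text \<open>Both sides satisfy the same fixed-point equation. In its quadratic term the components at \<open>1\<close> vanish, and a product
  of an element of \<open>\<mm>\<close> with one of \<open>\<mm>\<^sup>j\<close> has no component in \<open>E (Suc j)\<close>; so the values on \<open>E j\<close> determine those
  on \<open>E (Suc j)\<close>.\<close>

lemma Gsum_eq_psi:
  assumes t: "t \<in> xi n" and n: "2 \<le> n"
  shows "j \<le> n \<Longrightarrow> e \<in> E j \<Longrightarrow> Gsum t n e [a, b] = psi e [a, b]"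
proof (induction j arbitrary: e a b)
  case 0
  then show ?case by (simp add: E_0)
next
  case (Suc j)
  have e: "e \<in> E n" using Suc.prems E_mono by blast
  note rG = rel2_Gsum[OF t] and rP = rel2_psi
  have terms: "sA (lam e (e' * e'')) (hup 2 (brk 0 0 (Gsum t n e') (Gsum t n e'')) [a, b]) =
      sA (lam e (e' * e'')) (hup 2 (brk 0 0 (psi e') (psi e'')) [a, b])" if E: "e' \<in> E n" "e'' \<in> E n" for e' e''
  proof (cases "lam e (e' * e'') = 0")
    case nz: False
    have z: "brk 0 0 f g [x, y, z] = 0" if "rel2 f" "rel2 g" "(\<forall>a b. f [a, b] = 0) \<or> (\<forall>a b. g [a, b] = 0)" for f g x y z
      using that(3)
    proof
      assume "\<forall>a b. f [a, b] = 0"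
      then show ?thesis unfolding brk_commute[of f g] by (intro brk_zero[OF that(2)]) simp
    next
      assume "\<forall>a b. g [a, b] = 0"
      then show ?thesis by (intro brk_zero[OF that(1)]) simp
    qed
    have eq: "brk 0 0 (Gsum t n e') (Gsum t n e'') [x, y, z] = brk 0 0 (psi e') (psi e'') [x, y, z]" for x y z
    proof (cases "e' = 1 \<or> e'' = 1")
      case True
      then have "(\<forall>a b. Gsum t n e' [a, b] = 0) \<or> (\<forall>a b. Gsum t n e'' [a, b] = 0)"
        "(\<forall>a b. psi e' [a, b] = 0) \<or> (\<forall>a b. psi e'' [a, b] = 0)"
        using Gsum_1[OF t] psi_1 by auto
      then show ?thesis using z[OF rG rG] z[OF rP rP] by simp
    next
      case False
      then have m: "e' \<in> \<mm>" "e'' \<in> \<mm>" using E_mm E by auto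
      have "e'' \<in> E j"
      proof (rule ccontr)
        assume "e'' \<notin> E j"
        from lam_Pw[OF Pw_Suc[OF m(1) E_Pw[OF E(2) this]] Suc.prems(2)] nz show False by simp
      qed
      moreover have "e' \<in> E j"
      proof (rule ccontr)
        assume "e' \<notin> E j"
        from lam_Pw[OF Pw_Suc[OF m(2) E_Pw[OF E(1) this]] Suc.prems(2)] nz show False by (simp add: mult.commute)
      qed
      ultimately show ?thesis
        using Suc.prems(1) by (intro brk_cong Suc.IH) auto
    qed
    have "hup 2 (brk 0 0 (Gsum t n e') (Gsum t n e'')) [a, b] = hup 2 (brk 0 0 (psi e') (psi e'')) [a, b]"
      by (rule cubicD(1)[OF cubic_hup rel3_brk[OF rG rG] eq])
    then show ?thesis by simp
  qed simp
  then show ?case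
    unfolding Gsum_eq[OF t e n] psi_fixed[OF e]
    by (intro arg_cong2[of _ _ _ _ "(+)"] arg_cong[of _ _ "sA _"] sum.cong refl terms)
qed

lemma xi_maurer_cartan: "xi \<in> maurer_cartan"
  unfolding maurer_cartan_def
proof (intro CollectI conjI allI ballI xi_ctensor)
  fix n t assume t: "t \<in> xi n"
  show "(\<Sum>k = 1..<n. fscale (1 / fact k) (bracket_ext k t)) \<in> ct_null sP (Pn 3) sB \<mm> \<mm> n"
  proof (cases "2 \<le> n")
    case n: True
    show ?thesis
    proof (rule ct_null_of_coord[OF vector_space_sP subspace_Pn mm_B_subspace _ bracket_sum_keys[OF t]])
      fix e assume e: "e \<in> E n"
      show "coord sP (\<Sum>k = 1..<n. fscale (1 / fact k) (bracket_ext k t)) e = 0"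
      proof (rule ext)
        fix w
        have "Fup 3 (brk 0 0 (Gsum t n e') (Gsum t n e'')) w = Fup 3 (brk 0 0 (psi e') (psi e'')) w"
          if "e' \<in> E n" "e'' \<in> E n" for e' e''
          by (rule cubicD(1)[OF cubic_Fup rel3_brk[OF rel2_Gsum[OF t] rel2_Gsum[OF t]]])
            (intro brk_cong Gsum_eq_psi[OF t n order_refl] that)
        then have "coord sP (\<Sum>k = 1..<n. fscale (1 / fact k) (bracket_ext k t)) e w = unary_bracket 2 (ft e) w +
            sA (1 / 2) (\<Sum>e'\<in>E n. \<Sum>e''\<in>E n. sA (lam e (e' * e'')) (Fup 3 (brk 0 0 (psi e') (psi e'')) w))"
          unfolding bracket_sum[OF t e n] by simp
        also have "\<dots> = 0"
          unfolding Fup_gpsi[symmetric] cubic_gpsi[OF cubic_Fup e, of w] A.scale_left_distrib[symmetric] by simp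
        finally show "coord sP (\<Sum>k = 1..<n. fscale (1 / fact k) (bracket_ext k t)) e w = 0 w" by simp
      qed
    qed (rule mm_lam)
  next
    case False
    then have "{1..<n} = {}" by auto
    then show ?thesis
      using fs.subspace_0[OF subspace_ct_null[OF vector_space_sP subspace_Pn mm_B_subspace]] by (simp only: sum.empty)
  qed
qed

end

section \<open>Gauge equivalence\<close>

context def_setup
begin

definition toC :: "(nat \<Rightarrow> ('a \<times> 'b \<Rightarrow>\<^sub>0 'k) set) \<Rightarrow> 'b \<Rightarrow> 'a" where
  "toC x = (SOME f. f \<in> C \<and> fromC f = x)"

lemma toC: "x \<in> AB \<Longrightarrow> toC x \<in> C" "x \<in> AB \<Longrightarrow> fromC (toC x) = x"
proof -
  assume "x \<in> AB"
  then have "\<exists>f. f \<in> C \<and> fromC f = x" using AB_fromC by blast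
  from someI_ex[OF this] show "toC x \<in> C" "fromC (toC x) = x" by (simp_all add: toC_def)
qed

lemma toC_fromC: "f \<in> C \<Longrightarrow> toC (fromC f) = f"
  using toC[OF fromC_AB[of f]] by (intro fromC_inj) simp_all

lemma deformation_is_combinatorial:
  assumes def: "formal_deformation star"
  shows "\<exists>\<xi>\<in>maurer_cartan. gauge_equivalent star (comb_star \<xi>)"
proof -
  have AB: "star x y \<in> AB" if "x \<in> AB" "y \<in> AB" for x y
    using def that unfolding formal_deformation_def by blast
  have add: "star (AB_add x y) z = AB_add (star x z) (star y z)" "star x (AB_add y z) = AB_add (star x y) (star x z)"
      "star (star x y) z = star x (star y z)" if "x \<in> AB" "y \<in> AB" "z \<in> AB" for x y z
    using def that unfolding formal_deformation_def by blast+
  have scale: "star (AB_scale b x) y = AB_scale b (star x y)" "star x (AB_scale b y) = AB_scale b (star x y)"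
    if "x \<in> AB" "y \<in> AB" for b x y
    using def that unfolding formal_deformation_def by blast+
  have red: "reduces_to (star x y) (a * a')" if "x \<in> AB" "y \<in> AB" "reduces_to x a" "reduces_to y a'" for x y a a'
    using def that unfolding formal_deformation_def by blast
  define st where "st f g = toC (star (fromC f) (fromC g))" for f g
  have st_C: "st f g \<in> C" and st: "fromC (st f g) = star (fromC f) (fromC g)" for f g
    unfolding st_def by (rule toC[OF AB[OF fromC_AB fromC_AB]])+
  interpret CA: C_algebra G S \<phi> sA \<pi> sB \<mm> I E lam st
  proof (unfold_locales)
    fix f f' g g' h b
    show "st f g \<in> C" by (rule st_C)
    show "st (f + f') g = st f g + st f' g"
      by (rule fromC_inj[OF st_C C_add[OF st_C st_C]])
        (simp only: st AB_add_fromC[symmetric] add[OF fromC_AB fromC_AB fromC_AB])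
    show "st f (g + g') = st f g + st f g'"
      by (rule fromC_inj[OF st_C C_add[OF st_C st_C]])
        (simp only: st AB_add_fromC[symmetric] add[OF fromC_AB fromC_AB fromC_AB])
    show "st (st f g) h = st f (st g h)"
      by (rule fromC_inj[OF st_C st_C]) (simp only: st add(3)[OF fromC_AB fromC_AB fromC_AB])
    show "st (act b f) g = act b (st f g)"
      by (rule fromC_inj[OF st_C act_C]) (simp only: st AB_scale_fromC[symmetric] scale[OF fromC_AB fromC_AB])
    show "st f (act b g) = act b (st f g)"
      by (rule fromC_inj[OF st_C act_C]) (simp only: st AB_scale_fromC[symmetric] scale[OF fromC_AB fromC_AB])
    show "st f g 1 = f 1 * g 1"
      using red[OF fromC_AB fromC_AB, of f "f 1" g "g 1"] unfolding st[symmetric] reduces_to_fromC by simp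
  qed
  interpret gf: gauge_fixed G S \<phi> sA \<pi> sB \<mm> I E lam CA.st'
    by (rule CA.gauge_fixed_st')
  define T where "T x = fromC (CA.Ti (toC x))" for x
  have T: "T (fromC f) = fromC (CA.Ti f)" if "f \<in> C" for f
    by (simp add: T_def toC_fromC that)
  have Ti_add: "CA.Ti (f + g) = CA.Ti f + CA.Ti g" if "f \<in> C" "g \<in> C" for f g
    by (rule CA.T_inj) (simp_all add: that CA.Ti_C C_add CA.T_Ti BlinD(1)[OF CA.Blin_T])
  have Ti_act: "CA.Ti (act b f) = act b (CA.Ti f)" if "f \<in> C" for b f
    by (rule CA.T_inj) (simp_all add: that CA.Ti_C CA.T_Ti BlinD(2)[OF CA.Blin_T])
  have "gauge_equivalent star (comb_star gf.xi)"
    unfolding gauge_equivalent_def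
  proof (intro exI[of _ T] conjI ballI allI impI)
    show "bij_betw T AB AB"
    proof (rule bij_betwI[where g = "\<lambda>x. fromC (CA.T (toC x))"])
      show "T \<in> AB \<rightarrow> AB" "(\<lambda>x. fromC (CA.T (toC x))) \<in> AB \<rightarrow> AB"
        by (simp_all add: T_def fromC_AB)
      fix x assume x: "x \<in> AB"
      show "fromC (CA.T (toC (T x))) = x"
        by (simp add: T_def toC_fromC CA.Ti_C toC x CA.T_Ti)
      show "T (fromC (CA.T (toC x))) = x"
        by (simp add: T_def toC_fromC toC x CA.Ti_T)
    qed
  next
    fix x y assume xy: "x \<in> AB" "y \<in> AB"
    obtain f g where f: "f \<in> C" "x = fromC f" and g: "g \<in> C" "y = fromC g"
      using AB_fromC xy by meson
    show "T (AB_add x y) = AB_add (T x) (T y)"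
      unfolding f g AB_add_fromC T[OF f(1)] T[OF g(1)] T[OF C_add[OF f(1) g(1)]] Ti_add[OF f(1) g(1)] ..
    show "T (star x y) = comb_star gf.xi (T x) (T y)"
      unfolding f g T[OF f(1)] T[OF g(1)] gf.comb_star_fromC[OF CA.Ti_C[OF f(1)] CA.Ti_C[OF g(1)]]
      unfolding st[symmetric] T[OF st_C] CA.st'_def CA.T_Ti[OF f(1)] CA.T_Ti[OF g(1)] ..
  next
    fix b x assume "x \<in> AB"
    then obtain f where f: "f \<in> C" "x = fromC f" using AB_fromC by blast
    show "T (AB_scale b x) = AB_scale b (T x)"
      unfolding f AB_scale_fromC T[OF f(1)] T[OF act_C] Ti_act[OF f(1)] ..
  next
    fix x a assume "x \<in> AB" "reduces_to x a"
    then obtain f where f: "f \<in> C" "x = fromC f" "f 1 = a" using AB_fromC reduces_to_fromC by blast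
    have "CA.Ti f 1 = a"
      using CA.T_one[of "CA.Ti f"] f by (simp add: CA.T_Ti)
    then show "reduces_to (T x) a"
      unfolding f(2) T[OF f(1)] reduces_to_fromC .
  qed
  then show ?thesis
    using gf.xi_maurer_cartan by blast
qed

end

theorem corollary7p33:
  fixes G :: "('v, 'e) pre_digraph"
    and I :: "(('v, 'e) qpath \<Rightarrow>\<^sub>0 'k::field_char_0) set"
    and S :: "('v, 'e) qpath set"
    and \<phi> :: "('v, 'e) qpath \<Rightarrow> ('v, 'e) qpath \<Rightarrow>\<^sub>0 'k"
    and sA :: "'k \<Rightarrow> 'a \<Rightarrow> 'a::ring"
    and \<pi> :: "(('v, 'e) qpath \<Rightarrow>\<^sub>0 'k) \<Rightarrow> 'a"
    and sB :: "'k \<Rightarrow> 'b \<Rightarrow> 'b::comm_ring_1"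
    and \<mm> :: "'b set"
    and star :: "(nat \<Rightarrow> ('a \<times> 'b \<Rightarrow>\<^sub>0 'k) set) \<Rightarrow> (nat \<Rightarrow> ('a \<times> 'b \<Rightarrow>\<^sub>0 'k) set)
      \<Rightarrow> (nat \<Rightarrow> ('a \<times> 'b \<Rightarrow>\<^sub>0 'k) set)"
  assumes "fin_digraph G"
    and "two_sided_ideal G I"
    and "quotient_algebra G I sA \<pi>"
    and "reduction_system G S \<phi>"
    and "diamond G S \<phi> I"
    and "complete_local_noetherian sB \<mm>"
    and "deformation_data.formal_deformation sA sB \<mm> star"
  shows "\<exists>\<xi> \<in> deformation_data.maurer_cartan G S sA \<pi> sB \<mm>.
    deformation_data.gauge_equivalent sA sB \<mm> star
      (deformation_data.comb_star G S \<phi> sA \<pi> sB \<mm> \<xi>)"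
proof -
  have rs: "reduction_setup G S \<phi> sA \<pi> I"
    using assms(1-5) by (intro reduction_setup.intro)
  interpret local_alg sB \<mm>
    using assms(6) by (rule local_alg.intro)
  interpret def_setup G S \<phi> sA \<pi> sB \<mm> I Eb lamb
    by (rule def_setup.intro[OF rs top_basis_exists])
  show ?thesis
    by (rule deformation_is_combinatorial[OF assms(7)])
qed

end
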